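(* Let $U=U_q(\mathfrak{sl}_4^+)$, with center $Z_q(\mathfrak{sl}_4^+)$, and let $D_1,D_4,D_6$ be the three $\mathbb{K}$-derivations of $U$ defined in the context. 1. Every $\mathbb{K}$-derivation $D$ of $U$ can be uniquely written as $$D=\mathrm{ad}_x+\mu_1D_1+\mu_4D_4+\mu_6D_6,$$ with $\mathrm{ad}_x\in\mathrm{InnDer}(U)$ and $\mu_1,\mu_4,\mu_6\in Z_q(\mathfrak{sl}_4^+)$. 2. $\mathrm{HH}^1(U)$ is a free $Z_q(\mathfrak{sl}_4^+)$-module of rank $3$ with basis $(\overline{D_1},\overline{D_4},\overline{D_6})$, where $\overline{D_i}$ is the class of $D_i$.
   Context: $\mathbb{K}$ is a field of characteristic $0$ and $q\in\mathbb{K}^*$ is not a root of unity. $U=U_q(\mathfrak{sl}_4^+)$ is the unital associative $\mathbb{K}$-algebra with generators $e_1,e_2,e_3$ subject to the quantum Serre relations $e_1e_3-e_3e_1=0$ and $e_i^2e_j-(q+q^{-1})e_ie_je_i+e_je_i^2=0$ whenever $|i-j|=1$. $Z_q(\mathfrak{sl}_4^+)$ denotes the center of $U$. Set $X_1=e_1$, $X_2=e_1e_2-q^{-1}e_2e_1$, $X_4=e_2$, $X_5=e_2e_3-q^{-1}e_3e_2$, $X_6=e_3$, $X_3=e_1X_5-q^{-1}X_5e_1$. $D_1,D_4,D_6$ are the $\mathbb{K}$-derivations of $U$ given by: $D_1(X_j)=X_j$ for $j\in\{1,2,3\}$ and $D_1(X_j)=0$ otherwise; $D_4(X_j)=X_j$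 for $j\in\{2,3,4,5\}$ and $D_4(X_j)=0$ otherwise; $D_6(X_j)=X_j$ for $j\in\{3,5,6\}$ and $D_6(X_j)=0$ otherwise. For $x\in U$, $\mathrm{ad}_x(y)=xy-yx$. $\mathrm{Der}(U)$ is the Lie algebra of $\mathbb{K}$-derivations of $U$, $\mathrm{InnDer}(U)=\{\mathrm{ad}_x\mid x\in U\}$ is the Lie algebra of inner derivations, and $\mathrm{HH}^1(U)=\mathrm{Der}(U)/\mathrm{InnDer}(U)$ is the Hochschild cohomology group of degree $1$, viewed as a module over $\mathrm{HH}^0(U)=Z_q(\mathfrak{sl}_4^+)$ via $(zD)(u)=zD(u)$. Uniqueness in part 1 means that the inner derivation $\mathrm{ad}_x$ and $\mu_1,\mu_4,\mu_6$ are uniquely determined by $D$ (not $x$ itself). *)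

theory Defs
  imports "HOL-Algebra.Module" "HOL-Algebra.QuotRing" "HOL-Library.Poly_Mapping"
begin

section \<open>The free algebra on three letters\<close>

datatype letter = E1 | E2 | E3

text \<open>Words form a monoid under concatenation, written additively because
  \<^typ>\<open>'a \<Rightarrow>\<^sub>0 'b\<close> is the monoid algebra over an additive monoid.\<close>

datatype word = Word (letters: "letter list")

instantiation word :: monoid_add
begin
definition zero_word :: word where "0 = Word []"
definition plus_word :: "word \<Rightarrow> word \<Rightarrow> word" where "u + v = Word (letters u @ letters v)"
instance by standard (simp_all add: zero_word_def plus_word_def)
end

type_synonym 'k free_alg = "word \<Rightarrow>\<^sub>0 'k"

definition scalar :: "'k \<Rightarrow> 'k::field free_alg"
  where "scalar c = Poly_Mapping.single 0 c"

definition letter :: "letter \<Rightarrow> 'k::field free_alg"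
  where "letter a = Poly_Mapping.single (Word [a]) 1"

definition free_ring :: "'k::field free_alg ring"
  where "free_ring = \<lparr>carrier = UNIV, mult = (*), one = 1, zero = 0, add = (+)\<rparr>"


section \<open>The algebra $U_q(\mathfrak{sl}_4^+)$\<close>

definition serre_rels :: "'k::field \<Rightarrow> 'k free_alg set" where
  "serre_rels q =
     insert (letter E1 * letter E3 - letter E3 * letter E1)
       {letter a ^ 2 * letter b - scalar (q + inverse q) * (letter a * letter b * letter a)
          + letter b * letter a ^ 2 | a b.
        (a, b) \<in> {(E1, E2), (E2, E1), (E2, E3), (E3, E2)}}"

definition serre_ideal :: "'k::field \<Rightarrow> 'k free_alg set" where
  "serre_ideal q = Idl\<^bsub>free_ring\<^esub> (serre_rels q)"

definition Uq_class :: "'k::field \<Rightarrow> 'k free_alg \<Rightarrow> 'k free_alg set" where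
  "Uq_class q f = serre_ideal q +>\<^bsub>free_ring\<^esub> f"

text \<open>A noncommutative algebra over the field given by the whole type \<^typ>\<open>'k\<close> is
  represented by a \<^typ>\<open>('k, 'a) module\<close> record, whose \<^const>\<open>smult\<close> is the scalar action.\<close>

definition Uq :: "'k::field \<Rightarrow> ('k, 'k free_alg set) module" where
  "Uq q = (let Q = free_ring Quot serre_ideal q in
     \<lparr>carrier = carrier Q, mult = mult Q, one = one Q, zero = zero Q, add = add Q,
      smult = (\<lambda>c u. Uq_class q (scalar c) \<otimes>\<^bsub>Q\<^esub> u)\<rparr>)"

definition Uq_gen :: "'k::field \<Rightarrow> letter \<Rightarrow> 'k free_alg set" where
  "Uq_gen q a = Uq_class q (letter a)"

definition qcomm :: "'k::field \<Rightarrow> 'k free_alg set \<Rightarrow> 'k free_alg set \<Rightarrow> 'k free_alg set" where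
  "qcomm q u v = u \<otimes>\<^bsub>Uq q\<^esub> v \<ominus>\<^bsub>Uq q\<^esub> (inverse q \<odot>\<^bsub>Uq q\<^esub> (v \<otimes>\<^bsub>Uq q\<^esub> u))"

text \<open>Only the indices 1 to 6 are meaningful.\<close>

definition Uq_X :: "'k::field \<Rightarrow> nat \<Rightarrow> 'k free_alg set" where
  "Uq_X q j =
     (let e1 = Uq_gen q E1; e2 = Uq_gen q E2; e3 = Uq_gen q E3 in
      if j = 1 then e1
      else if j = 2 then qcomm q e1 e2
      else if j = 3 then qcomm q e1 (qcomm q e2 e3)
      else if j = 4 then e2
      else if j = 5 then qcomm q e2 e3
      else if j = 6 then e3
      else undefined)"


section \<open>Center, derivations and first Hochschild cohomology\<close>

definition center :: "('k, 'a) module \<Rightarrow> 'a ring" where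
  "center A =
     \<lparr>carrier = {z \<in> carrier A. \<forall>x \<in> carrier A. z \<otimes>\<^bsub>A\<^esub> x = x \<otimes>\<^bsub>A\<^esub> z},
      mult = mult A, one = one A, zero = zero A, add = add A\<rparr>"

text \<open>Maps on an algebra are taken extensional, so that equality of maps is
  equality on the carrier.\<close>

definition derivations :: "('k, 'a) module \<Rightarrow> ('a \<Rightarrow> 'a) set" where
  "derivations A = {D \<in> carrier A \<rightarrow>\<^sub>E carrier A.
     (\<forall>x \<in> carrier A. \<forall>y \<in> carrier A. D (x \<oplus>\<^bsub>A\<^esub> y) = D x \<oplus>\<^bsub>A\<^esub> D y) \<and>
     (\<forall>c. \<forall>x \<in> carrier A. D (c \<odot>\<^bsub>A\<^esub> x) = c \<odot>\<^bsub>A\<^esub> D x) \<and>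
     (\<forall>x \<in> carrier A. \<forall>y \<in> carrier A.
        D (x \<otimes>\<^bsub>A\<^esub> y) = D x \<otimes>\<^bsub>A\<^esub> y \<oplus>\<^bsub>A\<^esub> x \<otimes>\<^bsub>A\<^esub> D y)}"

definition ad :: "('k, 'a) module \<Rightarrow> 'a \<Rightarrow> 'a \<Rightarrow> 'a" where
  "ad A x = (\<lambda>y \<in> carrier A. x \<otimes>\<^bsub>A\<^esub> y \<ominus>\<^bsub>A\<^esub> y \<otimes>\<^bsub>A\<^esub> x)"

definition inner_derivations :: "('k, 'a) module \<Rightarrow> ('a \<Rightarrow> 'a) set" where
  "inner_derivations A = ad A ` carrier A"

text \<open>The derivations as a module over the center. The fields \<^const>\<open>mult\<close> and \<^const>\<open>one\<close>,
  which every \<^typ>\<open>('a, 'b) module\<close> record carries, play no role in a module.\<close>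

definition Der :: "('k, 'a) module \<Rightarrow> ('a, 'a \<Rightarrow> 'a) module" where
  "Der A =
     \<lparr>carrier = derivations A, mult = undefined, one = undefined,
      zero = (\<lambda>u \<in> carrier A. \<zero>\<^bsub>A\<^esub>),
      add = (\<lambda>D E. \<lambda>u \<in> carrier A. D u \<oplus>\<^bsub>A\<^esub> E u),
      smult = (\<lambda>z D. \<lambda>u \<in> carrier A. z \<otimes>\<^bsub>A\<^esub> D u)\<rparr>"

text \<open>As for \<^const>\<open>rcoset_mult\<close>, the scalar action on cosets is given by the union over
  all representatives, which is a single coset when \<open>N\<close> is a submodule.\<close>

definition quotient_module :: "('r, 'm) module \<Rightarrow> 'm set \<Rightarrow> ('r, 'm set) module" where
  "quotient_module M N =
     \<lparr>carrier = a_rcosets\<^bsub>M\<^esub> N, mult = undefined, one = undefined,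
      zero = N, add = set_add M,
      smult = (\<lambda>r C. \<Union>m \<in> C. N +>\<^bsub>M\<^esub> (r \<odot>\<^bsub>M\<^esub> m))\<rparr>"

definition HH1 :: "('k, 'a) module \<Rightarrow> ('a, ('a \<Rightarrow> 'a) set) module" where
  "HH1 A = quotient_module (Der A) (inner_derivations A)"

definition HH1_class :: "('k, 'a) module \<Rightarrow> ('a \<Rightarrow> 'a) \<Rightarrow> ('a \<Rightarrow> 'a) set" where
  "HH1_class A D = inner_derivations A +>\<^bsub>Der A\<^esub> D"


section \<open>Bases of modules\<close>

definition module_basis :: "'r ring \<Rightarrow> ('r, 'm) module \<Rightarrow> 'i set \<Rightarrow> ('i \<Rightarrow> 'm) \<Rightarrow> bool" where
  "module_basis R M I b \<longleftrightarrow>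
     finite I \<and> b \<in> I \<rightarrow> carrier M \<and>
     (\<forall>m \<in> carrier M. \<exists>a \<in> I \<rightarrow> carrier R. m = (\<Oplus>\<^bsub>M\<^esub>i \<in> I. a i \<odot>\<^bsub>M\<^esub> b i)) \<and>
     (\<forall>a \<in> I \<rightarrow> carrier R.
        (\<Oplus>\<^bsub>M\<^esub>i \<in> I. a i \<odot>\<^bsub>M\<^esub> b i) = \<zero>\<^bsub>M\<^esub> \<longrightarrow> (\<forall>i \<in> I. a i = \<zero>\<^bsub>R\<^esub>))"

definition free_of_rank :: "'r ring \<Rightarrow> ('r, 'm) module \<Rightarrow> nat \<Rightarrow> bool" where
  "free_of_rank R M n \<longleftrightarrow> module R M \<and> (\<exists>b. module_basis R M {..<n} b)"


section \<open>The derivations $D_1$, $D_4$, $D_6$\<close>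

definition scales_X :: "'k::field \<Rightarrow> nat set \<Rightarrow> ('k free_alg set \<Rightarrow> 'k free_alg set) \<Rightarrow> bool" where
  "scales_X q S D \<longleftrightarrow>
     D \<in> derivations (Uq q) \<and>
     (\<forall>j \<in> {1..6}. D (Uq_X q j) = (if j \<in> S then Uq_X q j else \<zero>\<^bsub>Uq q\<^esub>))"

definition D1 :: "'k::field \<Rightarrow> 'k free_alg set \<Rightarrow> 'k free_alg set" where
  "D1 q = (THE D. scales_X q {1, 2, 3} D)"

definition D4 :: "'k::field \<Rightarrow> 'k free_alg set \<Rightarrow> 'k free_alg set" where
  "D4 q = (THE D. scales_X q {2, 3, 4, 5} D)"

definition D6 :: "'k::field \<Rightarrow> 'k free_alg set \<Rightarrow> 'k free_alg set" where
  "D6 q = (THE D. scales_X q {3, 5, 6} D)"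


section \<open>Well-definedness of \<open>Uq\<close> and of \<open>D1\<close>, \<open>D4\<close>, \<open>D6\<close>\<close>

text \<open>\<open>ring_Uq\<close> shows that the quotient is a ring, and \<open>scales_X_D\<close> that the definite
  descriptions defining \<open>D1\<close>, \<open>D4\<close> and \<open>D6\<close> denote.\<close>

lemma ring_free_ring: "ring (free_ring :: 'k::field free_alg ring)"
proof -
  have "\<exists>y. y + x = 0" for x :: "'k free_alg"
    by (rule exI[of _ "- x"]) simp
  then show ?thesis
    by unfold_locales
      (auto simp: free_ring_def Units_def algebra_simps intro: exI[of _ "- x" for x])
qed

lemma ideal_serre: "ideal (serre_ideal q) free_ring"
  unfolding serre_ideal_def
  by (rule ring.genideal_ideal[OF ring_free_ring]) (simp add: free_ring_def)

lemma free_ring_simps [simp]: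
  "carrier free_ring = UNIV" "x \<otimes>\<^bsub>free_ring\<^esub> y = x * y" "x \<oplus>\<^bsub>free_ring\<^esub> y = x + y"
  "\<one>\<^bsub>free_ring\<^esub> = 1" "\<zero>\<^bsub>free_ring\<^esub> = 0"
  by (simp_all add: free_ring_def)

lemma Uq_quot:
  "carrier (Uq q) = carrier (free_ring Quot serre_ideal q)"
  "mult (Uq q) = mult (free_ring Quot serre_ideal q)"
  "one (Uq q) = one (free_ring Quot serre_ideal q)"
  "zero (Uq q) = zero (free_ring Quot serre_ideal q)"
  "add (Uq q) = add (free_ring Quot serre_ideal q)"
  by (simp_all add: Uq_def Let_def)

lemma carrier_Uq: "carrier (Uq q) = range (Uq_class q)"
  by (auto simp: Uq_quot FactRing_def A_RCOSETS_def' Uq_class_def a_r_coset_def')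

lemma shows Uq_class_ring_hom:
  "Uq_class q (f + g) = Uq_class q f \<oplus>\<^bsub>Uq q\<^esub> Uq_class q g"
  "Uq_class q (f * g) = Uq_class q f \<otimes>\<^bsub>Uq q\<^esub> Uq_class q g"
  "Uq_class q 0 = \<zero>\<^bsub>Uq q\<^esub>"
  "Uq_class q 1 = \<one>\<^bsub>Uq q\<^esub>"
  and Uq_class_scalar: "Uq_class q (scalar c * f) = c \<odot>\<^bsub>Uq q\<^esub> Uq_class q f"
proof -
  interpret ideal "serre_ideal q" free_ring by (rule ideal_serre)
  interpret h: ring_hom_ring free_ring "free_ring Quot serre_ideal q" "Uq_class q"
    unfolding Uq_class_def[abs_def] by (rule rcos_ring_hom_ring)
  show "Uq_class q (f + g) = Uq_class q f \<oplus>\<^bsub>Uq q\<^esub> Uq_class q g"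
    "Uq_class q (f * g) = Uq_class q f \<otimes>\<^bsub>Uq q\<^esub> Uq_class q g"
    "Uq_class q 0 = \<zero>\<^bsub>Uq q\<^esub>" "Uq_class q 1 = \<one>\<^bsub>Uq q\<^esub>"
    using h.hom_add[of f g] h.hom_mult[of f g] h.hom_zero h.hom_one by (simp_all add: Uq_quot)
  show "Uq_class q (scalar c * f) = c \<odot>\<^bsub>Uq q\<^esub> Uq_class q f"
    using h.hom_mult[of "scalar c" f] by (simp add: Uq_def Let_def)
qed

lemma ring_Uq: "ring (Uq q)"
proof (rule ringI)
  show "abelian_group (Uq q)"
  proof (rule abelian_groupI)
    fix x assume "x \<in> carrier (Uq q)"
    then obtain f where "x = Uq_class q f" by (auto simp: carrier_Uq)
    then show "\<exists>y \<in> carrier (Uq q). y \<oplus>\<^bsub>Uq q\<^esub> x = \<zero>\<^bsub>Uq q\<^esub>"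
      by (intro bexI[of _ "Uq_class q (- f)"])
         (auto simp: carrier_Uq simp flip: Uq_class_ring_hom)
  qed (auto simp: carrier_Uq add_ac simp flip: Uq_class_ring_hom)
  show "Group.monoid (Uq q)"
    by (rule monoidI) (auto simp: carrier_Uq mult.assoc simp flip: Uq_class_ring_hom)
qed (auto simp: carrier_Uq algebra_simps simp flip: Uq_class_ring_hom)

lemma Uq_class_diff: "Uq_class q (f - g) = Uq_class q f \<ominus>\<^bsub>Uq q\<^esub> Uq_class q g"
proof -
  interpret U: ring "Uq q" by (rule ring_Uq)
  have c: "Uq_class q h \<in> carrier (Uq q)" for h by (simp add: carrier_Uq)
  have "Uq_class q (f - g) \<oplus>\<^bsub>Uq q\<^esub> Uq_class q g = Uq_class q f"
    by (simp flip: Uq_class_ring_hom)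
  then show ?thesis
    using c[of f] c[of g] c[of "f - g"]
    by (metis U.a_assoc U.a_inv_closed U.minus_eq U.r_neg U.r_zero)
qed

lemma Uq_class_eq_iff: "Uq_class q f = Uq_class q g \<longleftrightarrow> f - g \<in> serre_ideal q"
proof -
  interpret ideal "serre_ideal q" free_ring by (rule ideal_serre)
  have m: "\<ominus>\<^bsub>free_ring\<^esub> g = - g"
    by (rule minus_equality) auto
  show ?thesis
    using quotient_eq_iff_same_a_r_cos[OF ideal_serre, of f g] m
    by (simp add: Uq_class_def a_minus_def)
qed

text \<open>The derivation of the free algebra multiplying each word by the number of
  its letters \<open>a\<close>.\<close>

definition wt :: "letter \<Rightarrow> word \<Rightarrow> nat" where
  "wt a w = count_list (letters w) a"

definition dfree :: "letter \<Rightarrow> 'k::field free_alg \<Rightarrow> 'k free_alg" where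
  "dfree a f = Poly_Mapping.Abs_poly_mapping (\<lambda>w. of_nat (wt a w) * Poly_Mapping.lookup f w)"

lemma lookup_dfree: "Poly_Mapping.lookup (dfree a f) w = of_nat (wt a w) * Poly_Mapping.lookup f w"
proof -
  have "finite {w. of_nat (wt a w) * Poly_Mapping.lookup f w \<noteq> 0}"
    by (rule finite_subset[OF _ Poly_Mapping.finite_keys[of f]]) (auto simp: in_keys_iff)
  then show ?thesis by (simp add: dfree_def)
qed

lemma dfree_add: "dfree a (f + g) = dfree a f + dfree a g"
  by (rule poly_mapping_eqI) (simp add: lookup_dfree lookup_add algebra_simps)

lemma dfree_zero: "dfree a 0 = 0"
  by (rule poly_mapping_eqI) (simp add: lookup_dfree)

lemma dfree_diff: "dfree a (f - g) = dfree a f - dfree a g"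
  by (rule poly_mapping_eqI) (simp add: lookup_dfree lookup_minus algebra_simps)

lemma dfree_single: "dfree a (Poly_Mapping.single w c) = of_nat (wt a w) * Poly_Mapping.single w c"
  by (rule poly_mapping_eqI)
     (auto simp: lookup_dfree lookup_single when_def mult_single simp flip: single_of_nat)

lemma free_alg_induct [case_names add single]:
  assumes "\<And>f g. P f \<Longrightarrow> P g \<Longrightarrow> P (f + g)" "\<And>w c. P (Poly_Mapping.single w c)"
  shows "P (f :: 'k::field free_alg)"
proof (induction f rule: update_induct)
  case const
  show ?case using assms(2)[of 0 0] by simp
next
  case (update f w c)
  have "Poly_Mapping.update w c f = f + Poly_Mapping.single w c"
    using update(1) by (intro poly_mapping_eqI) (auto simp: lookup_update lookup_add lookup_single when_def in_keys_iff)
  then show ?case using assms update by simp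
qed

lemma dfree_mult: "dfree a (f * g) = dfree a f * g + f * dfree a g"
proof (induction f rule: free_alg_induct)
  case (single u c)
  show ?case
  proof (induction g rule: free_alg_induct)
    case (single v d)
    have "wt a (u + v) = wt a u + wt a v"
      by (simp add: wt_def plus_word_def)
    then show ?case
      by (simp add: dfree_single mult_single single_add algebra_simps flip: single_of_nat)
  qed (simp add: dfree_add algebra_simps)
qed (simp add: dfree_add algebra_simps)

lemma dfree_scalar: "dfree a (scalar c) = 0"
  by (simp add: scalar_def dfree_single wt_def zero_word_def)

lemma dfree_letter: "dfree a (letter b) = (if a = b then letter b else 0)"
  by (simp add: letter_def dfree_single wt_def)

lemma scalar_commutes: "f * scalar c = scalar c * (f :: 'k::field free_alg)"
  by (induction f rule: free_alg_induct) (simp_all add: scalar_def mult_single algebra_simps)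

lemma serre_ideal_closed:
  "0 \<in> serre_ideal q"
  "x \<in> serre_ideal q \<Longrightarrow> y \<in> serre_ideal q \<Longrightarrow> x + y \<in> serre_ideal q"
  "x \<in> serre_ideal q \<Longrightarrow> z * x \<in> serre_ideal q"
  "x \<in> serre_ideal q \<Longrightarrow> x * z \<in> serre_ideal q"
proof -
  interpret I: ideal "serre_ideal q" free_ring by (rule ideal_serre)
  show "0 \<in> serre_ideal q"
    "x \<in> serre_ideal q \<Longrightarrow> y \<in> serre_ideal q \<Longrightarrow> x + y \<in> serre_ideal q"
    "x \<in> serre_ideal q \<Longrightarrow> z * x \<in> serre_ideal q"
    "x \<in> serre_ideal q \<Longrightarrow> x * z \<in> serre_ideal q"
    using additive_subgroup.zero_closed[OF I.additive_subgroup_axioms]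
      additive_subgroup.a_closed[OF I.additive_subgroup_axioms, of x y]
      I.I_l_closed[of x z] I.I_r_closed[of x z] by auto
qed

lemma dfree_serre_rels:
  assumes "r \<in> serre_rels q"
  obtains n :: nat where "dfree a r = of_nat n * r"
proof -
  let ?S = "\<lambda>a b. letter a ^ 2 * letter b
    - scalar (q + inverse q) * (letter a * letter b * letter a) + letter b * letter a ^ 2"
  have "r = letter E1 * letter E3 - letter E3 * letter E1 \<or>
      r = ?S E1 E2 \<or> r = ?S E2 E1 \<or> r = ?S E2 E3 \<or> r = ?S E3 E2"
    using assms by (auto simp: serre_rels_def)
  then have "dfree a r = 0 * r \<or> dfree a r = 1 * r \<or> dfree a r = 2 * r"
    by (elim disjE; hypsubst; cases a)
       (simp_all add: dfree_add dfree_diff dfree_mult dfree_scalar dfree_letter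
          power2_eq_square distrib_left distrib_right mult_2 mult.assoc right_diff_distrib)
  then show ?thesis
    using that[of 0] that[of 1] that[of 2] by auto
qed

lemma dfree_serre_ideal:
  assumes "f \<in> serre_ideal q"
  shows "dfree a f \<in> serre_ideal q"
proof -
  interpret F: ring "free_ring :: 'a free_alg ring" by (rule ring_free_ring)
  let ?J = "{f \<in> serre_ideal q. dfree a f \<in> serre_ideal q}"
  have "ideal ?J free_ring"
  proof (rule idealI)
    have minus: "inv\<^bsub>add_monoid free_ring\<^esub> x = - 1 * x" for x :: "'a free_alg"
      using F.minus_equality[of "- x" x] by (simp add: a_inv_def)
    have "dfree a (- 1 * x) = - 1 * dfree a x" for x :: "'a free_alg"
      using dfree_diff[of a 0 x] by (simp add: dfree_zero)
    then show "subgroup ?J (add_monoid free_ring)"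
      unfolding subgroup_def minus
      by (auto simp: serre_ideal_closed dfree_add dfree_zero simp del: mult_minus1 mult_minus_left)
  qed (auto simp: serre_ideal_closed dfree_mult ring_free_ring)
  moreover have "serre_rels q \<subseteq> ?J"
  proof
    fix r assume r: "r \<in> serre_rels q"
    then have "r \<in> serre_ideal q"
      unfolding serre_ideal_def using F.genideal_self[of "serre_rels q"] by auto
    moreover obtain n :: nat where "dfree a r = of_nat n * r"
      using dfree_serre_rels[OF r] .
    ultimately show "r \<in> ?J"
      by (simp add: serre_ideal_closed)
  qed
  ultimately have "Idl\<^bsub>free_ring\<^esub> (serre_rels q) \<subseteq> ?J"
    by (rule F.genideal_minimal)
  then have "serre_ideal q \<subseteq> ?J"
    by (simp only: serre_ideal_def[symmetric])
  then show ?thesis using assms by auto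
qed

lemma Uq_letter_derivation:
  obtains D where "D \<in> derivations (Uq q)"
    "\<And>f. D (Uq_class q f) = Uq_class q (dfree a f)"
proof -
  define D where "D = (\<lambda>u \<in> carrier (Uq q). Uq_class q (dfree a (SOME f. u = Uq_class q f)))"
  have D: "D (Uq_class q f) = Uq_class q (dfree a f)" for f
  proof -
    have "Uq_class q f = Uq_class q (SOME g. Uq_class q f = Uq_class q g)"
      by (rule someI) (rule refl)
    then have "f - (SOME g. Uq_class q f = Uq_class q g) \<in> serre_ideal q"
      by (simp only: Uq_class_eq_iff)
    from dfree_serre_ideal[OF this, of a] show ?thesis
      by (simp add: D_def carrier_Uq dfree_diff flip: Uq_class_eq_iff)
  qed
  have "D \<in> carrier (Uq q) \<rightarrow>\<^sub>E carrier (Uq q)"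
    by (auto simp: D_def carrier_Uq)
  then have "D \<in> derivations (Uq q)"
    unfolding derivations_def
    by (auto simp: carrier_Uq D dfree_add dfree_mult dfree_scalar simp flip: Uq_class_ring_hom Uq_class_scalar)
  then show ?thesis using that D by blast
qed

lemma Uq_derivation_eqI:
  assumes D: "D \<in> derivations (Uq q)" and E: "E \<in> derivations (Uq q)"
    and gen: "\<And>a. D (Uq_gen q a) = E (Uq_gen q a)"
  shows "D = E"
proof -
  interpret U: ring "Uq q" by (rule ring_Uq)
  have add: "F (Uq_class q (f + g)) = F (Uq_class q f) \<oplus>\<^bsub>Uq q\<^esub> F (Uq_class q g)"
    and mult: "F (Uq_class q (f * g)) =
      F (Uq_class q f) \<otimes>\<^bsub>Uq q\<^esub> Uq_class q g \<oplus>\<^bsub>Uq q\<^esub> Uq_class q f \<otimes>\<^bsub>Uq q\<^esub> F (Uq_class q g)"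
    and scal: "F (Uq_class q (scalar c * f)) = c \<odot>\<^bsub>Uq q\<^esub> F (Uq_class q f)"
    and car: "F (Uq_class q f) \<in> carrier (Uq q)"
    if "F \<in> derivations (Uq q)" for F f g c
    unfolding Uq_class_scalar Uq_class_ring_hom(1,3,4) Uq_class_ring_hom(2)[of q f g]
    using that by (auto simp: derivations_def carrier_Uq)
  have one: "F (Uq_class q 1) = \<zero>\<^bsub>Uq q\<^esub>" if F: "F \<in> derivations (Uq q)" for F
  proof -
    have "F (Uq_class q 1) = F (Uq_class q 1) \<oplus>\<^bsub>Uq q\<^esub> F (Uq_class q 1)"
      using mult[OF F, of 1 1] car[OF F, of 1] by (simp add: Uq_class_ring_hom)
    then show ?thesis using car[OF F, of 1] U.add.r_cancel_one' by metis
  qed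
  have word: "D (Uq_class q (Poly_Mapping.single (Word w) 1)) =
      E (Uq_class q (Poly_Mapping.single (Word w) 1))" for w
  proof (induction w)
    case Nil
    then show ?case using one[OF D] one[OF E] by (simp flip: zero_word_def)
  next
    case (Cons a w)
    have "Poly_Mapping.single (Word (a # w)) (1 :: 'a) = letter a * Poly_Mapping.single (Word w) 1"
      by (simp add: letter_def mult_single plus_word_def)
    then show ?case
      using Cons gen[of a] by (simp add: mult[OF D] mult[OF E] Uq_gen_def)
  qed
  have "D (Uq_class q f) = E (Uq_class q f)" for f
  proof (induction f rule: free_alg_induct)
    case (single w c)
    have "Poly_Mapping.single w c = scalar c * Poly_Mapping.single (Word (letters w)) 1"
      by (simp add: scalar_def mult_single)
    then show ?case using word[of "letters w"] by (simp add: scal[OF D] scal[OF E])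
  qed (simp add: add[OF D] add[OF E])
  then show ?thesis
    using D E by (intro PiE_ext[of D "carrier (Uq q)" "\<lambda>_. carrier (Uq q)" E])
      (auto simp: derivations_def carrier_Uq)
qed

lemma qcomm_class:
  "qcomm q (Uq_class q f) (Uq_class q g) = Uq_class q (f * g - scalar (inverse q) * (g * f))"
  by (simp add: qcomm_def Uq_class_diff Uq_class_ring_hom(2)[symmetric] Uq_class_scalar[symmetric])

lemma dfree_qcomm:
  assumes "dfree a f = of_nat m * f" "dfree a g = of_nat n * g"
  shows "dfree a (f * g - scalar c * (g * f)) = of_nat (m + n) * (f * g - scalar c * (g * f))"
proof -
  have comm: "h * (of_nat k * h') = of_nat k * (h * h')" for k and h h' :: "'a free_alg"
    by (metis mult.assoc mult_of_nat_commute)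
  show ?thesis
    by (simp add: dfree_diff dfree_mult dfree_scalar assms comm mult.assoc
        distrib_right distrib_left right_diff_distrib)
qed

lemma scales_X_ex1:
  assumes "(a, S) \<in> {(E1, {1, 2, 3}), (E2, {2, 3, 4, 5}), (E3, {3, 5, 6})}"
  shows "\<exists>!D. scales_X q S D"
proof -
  obtain D where D: "D \<in> derivations (Uq q)"
    "\<And>f. D (Uq_class q f) = Uq_class q (dfree a f)"
    using Uq_letter_derivation[of q a] by blast
  define n where "n b = (if a = b then 1 else 0 :: nat)" for b
  have l: "dfree a (letter b) = of_nat (n b) * letter b" for b
    by (simp add: dfree_letter n_def)
  note l2 = dfree_qcomm[OF l l] and l3 = dfree_qcomm[OF l dfree_qcomm[OF l l]]
  have DX: "D (Uq_X q 1) = Uq_class q (of_nat (n E1) * letter E1)"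
    "D (Uq_X q 2) = Uq_class q (of_nat (n E1 + n E2) *
       (letter E1 * letter E2 - scalar (inverse q) * (letter E2 * letter E1)))"
    "D (Uq_X q 3) = Uq_class q (of_nat (n E1 + (n E2 + n E3)) *
       (letter E1 * (letter E2 * letter E3 - scalar (inverse q) * (letter E3 * letter E2))
        - scalar (inverse q) *
          ((letter E2 * letter E3 - scalar (inverse q) * (letter E3 * letter E2)) * letter E1)))"
    "D (Uq_X q 4) = Uq_class q (of_nat (n E2) * letter E2)"
    "D (Uq_X q 5) = Uq_class q (of_nat (n E2 + n E3) *
       (letter E2 * letter E3 - scalar (inverse q) * (letter E3 * letter E2)))"
    "D (Uq_X q 6) = Uq_class q (of_nat (n E3) * letter E3)"
    by (simp_all add: Uq_X_def Let_def Uq_gen_def qcomm_class del: of_nat_add)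
       (simp_all only: D(2) l l2 l3)
  have set: "{1..6} = {1, 2, 3, 4, 5, 6::nat}" by auto
  consider "a = E1" "S = {1, 2, 3}" | "a = E2" "S = {2, 3, 4, 5}" | "a = E3" "S = {3, 5, 6}"
    using assms by blast
  then have "\<forall>j \<in> {1..6}. D (Uq_X q j) = (if j \<in> S then Uq_X q j else \<zero>\<^bsub>Uq q\<^esub>)"
    unfolding set
    by cases (simp_all only: ball_simps DX, simp_all add: n_def Uq_X_def Uq_gen_def qcomm_class
        Uq_class_ring_hom(3))
  then have sD: "scales_X q S D"
    using D(1) by (simp only: scales_X_def simp_thms)
  moreover have "E = D" if sE: "scales_X q S E" for E
  proof (rule Uq_derivation_eqI)
    have *: "E (Uq_X q j) = D (Uq_X q j)" if "j \<in> {1..6}" for j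
      using sE sD that unfolding scales_X_def by metis
    have "Uq_X q 1 = Uq_gen q E1" "Uq_X q 4 = Uq_gen q E2" "Uq_X q 6 = Uq_gen q E3"
      by (simp_all add: Uq_X_def)
    then show "E (Uq_gen q b) = D (Uq_gen q b)" for b
      using *[of 1] *[of 4] *[of 6] by (cases b) simp_all
    show "E \<in> derivations (Uq q)" using sE by (simp only: scales_X_def)
  qed (rule D(1))
  ultimately show ?thesis by blast
qed

lemma scales_X_D:
  "scales_X q {1, 2, 3} (D1 q)" "scales_X q {2, 3, 4, 5} (D4 q)" "scales_X q {3, 5, 6} (D6 q)"
proof -
  show "scales_X q {1, 2, 3} (D1 q)"
    unfolding D1_def by (rule theI'[OF scales_X_ex1[of E1]]) blast
  show "scales_X q {2, 3, 4, 5} (D4 q)"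
    unfolding D4_def by (rule theI'[OF scales_X_ex1[of E2]]) blast
  show "scales_X q {3, 5, 6} (D6 q)"
    unfolding D6_def by (rule theI'[OF scales_X_ex1[of E3]]) blast
qed

end

theory Submission
  imports Defs "HOL-Library.Product_Plus"
begin

text \<open>The algebra \<open>U\<close> acts faithfully on itself by left multiplication, and in the PBW basis of
  ordered monomials in \<open>X\<^sub>1, \<dots>, X\<^sub>6\<close> this makes divisibility by \<open>X\<^sub>i\<close> a matter of exponents. The
  element \<open>X\<^sub>3\<close> and its mirror image \<open>De\<close> under \<open>e\<^sub>1 \<leftrightarrow> e\<^sub>3\<close> are normal, with central product, and
  \<open>X\<^sub>2\<close>, \<open>X\<^sub>5\<close> are normal modulo \<open>X\<^sub>3\<close>; the center is generated by \<open>X\<^sub>3 De\<close> and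
  \<open>z = X\<^sub>2 X\<^sub>5 - q X\<^sub>3 X\<^sub>4\<close>.

  A homogeneous skew derivation \<open>E\<close> whose weight pairs nontrivially with the commutation
  character of a normal element \<open>y\<close> would be inner in the localization at \<open>y\<close>; comparing the
  implementing elements for two coprime normal elements shows that \<open>E\<close> is inner modulo \<open>y\<close>, and
  \<open>E\<close> minus an inner part can be divided by \<open>y\<close>, giving a skew derivation of smaller weight. A
  derivation of weight \<open>(g, h, g)\<close> escapes this argument, but it acts on \<open>X\<^sub>3\<close> and \<open>De\<close> by a
  common central factor, which a multiple of \<open>D\<^sub>1\<close> removes. If \<open>h \<noteq> 2 g\<close> it is then inner modulo
  \<open>X\<^sub>3\<close>, and dividing by \<open>X\<^sub>3\<close> and \<open>De\<close> lowers the weight. If \<open>h = 2 g\<close>, multiples of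
  \<open>z\<^sup>g D\<^sub>i\<close> first remove the values on \<open>z\<close> and, modulo \<open>X\<^sub>3\<close>, on \<open>X\<^sub>2\<close>. Uniqueness follows by
  evaluating on \<open>X\<^sub>3\<close> and \<open>z\<close> and by the same divisions.\<close>

section \<open>The PBW representation\<close>

text \<open>The localizations are never formed. \<open>inner_mod\<close> replaces them by
  congruences modulo an ideal, and this is why normal elements come in coprime pairs. Two kinds of
  triples are tracked: weights, and characters recording the power of \<open>q\<close> gained when a
  normal element passes a homogeneous one. The characters of \<open>x3\<close> and \<open>De\<close>
  are opposite, and so are those of \<open>x2\<close> and \<open>x5\<close> modulo
  \<open>x3\<close>. A weight \<open>(a,b,c)\<close> pairs to zero with the first two iff
  \<open>a = c\<close> and with the last two iff \<open>b = a + c\<close>. For an untwisted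
  derivation these resonances are where the argument fails, which singles out the weights
  \<open>(g,h,g)\<close> and, among them, the weights \<open>(g,2g,g)\<close> of the powers of
  \<open>z\<close>. Dividing a derivation by a normal element subtracts the character of that
  element from the twist, so the descent leaves the class of ordinary derivations. At a resonance an
  inner part does not change the value on the normal element; hence zero values on
  \<open>x3\<close>, \<open>De\<close>, \<open>x2\<close> and \<open>x5\<close>, once arranged,
  survive the later steps.\<close>

type_synonym expo = "int \<times> int \<times> int \<times> int \<times> int \<times> int"

text \<open>Admitting coefficient functions of infinite support makes every operator total. Having
  the operators as a type gives them the class \<open>ring_1\<close>, so that identities in U become
  ring rewriting. Finite support returns later as \<open>V\<close>.\<close>

typedef (overloaded) 'k lin =
  "{T :: (expo \<Rightarrow> 'k::field) \<Rightarrow> expo \<Rightarrow> 'k.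
     (\<forall>v w. T (\<lambda>m. v m + w m) = (\<lambda>m. T v m + T w m)) \<and>
     (\<forall>c v. T (\<lambda>m. c * v m) = (\<lambda>m. c * T v m))}"
  morphisms app Lin
  by (rule exI[of _ "\<lambda>v. v"]) simp

setup_lifting type_definition_lin

lemma app_add: "app T (\<lambda>m. v m + w m) = (\<lambda>m. app T v m + app T w m)"
  and app_scale: "app T (\<lambda>m. c * v m) = (\<lambda>m. c * app T v m)"
  using app[of T] by auto

lemma app_zero [simp]: "app T (\<lambda>m. 0) = (\<lambda>m. 0)"
  using app_scale[of T 0 "\<lambda>m. 0"] by simp

lemma app_diff: "app T (\<lambda>m. v m - w m) = (\<lambda>m. app T v m - app T w m)"
proof -
  have "app T (\<lambda>m. v m + (-1) * w m) = (\<lambda>m. app T v m + (-1) * app T w m)"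
    by (simp only: app_add app_scale)
  then show ?thesis by simp
qed

lemma lin_eqI: "(\<And>v m. app S v m = app T v m) \<Longrightarrow> S = T"
  by (metis app_inject ext)

instantiation lin :: (field) ring_1
begin
lift_definition zero_lin :: "'a lin" is "\<lambda>v m. 0" by simp
lift_definition one_lin :: "'a lin" is "\<lambda>v. v" by simp
lift_definition plus_lin :: "'a lin \<Rightarrow> 'a lin \<Rightarrow> 'a lin" is "\<lambda>S T v m. S v m + T v m"
  by (simp add: algebra_simps)
lift_definition minus_lin :: "'a lin \<Rightarrow> 'a lin \<Rightarrow> 'a lin" is "\<lambda>S T v m. S v m - T v m"
  by (simp add: algebra_simps)
lift_definition uminus_lin :: "'a lin \<Rightarrow> 'a lin" is "\<lambda>S v m. - S v m"
  by simp
lift_definition times_lin :: "'a lin \<Rightarrow> 'a lin \<Rightarrow> 'a lin" is "\<lambda>S T v. S (T v)" by simp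
instance
proof
  show "(0::'a lin) \<noteq> 1"
  proof
    assume "(0::'a lin) = 1"
    then have "app (0::'a lin) (\<lambda>m. 1) = app 1 (\<lambda>m. 1)" by simp
    then show False by transfer (simp add: fun_eq_iff)
  qed
qed (transfer; simp add: algebra_simps)+
end

lemmas app_simps [simp] = zero_lin.rep_eq one_lin.rep_eq plus_lin.rep_eq minus_lin.rep_eq
  uminus_lin.rep_eq times_lin.rep_eq

lift_definition sc :: "'k::field \<Rightarrow> 'k lin" is "\<lambda>c v m. c * v m" by (simp add: algebra_simps)

lemma app_sc [simp]: "app (sc c) v m = c * v m" by (simp add: sc.rep_eq)

lemma sc_comm: "u * sc c = sc c * u"
  by (rule lin_eqI) (simp add: sc.rep_eq app_scale)
lemma sc_comm2: "u * (sc c * v) = sc c * (u * v)"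
  by (metis sc_comm mult.assoc)
lemma sc_simps: "sc 0 = 0" "sc 1 = 1" "sc (c + d) = sc c + sc d" "sc (c - d) = sc c - sc d"
  "sc (c * d) = sc c * sc d" "sc (- c) = - sc c"
  by (auto intro!: lin_eqI simp: sc.rep_eq algebra_simps)

text \<open>Left multiplication by \<open>X\<^sub>1\<close>, \<open>X\<^sub>4\<close>, \<open>X\<^sub>6\<close> on the ordered monomials in
  \<open>X\<^sub>1, \<dots>, X\<^sub>6\<close>, written on coefficient functions. Exponents run over all integers so that the
  formulas need no case distinctions: the quantum integers vanish where a negative exponent
  would contribute.\<close>

lift_definition opX1 :: "'k::field lin" is
  "\<lambda>v (a,b,c,d,e,f). v (a - 1,b,c,d,e,f)" by (auto simp: fun_eq_iff)

definition qint :: "'k::field \<Rightarrow> int \<Rightarrow> 'k"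
  where "qint q n = (q powi n - q powi (- n)) / (q - inverse q)"

lift_definition opX4 :: "'k::field \<Rightarrow> 'k lin" is
  "\<lambda>q v (a,b,c,d,e,f). q powi (a - b) * v (a,b,c,d - 1,e,f)
     - q * qint q (a + 1) * v (a + 1,b - 1,c,d,e,f)"
  by (auto simp: fun_eq_iff algebra_simps)

lift_definition opX6 :: "'k::field \<Rightarrow> 'k lin" is
  "\<lambda>q v (a,b,c,d,e,f). q powi (b - c + d - e) * v (a,b,c,d,e,f - 1)
     - q * qint q (b + 1) * v (a,b + 1,c - 1,d,e,f)
     - q * q powi (b - c) * qint q (d + 1) * v (a,b,c,d + 1,e - 1,f)"
  by (auto simp: fun_eq_iff algebra_simps)

locale quantum_parameter =
  fixes q :: "'k::field_char_0"
  assumes q_nz: "q \<noteq> 0" and q_nonroot: "\<forall>n::nat. n > 0 \<longrightarrow> q ^ n \<noteq> 1"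
begin

lemma powi_eq_1 [simp]: "q powi n = 1 \<longleftrightarrow> n = 0"
proof (cases "n \<ge> 0")
  case True
  then show ?thesis using q_nonroot[rule_format, of "nat n"] by (cases "n = 0") (auto simp: power_int_def)
next
  case False
  then have "q ^ nat (- n) \<noteq> 1" using q_nonroot by simp
  then show ?thesis using False by (auto simp: power_int_def power_inverse)
qed

lemma powi_inj [simp]: "q powi m = q powi n \<longleftrightarrow> m = n"
proof -
  have "q powi m = q powi n \<longleftrightarrow> q powi (m - n) = 1"
    using q_nz by (simp add: power_int_diff)
  then show ?thesis by simp
qed

lemma q2_neq_1: "q * q \<noteq> 1"
  using q_nonroot[rule_format, of 2] by (simp add: power2_eq_square)

lemma q4_neq_1: "q * q * (q * q) \<noteq> 1"
  using q_nonroot[rule_format, of 4] by (simp add: power4_eq_xxxx mult.assoc)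

lemma q2_neq_m1: "q * q \<noteq> - 1"
  using q4_neq_1 by auto

definition x1 where "x1 = (opX1 :: 'k lin)"
definition x4 where "x4 = opX4 q"
definition x6 where "x6 = opX6 q"

lemma app_x1: "app x1 v (a,b,c,d,e,f) = v (a - 1,b,c,d,e,f)"
  by (simp add: x1_def opX1.rep_eq)
lemma app_x4: "app x4 v (a,b,c,d,e,f) = q powi (a - b) * v (a,b,c,d - 1,e,f)
     - q * qint q (a + 1) * v (a + 1,b - 1,c,d,e,f)"
  by (simp add: x4_def opX4.rep_eq)
lemma app_x6: "app x6 v (a,b,c,d,e,f) = q powi (b - c + d - e) * v (a,b,c,d,e,f - 1)
     - q * qint q (b + 1) * v (a,b + 1,c - 1,d,e,f)
     - q * q powi (b - c) * qint q (d + 1) * v (a,b,c,d + 1,e - 1,f)"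
  by (simp add: x6_def opX6.rep_eq)

definition h where "h = inverse (q - inverse q)"
lemma h: "q - inverse q = inverse h" "h \<noteq> 0"
  using q2_neq_1 q_nz by (auto simp: h_def field_simps)
lemma qint_h: "qint q n = (q powi n - inverse (q powi n)) * h"
  by (simp add: qint_def h_def power_int_minus divide_simps)
lemma x1_x6: "x1 * x6 = x6 * x1"
  by (rule lin_eqI) (auto simp: app_x1 app_x6 app_x4)

definition x5 where "x5 = x4 * x6 - sc (inverse q) * (x6 * x4)"

lemmas pointwise_simps = app_x1 app_x6 app_x4 sc.rep_eq power_int_add power_int_diff power_int_minus q_nz
  power_int_numeral power2_eq_square divide_inverse

text \<open>Operator identities are checked coefficientwise after each power of \<open>q\<close> has
  been replaced by an atom with a named inverse. The two quantified clauses cancel such a pair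
  inside a longer product, so that no division remains.\<close>

definition recip :: "'k \<Rightarrow> 'k \<Rightarrow> bool" where
  "recip x x' \<longleftrightarrow> inverse x = x' \<and> inverse x' = x \<and> x * x' = 1 \<and> x' * x = 1 \<and>
     (\<forall>y. x * (x' * y) = y) \<and> (\<forall>y. x' * (x * y) = y)"

lemma ex_recip: "\<exists>q'. recip q q'" "\<exists>A A'. q powi n = A \<and> recip A A'"
proof -
  have "recip x (inverse x)" if "x \<noteq> 0" for x
    using that by (simp add: recip_def flip: mult.assoc)
  then show "\<exists>q'. recip q q'" "\<exists>A A'. q powi n = A \<and> recip A A'"
    using q_nz power_int_eq_0_iff[of q n] by metis+
qed

lemma serre_14: "x1 * x1 * x4 - sc (q + inverse q) * (x1 * x4 * x1) + x4 * x1 * x1 = 0"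
proof (rule lin_eqI)
  fix v and m :: expo
  obtain a b c d e f where m: "m = (a,b,c,d,e,f)" by (cases m)
  obtain q' A A' B B' C C' D D' E E' where rec: "recip q q'" "q powi a = A" "recip A A'" "q powi b = B" "recip B B'"
    "q powi c = C" "recip C C'" "q powi d = D" "recip D D'" "q powi e = E" "recip E E'"
    using ex_recip by meson
  note r = rec(2,4,6,8,10) rec(1,3,5,7,9,11)[unfolded recip_def]
  have "app (x1 * x1 * x4 - sc (q + inverse q) * (x1 * x4 * x1) + x4 * x1 * x1) v (a,b,c,d,e,f) = app (0) v (a,b,c,d,e,f)"
    apply (simp add: pointwise_simps qint_h  r add.commute[of 1])
    apply (simp add: algebra_simps r)
    done
  then show "app (x1 * x1 * x4 - sc (q + inverse q) * (x1 * x4 * x1) + x4 * x1 * x1) v m = app (0) v m" by (simp only: m)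
qed

lemma serre_41: "x4 * x4 * x1 - sc (q + inverse q) * (x4 * x1 * x4) + x1 * x4 * x4 = 0"
proof (rule lin_eqI)
  fix v and m :: expo
  obtain a b c d e f where m: "m = (a,b,c,d,e,f)" by (cases m)
  obtain q' A A' B B' C C' D D' E E' where rec: "recip q q'" "q powi a = A" "recip A A'" "q powi b = B" "recip B B'"
    "q powi c = C" "recip C C'" "q powi d = D" "recip D D'" "q powi e = E" "recip E E'"
    using ex_recip by meson
  note r = rec(2,4,6,8,10) rec(1,3,5,7,9,11)[unfolded recip_def]
  have "app (x4 * x4 * x1 - sc (q + inverse q) * (x4 * x1 * x4) + x1 * x4 * x4) v (a,b,c,d,e,f) = app (0) v (a,b,c,d,e,f)"
    apply (simp add: pointwise_simps qint_h  r add.commute[of 1])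
    apply (simp add: algebra_simps r)
    done
  then show "app (x4 * x4 * x1 - sc (q + inverse q) * (x4 * x1 * x4) + x1 * x4 * x4) v m = app (0) v m" by (simp only: m)
qed

lemma qint_add1: "qint q (n + 1) = q * qint q n + inverse (q powi n)"
  using q2_neq_1 q_nz by (simp add: qint_def power_int_add power_int_diff power_int_minus divide_simps) (simp add: algebra_simps)

lemma qint_shift: "qint q (1 + n) = q * qint q n + inverse (q powi n)"
  "qint q (n + 2) = q * (q * qint q n + inverse (q powi n)) + inverse (q * q powi n)"
  "qint q (2 + n) = q * (q * qint q n + inverse (q powi n)) + inverse (q * q powi n)"
  "qint q (n - 1) = inverse q * qint q n - inverse (q powi n)"
  using qint_add1[of n] qint_add1[of "n + 1"] qint_add1[of "n - 1"] q_nz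
  by (simp_all add: power_int_add power_int_diff field_simps)

text \<open>The last two terms read \<open>v\<close> at \<open>c - 1\<close>. On coefficients with
  \<open>c = 0\<close> of a vector in \<open>V\<close> only the first survives: modulo
  \<open>x3\<close>, \<open>x5\<close> is a weighted shift.\<close>

lemma app_x5: "app x5 v (a,b,c,d,e,f) = q powi (a - c - d) * v (a,b,c,d,e - 1,f)
   - q * inverse (q powi b) * qint q (a + 1) * v (a + 1,b,c - 1,d,e,f)
   - q powi (a - b) * (q - inverse q) * qint q (b + 1) * v (a,b + 1,c - 1,d - 1,e,f)"
proof -
  obtain q' A A' B B' C C' D D' E E' where rec: "recip q q'" "q powi a = A" "recip A A'" "q powi b = B" "recip B B'"
    "q powi c = C" "recip C C'" "q powi d = D" "recip D D'" "q powi e = E" "recip E E'"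
    using ex_recip by meson
  note r = rec(2,4,6,8,10) rec(1,3,5,7,9,11)[unfolded recip_def]
  show ?thesis
    apply (simp add: x5_def pointwise_simps qint_add1 qint_shift r add.commute[of 1] add.commute[of 2])
    apply (simp add: algebra_simps r)
    done
qed

lemma x4_x5: "x4 * x5 = sc q * (x5 * x4)"
proof (rule lin_eqI)
  fix v and m :: expo
  obtain a b c d e f where m: "m = (a,b,c,d,e,f)" by (cases m)
  obtain q' A A' B B' C C' D D' E E' where rec: "recip q q'" "q powi a = A" "recip A A'" "q powi b = B" "recip B B'"
    "q powi c = C" "recip C C'" "q powi d = D" "recip D D'" "q powi e = E" "recip E E'"
    using ex_recip by meson
  note r = rec(2,4,6,8,10) rec(1,3,5,7,9,11)[unfolded recip_def]
  have "app (x4 * x5) v (a,b,c,d,e,f) = app (sc q * (x5 * x4)) v (a,b,c,d,e,f)"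
    apply (simp add: pointwise_simps qint_add1 qint_shift app_x5 r add.commute[of 1] add.commute[of 2])
    apply (simp add: algebra_simps r)
    done
  then show "app (x4 * x5) v m = app (sc q * (x5 * x4)) v m" by (simp only: m)
qed

lemma x5_x6: "x5 * x6 = sc q * (x6 * x5)"
proof (rule lin_eqI)
  fix v and m :: expo
  obtain a b c d e f where m: "m = (a,b,c,d,e,f)" by (cases m)
  obtain q' A A' B B' C C' D D' E E' where rec: "recip q q'" "q powi a = A" "recip A A'" "q powi b = B" "recip B B'"
    "q powi c = C" "recip C C'" "q powi d = D" "recip D D'" "q powi e = E" "recip E E'"
    using ex_recip by meson
  note r = rec(2,4,6,8,10) rec(1,3,5,7,9,11)[unfolded recip_def]
  have "app (x5 * x6) v (a,b,c,d,e,f) = app (sc q * (x6 * x5)) v (a,b,c,d,e,f)"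
    apply (simp add: pointwise_simps qint_add1 qint_shift app_x5 r add.commute[of 1] add.commute[of 2])
    apply (simp add: algebra_simps r)
    done
  then show "app (x5 * x6) v m = app (sc q * (x6 * x5)) v m" by (simp only: m)
qed

definition x2 where "x2 = x1 * x4 - sc (inverse q) * (x4 * x1)"
definition x3 where "x3 = x1 * x5 - sc (inverse q) * (x5 * x1)"

lemma app_x2: "app x2 v (a,b,c,d,e,f) = q powi (- a) * v (a,b - 1,c,d,e,f)"
proof -
  obtain q' A A' B B' C C' D D' E E' where rec: "recip q q'" "q powi a = A" "recip A A'" "q powi b = B" "recip B B'"
    "q powi c = C" "recip C C'" "q powi d = D" "recip D D'" "q powi e = E" "recip E E'"
    using ex_recip by meson
  note r = rec(2,4,6,8,10) rec(1,3,5,7,9,11)[unfolded recip_def]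
  show ?thesis
    apply (simp add: x2_def pointwise_simps qint_add1 qint_shift r add.commute[of 1] add.commute[of 2])
    apply (simp add: algebra_simps r)?
    done
qed

lemma app_x3: "app x3 v (a,b,c,d,e,f) = q powi (- a - b) * v (a,b,c - 1,d,e,f)"
proof -
  obtain q' A A' B B' C C' D D' E E' where rec: "recip q q'" "q powi a = A" "recip A A'" "q powi b = B" "recip B B'"
    "q powi c = C" "recip C C'" "q powi d = D" "recip D D'" "q powi e = E" "recip E E'"
    using ex_recip by meson
  note r = rec(2,4,6,8,10) rec(1,3,5,7,9,11)[unfolded recip_def]
  show ?thesis
    apply (simp add: x3_def app_x5 pointwise_simps qint_add1 qint_shift r add.commute[of 1] add.commute[of 2])
    apply (simp add: algebra_simps r)?
    done
qed

lemma sc_cancel: "sc q * (sc (inverse q) * u) = u" "sc (inverse q) * (sc q * u) = u"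
  "sc q * sc (inverse q) = 1" "sc (inverse q) * sc q = 1"
  using q_nz by (simp_all flip: mult.assoc sc_simps(5) add: sc_simps(2))

lemma sc_merge: "sc a * sc b = sc (a * b)" "sc a * (sc b * u) = sc (a * b) * u"
  by (simp_all add: sc_simps mult.assoc)

lemmas sc_left = sc_comm[of x1] sc_comm[of x2] sc_comm[of x3] sc_comm[of x4] sc_comm[of x5] sc_comm[of x6]
  sc_comm2[of x1] sc_comm2[of x2] sc_comm2[of x3] sc_comm2[of x4] sc_comm2[of x5] sc_comm2[of x6]

text \<open>The left side is a q-commutator of \<open>x4\<close> with \<open>x5\<close>, so the
  cubic relation reduces to \<open>x4_x5\<close>. In the same way \<open>serre_64\<close> reduces to
  \<open>x5_x6\<close>.\<close>

lemma serre_46: "x4 * x4 * x6 - sc (q + inverse q) * (x4 * x6 * x4) + x6 * x4 * x4 = 0"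
proof -
  have "x4 * x4 * x6 - sc (q + inverse q) * (x4 * x6 * x4) + x6 * x4 * x4 = x4 * x5 - sc q * (x5 * x4)"
    by (simp add: x5_def left_diff_distrib right_diff_distrib distrib_right mult.assoc sc_left sc_cancel sc_simps(3))
  then show ?thesis using x4_x5 by simp
qed

lemma serre_64: "x6 * x6 * x4 - sc (q + inverse q) * (x6 * x4 * x6) + x4 * x6 * x6 = 0"
proof -
  have "x6 * x6 * x4 - sc (q + inverse q) * (x6 * x4 * x6) + x4 * x6 * x6 = x5 * x6 - sc q * (x6 * x5)"
    by (simp add: x5_def left_diff_distrib right_diff_distrib distrib_right mult.assoc sc_left sc_cancel sc_simps(3))
  then show ?thesis using x5_x6 by simp
qed

end

section \<open>Evaluation of the free algebra at operators, and the Serre ideal\<close>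

definition ev :: "(letter \<Rightarrow> 'k::field lin) \<Rightarrow> 'k free_alg \<Rightarrow> 'k lin" where
  "ev x f = (\<Sum>w \<in> Poly_Mapping.keys f. sc (Poly_Mapping.lookup f w) * prod_list (map x (letters w)))"

lemma ev_superset:
  assumes "finite S" "Poly_Mapping.keys f \<subseteq> S"
  shows "ev x f = (\<Sum>w \<in> S. sc (Poly_Mapping.lookup f w) * prod_list (map x (letters w)))"
  unfolding ev_def
  by (rule sum.mono_neutral_left) (use assms in \<open>auto simp: in_keys_iff sc_simps\<close>)

lemma ev_add: "ev x (f + g) = ev x f + ev x g"
proof -
  let ?S = "Poly_Mapping.keys f \<union> Poly_Mapping.keys g"
  have "finite ?S" by simp
  then have "ev x h = (\<Sum>w \<in> ?S. sc (Poly_Mapping.lookup h w) * prod_list (map x (letters w)))"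
    if "Poly_Mapping.keys h \<subseteq> ?S" for h
    using ev_superset that by blast
  then show ?thesis
    using Poly_Mapping.keys_add[of f g]
    by (simp add: lookup_add sc_simps distrib_right sum.distrib)
qed

lemma ev_single: "ev x (Poly_Mapping.single w c) = sc c * prod_list (map x (letters w))"
  by (simp add: ev_def sc_simps)

lemma ev_mult: "ev x (f * g) = ev x f * ev x g"
proof (induction f rule: free_alg_induct)
  case (single u c)
  show ?case
  proof (induction g rule: free_alg_induct)
    case (single v d)
    show ?case by (simp add: mult_single ev_single plus_word_def sc_simps mult.assoc sc_comm2[of "prod_list xs" for xs])
  qed (simp add: ev_add algebra_simps)
qed (simp add: ev_add algebra_simps)

lemma ev_basic: "ev x 0 = 0" "ev x 1 = 1" "ev x (scalar c) = sc c" "ev x (letter a) = x a"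
  by (simp_all add: ev_single scalar_def letter_def zero_word_def sc_simps flip: single_one)
    (simp add: ev_def)

lemma ev_diff: "ev x (f - g) = ev x f - ev x g"
  by (metis add_diff_cancel_right' diff_add_cancel ev_add)

lemma scalar_simps: "scalar 0 = 0" "scalar 1 = 1" "scalar (c + d) = scalar c + scalar d"
  "scalar (c - d) = scalar c - scalar d" "scalar (c * d) = scalar c * scalar d" "scalar (- c) = - scalar (c :: 'k::field)"
  by (simp_all add: scalar_def single_add single_diff mult_single single_uminus)

lemma scalar_left: "f * (scalar c * g) = scalar c * (f * (g :: 'k::field free_alg))"
  by (metis scalar_commutes mult.assoc)

lemma scalar_merge: "scalar a * scalar b = scalar (a * b)" "scalar a * (scalar b * u) = scalar (a * b) * (u :: 'k::field free_alg)"
  by (simp_all add: scalar_simps mult.assoc)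

lemma ev_serre_ideal:
  assumes "\<And>r. r \<in> serre_rels q \<Longrightarrow> ev x r = 0" and "f \<in> serre_ideal q"
  shows "ev x f = 0"
proof -
  interpret F: ring "free_ring :: 'a free_alg ring" by (rule ring_free_ring)
  let ?J = "{f. ev x f = 0}"
  have "ideal ?J free_ring"
  proof (rule idealI)
    have minus: "inv\<^bsub>add_monoid free_ring\<^esub> y = - y" for y :: "'a free_alg"
      using F.minus_equality[of "- y" y] by (simp add: a_inv_def)
    have "ev x (- y) = - ev x y" for y using ev_diff[of x 0 y] by (simp add: ev_basic)
    then show "subgroup ?J (add_monoid free_ring)"
      unfolding subgroup_def minus by (auto simp: ev_add ev_basic)
  qed (auto simp: ev_mult ring_free_ring)
  then have "Idl\<^bsub>free_ring\<^esub> (serre_rels q) \<subseteq> ?J"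
    by (rule F.genideal_minimal) (use assms in auto)
  then show ?thesis using assms(2) by (auto simp: serre_ideal_def)
qed

lemma serre_rels_ideal: "serre_rels q \<subseteq> serre_ideal q"
  unfolding serre_ideal_def by (rule ring.genideal_self[OF ring_free_ring]) simp

lemma serre_ideal_minus: "f \<in> serre_ideal q \<Longrightarrow> - f \<in> serre_ideal q"
  using serre_ideal_closed(3)[of f q "-1"] by simp
lemma serre_ideal_diff: "f \<in> serre_ideal q \<Longrightarrow> g \<in> serre_ideal q \<Longrightarrow> f - g \<in> serre_ideal q"
  using serre_ideal_closed(2)[of f q "- g"] serre_ideal_minus[of g q] by simp

context quantum_parameter begin

definition gen :: "letter \<Rightarrow> 'k lin" where
  "gen a = (case a of E1 \<Rightarrow> x1 | E2 \<Rightarrow> x4 | E3 \<Rightarrow> x6)"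

definition \<phi> where "\<phi> = ev gen"

lemma \<phi>_rels: "r \<in> serre_rels q \<Longrightarrow> \<phi> r = 0"
proof -
  assume "r \<in> serre_rels q"
  then have "r = letter E1 * letter E3 - letter E3 * letter E1 \<or>
      (\<exists>a b. (a, b) \<in> {(E1, E2), (E2, E1), (E2, E3), (E3, E2)} \<and> r = letter a ^ 2 * letter b
        - scalar (q + inverse q) * (letter a * letter b * letter a) + letter b * letter a ^ 2)"
    unfolding serre_rels_def by blast
  moreover have "\<phi> (letter a ^ 2 * letter b
        - scalar (q + inverse q) * (letter a * letter b * letter a) + letter b * letter a ^ 2)
      = gen a * gen a * gen b - sc (q + inverse q) * (gen a * gen b * gen a) + gen b * gen a * gen a" for a b
    by (simp only: \<phi>_def ev_add ev_diff ev_mult ev_basic power2_eq_square mult.assoc)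
  moreover have "\<phi> (letter E1 * letter E3 - letter E3 * letter E1) = 0"
    by (simp add: \<phi>_def ev_diff ev_mult ev_basic gen_def x1_x6)
  ultimately show ?thesis
    using serre_14 serre_41 serre_46 serre_64 by (auto simp: gen_def simp del: sc_simps)
qed

lemma \<phi>_ideal: "f \<in> serre_ideal q \<Longrightarrow> \<phi> f = 0"
  unfolding \<phi>_def by (rule ev_serre_ideal) (use \<phi>_rels in \<open>auto simp: \<phi>_def\<close>)

text \<open>The straightening relations are derived in the free algebra modulo the Serre ideal and
  not in the image of \<open>\<phi>\<close>: faithfulness of \<open>\<phi>\<close> is still open
  here, and its proof needs the ordered monomials to span the quotient itself.\<close>

definition cg :: "'k free_alg \<Rightarrow> 'k free_alg \<Rightarrow> bool" (infix \<open>\<approx>\<close> 50) where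
  "f \<approx> g \<longleftrightarrow> f - g \<in> serre_ideal q"

lemma cg_refl [simp]: "f \<approx> f" by (simp add: cg_def serre_ideal_closed)
lemma cg_sym: "f \<approx> g \<Longrightarrow> g \<approx> f"
  using serre_ideal_minus[of "f - g" q] by (simp add: cg_def)
lemma cg_add: "f \<approx> g \<Longrightarrow> f' \<approx> g' \<Longrightarrow> f + f' \<approx> g + g'"
  using serre_ideal_closed(2)[of "f - g" q "f' - g'"] by (simp add: cg_def algebra_simps)
lemma cg_trans [trans]: "f \<approx> g \<Longrightarrow> g \<approx> k \<Longrightarrow> f \<approx> k"
  using serre_ideal_closed(2)[of "f - g" q "g - k"] by (simp add: cg_def)
lemma cg_trans_eq [trans]: "f = g \<Longrightarrow> g \<approx> k \<Longrightarrow> f \<approx> k" "f \<approx> g \<Longrightarrow> g = k \<Longrightarrow> f \<approx> k"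
  by simp_all
lemma cg_left: "f \<approx> g \<Longrightarrow> u * f \<approx> u * g"
  using serre_ideal_closed(3)[of "f - g" q u] by (simp add: cg_def algebra_simps)
lemma cg_right: "f \<approx> g \<Longrightarrow> f * u \<approx> g * u"
  using serre_ideal_closed(4)[of "f - g" q u] by (simp add: cg_def algebra_simps)

definition y1 :: "'k free_alg" where "y1 = letter E1"
definition y4 :: "'k free_alg" where "y4 = letter E2"
definition y6 :: "'k free_alg" where "y6 = letter E3"
definition y2 where "y2 = y1 * y4 - scalar (inverse q) * (y4 * y1)"
definition y5 where "y5 = y4 * y6 - scalar (inverse q) * (y6 * y4)"
definition y3 where "y3 = y1 * y5 - scalar (inverse q) * (y5 * y1)"

lemmas y_left = scalar_commutes[of y1] scalar_commutes[of y2] scalar_commutes[of y3] scalar_commutes[of y4]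
  scalar_commutes[of y5] scalar_commutes[of y6] scalar_left[of y1] scalar_left[of y2] scalar_left[of y3]
  scalar_left[of y4] scalar_left[of y5] scalar_left[of y6]

lemmas y_ring = left_diff_distrib right_diff_distrib distrib_left distrib_right mult.assoc y_left scalar_merge

lemma serre_cg:
  "y1 * y6 - y6 * y1 \<in> serre_ideal q"
  "y1 * y2 - scalar q * (y2 * y1) \<in> serre_ideal q"
  "y2 * y4 - scalar q * (y4 * y2) \<in> serre_ideal q"
  "y4 * y5 - scalar q * (y5 * y4) \<in> serre_ideal q"
  "y5 * y6 - scalar q * (y6 * y5) \<in> serre_ideal q"
proof -
  have s: "(a, b) \<in> {(E1, E2), (E2, E1), (E2, E3), (E3, E2)} \<Longrightarrow>
    letter a ^ 2 * letter b - scalar (q + inverse q) * (letter a * letter b * letter a)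
          + letter b * letter a ^ 2 \<in> serre_ideal q" for a b
    using serre_rels_ideal[of q] unfolding serre_rels_def by blast
  show "y1 * y6 - y6 * y1 \<in> serre_ideal q"
    using serre_rels_ideal[of q] by (auto simp: serre_rels_def y1_def y6_def)
  have "y1 * y2 - scalar q * (y2 * y1) = y1 ^ 2 * y4 - scalar (q + inverse q) * (y1 * y4 * y1) + y4 * y1 ^ 2"
    using q_nz by (simp add: y2_def y_ring power2_eq_square scalar_simps(1-4))
  then show "y1 * y2 - scalar q * (y2 * y1) \<in> serre_ideal q"
    using s[of E1 E2] by (simp add: y1_def y4_def)
  have "y2 * y4 - scalar q * (y4 * y2) = y4 ^ 2 * y1 - scalar (q + inverse q) * (y4 * y1 * y4) + y1 * y4 ^ 2"
    using q_nz by (simp add: y2_def y_ring power2_eq_square scalar_simps(1-4))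
  then show "y2 * y4 - scalar q * (y4 * y2) \<in> serre_ideal q"
    using s[of E2 E1] by (simp add: y1_def y4_def)
  have "y4 * y5 - scalar q * (y5 * y4) = y4 ^ 2 * y6 - scalar (q + inverse q) * (y4 * y6 * y4) + y6 * y4 ^ 2"
    using q_nz by (simp add: y5_def y_ring power2_eq_square scalar_simps(1-4))
  then show "y4 * y5 - scalar q * (y5 * y4) \<in> serre_ideal q"
    using s[of E2 E3] by (simp add: y6_def y4_def)
  have "y5 * y6 - scalar q * (y6 * y5) = y6 ^ 2 * y4 - scalar (q + inverse q) * (y6 * y4 * y6) + y4 * y6 ^ 2"
    using q_nz by (simp add: y5_def y_ring power2_eq_square scalar_simps(1-4))
  then show "y5 * y6 - scalar q * (y6 * y5) \<in> serre_ideal q"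
    using s[of E3 E2] by (simp add: y6_def y4_def)
qed

lemmas IA = serre_ideal_closed(2) and IL = serre_ideal_closed(3) and IR = serre_ideal_closed(4)
  and ID = serre_ideal_diff

text \<open>The two bracketings of the longest root vector agree because \<open>y1\<close> and
  \<open>y6\<close> commute.\<close>

lemma y2_y6: "y2 * y6 - scalar (inverse q) * (y6 * y2) - y3 \<in> serre_ideal q"
proof -
  let ?r = "y1 * y6 - y6 * y1"
  have "y2 * y6 - scalar (inverse q) * (y6 * y2) - y3
      = scalar (inverse q) * (?r * y4) - scalar (inverse q) * (y4 * ?r)"
    by (simp add: y2_def y3_def y5_def y_ring)
  then show ?thesis using ID[OF IL[OF IR[OF serre_cg(1)]] IL[OF IL[OF serre_cg(1)]]] by (simp only:)
qed

lemma y3_y6: "y3 * y6 - scalar q * (y6 * y3) \<in> serre_ideal q"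
proof -
  let ?r = "y1 * y6 - y6 * y1" and ?s = "y5 * y6 - scalar q * (y6 * y5)"
  have "y3 * y6 - scalar q * (y6 * y3)
      = y1 * ?s + scalar q * (?r * y5) - scalar (inverse q) * (y5 * ?r) - scalar (inverse q) * (?s * y1)"
    using q_nz by (simp add: y3_def y_ring scalar_simps(1-4,6))
  then show ?thesis using ID[OF ID[OF IA[OF IL[OF serre_cg(5)] IL[OF IR[OF serre_cg(1)]]] IL[OF IL[OF serre_cg(1)]]] IL[OF IR[OF serre_cg(5)]]] by (simp only:)
qed

text \<open>Each of the two bracketings of \<open>y3\<close> expresses one of the products
  \<open>y3 * y4\<close>, \<open>y4 * y3\<close> through the other and the same multiple of
  \<open>y2 * y5 - y5 * y2\<close>. The difference is \<open>1 + inverse q * inverse q\<close> times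
  the commutator, and this factor is nonzero because the square of \<open>q\<close> is not
  -1.\<close>

lemma y3_y4: "y3 * y4 - y4 * y3 \<in> serre_ideal q"
proof -
  let ?i = "inverse q"
  let ?r = "y4 * y5 - scalar q * (y5 * y4)" and ?s = "y2 * y4 - scalar q * (y4 * y2)"
    and ?t = "y2 * y6 - scalar (inverse q) * (y6 * y2) - y3"
  have 1: "y3 * y4 - scalar ?i * (y2 * y5 - y5 * y2) - scalar (?i * ?i) * (y4 * y3)
     = scalar (?i * ?i * ?i) * (?r * y1) - scalar ?i * (y1 * ?r)"
    using q_nz by (simp add: y3_def y2_def y_ring scalar_simps(1-2))
  have 2: "y4 * y3 - scalar ?i * (y2 * y5 - y5 * y2) - scalar (?i * ?i) * (y3 * y4)
     = scalar (?i * ?i * ?i) * (y6 * ?s) - scalar ?i * (?s * y6) - y4 * ?t + scalar (?i * ?i) * (?t * y4)"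
    using q_nz by (simp add: y5_def y_ring scalar_simps(1-2))
  have "scalar (1 + ?i * ?i) * (y3 * y4 - y4 * y3) =
     (y3 * y4 - scalar ?i * (y2 * y5 - y5 * y2) - scalar (?i * ?i) * (y4 * y3))
     - (y4 * y3 - scalar ?i * (y2 * y5 - y5 * y2) - scalar (?i * ?i) * (y3 * y4))"
    by (simp add: y_ring scalar_simps(1-4))
  also have "\<dots> \<in> serre_ideal q"
    unfolding 1 2 by (rule ID[OF ID[OF IL[OF IR[OF serre_cg(4)]] IL[OF IL[OF serre_cg(4)]]] IA[OF ID[OF ID[OF IL[OF IL[OF serre_cg(3)]] IL[OF IR[OF serre_cg(3)]]] IL[OF y2_y6]] IL[OF IR[OF y2_y6]]]])
  finally have "scalar (inverse (1 + ?i * ?i)) * (scalar (1 + ?i * ?i) * (y3 * y4 - y4 * y3)) \<in> serre_ideal q"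
    by (rule IL)
  moreover have "1 + ?i * ?i \<noteq> 0"
  proof
    assume "1 + ?i * ?i = 0"
    moreover have "q * ?i = 1" using q_nz by simp
    moreover have "q * q * (1 + ?i * ?i) = q * q + (q * ?i) * (q * ?i)" by (simp only: distrib_left mult_ac mult_1_right mult_1_left)
    ultimately have "q * q + 1 = 0" by (simp only: mult_zero_right mult_1_right)
    then show False using q2_neq_m1 add_eq_0_iff2[of "q * q" 1] by blast
  qed
  ultimately show ?thesis by (simp only: scalar_merge left_inverse scalar_simps(2) mult_1_left not_False_eq_True if_True simp_thms)
qed

lemma y1_y3: "y1 * y3 - scalar q * (y3 * y1) \<in> serre_ideal q"
proof -
  let ?i = "inverse q"
  let ?r = "y1 * y6 - y6 * y1" and ?s = "y1 * y2 - scalar q * (y2 * y1)"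
    and ?t = "y2 * y6 - scalar (inverse q) * (y6 * y2) - y3"
  have "y1 * y3 - scalar q * (y3 * y1)
      = ?s * y6 + scalar q * (y2 * ?r) - scalar ?i * (?r * y2) - scalar ?i * (y6 * ?s) - y1 * ?t + scalar q * (?t * y1)"
    using q_nz by (simp add: y_ring scalar_simps(1-2))
  then show ?thesis using IA[OF ID[OF ID[OF ID[OF IA[OF IR[OF serre_cg(2)] IL[OF IL[OF serre_cg(1)]]] IL[OF IR[OF serre_cg(1)]]] IL[OF IL[OF serre_cg(2)]]] IL[OF y2_y6]] IL[OF IR[OF y2_y6]]] by (simp only:)
qed

lemma y2_y3: "y2 * y3 - scalar q * (y3 * y2) \<in> serre_ideal q"
proof -
  let ?i = "inverse q"
  let ?r = "y3 * y4 - y4 * y3" and ?s = "y1 * y3 - scalar q * (y3 * y1)"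
  have "y2 * y3 - scalar q * (y3 * y2)
      = ?s * y4 - y1 * ?r - scalar ?i * (y4 * ?s) + ?r * y1"
    using q_nz by (simp add: y2_def y_ring scalar_simps(1-2))
  then show ?thesis using IA[OF ID[OF ID[OF IR[OF y1_y3] IL[OF y3_y4]] IL[OF IL[OF y1_y3]]] IR[OF y3_y4]] by (simp only:)
qed

section \<open>Ordered monomials\<close>

definition mon :: "nat \<Rightarrow> nat \<Rightarrow> nat \<Rightarrow> nat \<Rightarrow> nat \<Rightarrow> nat \<Rightarrow> 'k free_alg" where
  "mon a b c d e f = y1 ^ a * (y2 ^ b * (y3 ^ c * (y4 ^ d * (y5 ^ e * y6 ^ f))))"

text \<open>The error term \<open>w\<close> itself q-commutes with \<open>u\<close>, so moving
  \<open>v\<close> through a power creates only one further kind of monomial. The clause for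
  \<open>n = 0\<close> removes the error term where the truncated exponent \<open>n - 1\<close> is
  wrong; the induction needs it to merge the two contributions.\<close>

lemma pow_step:
  assumes vu: "v * u \<approx> scalar c * (u * v) + scalar d * w" and wu: "w * u \<approx> scalar e * (u * w)"
  shows "\<exists>\<alpha> \<beta>. v * u ^ n \<approx> scalar \<alpha> * (u ^ n * v) + scalar \<beta> * (u ^ (n - 1) * w) \<and> (n = 0 \<longrightarrow> \<beta> = 0)"
proof (induction n)
  case 0
  show ?case by (intro exI[of _ 1] exI[of _ 0]) (simp add: scalar_simps)
next
  case (Suc n)
  then obtain \<alpha> \<beta> where IH: "v * u ^ n \<approx> scalar \<alpha> * (u ^ n * v) + scalar \<beta> * (u ^ (n - 1) * w)"
    and z: "n = 0 \<Longrightarrow> \<beta> = 0" by auto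
  have "v * u ^ Suc n = (v * u ^ n) * u" by (simp only: power_Suc2 mult.assoc)
  also have "\<dots> \<approx> (scalar \<alpha> * (u ^ n * v) + scalar \<beta> * (u ^ (n - 1) * w)) * u"
    by (rule cg_right[OF IH])
  also have "\<dots> = scalar \<alpha> * (u ^ n * (v * u)) + scalar \<beta> * (u ^ (n - 1) * (w * u))"
    by (simp only: distrib_right mult.assoc)
  also have "\<dots> \<approx> scalar \<alpha> * (u ^ n * (scalar c * (u * v) + scalar d * w)) + scalar \<beta> * (u ^ (n - 1) * (scalar e * (u * w)))"
    by (intro cg_add cg_left vu wu)
  also have "\<dots> = scalar (\<alpha> * c) * (u ^ Suc n * v) + (scalar (\<alpha> * d) * (u ^ n * w) + scalar (\<beta> * e) * (u ^ (n - 1) * (u * w)))"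
    by (simp only: distrib_left scalar_left[of "u ^ k" for k] scalar_merge power_Suc2 mult.assoc add.assoc)
  also have "scalar (\<beta> * e) * (u ^ (n - 1) * (u * w)) = scalar (\<beta> * e) * (u ^ n * w)"
  proof (cases n)
    case 0
    then show ?thesis using z by (simp add: scalar_simps)
  next
    case (Suc m)
    then show ?thesis by (simp only: diff_Suc_1 power_Suc2 mult.assoc)
  qed
  also have "scalar (\<alpha> * d) * (u ^ n * w) + scalar (\<beta> * e) * (u ^ n * w) = scalar (\<alpha> * d + \<beta> * e) * (u ^ n * w)"
    by (simp only: scalar_simps distrib_right)
  finally show ?case by (intro exI[of _ "\<alpha> * c"] exI[of _ "\<alpha> * d + \<beta> * e"]) simp
qed

lemma pow_comm:
  assumes "v * u \<approx> scalar c * (u * v)"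
  shows "\<exists>\<alpha>. v * u ^ n \<approx> scalar \<alpha> * (u ^ n * v)"
proof -
  have "v * u \<approx> scalar c * (u * v) + scalar 0 * 0" "0 * u \<approx> scalar 1 * (u * 0)"
    using assms by simp_all
  from pow_step[OF this, of n] show ?thesis by (simp only: mult_zero_right add_0_right) blast
qed

text \<open>Combinations of ordered monomials modulo the ideal. As an inductive predicate, stability
  under left multiplication needs to be checked on monomials only.\<close>

inductive W where
  W_mon: "W (scalar k * mon a b c d e f)"
| W_add: "W f \<Longrightarrow> W g \<Longrightarrow> W (f + g)"
| W_cong: "W f \<Longrightarrow> g \<approx> f \<Longrightarrow> W g"

lemma W_scalar: "W f \<Longrightarrow> W (scalar k * f)"
proof (induction rule: W.induct)
  case (W_mon k' a b c d e f)
  then show ?case by (simp only: scalar_merge W.W_mon)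
qed (auto simp: distrib_left intro: W.W_add W.W_cong cg_left)

lemma W_left:
  assumes "\<And>a b c d e f. W (u * mon a b c d e f)" "W f"
  shows "W (u * f)"
  using assms(2)
proof (induction rule: W.induct)
  case (W_mon k a b c d e f)
  show ?case using assms(1) W_scalar by (simp only: scalar_left)
qed (auto simp: distrib_left intro: W.W_add W.W_cong cg_left)

lemma cg_flip: "u * v - scalar q * (v * u) \<in> serre_ideal q \<Longrightarrow> v * u \<approx> scalar (inverse q) * (u * v)"
proof -
  assume *: "u * v - scalar q * (v * u) \<in> serre_ideal q"
  have "v * u - scalar (inverse q) * (u * v) = scalar (- inverse q) * (u * v - scalar q * (v * u))"
    using q_nz by (simp add: right_diff_distrib scalar_merge scalar_simps(1-4,6))
  then show ?thesis using IL[OF *] by (simp only: cg_def)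
qed

lemma cg_21: "y2 * y1 \<approx> scalar (inverse q) * (y1 * y2)"
  and cg_42: "y4 * y2 \<approx> scalar (inverse q) * (y2 * y4)"
  and cg_43: "y4 * y3 \<approx> scalar 1 * (y3 * y4)"
  and cg_61: "y6 * y1 \<approx> scalar 1 * (y1 * y6)"
  and cg_32: "y3 * y2 \<approx> scalar (inverse q) * (y2 * y3)"
  and cg_63: "y6 * y3 \<approx> scalar (inverse q) * (y3 * y6)"
  and cg_54: "y5 * y4 \<approx> scalar (inverse q) * (y4 * y5)"
  and cg_65: "y6 * y5 \<approx> scalar (inverse q) * (y5 * y6)"
  and cg_41: "y4 * y1 \<approx> scalar q * (y1 * y4) + scalar (- q) * y2"
  and cg_64: "y6 * y4 \<approx> scalar q * (y4 * y6) + scalar (- q) * y5"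
  and cg_62: "y6 * y2 \<approx> scalar q * (y2 * y6) + scalar (- q) * y3"
proof -
  show "y2 * y1 \<approx> scalar (inverse q) * (y1 * y2)" "y4 * y2 \<approx> scalar (inverse q) * (y2 * y4)"
    "y3 * y2 \<approx> scalar (inverse q) * (y2 * y3)" "y6 * y3 \<approx> scalar (inverse q) * (y3 * y6)"
    "y5 * y4 \<approx> scalar (inverse q) * (y4 * y5)" "y6 * y5 \<approx> scalar (inverse q) * (y5 * y6)"
    by (intro cg_flip serre_cg y2_y3 y3_y6)+
  show "y4 * y3 \<approx> scalar 1 * (y3 * y4)" "y6 * y1 \<approx> scalar 1 * (y1 * y6)"
    using y3_y4 serre_cg(1) by (simp_all add: scalar_simps cg_sym cg_def[symmetric])
  have "y4 * y1 = scalar q * (y1 * y4) + scalar (- q) * y2"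
    using q_nz by (simp add: y2_def y_ring scalar_simps(1-4,6))
  then show "y4 * y1 \<approx> scalar q * (y1 * y4) + scalar (- q) * y2" by simp
  have "y6 * y4 = scalar q * (y4 * y6) + scalar (- q) * y5"
    using q_nz by (simp add: y5_def y_ring scalar_simps(1-4,6))
  then show "y6 * y4 \<approx> scalar q * (y4 * y6) + scalar (- q) * y5" by simp
  have "y6 * y2 - (scalar q * (y2 * y6) + scalar (- q) * y3) = scalar (- q) * (y2 * y6 - scalar (inverse q) * (y6 * y2) - y3)"
    using q_nz by (simp add: right_diff_distrib scalar_merge scalar_simps(1-4,6))
  then show "y6 * y2 \<approx> scalar q * (y2 * y6) + scalar (- q) * y3"
    using IL[OF y2_y6] by (simp only: cg_def)
qed

lemma pow_tail: "v * u \<approx> scalar \<alpha> * (u' * v') \<Longrightarrow> v * (u * T) \<approx> scalar \<alpha> * (u' * (v' * T))"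
  by (drule cg_right[where u = T]) (simp only: mult.assoc)
lemma pow_tail2: "v * u \<approx> scalar \<alpha> * (u' * v') + scalar \<beta> * (u'' * w) \<Longrightarrow>
    v * (u * T) \<approx> scalar \<alpha> * (u' * (v' * T)) + scalar \<beta> * (u'' * (w * T))"
  by (drule cg_right[where u = T]) (simp only: mult.assoc distrib_right)

lemma W_y1: "W (y1 * mon a b c d e f)"
proof -
  have "y1 * mon a b c d e f = scalar 1 * mon (Suc a) b c d e f"
    by (simp add: mon_def mult.assoc scalar_simps)
  then show ?thesis using W_mon by metis
qed

lemma W_scaled: "g \<approx> scalar k * f \<Longrightarrow> W f \<Longrightarrow> W g"
  by (rule W_cong[OF W_scalar])
lemma W_scaled2: "g \<approx> scalar k * f + scalar k' * f' \<Longrightarrow> W f \<Longrightarrow> W f' \<Longrightarrow> W g"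
  by (rule W_cong[OF W_add[OF W_scalar W_scalar]])
lemma cg_scaled: "g \<approx> scalar k * (u * f) \<Longrightarrow> f \<approx> scalar l * f' \<Longrightarrow> g \<approx> scalar (k * l) * (u * f')"
proof -
  assume *: "g \<approx> scalar k * (u * f)" "f \<approx> scalar l * f'"
  have "g \<approx> scalar k * (u * f)" by fact
  also have "\<dots> \<approx> scalar k * (u * (scalar l * f'))" by (intro cg_left *)
  also have "\<dots> = scalar (k * l) * (u * f')" by (simp only: scalar_left[of u] scalar_merge)
  finally show ?thesis .
qed

lemma W_mon1: "W (mon a b c d e f)"
  using W_mon[of 1] by (simp add: scalar_simps)

lemma W_pow1: "W f \<Longrightarrow> W (y1 ^ n * f)"
proof (induction n)
  case (Suc n)
  then show ?case using W_left[OF W_y1, of "y1 ^ n * f"] by (simp add: mult.assoc)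
qed simp

lemma W_y4: "W (y4 * mon a b c d e f)"
proof -
  define T where "T = y2 ^ b * (y3 ^ c * (y4 ^ d * (y5 ^ e * y6 ^ f)))"
  obtain \<alpha> \<beta> where "y4 * y1 ^ a \<approx> scalar \<alpha> * (y1 ^ a * y4) + scalar \<beta> * (y1 ^ (a - 1) * y2)"
    using pow_step[OF cg_41 cg_21, of a] by blast
  then have *: "y4 * mon a b c d e f \<approx> scalar \<alpha> * (y1 ^ a * (y4 * T)) + scalar \<beta> * (y1 ^ (a - 1) * (y2 * T))"
    unfolding mon_def T_def by (rule pow_tail2)
  obtain k l where k: "y4 * y2 ^ b \<approx> scalar k * (y2 ^ b * y4)" and l: "y4 * y3 ^ c \<approx> scalar l * (y3 ^ c * y4)"
    using pow_comm[OF cg_42] pow_comm[OF cg_43] by meson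
  have "y4 * T \<approx> scalar (k * l) * (y2 ^ b * (y3 ^ c * (y4 * (y4 ^ d * (y5 ^ e * y6 ^ f)))))"
    unfolding T_def by (rule cg_scaled[OF pow_tail[OF k] pow_tail[OF l]])
  then have "y4 * T \<approx> scalar (k * l) * mon 0 b c (Suc d) e f"
    by (simp add: mon_def mult.assoc)
  then have 1: "W (y4 * T)" using W_mon1 by (rule W_scaled)
  have "y2 * T = mon 0 (Suc b) c d e f" by (simp add: mon_def T_def mult.assoc)
  then have 2: "W (y2 * T)" using W_mon1 by metis
  show ?thesis by (rule W_scaled2[OF *]) (intro W_pow1 1 2)+
qed

lemma y6_T5: "\<exists>k. y6 * (y5 ^ e * y6 ^ f) \<approx> scalar k * (y5 ^ e * y6 ^ Suc f)"
proof -
  obtain k where k: "y6 * y5 ^ e \<approx> scalar k * (y5 ^ e * y6)"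
    using pow_comm[OF cg_65] by meson
  show ?thesis using pow_tail[OF k, of "y6 ^ f"] by auto
qed

text \<open>Passing \<open>y2\<close> leaves a factor \<open>y3\<close> and passing
  \<open>y4\<close> leaves a factor \<open>y5\<close>. Both errors arise where the ordered form has
  its next slot, so they need no further straightening.\<close>

lemma W_y6: "W (y6 * mon a b c d e f)"
proof -
  define T2 where "T2 = y2 ^ b * (y3 ^ c * (y4 ^ d * (y5 ^ e * y6 ^ f)))"
  define T3 where "T3 = y3 ^ c * (y4 ^ d * (y5 ^ e * y6 ^ f))"
  define T4 where "T4 = y4 ^ d * (y5 ^ e * y6 ^ f)"
  define T5 where "T5 = y5 ^ e * y6 ^ f"
  have T: "T2 = y2 ^ b * T3" "T3 = y3 ^ c * T4" "T4 = y4 ^ d * T5"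
    by (simp_all add: T2_def T3_def T4_def T5_def)
  have monT: "y2 ^ b * (y3 ^ c * (y4 ^ d * (y5 ^ Suc e * y6 ^ f'))) = mon 0 b c d (Suc e) f'" for b c d e f'
    by (simp add: mon_def)
  obtain k where "y6 * y1 ^ a \<approx> scalar k * (y1 ^ a * y6)"
    using pow_comm[OF cg_61] by meson
  from pow_tail[OF this] have 1: "y6 * mon a b c d e f \<approx> scalar k * (y1 ^ a * (y6 * T2))"
    by (simp only: mon_def T2_def)
  obtain \<alpha> \<beta> where "y6 * y2 ^ b \<approx> scalar \<alpha> * (y2 ^ b * y6) + scalar \<beta> * (y2 ^ (b - 1) * y3)"
    using pow_step[OF cg_62 cg_32, of b] by blast
  from pow_tail2[OF this] have 2: "y6 * T2 \<approx> scalar \<alpha> * (y2 ^ b * (y6 * T3)) + scalar \<beta> * (y2 ^ (b - 1) * (y3 * T3))"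
    by (simp only: T)
  obtain l where l: "y6 * y3 ^ c \<approx> scalar l * (y3 ^ c * y6)"
    using pow_comm[OF cg_63] by meson
  obtain \<gamma> \<delta> where "y6 * y4 ^ d \<approx> scalar \<gamma> * (y4 ^ d * y6) + scalar \<delta> * (y4 ^ (d - 1) * y5)"
    using pow_step[OF cg_64 cg_54, of d] by blast
  from pow_tail2[OF this] have 4: "y6 * T4 \<approx> scalar \<gamma> * (y4 ^ d * (y6 * T5)) + scalar \<delta> * (y4 ^ (d - 1) * (y5 * T5))"
    by (simp only: T)
  obtain m where m: "y6 * T5 \<approx> scalar m * (y5 ^ e * y6 ^ Suc f)"
    unfolding T5_def using y6_T5 by blast
  have W1: "W (y2 ^ b * (y3 ^ c * (y4 ^ d * (y6 * T5))))"
  proof (rule W_cong)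
    show "y2 ^ b * (y3 ^ c * (y4 ^ d * (y6 * T5))) \<approx> scalar m * mon 0 b c d e (Suc f)"
      using cg_left[OF cg_left[OF cg_left[OF m]], of "y2 ^ b" "y3 ^ c" "y4 ^ d"]
      by (simp add: mon_def scalar_left)
  qed (rule W_mon)
  have W2: "W (y2 ^ b * (y3 ^ c * (y4 ^ (d - 1) * (y5 * T5))))"
    using W_mon1[of 0 b c "d - 1" "Suc e" f] by (simp add: mon_def T5_def mult.assoc)
  have "y2 ^ b * (y6 * T3) \<approx> scalar l * (y2 ^ b * (y3 ^ c * (y6 * T4)))"
    using cg_left[OF pow_tail[OF l], of "y2 ^ b" T4] by (simp add: T scalar_left)
  also have "\<dots> \<approx> scalar l * (y2 ^ b * (y3 ^ c * (scalar \<gamma> * (y4 ^ d * (y6 * T5)) + scalar \<delta> * (y4 ^ (d - 1) * (y5 * T5)))))"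
    by (intro cg_left 4)
  also have "\<dots> = scalar (l * \<gamma>) * (y2 ^ b * (y3 ^ c * (y4 ^ d * (y6 * T5)))) + scalar (l * \<delta>) * (y2 ^ b * (y3 ^ c * (y4 ^ (d - 1) * (y5 * T5))))"
    by (simp only: distrib_left scalar_left[of "y2 ^ b"] scalar_left[of "y3 ^ c"] scalar_merge)
  finally have W3: "W (y2 ^ b * (y6 * T3))" using W1 W2 by (rule W_scaled2)
  have W4: "W (y2 ^ (b - 1) * (y3 * T3))"
    using W_mon1[of 0 "b - 1" "Suc c" d e f] by (simp add: mon_def T3_def mult.assoc)
  have "W (y6 * T2)" using W_scaled2[OF 2 W3 W4] .
  then show ?thesis using 1 W_scaled W_pow1 by blast
qed

lemma W_all: "W f"
proof (induction f rule: free_alg_induct)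
  case (single w c)
  have word: "W (Poly_Mapping.single (Word ls) 1)" for ls
  proof (induction ls)
    case Nil
    show ?case using W_mon1[of 0 0 0 0 0 0] by (simp add: mon_def flip: zero_word_def)
  next
    case (Cons l ls)
    have "Poly_Mapping.single (Word (l # ls)) (1::'k) = letter l * Poly_Mapping.single (Word ls) 1"
      by (simp add: letter_def mult_single plus_word_def)
    moreover have "W (letter l * Poly_Mapping.single (Word ls) 1)"
      using W_left[OF W_y1 Cons] W_left[OF W_y4 Cons] W_left[OF W_y6 Cons]
      by (cases l) (simp_all only: y1_def y4_def y6_def)
    ultimately show ?case by simp
  qed
  have "Poly_Mapping.single w c = scalar c * Poly_Mapping.single (Word (letters w)) 1"
    by (simp add: scalar_def mult_single)
  then show ?case using word W_scalar by metis
qed (rule W_add)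

end

section \<open>Weights and homogeneous components of operators\<close>

type_synonym weight = "int \<times> int \<times> int"

definition dl :: "expo \<Rightarrow> expo \<Rightarrow> 'k::field" where "dl m = (\<lambda>n. if n = m then 1 else 0)"

text \<open>The coordinates count the occurrences of the three generators in the ordered monomial
  with the given exponents.\<close>

definition wt6 :: "expo \<Rightarrow> weight" where
  "wt6 = (\<lambda>(a,b,c,d,e,f). (a + b + c, b + c + d + e, c + e + f))"

definition N6 :: "expo set" where
  "N6 = {(a,b,c,d,e,f). 0 \<le> a \<and> 0 \<le> b \<and> 0 \<le> c \<and> 0 \<le> d \<and> 0 \<le> e \<and> 0 \<le> f}"

definition V :: "(expo \<Rightarrow> 'k::field) set" where
  "V = {v. finite {m. v m \<noteq> 0} \<and> (\<forall>m. v m \<noteq> 0 \<longrightarrow> m \<in> N6)}"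

text \<open>The part of \<open>T\<close> that raises weights by \<open>\<gamma>\<close>. Restricting
  the input separately for each output index defines it for every operator, with no sum over
  weights.\<close>

lift_definition comp :: "weight \<Rightarrow> 'k::field lin \<Rightarrow> 'k lin" is
  "\<lambda>\<gamma> T v m. T (\<lambda>n. if wt6 n = wt6 m - \<gamma> then v n else 0) m"
proof (intro conjI allI ext)
  fix \<gamma> :: weight and T :: "(expo \<Rightarrow> 'k) \<Rightarrow> expo \<Rightarrow> 'k" and v w :: "expo \<Rightarrow> 'k" and c m
  assume *: "(\<forall>v w. T (\<lambda>m. v m + w m) = (\<lambda>m. T v m + T w m)) \<and> (\<forall>c v. T (\<lambda>m. c * v m) = (\<lambda>m. c * T v m))"
  have "(\<lambda>n. if wt6 n = wt6 m - \<gamma> then v n + w n else 0) =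
     (\<lambda>n. (if wt6 n = wt6 m - \<gamma> then v n else 0) + (if wt6 n = wt6 m - \<gamma> then w n else 0))" by auto
  then show "T (\<lambda>n. if wt6 n = wt6 m - \<gamma> then v n + w n else 0) m =
     T (\<lambda>n. if wt6 n = wt6 m - \<gamma> then v n else 0) m + T (\<lambda>n. if wt6 n = wt6 m - \<gamma> then w n else 0) m"
    using * by simp
  have "(\<lambda>n. if wt6 n = wt6 m - \<gamma> then c * v n else 0) =
     (\<lambda>n. c * (if wt6 n = wt6 m - \<gamma> then v n else 0))" by auto
  then show "T (\<lambda>n. if wt6 n = wt6 m - \<gamma> then c * v n else 0) m =
     c * T (\<lambda>n. if wt6 n = wt6 m - \<gamma> then v n else 0) m"
    using * by simp
qed

text \<open>Homogeneity phrased as locality, because an input function of infinite support need not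
  split into finitely many weights.\<close>

definition loc :: "weight \<Rightarrow> 'k::field lin \<Rightarrow> bool" where
  "loc \<gamma> u \<longleftrightarrow> (\<forall>\<delta> v. (\<forall>m. wt6 m = \<delta> \<longrightarrow> v m = 0) \<longrightarrow> (\<forall>m. wt6 m = \<gamma> + \<delta> \<longrightarrow> app u v m = 0))"

lemma locD: "loc \<gamma> u \<Longrightarrow> (\<And>n. wt6 n = wt6 m - \<gamma> \<Longrightarrow> v n = 0) \<Longrightarrow> app u v m = 0"
  unfolding loc_def by (metis add_diff_cancel_left' add.commute diff_add_cancel)

lemma locI: "(\<And>m v. (\<And>n. wt6 n = wt6 m - \<gamma> \<Longrightarrow> v n = 0) \<Longrightarrow> app u v m = 0) \<Longrightarrow> loc \<gamma> u"
  unfolding loc_def by (metis add_diff_cancel_left')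

lemma loc_add: "loc \<gamma> u \<Longrightarrow> loc \<gamma> v \<Longrightarrow> loc \<gamma> (u + v)"
  and loc_diff: "loc \<gamma> u \<Longrightarrow> loc \<gamma> v \<Longrightarrow> loc \<gamma> (u - v)"
  by (rule locI; simp add: locD)+

lemma loc_mult: "loc \<gamma> u \<Longrightarrow> loc \<delta> v \<Longrightarrow> loc (\<gamma> + \<delta>) (u * v)"
proof (rule locI)
  fix m and w :: "expo \<Rightarrow> 'a" assume u: "loc \<gamma> u" and v: "loc \<delta> v" and w: "\<And>n. wt6 n = wt6 m - (\<gamma> + \<delta>) \<Longrightarrow> w n = 0"
  have "app v w n = 0" if "wt6 n = wt6 m - \<gamma>" for n
    by (rule locD[OF v]) (use w that in \<open>simp add: algebra_simps\<close>)
  then show "app (u * v) w m = 0" using locD[OF u] by simp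
qed

lemma loc_sc: "loc 0 (sc c)" and loc_0: "loc \<gamma> 0" and loc_1: "loc 0 1"
  by (auto intro!: locI)

lemma comp_add: "comp \<gamma> (u + v) = comp \<gamma> u + comp \<gamma> v"
  and comp_diff: "comp \<gamma> (u - v) = comp \<gamma> u - comp \<gamma> v"
  and comp_0: "comp \<gamma> 0 = 0"
  by (rule lin_eqI; simp add: comp.rep_eq)+

lemma comp_sc: "comp \<gamma> (sc c * u) = sc c * comp \<gamma> u"
  by (rule lin_eqI) (simp add: comp.rep_eq)

lemma comp_loc: "loc \<gamma> u \<Longrightarrow> comp \<gamma> u = u"
proof (rule lin_eqI)
  fix v m assume u: "loc \<gamma> u"
  have "app u (\<lambda>n. v n - (if wt6 n = wt6 m - \<gamma> then v n else 0)) m = 0"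
    by (rule locD[OF u]) simp
  then show "app (comp \<gamma> u) v m = app u v m"
    by (simp add: comp.rep_eq app_diff)
qed

lemma comp_loc_other: "loc \<gamma> u \<Longrightarrow> \<delta> \<noteq> \<gamma> \<Longrightarrow> comp \<delta> u = 0"
proof (rule lin_eqI)
  fix v m assume "loc \<gamma> u" "\<delta> \<noteq> \<gamma>"
  then show "app (comp \<delta> u) v m = app 0 v m"
    by (auto simp: comp.rep_eq intro!: locD)
qed

lemma comp_mult_right: "loc \<delta> v \<Longrightarrow> comp (\<gamma> + \<delta>) (u * v) = comp \<gamma> u * v"
proof (rule lin_eqI)
  fix w m assume v: "loc \<delta> v"
  have "app v (\<lambda>n. if wt6 n = wt6 m - (\<gamma> + \<delta>) then w n else 0) =
      (\<lambda>k. if wt6 k = wt6 m - \<gamma> then app v w k else 0)"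
  proof (rule ext)
    fix k
    show "app v (\<lambda>n. if wt6 n = wt6 m - (\<gamma> + \<delta>) then w n else 0) k =
      (if wt6 k = wt6 m - \<gamma> then app v w k else 0)"
  proof (cases "wt6 k = wt6 m - \<gamma>")
    case True
    have "app v (\<lambda>n. w n - (if wt6 n = wt6 m - (\<gamma> + \<delta>) then w n else 0)) k = 0"
      by (rule locD[OF v]) (use True in \<open>simp add: algebra_simps\<close>)
    then show ?thesis using True by (simp add: app_diff)
  next
    case False
    have "wt6 n \<noteq> wt6 m - (\<gamma> + \<delta>)" if "wt6 n = wt6 k - \<delta>" for n
    proof
      assume "wt6 n = wt6 m - (\<gamma> + \<delta>)"
      then have "wt6 k - \<delta> = (wt6 m - \<gamma>) - \<delta>" using that by (simp add: diff_diff_add)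
      then show False using False by simp
    qed
    then have "app v (\<lambda>n. if wt6 n = wt6 m - (\<gamma> + \<delta>) then w n else 0) k = 0"
      by (intro locD[OF v]) auto
    then show ?thesis using False by simp
  qed
  qed
  then show "app (comp (\<gamma> + \<delta>) (u * v)) w m = app (comp \<gamma> u * v) w m"
    by (simp add: comp.rep_eq)
qed

lemma comp_mult_left: "loc \<delta> v \<Longrightarrow> comp (\<delta> + \<gamma>) (v * u) = v * comp \<gamma> u"
proof (rule lin_eqI)
  fix w m assume v: "loc \<delta> v"
  have "app v (\<lambda>k. app u (\<lambda>n. if wt6 n = wt6 m - (\<delta> + \<gamma>) then w n else 0) k
      - app u (\<lambda>n. if wt6 n = wt6 k - \<gamma> then w n else 0) k) m = 0"
    by (rule locD[OF v]) (simp add: diff_diff_add)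
  then show "app (comp (\<delta> + \<gamma>) (v * u)) w m = app (v * comp \<gamma> u) w m"
    by (simp add: comp.rep_eq app_diff)
qed

context quantum_parameter begin

definition S where "S = range \<phi>"

lemma \<phi>_simps: "\<phi> (f + g) = \<phi> f + \<phi> g" "\<phi> (f - g) = \<phi> f - \<phi> g" "\<phi> (f * g) = \<phi> f * \<phi> g"
  "\<phi> 0 = 0" "\<phi> 1 = 1" "\<phi> (scalar c) = sc c" "\<phi> (letter a) = gen a"
  "\<phi> y1 = x1" "\<phi> y4 = x4" "\<phi> y6 = x6"
  by (simp_all add: \<phi>_def ev_add ev_diff ev_mult ev_basic y1_def y4_def y6_def gen_def)

lemma \<phi>_y: "\<phi> y2 = x2" "\<phi> y5 = x5" "\<phi> y3 = x3"
  by (simp_all add: y2_def y3_def y5_def x2_def x3_def x5_def \<phi>_simps)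

lemma S_closed: "u \<in> S \<Longrightarrow> v \<in> S \<Longrightarrow> u + v \<in> S" "u \<in> S \<Longrightarrow> v \<in> S \<Longrightarrow> u - v \<in> S"
  "u \<in> S \<Longrightarrow> v \<in> S \<Longrightarrow> u * v \<in> S" "sc c \<in> S" "0 \<in> S" "1 \<in> S"
  "x1 \<in> S" "x2 \<in> S" "x3 \<in> S" "x4 \<in> S" "x5 \<in> S" "x6 \<in> S" "gen a \<in> S"
  unfolding S_def by (auto simp flip: \<phi>_simps \<phi>_y)

lemma S_induct [consumes 1, case_names add sc mult scale]:
  assumes "u \<in> S" "\<And>u v. u \<in> S \<Longrightarrow> v \<in> S \<Longrightarrow> P u \<Longrightarrow> P v \<Longrightarrow> P (u + v)" "\<And>c. P (sc c)"
    "\<And>a u. u \<in> S \<Longrightarrow> P u \<Longrightarrow> P (gen a * u)" "\<And>c u. u \<in> S \<Longrightarrow> P u \<Longrightarrow> P (sc c * u)"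
  shows "P u"
proof -
  have "P (\<phi> f)" for f
  proof (induction f rule: free_alg_induct)
    case (single w c)
    have "P (\<phi> (Poly_Mapping.single (Word ls) 1))" for ls
    proof (induction ls)
      case Nil
      then show ?case using assms(3)[of 1] by (simp add: sc_simps \<phi>_simps flip: zero_word_def)
    next
      case (Cons a ls)
      have "Poly_Mapping.single (Word (a # ls)) (1::'k) = letter a * Poly_Mapping.single (Word ls) 1"
        by (simp add: letter_def mult_single plus_word_def)
      then show ?case using Cons assms(4) by (simp add: \<phi>_simps S_def)
    qed
    moreover have "Poly_Mapping.single w c = scalar c * Poly_Mapping.single (Word (letters w)) 1"
      by (simp add: scalar_def mult_single)
    ultimately show ?case using assms(5)[of "\<phi> (Poly_Mapping.single (Word (letters w)) 1)"]
      by (simp only: \<phi>_simps) (simp add: S_def)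
  qed (use assms(2) in \<open>auto simp: \<phi>_simps S_def\<close>)
  then show ?thesis using assms(1) by (auto simp: S_def)
qed

section \<open>Faithfulness of the representation through the vacuum vector\<close>

definition ord_mon :: "nat \<times> nat \<times> nat \<times> nat \<times> nat \<times> nat \<Rightarrow> 'k free_alg" where
  "ord_mon = (\<lambda>(a,b,c,d,e,f). mon a b c d e f)"

definition int6 :: "nat \<times> nat \<times> nat \<times> nat \<times> nat \<times> nat \<Rightarrow> expo" where
  "int6 = (\<lambda>(a,b,c,d,e,f). (int a, int b, int c, int d, int e, int f))"

lemma inj_int6: "inj int6"
  by (auto simp: inj_on_def int6_def)
lemma int6_eq: "int6 m = int6 n \<longleftrightarrow> m = n"
  by (simp add: inj_eq[OF inj_int6])
lemma range_int6: "range int6 = N6"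
proof
  show "N6 \<subseteq> range int6"
  proof
    fix m assume "m \<in> N6"
    then obtain a b c d e f where "m = (a,b,c,d,e,f)" "0 \<le> a \<and> 0 \<le> b \<and> 0 \<le> c \<and> 0 \<le> d \<and> 0 \<le> e \<and> 0 \<le> f"
      unfolding N6_def by blast
    then have "m = int6 (nat a, nat b, nat c, nat d, nat e, nat f)" by (simp add: int6_def)
    then show "m \<in> range int6" by blast
  qed
qed (auto simp: int6_def N6_def)

abbreviation vac :: "expo \<Rightarrow> 'k" where "vac \<equiv> dl (0,0,0,0,0,0)"

lemma qint_0 [simp]: "qint q 0 = 0" by (simp add: qint_def)

text \<open>Multiplying a monomial without earlier factors keeps it ordered, so an ordered word
  applied to \<open>vac\<close> from the right end yields a single basis vector.\<close>

lemma dl_raise: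
  "app x1 (dl (a,b,c,d,e,f)) = dl (a + 1,b,c,d,e,f)"
  "app x2 (dl (0,b,c,d,e,f)) = dl (0,b + 1,c,d,e,f)"
  "app x3 (dl (0,0,c,d,e,f)) = dl (0,0,c + 1,d,e,f)"
  "app x4 (dl (0,0,0,d,e,f)) = dl (0,0,0,d + 1,e,f)"
  "app x5 (dl (0,0,0,0,e,f)) = dl (0,0,0,0,e + 1,f)"
  "app x6 (dl (0,0,0,0,0,f)) = dl (0,0,0,0,0,f + 1)"
  by (rule ext, rename_tac m, case_tac m, auto simp: dl_def app_x1 app_x2 app_x3 app_x4 app_x5 app_x6 split: if_splits)+

lemma dl_powers:
  "app (x1 ^ n) (dl (0,b,c,d,e,f)) = dl (int n,b,c,d,e,f)"
  "app (x2 ^ n) (dl (0,0,c,d,e,f)) = dl (0,int n,c,d,e,f)"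
  "app (x3 ^ n) (dl (0,0,0,d,e,f)) = dl (0,0,int n,d,e,f)"
  "app (x4 ^ n) (dl (0,0,0,0,e,f)) = dl (0,0,0,int n,e,f)"
  "app (x5 ^ n) (dl (0,0,0,0,0,f)) = dl (0,0,0,0,int n,f)"
  "app (x6 ^ n) (dl (0,0,0,0,0,0)) = dl (0,0,0,0,0,int n)"
  by (induction n) (simp_all add: dl_raise add.commute)

lemma \<phi>_power: "\<phi> (f ^ n) = \<phi> f ^ n"
  by (induction n) (simp_all add: \<phi>_simps)

lemma \<phi>_mon: "app (\<phi> (ord_mon n)) vac = dl (int6 n)"
  by (cases n) (simp add: ord_mon_def int6_def mon_def \<phi>_simps \<phi>_y \<phi>_power dl_powers)

lemma ord_mon_span: "\<exists>F c. finite F \<and> f \<approx> (\<Sum>n\<in>F. scalar (c n) * ord_mon n)"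
proof -
  have "W f" by (rule W_all)
  then show ?thesis
  proof (induction rule: W.induct)
    case (W_mon k a b c d e f)
    show ?case by (rule exI[of _ "{(a,b,c,d,e,f)}"], rule exI[of _ "\<lambda>_. k"]) (simp add: ord_mon_def)
  next
    case (W_add f g)
    then obtain F c G d where *: "finite F" "f \<approx> (\<Sum>n\<in>F. scalar (c n) * ord_mon n)"
      "finite G" "g \<approx> (\<Sum>n\<in>G. scalar (d n) * ord_mon n)" by blast
    define k where "k n = (if n \<in> F then c n else 0) + (if n \<in> G then d n else 0)" for n
    have "(\<Sum>n\<in>F. scalar (c n) * ord_mon n) = (\<Sum>n\<in>F \<union> G. scalar (if n \<in> F then c n else 0) * ord_mon n)"
      by (rule sum.mono_neutral_cong_left) (use * in \<open>auto simp: scalar_simps\<close>)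
    moreover have "(\<Sum>n\<in>G. scalar (d n) * ord_mon n) = (\<Sum>n\<in>F \<union> G. scalar (if n \<in> G then d n else 0) * ord_mon n)"
      by (rule sum.mono_neutral_cong_left) (use * in \<open>auto simp: scalar_simps\<close>)
    ultimately have "f + g \<approx> (\<Sum>n\<in>F \<union> G. scalar (k n) * ord_mon n)"
      using cg_add[OF *(2) *(4)] by (simp add: k_def scalar_simps(3) distrib_right sum.distrib)
    then show ?case using * by (intro exI[of _ "F \<union> G"] exI[of _ k]) simp
  next
    case (W_cong f g)
    then show ?case using cg_trans by blast
  qed
qed

lemma \<phi>_sum: "\<phi> (sum g F) = (\<Sum>x\<in>F. \<phi> (g x))"
  by (induction F rule: infinite_finite_induct) (auto simp: \<phi>_simps)
lemma app_sum: "app (sum g F) v m = (\<Sum>x\<in>F. app (g x) v m)"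
  by (induction F rule: infinite_finite_induct) auto

lemma \<phi>_cg: "f \<approx> g \<Longrightarrow> \<phi> f = \<phi> g"
  using \<phi>_ideal[of "f - g"] by (simp add: cg_def \<phi>_simps)

text \<open>Ordered monomials span modulo the ideal and send \<open>vac\<close> to distinct basis
  vectors, so an element killing \<open>vac\<close> has only zero coefficients. This gives both that
  the kernel of \<open>\<phi>\<close> is the Serre ideal and that \<open>vac\<close> separates the
  elements of \<open>S\<close>.\<close>

lemma \<phi>_vac_zero:
  assumes "app (\<phi> f) vac = (\<lambda>m. 0)"
  shows "f \<in> serre_ideal q"
proof -
  obtain F c where F: "finite F" "f \<approx> (\<Sum>n\<in>F. scalar (c n) * ord_mon n)"
    using ord_mon_span by blast
  have "app (\<phi> f) vac m = (\<Sum>n\<in>F. c n * dl (int6 n) m)" for m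
    unfolding \<phi>_cg[OF F(2)] by (simp add: \<phi>_sum app_sum \<phi>_simps \<phi>_mon)
  then have *: "(\<Sum>n\<in>F. c n * dl (int6 n) m) = 0" for m using assms by simp
  have "c k = 0" if "k \<in> F" for k
  proof -
    have "(\<Sum>n\<in>F. c n * dl (int6 n) (int6 k)) = (\<Sum>n\<in>F. if n = k then c n else 0)"
      by (rule sum.cong) (simp_all add: dl_def int6_eq)
    then show ?thesis using *[of "int6 k"] F(1) that by simp
  qed
  then have "(\<Sum>n\<in>F. scalar (c n) * ord_mon n) = 0" by (simp add: scalar_simps)
  then show ?thesis using F(2) by (simp add: cg_def)
qed

lemma S_faithful: "u \<in> S \<Longrightarrow> app u vac = (\<lambda>m. 0) \<Longrightarrow> u = 0"
  using \<phi>_vac_zero \<phi>_ideal by (auto simp: S_def)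

lemma \<phi>_eq_iff: "\<phi> f = \<phi> g \<longleftrightarrow> f - g \<in> serre_ideal q"
proof
  assume "\<phi> f = \<phi> g"
  then show "f - g \<in> serre_ideal q" by (intro \<phi>_vac_zero) (simp add: \<phi>_simps)
qed (use \<phi>_ideal[of "f - g"] in \<open>simp add: \<phi>_simps\<close>)

lemma V_surj:
  assumes "v \<in> V"
  shows "\<exists>u\<in>S. app u vac = v"
proof -
  define u where "u = \<phi> (\<Sum>n \<in> {n. v (int6 n) \<noteq> 0}. scalar (v (int6 n)) * ord_mon n)"
  have fin: "finite {n. v (int6 n) \<noteq> 0}"
    using finite_vimageI[of "{m. v m \<noteq> 0}" int6] assms inj_int6 by (auto simp: V_def vimage_def)
  have "app u vac m = v m" for m
  proof -
    have 1: "app u vac m = (\<Sum>n \<in> {n. v (int6 n) \<noteq> 0}. v (int6 n) * dl (int6 n) m)"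
      by (simp add: u_def \<phi>_sum app_sum \<phi>_simps \<phi>_mon)
    show ?thesis
    proof (cases "m \<in> N6")
      case True
      then obtain k where k: "m = int6 k" using range_int6 by blast
      have "(\<Sum>n \<in> {n. v (int6 n) \<noteq> 0}. v (int6 n) * dl (int6 n) m) =
         (\<Sum>n \<in> {n. v (int6 n) \<noteq> 0}. if n = k then v (int6 n) else 0)"
        by (rule sum.cong) (simp_all add: k dl_def int6_eq)
      then show ?thesis using 1 fin k by simp
    next
      case False
      then have "dl (int6 n) m = (0::'k)" for n using range_int6 by (auto simp: dl_def)
      moreover have "v m = 0" using False assms unfolding V_def by blast
      ultimately show ?thesis using 1 by simp
    qed
  qed
  then show ?thesis unfolding u_def S_def by blast
qed

end

section \<open>Ideals spanned by ordered monomials\<close>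

lemma V_zero: "v \<in> V \<Longrightarrow> m \<notin> N6 \<Longrightarrow> v m = 0"
  unfolding V_def by blast

lemma V_neg: "v \<in> V \<Longrightarrow> a < 0 \<or> b < 0 \<or> c < 0 \<or> d < 0 \<or> e < 0 \<or> f < 0 \<Longrightarrow> v (a,b,c,d,e,f) = 0"
  by (rule V_zero) (auto simp: N6_def)

lemma V_I: "finite {m. v m \<noteq> 0} \<Longrightarrow> (\<And>m. m \<notin> N6 \<Longrightarrow> v m = 0) \<Longrightarrow> v \<in> V"
  unfolding V_def by blast

lemma V_finite: "v \<in> V \<Longrightarrow> finite {m. v m \<noteq> 0}"
  by (simp add: V_def)

lemma V_add: "v \<in> V \<Longrightarrow> w \<in> V \<Longrightarrow> (\<lambda>m. v m + w m) \<in> V"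
  by (rule V_I, rule finite_subset[where B = "{m. v m \<noteq> 0} \<union> {m. w m \<noteq> 0}"]) (auto simp: V_zero V_finite)
lemma V_scale: "v \<in> V \<Longrightarrow> (\<lambda>m. c * v m) \<in> V"
  by (rule V_I, rule finite_subset[where B = "{m. v m \<noteq> 0}"]) (auto simp: V_zero V_finite)
lemma V_restrict: "v \<in> V \<Longrightarrow> (\<lambda>m. if P m then v m else 0) \<in> V"
  by (rule V_I, rule finite_subset[where B = "{m. v m \<noteq> 0}"]) (auto simp: V_zero V_finite)
lemma V_shift_finite: "v \<in> V \<Longrightarrow> inj g \<Longrightarrow> finite {m. v (g m) \<noteq> 0}"
  using finite_vimageI[OF V_finite, of v g] by (simp add: vimage_def)
lemma V_dl: "dl (0,0,0,0,0,0) \<in> V"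
  by (rule V_I) (auto simp: dl_def N6_def)

definition VM :: "(expo \<Rightarrow> bool) \<Rightarrow> (expo \<Rightarrow> 'k::field) \<Rightarrow> bool" where
  "VM M v \<longleftrightarrow> (\<forall>m. \<not> M m \<longrightarrow> v m = 0)"

text \<open>The mask \<open>M\<close> of exponents encodes the ideal \<open>J M\<close> spanned by the monomials with
  exponents in \<open>M\<close>: \<open>J M3\<close> is generated by \<open>x3\<close>, \<open>J M32\<close> by \<open>x3\<close> and \<open>x2\<close>, and so on.\<close>

definition M0 :: "expo \<Rightarrow> bool" where "M0 = (\<lambda>m. False)"
definition M3 :: "expo \<Rightarrow> bool" where "M3 = (\<lambda>(a,b,c,d,e,f). 1 \<le> c)"
definition M32 :: "expo \<Rightarrow> bool" where "M32 = (\<lambda>(a,b,c,d,e,f). 1 \<le> c \<or> 1 \<le> b)"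
definition M35 :: "expo \<Rightarrow> bool" where "M35 = (\<lambda>(a,b,c,d,e,f). 1 \<le> c \<or> 1 \<le> e)"
definition M321 :: "expo \<Rightarrow> bool" where "M321 = (\<lambda>(a,b,c,d,e,f). 1 \<le> c \<or> 1 \<le> b \<or> 1 \<le> a)"
definition M356 :: "expo \<Rightarrow> bool" where "M356 = (\<lambda>(a,b,c,d,e,f). 1 \<le> c \<or> 1 \<le> e \<or> 1 \<le> f)"

definition M325 :: "expo \<Rightarrow> bool" where "M325 = (\<lambda>(a,b,c,d,e,f). 1 \<le> c \<or> 1 \<le> b \<or> 1 \<le> e)"

lemmas M_defs = M0_def M3_def M32_def M35_def M321_def M356_def M325_def

context quantum_parameter begin

lemma V_gen: "v \<in> V \<Longrightarrow> app (gen l) v \<in> V"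
proof -
  assume v: "v \<in> V"
  have x1: "app x1 v \<in> V"
  proof (rule V_I)
    show "finite {m. app x1 v m \<noteq> 0}"
    proof (rule finite_subset)
      show "{m. app x1 v m \<noteq> 0} \<subseteq> {m. v ((\<lambda>(a,b,c,d,e,f). (a - 1,b,c,d,e,f)) m) \<noteq> 0}"
        by (rule subsetI, rename_tac m, case_tac m) (auto simp: app_x1)
      show "finite ({m. v ((\<lambda>(a,b,c,d,e,f). (a - 1,b,c,d,e,f)) m) \<noteq> 0})"
        by (intro finite_UnI V_shift_finite[OF v]) (auto simp: inj_on_def)
    qed
    fix m :: expo assume "m \<notin> N6"
    then show "app x1 v m = 0" by (cases m) (auto simp: app_x1 N6_def V_neg[OF v])
  qed
  have x4: "app x4 v \<in> V"
  proof (rule V_I)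
    show "finite {m. app x4 v m \<noteq> 0}"
    proof (rule finite_subset)
      show "{m. app x4 v m \<noteq> 0} \<subseteq> {m. v ((\<lambda>(a,b,c,d,e,f). (a,b,c,d - 1,e,f)) m) \<noteq> 0} \<union> {m. v ((\<lambda>(a,b,c,d,e,f). (a + 1,b - 1,c,d,e,f)) m) \<noteq> 0}"
        by (rule subsetI, rename_tac m, case_tac m) (auto simp: app_x4)
      show "finite ({m. v ((\<lambda>(a,b,c,d,e,f). (a,b,c,d - 1,e,f)) m) \<noteq> 0} \<union> {m. v ((\<lambda>(a,b,c,d,e,f). (a + 1,b - 1,c,d,e,f)) m) \<noteq> 0})"
        by (intro finite_UnI V_shift_finite[OF v]) (auto simp: inj_on_def)
    qed
    fix m :: expo assume m: "m \<notin> N6"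
    obtain a b c d e f where *: "m = (a,b,c,d,e,f)" by (cases m)
    \<comment> \<open>For \<open>a = -1\<close> the shifted index may lie in \<open>N6\<close>;
      there the quantum integer vanishes instead.\<close>
    have "qint q (a + 1) = 0 \<or> v (a + 1,b - 1,c,d,e,f) = 0"
      using m by (cases "a = -1") (auto simp: * N6_def V_neg[OF v])
    then show "app x4 v m = 0" using m by (auto simp: * app_x4 N6_def V_neg[OF v])
  qed
  have x6: "app x6 v \<in> V"
  proof (rule V_I)
    show "finite {m. app x6 v m \<noteq> 0}"
    proof (rule finite_subset)
      show "{m. app x6 v m \<noteq> 0} \<subseteq> {m. v ((\<lambda>(a,b,c,d,e,f). (a,b,c,d,e,f - 1)) m) \<noteq> 0} \<union> {m. v ((\<lambda>(a,b,c,d,e,f). (a,b + 1,c - 1,d,e,f)) m) \<noteq> 0} \<union> {m. v ((\<lambda>(a,b,c,d,e,f). (a,b,c,d + 1,e - 1,f)) m) \<noteq> 0}"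
        by (rule subsetI, rename_tac m, case_tac m) (auto simp: app_x6)
      show "finite ({m. v ((\<lambda>(a,b,c,d,e,f). (a,b,c,d,e,f - 1)) m) \<noteq> 0} \<union> {m. v ((\<lambda>(a,b,c,d,e,f). (a,b + 1,c - 1,d,e,f)) m) \<noteq> 0} \<union> {m. v ((\<lambda>(a,b,c,d,e,f). (a,b,c,d + 1,e - 1,f)) m) \<noteq> 0})"
        by (intro finite_UnI V_shift_finite[OF v]) (auto simp: inj_on_def)
    qed
    fix m :: expo assume m: "m \<notin> N6"
    obtain a b c d e f where *: "m = (a,b,c,d,e,f)" by (cases m)
    have "qint q (b + 1) = 0 \<or> v (a,b + 1,c - 1,d,e,f) = 0"
      using m by (cases "b = -1") (auto simp: * N6_def V_neg[OF v])
    moreover have "qint q (d + 1) = 0 \<or> v (a,b,c,d + 1,e - 1,f) = 0"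
      using m by (cases "d = -1") (auto simp: * N6_def V_neg[OF v])
    ultimately show "app x6 v m = 0" using m by (auto simp: * app_x6 N6_def V_neg[OF v])
  qed
  show ?thesis using x1 x4 x6 by (cases l) (auto simp: gen_def)
qed

lemma app_sc': "app (sc c) v = (\<lambda>m. c * v m)"
  by (rule ext) simp

lemma S_V: "u \<in> S \<Longrightarrow> v \<in> V \<Longrightarrow> app u v \<in> V"
  by (induction u rule: S_induct) (auto simp: V_add app_sc' V_scale V_gen)

definition stable :: "(expo \<Rightarrow> bool) \<Rightarrow> bool" where
  "stable M \<longleftrightarrow> (\<forall>l v. v \<in> V \<longrightarrow> VM M v \<longrightarrow> VM M (app (gen l) (v :: expo \<Rightarrow> 'k)))"

lemma stable_masks: "stable M0" "stable M3" "stable M32" "stable M35" "stable M321" "stable M356" "stable M325"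
  unfolding stable_def
  by (intro allI impI; rename_tac l v; case_tac l;
    auto simp: VM_def M_defs gen_def app_x1 app_x4 app_x6 V_neg)+

text \<open>The condition is imposed on all vectors of \<open>V\<close> and not only on
  \<open>vac\<close>: right multiplication merely replaces one vector of \<open>V\<close> by
  another, so the ideal is two-sided as soon as the mask is stable.\<close>

definition J :: "(expo \<Rightarrow> bool) \<Rightarrow> 'k lin set" where
  "J M = {u \<in> S. \<forall>v\<in>V. VM M (app u v)}"

lemma J_left: "stable M \<Longrightarrow> u \<in> S \<Longrightarrow> w \<in> J M \<Longrightarrow> u * w \<in> J M"
proof -
  assume M: "stable M" and u: "u \<in> S" and w: "w \<in> J M"
  have "VM M (app u v)" if "v \<in> V" "VM M v" for v
    using u that
  proof (induction u rule: S_induct)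
    case (mult a u)
    then show ?case using M S_V by (simp add: stable_def)
  qed (auto simp: VM_def app_sc')
  then show ?thesis using u w S_V by (auto simp: J_def S_closed)
qed

lemma J_D: "u \<in> J M \<Longrightarrow> v \<in> V \<Longrightarrow> \<not> M m \<Longrightarrow> app u v m = 0"
  unfolding J_def VM_def by blast

definition hid :: "'k lin set \<Rightarrow> bool" where
  "hid I \<longleftrightarrow> I \<subseteq> S \<and> 0 \<in> I \<and> (\<forall>u\<in>I. \<forall>v\<in>I. u - v \<in> I) \<and> (\<forall>u\<in>S. \<forall>v\<in>I. u * v \<in> I \<and> v * u \<in> I)"

lemma hidD:
  assumes "hid I"
  shows "u \<in> I \<Longrightarrow> u \<in> S" "0 \<in> I" "u \<in> I \<Longrightarrow> v \<in> I \<Longrightarrow> u - v \<in> I" "u \<in> I \<Longrightarrow> v \<in> I \<Longrightarrow> u + v \<in> I"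
    "u \<in> S \<Longrightarrow> v \<in> I \<Longrightarrow> u * v \<in> I" "u \<in> S \<Longrightarrow> v \<in> I \<Longrightarrow> v * u \<in> I"
    "v \<in> I \<Longrightarrow> sc c * v \<in> I" "v \<in> I \<Longrightarrow> - v \<in> I"
proof -
  show "u \<in> I \<Longrightarrow> u \<in> S" "0 \<in> I" "u \<in> I \<Longrightarrow> v \<in> I \<Longrightarrow> u - v \<in> I"
    "u \<in> S \<Longrightarrow> v \<in> I \<Longrightarrow> u * v \<in> I" "u \<in> S \<Longrightarrow> v \<in> I \<Longrightarrow> v * u \<in> I"
    "v \<in> I \<Longrightarrow> sc c * v \<in> I"
    using assms S_closed(4) by (auto simp: hid_def)
  show m: "- v \<in> I" if "v \<in> I" for v
    using assms that unfolding hid_def by (metis diff_0)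
  show "u + v \<in> I" if "u \<in> I" "v \<in> I"
    using assms that(1) m[OF that(2)] unfolding hid_def by (metis diff_minus_eq_add)
qed

lemma hid_J: "stable M \<Longrightarrow> hid (J M)"
  unfolding hid_def using J_left S_V
  by (auto simp: J_def S_closed VM_def V_dl)

text \<open>Under this criterion \<open>J M\<close> consists of exactly the elements whose PBW
  coordinates are supported in \<open>M\<close>. It is trivial for \<open>M0\<close> and is carried
  up the chain of masks by \<open>crit_step\<close>.\<close>

definition crit where "crit M \<longleftrightarrow> (\<forall>u\<in>S. VM M (app u vac) \<longrightarrow> u \<in> J M)"

lemma crit_M0: "crit M0"
  unfolding crit_def
proof (intro ballI impI)
  fix u assume "u \<in> S" "VM M0 (app u vac)"
  then have "app u vac = (\<lambda>m. 0)" by (intro ext) (simp only: VM_def M0_def simp_thms)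
  then have "u = 0" using S_faithful \<open>u \<in> S\<close> by blast
  then show "u \<in> J M0" using hidD(2)[OF hid_J] stable_masks by blast
qed

lemma J_M0: "J M0 = {0}"
proof -
  have "u = 0" if "u \<in> J M0" for u
  proof (rule S_faithful)
    show "u \<in> S" using that by (simp add: J_def)
    show "app u vac = (\<lambda>m. 0)"
      by (rule ext, rule J_D[OF that V_dl]) (simp add: M0_def)
  qed
  then show ?thesis using hidD(2)[OF hid_J] stable_masks by blast
qed

end

text \<open>Here \<open>y\<close> acts modulo \<open>J M\<close> as an invertible weighted shift, so that division by \<open>y\<close>
  amounts to undoing the shift.\<close>

locale shift_step = quantum_parameter q for q :: "'k::field_char_0" +
  fixes M M' :: "expo \<Rightarrow> bool" and y :: "'k lin" and \<kappa> :: "expo \<Rightarrow> 'k" and up dn :: "expo \<Rightarrow> expo"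
  assumes act: "\<And>v m. v \<in> V \<Longrightarrow> \<not> M m \<Longrightarrow> m \<in> N6 \<Longrightarrow> app y v m = \<kappa> m * v (dn m)"
    and nz: "\<And>m. \<kappa> m \<noteq> 0" and yS: "y \<in> S"
    and updn: "\<And>m. up (dn m) = m" "\<And>m. dn (up m) = m"
    and Mup: "\<And>m. M (up m) \<longleftrightarrow> M m"
    and upN: "\<And>m. m \<in> N6 \<Longrightarrow> up m \<in> N6"
    and M': "\<And>m. m \<in> N6 \<Longrightarrow> M' m \<longleftrightarrow> M m \<or> dn m \<in> N6"
    and st: "stable M" "stable M'"
begin

lemma sub: "J M \<subseteq> J M'"
proof
  fix u assume u: "u \<in> J M"
  then have "u \<in> S" by (simp add: J_def)
  moreover have "VM M' (app u v)" if v: "v \<in> V" for v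
    unfolding VM_def
  proof (intro allI impI)
    fix m assume "\<not> M' m"
    then show "app u v m = 0"
      using J_D[OF u v, of m] M'[of m] V_zero[OF S_V[OF \<open>u \<in> S\<close> v], of m] by blast
  qed
  ultimately show "u \<in> J M'" by (simp add: J_def)
qed

lemma reg: "u \<in> S \<Longrightarrow> y * u \<in> J M \<Longrightarrow> u \<in> J M"
proof -
  assume u: "u \<in> S" "y * u \<in> J M"
  have "VM M (app u v)" if v: "v \<in> V" for v
    unfolding VM_def
  proof (intro allI impI)
    fix m assume m: "\<not> M m"
    show "app u v m = 0"
    proof (cases "m \<in> N6")
      case True
      have "app (y * u) v (up m) = 0" using J_D[OF u(2) v] m Mup by blast
      then show ?thesis
        using act[OF S_V[OF u(1) v], of "up m"] m Mup upN[OF True] nz updn by simp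
    qed (use V_zero[OF S_V[OF u(1) v]] in blast)
  qed
  then show "u \<in> J M" using u by (simp add: J_def)
qed

lemma y_in: "y \<in> J M'"
proof -
  have "VM M' (app y v)" if v: "v \<in> V" for v
    unfolding VM_def
  proof (intro allI impI)
    fix m assume m: "\<not> M' m"
    show "app y v m = 0"
    proof (cases "m \<in> N6")
      case True
      then show ?thesis using m M' act[OF v, of m] V_zero[OF v, of "dn m"] by auto
    qed (use V_zero[OF S_V[OF yS v]] in blast)
  qed
  then show ?thesis using yS by (simp add: J_def)
qed

lemma V_divide:
  assumes v: "v \<in> V" "VM M' v"
  shows "\<exists>w\<in>V. VM M (\<lambda>m. v m - app y w m)"
proof -
  define w where "w m = (if m \<in> N6 then v (up m) / \<kappa> (up m) else 0)" for m
  have w: "w \<in> V"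
  proof (rule V_I)
    show "finite {m. w m \<noteq> 0}"
    proof (rule finite_subset)
      show "{m. w m \<noteq> 0} \<subseteq> {m. v (up m) \<noteq> 0}"
        by (rule subsetI) (simp add: w_def split: if_splits)
      show "finite {m. v (up m) \<noteq> 0}"
        by (rule V_shift_finite[OF v(1)]) (metis injI updn(2))
    qed
  qed (simp add: w_def)
  have "v m - app y w m = 0" if m: "\<not> M m" for m
  proof (cases "m \<in> N6")
    case True
    have "\<not> M' m \<Longrightarrow> v m = 0" using v(2) unfolding VM_def by blast
    then show ?thesis using act[OF w m True] nz[of m] M'[OF True] m
      by (auto simp: w_def updn)
  next
    case False
    then show ?thesis using V_zero[OF v(1)] V_zero[OF S_V[OF yS w]] by simp
  qed
  then show ?thesis using w by (auto simp: VM_def)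
qed

text \<open>Dividing the coordinates by \<open>y\<close> leaves a remainder to which the criterion
  for \<open>M\<close> applies, while the multiple of \<open>y\<close> lies in the two-sided ideal
  \<open>J M'\<close>.\<close>

lemma crit_step: "crit M \<Longrightarrow> crit M'"
  unfolding crit_def[of M']
proof (intro ballI impI)
  fix u assume M: "crit M" and u: "u \<in> S" "VM M' (app u vac)"
  obtain w where w: "w \<in> V" "VM M (\<lambda>m. app u vac m - app y w m)"
    using V_divide[OF S_V[OF u(1) V_dl] u(2)] by blast
  obtain s where s: "s \<in> S" "app s vac = w" using V_surj[OF w(1)] by blast
  have "u - y * s \<in> J M"
    using M w s u yS S_closed(2,3) by (auto simp: crit_def)
  then have "u - y * s \<in> J M'" using sub by blast
  moreover have "y * s \<in> J M'" using hidD(6)[OF hid_J[OF st(2)] s(1) y_in] .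
  ultimately have "(u - y * s) + y * s \<in> J M'" by (rule hidD(4)[OF hid_J[OF st(2)]])
  then show "u \<in> J M'" by simp
qed

lemma divide:
  assumes "crit M" "u \<in> J M'"
  shows "\<exists>s\<in>S. u - y * s \<in> J M"
proof -
  have u: "u \<in> S" "VM M' (app u vac)" using assms(2) V_dl by (auto simp: J_def)
  obtain w where w: "w \<in> V" "VM M (\<lambda>m. app u vac m - app y w m)"
    using V_divide[OF S_V[OF u(1) V_dl] u(2)] by blast
  obtain s where s: "s \<in> S" "app s vac = w" using V_surj[OF w(1)] by blast
  have "u - y * s \<in> J M"
    using assms(1) w s u yS S_closed(2,3) by (auto simp: crit_def)
  then show ?thesis using s by blast
qed

end

section \<open>The chains of ideals and the regular elements of their quotients\<close>

context quantum_parameter begin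

sublocale s3: shift_step q M0 M3 x3 "\<lambda>(a,b,c,d,e,f). q powi (- a - b)"
    "\<lambda>(a,b,c,d,e,f). (a,b,c + 1,d,e,f)" "\<lambda>(a,b,c,d,e,f). (a,b,c - 1,d,e,f)"
  by unfold_locales (use q_nz in \<open>auto simp: app_x3 M_defs N6_def S_closed stable_masks[unfolded M_defs]\<close>)

sublocale s2: shift_step q M3 M32 x2 "\<lambda>(a,b,c,d,e,f). q powi (- a)"
    "\<lambda>(a,b,c,d,e,f). (a,b + 1,c,d,e,f)" "\<lambda>(a,b,c,d,e,f). (a,b - 1,c,d,e,f)"
  by unfold_locales (use q_nz in \<open>auto simp: app_x2 M_defs N6_def S_closed stable_masks[unfolded M_defs]\<close>)

sublocale s1: shift_step q M32 M321 x1 "\<lambda>(a,b,c,d,e,f). 1"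
    "\<lambda>(a,b,c,d,e,f). (a + 1,b,c,d,e,f)" "\<lambda>(a,b,c,d,e,f). (a - 1,b,c,d,e,f)"
  by unfold_locales (use q_nz in \<open>auto simp: app_x1 M_defs N6_def S_closed stable_masks[unfolded M_defs]\<close>)

lemma app_x5_mod: "v \<in> V \<Longrightarrow> \<not> 1 \<le> c \<Longrightarrow> app x5 v (a,b,c,d,e,f) = q powi (a - c - d) * v (a,b,c,d,e - 1,f)"
  by (simp add: app_x5 V_neg)

sublocale s5: shift_step q M3 M35 x5 "\<lambda>(a,b,c,d,e,f). q powi (a - c - d)"
    "\<lambda>(a,b,c,d,e,f). (a,b,c,d,e + 1,f)" "\<lambda>(a,b,c,d,e,f). (a,b,c,d,e - 1,f)"
  by unfold_locales (use q_nz in \<open>auto simp: app_x5_mod M_defs N6_def S_closed V_neg stable_masks[unfolded M_defs]\<close>)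

text \<open>Supplies the regularity of \<open>x5\<close> modulo \<open>J M32\<close>, that is, the
  coprimality of \<open>x2\<close> and \<open>x5\<close> modulo \<open>x3\<close>. The
  interpretation \<open>s52\<close> does the same with the roles exchanged.\<close>

sublocale s25: shift_step q M32 M325 x5 "\<lambda>(a,b,c,d,e,f). q powi (a - c - d)"
    "\<lambda>(a,b,c,d,e,f). (a,b,c,d,e + 1,f)" "\<lambda>(a,b,c,d,e,f). (a,b,c,d,e - 1,f)"
proof (unfold_locales, goal_cases)
  case (1 v m)
  then show ?case by (cases m) (simp add: M_defs app_x5_mod)
qed (use q_nz in \<open>auto simp: M_defs N6_def S_closed stable_masks[unfolded M_defs]\<close>)

sublocale s52: shift_step q M35 M325 x2 "\<lambda>(a,b,c,d,e,f). q powi (- a)"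
    "\<lambda>(a,b,c,d,e,f). (a,b + 1,c,d,e,f)" "\<lambda>(a,b,c,d,e,f). (a,b - 1,c,d,e,f)"
  by unfold_locales (use q_nz in \<open>auto simp: app_x2 M_defs N6_def S_closed stable_masks[unfolded M_defs]\<close>)

lemma app_x6_mod: "v \<in> V \<Longrightarrow> \<not> 1 \<le> c \<Longrightarrow> \<not> 1 \<le> e \<Longrightarrow>
    app x6 v (a,b,c,d,e,f) = q powi (b - c + d - e) * v (a,b,c,d,e,f - 1)"
  by (simp add: app_x6 V_neg)

sublocale s6: shift_step q M35 M356 x6 "\<lambda>(a,b,c,d,e,f). q powi (b - c + d - e)"
    "\<lambda>(a,b,c,d,e,f). (a,b,c,d,e,f + 1)" "\<lambda>(a,b,c,d,e,f). (a,b,c,d,e,f - 1)"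
proof (unfold_locales, goal_cases)
  case (1 v m)
  then show ?case by (cases m) (simp add: M_defs app_x6_mod)
qed (use q_nz in \<open>auto simp: M_defs N6_def S_closed stable_masks[unfolded M_defs]\<close>)

lemmas crits = crit_M0 s3.crit_step[OF crit_M0] s2.crit_step[OF s3.crit_step[OF crit_M0]]
  s5.crit_step[OF s3.crit_step[OF crit_M0]]

text \<open>\<open>w1\<close> and \<open>w6\<close> are the mirror images of \<open>x2\<close> and
  \<open>x5\<close> under the exchange of the two outer generators. They serve as the second normal
  element, next to \<open>x1\<close> modulo \<open>J M32\<close> and next to \<open>x6\<close>
  modulo \<open>J M35\<close>.\<close>

definition w1 where "w1 = x6 * x4 - sc (inverse q) * (x4 * x6)"
definition w6 where "w6 = x4 * x1 - sc (inverse q) * (x1 * x4)"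

lemma w_S: "w1 \<in> S" "w6 \<in> S" by (simp_all add: w1_def w6_def S_closed)

lemma qint_q: "q * qint q (n + 1) - qint q n = q powi (n + 1)"
  using q2_neq_1 q_nz by (simp add: qint_def power_int_add power_int_diff power_int_minus divide_simps) (simp add: algebra_simps)

lemma app_w1: "v \<in> V \<Longrightarrow> app w1 v (a,0,0,d,e,f) =
    q powi (a + d - e) * (1 - inverse (q * q)) * v (a,0,0,d - 1,e,f - 1) - q powi (a + d + 1) * v (a,0,0,d,e - 1,f)"
proof -
  assume v: "v \<in> V"
  note n = V_neg[OF v] V_neg[OF S_V[OF S_closed(10) v]] V_neg[OF S_V[OF S_closed(12) v]]
  have "app w1 v (a,0,0,d,e,f) = q powi (d - e) * (q powi a * v (a,0,0,d - 1,e,f - 1))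
     - q * qint q (d + 1) * (q powi a * v (a,0,0,d,e - 1,f))
     - inverse q * (q powi a * (q powi (d - 1 - e) * v (a,0,0,d - 1,e,f - 1) - q * qint q d * v (a,0,0,d,e - 1,f)))"
    by (simp add: w1_def app_x4 app_x6 n)
  also have "\<dots> = q powi (a + d - e) * (1 - inverse (q * q)) * v (a,0,0,d - 1,e,f - 1)
      - q powi a * (q * qint q (d + 1) - qint q d) * v (a,0,0,d,e - 1,f)"
    using q_nz by (simp add: power_int_add power_int_diff divide_simps) (simp add: algebra_simps)
  also have "q powi a * (q * qint q (d + 1) - qint q d) = q powi (a + d + 1)"
    unfolding qint_q using q_nz by (simp add: power_int_add)
  finally show ?thesis .
qed

lemma app_w6: "v \<in> V \<Longrightarrow> app w6 v (a,b,c,d,e,f) =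
    q powi (a - b) * (1 - inverse (q * q)) * v (a - 1,b,c,d - 1,e,f) - q powi (a + 1) * v (a,b - 1,c,d,e,f)"
proof -
  have "app w6 v (a,b,c,d,e,f) = q powi (a - b) * v (a - 1,b,c,d - 1,e,f) - q * qint q (a + 1) * v (a,b - 1,c,d,e,f)
     - inverse q * (q powi (a - 1 - b) * v (a - 1,b,c,d - 1,e,f) - q * qint q a * v (a,b - 1,c,d,e,f))"
    by (simp add: w6_def app_x4 app_x1)
  also have "\<dots> = q powi (a - b) * (1 - inverse (q * q)) * v (a - 1,b,c,d - 1,e,f)
      - (q * qint q (a + 1) - qint q a) * v (a,b - 1,c,d,e,f)"
    using q_nz by (simp add: power_int_add power_int_diff divide_simps) (simp add: algebra_simps)
  finally show ?thesis unfolding qint_q .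
qed

lemma one_minus_nz: "1 - inverse (q * q) \<noteq> 0"
  using q2_neq_1 q_nz by (simp add: field_simps)

text \<open>Modulo the ideal \<open>w1\<close> is a sum of two weighted shifts, so
  \<open>shift_step\<close> does not apply. One of the shifts lowers \<open>e\<close>; induction on
  \<open>e\<close> makes that term vanish and isolates the other. In \<open>w6_reg\<close> the
  exponent \<open>b\<close> plays this part.\<close>

lemma w1_reg:
  assumes M: "M = M32 \<or> M = M321" and u: "u \<in> S" "w1 * u \<in> J M"
  shows "u \<in> J M"
proof -
  have "VM M (app u v)" if v: "v \<in> V" for v
  proof -
    let ?g = "app u v"
    have g: "?g \<in> V" using S_V u v by blast
    have z: "app w1 ?g m = 0" if "\<not> M m" for m
      using J_D[OF u(2) v that] by simp
    have e: "?g (a,0,0,d,int n,f) = 0" if "M (a,0,0,0,0,0) = False" for a d n f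
    proof (induction n arbitrary: d f)
      case 0
      have "\<not> M (a,0,0,d + 1,0,f + 1)" using M that by (auto simp: M_defs)
      from z[OF this] show ?case
        using app_w1[OF g, of a "d + 1" 0 "f + 1"] V_neg[OF g] q_nz one_minus_nz by simp
    next
      case (Suc n)
      have "\<not> M (a,0,0,d + 1,int (Suc n),f + 1)" using M that by (auto simp: M_defs)
      from z[OF this] show ?case
        using app_w1[OF g, of a "d + 1" "int (Suc n)" "f + 1"] Suc q_nz one_minus_nz by simp
    qed
    show ?thesis unfolding VM_def
    proof (intro allI impI)
      fix m assume m: "\<not> M m"
      obtain a b c d e f where *: "m = (a,b,c,d,e,f)" by (cases m)
      show "?g m = 0"
      proof (cases "m \<in> N6")
        case True
        then have "b = 0" "c = 0" "0 \<le> e" "M (a,0,0,0,0,0) = False" using m M * by (auto simp: M_defs N6_def)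
        then show ?thesis using e[of a d "nat e" f] * by simp
      qed (use V_zero[OF g] in blast)
    qed
  qed
  then show ?thesis using u by (simp add: J_def)
qed

lemma w6_reg:
  assumes u: "u \<in> S" "w6 * u \<in> J M356"
  shows "u \<in> J M356"
proof -
  have "VM M356 (app u v)" if v: "v \<in> V" for v
  proof -
    let ?g = "app u v"
    have g: "?g \<in> V" using S_V u v by blast
    have z: "app w6 ?g m = 0" if "\<not> M356 m" for m
      using J_D[OF u(2) v that] by simp
    have e: "?g (a,int n,0,d,0,0) = 0" for a d n
    proof (induction n arbitrary: a d)
      case 0
      have "\<not> M356 (a + 1,0,0,d + 1,0,0)" by (auto simp: M_defs)
      from z[OF this] show ?case
        using app_w6[OF g, of "a + 1" 0 0 "d + 1" 0 0] V_neg[OF g] q_nz one_minus_nz by simp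
    next
      case (Suc n)
      have "\<not> M356 (a + 1,int (Suc n),0,d + 1,0,0)" by (auto simp: M_defs)
      from z[OF this] show ?case
        using app_w6[OF g, of "a + 1" "int (Suc n)" 0 "d + 1" 0 0] Suc q_nz one_minus_nz by simp
    qed
    show ?thesis unfolding VM_def
    proof (intro allI impI)
      fix m assume m: "\<not> M356 m"
      obtain a b c d e f where *: "m = (a,b,c,d,e,f)" by (cases m)
      show "?g m = 0"
      proof (cases "m \<in> N6")
        case True
        then have "c = 0" "e = 0" "f = 0" "0 \<le> b" using m * by (auto simp: M_defs N6_def)
        then show ?thesis using e[of a "nat b" d] * by simp
      qed (use V_zero[OF g] in blast)
    qed
  qed
  then show ?thesis using u by (simp add: J_def)
qed

end

section \<open>Homogeneous elements\<close>

text \<open>Pairs a commutation character with a weight; its value is the exponent of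
  \<open>q\<close> gained in the commutation.\<close>

definition pr :: "weight \<Rightarrow> weight \<Rightarrow> int" where
  "pr = (\<lambda>(a,b,c) (x,y,z). a * x + b * y + c * z)"

lemma pr_simp [simp]: "pr (a,b,c) (x,y,z) = a * x + b * y + c * z"
  by (simp add: pr_def)
lemma pr_add: "pr n (\<gamma> + \<delta>) = pr n \<gamma> + pr n \<delta>" "pr (n + n') \<gamma> = pr n \<gamma> + pr n' \<gamma>"
  "pr (n - n') \<gamma> = pr n \<gamma> - pr n' \<gamma>" "pr n 0 = 0" "pr 0 \<gamma> = 0" "pr n (\<gamma> - \<delta>) = pr n \<gamma> - pr n \<delta>"
  by (cases n; cases n'; cases \<gamma>; cases \<delta>; simp add: algebra_simps zero_prod_def)+

definition flipw :: "weight \<Rightarrow> weight" where "flipw = (\<lambda>(a,b,c). (c,b,a))"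
lemma flipw_simp [simp]: "flipw (a,b,c) = (c,b,a)" by (simp add: flipw_def)
lemma flipw_add: "flipw (\<gamma> + \<delta>) = flipw \<gamma> + flipw \<delta>" "flipw (flipw \<gamma>) = \<gamma>" "flipw 0 = 0"
  "pr (flipw n) (flipw \<gamma>) = pr n \<gamma>"
  by (cases \<gamma>; cases \<delta>; cases n; simp add: zero_prod_def)+

definition aw :: "letter \<Rightarrow> weight" where
  "aw l = (case l of E1 \<Rightarrow> (1,0,0) | E2 \<Rightarrow> (0,1,0) | E3 \<Rightarrow> (0,0,1))"

context quantum_parameter begin

definition H :: "weight \<Rightarrow> 'k lin set" where "H \<gamma> = {u \<in> S. loc \<gamma> u}"

lemma H_S: "u \<in> H \<gamma> \<Longrightarrow> u \<in> S" by (simp add: H_def)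
lemma H_closed: "u \<in> H \<gamma> \<Longrightarrow> v \<in> H \<gamma> \<Longrightarrow> u + v \<in> H \<gamma>" "u \<in> H \<gamma> \<Longrightarrow> v \<in> H \<gamma> \<Longrightarrow> u - v \<in> H \<gamma>"
  "u \<in> H \<gamma> \<Longrightarrow> sc c * u \<in> H \<gamma>" "0 \<in> H \<gamma>" "sc c \<in> H 0" "1 \<in> H 0"
  using loc_add[of \<gamma> u v] loc_diff[of \<gamma> u v] loc_mult[OF loc_sc, of \<gamma> u c] loc_sc[of c] loc_0[of \<gamma>] loc_1
    S_closed(1,2)[of u v] S_closed(3)[of "sc c" u] S_closed(4)[of c] S_closed(5,6) by (simp_all add: H_def)
lemma H_uminus: "u \<in> H \<gamma> \<Longrightarrow> - u \<in> H \<gamma>"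
  using H_closed(2)[OF H_closed(4), of u \<gamma>] by simp
lemma H_mult: "u \<in> H \<gamma> \<Longrightarrow> v \<in> H \<delta> \<Longrightarrow> u * v \<in> H (\<gamma> + \<delta>)"
  using loc_mult[of \<gamma> u \<delta> v] S_closed(3)[of u v] by (simp add: H_def)
lemma H_mult': "u \<in> H \<gamma> \<Longrightarrow> v \<in> H \<delta> \<Longrightarrow> \<epsilon> = \<gamma> + \<delta> \<Longrightarrow> u * v \<in> H \<epsilon>"
  using H_mult by blast

lemma H_gen: "gen l \<in> H (aw l)"
proof -
  have "loc (aw l) (gen l)"
    by (rule locI; rename_tac m v; case_tac m; cases l; auto simp: gen_def aw_def app_x1 app_x4 app_x6 wt6_def)
  then show ?thesis by (simp add: H_def S_closed)
qed

lemma H_x: "x1 \<in> H (1,0,0)" "x4 \<in> H (0,1,0)" "x6 \<in> H (0,0,1)"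
  using H_gen[of E1] H_gen[of E2] H_gen[of E3] by (simp_all add: gen_def aw_def)

lemma H_x2: "x2 \<in> H (1,1,0)" and H_x5: "x5 \<in> H (0,1,1)" and H_w1: "w1 \<in> H (0,1,1)" and H_w6: "w6 \<in> H (1,1,0)"
  unfolding x2_def x5_def w1_def w6_def
  by (intro H_closed H_mult'[OF H_x(1) H_x(2)] H_mult'[OF H_x(2) H_x(1)]
    H_mult'[OF H_x(3) H_x(2)] H_mult'[OF H_x(2) H_x(3)]; simp)+

lemma H_x3: "x3 \<in> H (1,1,1)"
  unfolding x3_def by (intro H_closed H_mult'[OF H_x(1) H_x5] H_mult'[OF H_x5 H_x(1)]; simp)

lemma hom_induct [consumes 1, case_names hom add]:
  assumes "u \<in> S" and hom: "\<And>\<gamma> u. u \<in> H \<gamma> \<Longrightarrow> P u" and add: "\<And>u v. P u \<Longrightarrow> P v \<Longrightarrow> P (u + v)"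
  shows "P u"
proof -
  have "\<exists>F g. finite F \<and> (\<forall>x\<in>F. \<exists>\<gamma>. (g x :: 'k lin) \<in> H \<gamma>) \<and> u = sum g (F :: nat set)"
    using assms(1)
  proof (induction u rule: S_induct)
    case (add u v)
    then obtain F g G k where *: "finite F" "\<forall>x\<in>F. \<exists>\<gamma>. g x \<in> H \<gamma>" "u = sum g (F :: nat set)"
      "finite G" "\<forall>x\<in>G. \<exists>\<gamma>. k x \<in> H \<gamma>" "v = sum k (G :: nat set)" by blast
    obtain N where N: "\<forall>x\<in>F. x < N" using *(1) finite_nat_set_iff_bounded by blast
    let ?G = "(+) N ` G"
    let ?g = "\<lambda>x. if x < N then g x else k (x - N)"
    have 1: "sum ?g F = u" unfolding *(3) by (rule sum.cong) (use N in auto)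
    have 2: "sum ?g ?G = v" unfolding *(6) by (subst sum.reindex) (auto simp: inj_on_def)
    have "F \<inter> ?G = {}" using N by auto
    then have "sum ?g (F \<union> ?G) = u + v" using sum.union_disjoint[of F ?G ?g] * 1 2 by auto
    moreover have "\<forall>x\<in>F \<union> ?G. \<exists>\<gamma>. ?g x \<in> H \<gamma>" using * N by auto
    ultimately show ?case using * by (intro exI[of _ "F \<union> ?G"] exI[of _ ?g]) auto
  next
    case (sc c)
    have "\<exists>\<gamma>. sc c \<in> H \<gamma>" using H_closed(5) by blast
    then show ?case by (intro exI[of _ "{0}"] exI[of _ "\<lambda>_. sc c"]) (simp del: split_paired_Ex)
  next
    case (mult a u)
    then obtain F g where *: "finite F" "\<forall>x\<in>F. \<exists>\<gamma>. g x \<in> H \<gamma>" "u = sum g (F :: nat set)" by blast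
    then have "\<forall>x\<in>F. \<exists>\<gamma>. gen a * g x \<in> H \<gamma>" using H_mult[OF H_gen[of a]] by blast
    then show ?case using *(1,3)
      by (intro exI[of _ F] exI[of _ "\<lambda>x. gen a * g x"]) (simp add: sum_distrib_left del: split_paired_Ex)
  next
    case (scale c u)
    then obtain F g where *: "finite F" "\<forall>x\<in>F. \<exists>\<gamma>. g x \<in> H \<gamma>" "u = sum g (F :: nat set)" by blast
    then have "\<forall>x\<in>F. \<exists>\<gamma>. sc c * g x \<in> H \<gamma>" using H_closed(3) by blast
    then show ?case using *(1,3)
      by (intro exI[of _ F] exI[of _ "\<lambda>x. sc c * g x"]) (simp add: sum_distrib_left del: split_paired_Ex)
  qed
  then obtain F g where *: "finite F" "\<forall>x\<in>F. \<exists>\<gamma>. g x \<in> H \<gamma>" "u = sum g (F :: nat set)" by blast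
  have "P (sum g G)" if "G \<subseteq> F" for G
    using finite_subset[OF that *(1)] that
  proof (induction G rule: finite_induct)
    case empty
    show ?case using hom[OF H_closed(4)] by simp
  next
    case (insert x G)
    then obtain \<gamma> where "g x \<in> H \<gamma>" using *(2) by blast
    then have "P (g x)" by (rule hom)
    then show ?case using add insert by simp
  qed
  then show ?thesis using * by blast
qed

lemma comp_H: "u \<in> S \<Longrightarrow> comp \<gamma> u \<in> H \<gamma>"
proof (induction u rule: hom_induct)
  case (hom \<delta> u)
  then show ?case
    using comp_loc[of \<delta> u] comp_loc_other[of \<delta> u \<gamma>] H_closed(4)[of \<gamma>] by (cases "\<delta> = \<gamma>") (auto simp: H_def)
qed (simp add: comp_add H_closed)

lemma comp_eq: "u \<in> H \<gamma> \<Longrightarrow> comp \<gamma> u = u"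
  and comp_other: "u \<in> H \<gamma> \<Longrightarrow> \<delta> \<noteq> \<gamma> \<Longrightarrow> comp \<delta> u = 0"
  using comp_loc[of \<gamma> u] comp_loc_other[of \<gamma> u \<delta>] by (simp_all add: H_def)

lemma comp_sum_ex: "u \<in> S \<Longrightarrow> \<exists>F. finite F \<and> (\<forall>G. finite G \<longrightarrow> F \<subseteq> G \<longrightarrow> u = (\<Sum>\<gamma>\<in>G. comp \<gamma> u))"
proof (induction u rule: hom_induct)
  case (hom \<delta> u)
  have "u = (\<Sum>\<gamma>\<in>G. comp \<gamma> u)" if "finite G" "{\<delta>} \<subseteq> G" for G
  proof -
    have "(\<Sum>\<gamma>\<in>G. comp \<gamma> u) = (\<Sum>\<gamma>\<in>G. if \<gamma> = \<delta> then u else 0)"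
      by (rule sum.cong) (use comp_eq comp_other hom in auto)
    then show ?thesis using that by simp
  qed
  then show ?case by (intro exI[of _ "{\<delta>}"]) blast
next
  case (add u v)
  then obtain F G where *: "finite F" "\<forall>K. finite K \<longrightarrow> F \<subseteq> K \<longrightarrow> u = (\<Sum>\<gamma>\<in>K. comp \<gamma> u)"
    "finite G" "\<forall>K. finite K \<longrightarrow> G \<subseteq> K \<longrightarrow> v = (\<Sum>\<gamma>\<in>K. comp \<gamma> v)" by blast
  have "u + v = (\<Sum>\<gamma>\<in>K. comp \<gamma> (u + v))" if "finite K" "F \<union> G \<subseteq> K" for K
    using * that by (simp add: comp_add sum.distrib)
  then show ?case using * by (intro exI[of _ "F \<union> G"]) blast
qed

text \<open>\<open>S_induct\<close> may break a homogeneous element into inhomogeneous pieces. The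
  property is therefore proved for all components of an arbitrary element at once.\<close>

lemma H_induct [consumes 1, case_names zero sc add scale gen]:
  assumes "u \<in> H \<gamma>" and zero: "\<And>\<delta>. P \<delta> 0" and sc: "\<And>c. P 0 (sc c)"
    and add: "\<And>\<delta> u v. u \<in> H \<delta> \<Longrightarrow> v \<in> H \<delta> \<Longrightarrow> P \<delta> u \<Longrightarrow> P \<delta> v \<Longrightarrow> P \<delta> (u + v)"
    and scale: "\<And>\<delta> u c. u \<in> H \<delta> \<Longrightarrow> P \<delta> u \<Longrightarrow> P \<delta> (sc c * u)"
    and gen: "\<And>\<delta> u l. u \<in> H \<delta> \<Longrightarrow> P \<delta> u \<Longrightarrow> P (aw l + \<delta>) (gen l * u)"
  shows "P \<gamma> u"
proof -
  have "u \<in> S" using assms(1) H_S by blast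
  then have "\<forall>\<delta>. P \<delta> (comp \<delta> u)"
  proof (induction u rule: S_induct)
    case (add u v)
    then show ?case using assms(4) comp_H by (simp add: comp_add)
  next
    case (sc c)
    show ?case
    proof
      fix \<delta> show "P \<delta> (comp \<delta> (sc c))"
        using assms(3) zero comp_eq[OF H_closed(5)] comp_other[OF H_closed(5)] by (cases "\<delta> = 0") simp_all
    qed
  next
    case (mult a u)
    show ?case
    proof
      fix \<delta>
      have "comp (aw a + (\<delta> - aw a)) (gen a * u) = gen a * comp (\<delta> - aw a) u"
        using H_gen by (intro comp_mult_left) (simp add: H_def)
      then have "comp \<delta> (gen a * u) = gen a * comp (\<delta> - aw a) u" by simp
      moreover have "P (aw a + (\<delta> - aw a)) (gen a * comp (\<delta> - aw a) u)"
        by (intro gen comp_H mult) (use mult in blast)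
      ultimately show "P \<delta> (comp \<delta> (gen a * u))" by simp
    qed
  next
    case (scale c u)
    then show ?case using assms(5) comp_H by (simp add: comp_sc)
  qed
  then show ?thesis using comp_eq[OF assms(1)] by metis
qed

lemma vac_support: "u \<in> H \<gamma> \<Longrightarrow> app u vac m \<noteq> 0 \<Longrightarrow> wt6 m = \<gamma> \<and> m \<in> N6"
proof -
  assume u: "u \<in> H \<gamma>" and m: "app u vac m \<noteq> 0"
  have "m \<in> N6" using m V_zero[OF S_V[OF H_S[OF u] V_dl]] by blast
  moreover have "wt6 m = \<gamma>"
  proof (rule ccontr)
    assume "wt6 m \<noteq> \<gamma>"
    have "vac n = 0" if "wt6 n = wt6 m - \<gamma>" for n
    proof (cases "n = (0,0,0,0,0,0)")
      case True
      then have "wt6 m - \<gamma> = 0" using that by (simp add: wt6_def zero_prod_def)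
      then show ?thesis using \<open>wt6 m \<noteq> \<gamma>\<close> by simp
    qed (simp add: dl_def)
    then have "app u vac m = 0"
      using u by (intro locD[of \<gamma> u]) (simp_all add: H_def)
    then show False using m by simp
  qed
  ultimately show ?thesis by simp
qed

lemma wt6_simp [simp]: "wt6 (a,b,c,d,e,f) = (a + b + c, b + c + d + e, c + e + f)"
  by (simp add: wt6_def)

lemma H_eq0: "u \<in> H \<gamma> \<Longrightarrow> (\<And>m. m \<in> N6 \<Longrightarrow> wt6 m = \<gamma> \<Longrightarrow> app u vac m = 0) \<Longrightarrow> u = 0"
  using vac_support H_S by (intro S_faithful) blast+

text \<open>This ends every descent on the weight.\<close>

lemma H_neg: "u \<in> H (a,b,c) \<Longrightarrow> a < 0 \<or> b < 0 \<or> c < 0 \<Longrightarrow> u = 0"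
  by (erule H_eq0) (auto simp: N6_def)

lemma H_single:
  assumes u: "u \<in> H \<gamma>" and v: "v \<in> H \<gamma>" and m: "app v vac m \<noteq> 0"
    and uniq: "\<And>n. n \<in> N6 \<Longrightarrow> wt6 n = \<gamma> \<Longrightarrow> n = m"
  shows "\<exists>c. u = sc c * v"
proof -
  let ?c = "app u vac m / app v vac m"
  have "u - sc ?c * v = 0"
  proof (rule H_eq0)
    show "u - sc ?c * v \<in> H \<gamma>" using u v H_closed by blast
    fix n assume "n \<in> N6" "wt6 n = \<gamma>"
    then show "app (u - sc ?c * v) vac n = 0" using uniq m by simp
  qed
  then show ?thesis by (intro exI[of _ ?c]) simp
qed

lemma H_zero_scalar: "u \<in> H 0 \<Longrightarrow> \<exists>c. u = sc c"
proof -
  assume "u \<in> H 0"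
  then have "\<exists>c. u = sc c * 1"
    by (rule H_single[where m = "(0,0,0,0,0,0)"]) (use H_closed in \<open>auto simp: dl_def N6_def zero_prod_def\<close>)
  then show ?thesis by simp
qed

lemma H_gen_scalar: "u \<in> H (aw l) \<Longrightarrow> \<exists>c. u = sc c * gen l"
proof (cases l)
  case E1
  assume "u \<in> H (aw l)"
  then show ?thesis using E1 H_gen[of l]
    by (intro H_single[where m = "(1,0,0,0,0,0)" and \<gamma> = "aw l"])
      (auto simp: aw_def gen_def N6_def app_x1 dl_def)
next
  case E2
  assume "u \<in> H (aw l)"
  then show ?thesis using E2 H_gen[of l]
    by (intro H_single[where m = "(0,0,0,1,0,0)" and \<gamma> = "aw l"])
      (auto simp: aw_def gen_def N6_def app_x4 dl_def)
next
  case E3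
  assume "u \<in> H (aw l)"
  then show ?thesis using E3 H_gen[of l]
    by (intro H_single[where m = "(0,0,0,0,0,1)" and \<gamma> = "aw l"])
      (auto simp: aw_def gen_def N6_def app_x6 dl_def)
qed

subsection \<open>Relations\<close>

lemma \<phi>_rel: "f - g \<in> serre_ideal q \<Longrightarrow> \<phi> f = \<phi> g"
  by (simp add: \<phi>_eq_iff)

lemma rels:
  "x1 * x2 = sc q * (x2 * x1)" "x2 * x4 = sc q * (x4 * x2)" "x1 * x3 = sc q * (x3 * x1)"
  "x2 * x3 = sc q * (x3 * x2)" "x3 * x4 = x4 * x3" "x3 * x6 = sc q * (x6 * x3)"
  "x2 * x6 - sc (inverse q) * (x6 * x2) = x3"
  using \<phi>_rel[OF serre_cg(2)] \<phi>_rel[OF serre_cg(3)] \<phi>_rel[OF y1_y3] \<phi>_rel[OF y2_y3] \<phi>_rel[OF y3_y4]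
    \<phi>_rel[OF y3_y6] \<phi>_rel[OF y2_y6]
  by (simp_all only: \<phi>_simps \<phi>_y)

lemma x2_x6: "x2 * x6 = sc (inverse q) * (x6 * x2) + x3"
  using rels(7) by (simp add: algebra_simps)
lemma x1_x4: "x1 * x4 = sc (inverse q) * (x4 * x1) + x2"
  by (simp add: x2_def)
lemma x4_x6: "x4 * x6 = sc (inverse q) * (x6 * x4) + x5"
  by (simp add: x5_def)
lemma x1_x5: "x1 * x5 = sc (inverse q) * (x5 * x1) + x3"
  by (simp add: x3_def)

text \<open>Normality of \<open>y\<close> modulo \<open>I\<close>, with the commutation scalars
  prescribed by a character \<open>n\<close>.\<close>

definition qc :: "'k lin set \<Rightarrow> 'k lin \<Rightarrow> weight \<Rightarrow> bool" where
  "qc I y n \<longleftrightarrow> (\<forall>\<delta>. \<forall>u\<in>H \<delta>. y * u - sc (q powi pr n \<delta>) * (u * y) \<in> I)"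

lemma qcD: "qc I y n \<Longrightarrow> u \<in> H \<delta> \<Longrightarrow> y * u - sc (q powi pr n \<delta>) * (u * y) \<in> I"
  unfolding qc_def by blast

lemma qcI:
  assumes I: "hid I" and y: "y \<in> S"
    and g: "\<And>l. y * gen l - sc (q powi pr n (aw l)) * (gen l * y) \<in> I"
  shows "qc I y n"
  unfolding qc_def
proof (intro allI ballI)
  fix \<delta> u assume "u \<in> H \<delta>"
  then show "y * u - sc (q powi pr n \<delta>) * (u * y) \<in> I"
  proof (induction rule: H_induct)
    case (zero \<delta>)
    then show ?case using hidD(2)[OF I] by simp
  next
    case (sc c)
    then show ?case using hidD(2)[OF I] by (simp add: pr_add sc_simps(2) sc_comm[of y])
  next
    case (add \<delta> u v)
    have "y * (u + v) - sc (q powi pr n \<delta>) * ((u + v) * y) =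
      (y * u - sc (q powi pr n \<delta>) * (u * y)) + (y * v - sc (q powi pr n \<delta>) * (v * y))"
      by (simp add: distrib_left distrib_right)
    then show ?case using add hidD(4)[OF I] by metis
  next
    case (scale \<delta> u c)
    have "y * (sc c * u) - sc (q powi pr n \<delta>) * ((sc c * u) * y) =
      sc c * (y * u - sc (q powi pr n \<delta>) * (u * y))"
      by (simp add: right_diff_distrib sc_comm2[of y] sc_merge mult.assoc mult.commute[of c])
    then show ?case using scale hidD(7)[OF I] by metis
  next
    case (gen \<delta> u l)
    have "y * (gen l * u) - sc (q powi pr n (aw l + \<delta>)) * ((gen l * u) * y) =
      (y * gen l - sc (q powi pr n (aw l)) * (gen l * y)) * u +
      sc (q powi pr n (aw l)) * (gen l * (y * u - sc (q powi pr n \<delta>) * (u * y)))"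
      using q_nz by (simp add: right_diff_distrib left_diff_distrib sc_comm2[of "gen l"] sc_merge mult.assoc pr_add power_int_add)
    then show ?case using gen g hidD(4-7)[OF I] H_S S_closed(13) by metis
  qed
qed

lemma qcI3:
  assumes I: "hid I" and y: "y \<in> S"
    and "y * x1 - sc (q powi a) * (x1 * y) \<in> I" "y * x4 - sc (q powi b) * (x4 * y) \<in> I"
      "y * x6 - sc (q powi c) * (x6 * y) \<in> I"
  shows "qc I y (a,b,c)"
proof (rule qcI[OF I y])
  fix l show "y * gen l - sc (q powi pr (a,b,c) (aw l)) * (gen l * y) \<in> I"
    using assms(3-5) by (cases l) (simp_all add: gen_def aw_def)
qed

lemma hid0: "hid {0}" using hid_J[OF stable_masks(1)] J_M0 by simp

lemma qqi: "q * q * inverse q = q" "q * (q * inverse q) = q" "q * inverse q = 1" "q * (inverse q * inverse q) = inverse q"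
  using q_nz by simp_all

lemma flip_scalar: "u * v = sc q * (v * u) \<Longrightarrow> v * u = sc (inverse q) * (u * v)"
  by (simp add: sc_cancel)

lemma qc_x3: "qc {0} x3 (-1,0,1)"
  using rels flip_scalar[OF rels(3)] S_closed by (intro qcI3[OF hid0]) (simp_all add: power_int_minus sc_simps(2))

text \<open>The quantum determinant of the two by two block with rows \<open>x2\<close>,
  \<open>x3\<close> and \<open>x4\<close>, \<open>x5\<close>.\<close>

definition z where "z = x2 * x5 - sc q * (x3 * x4)"

lemma z_S: "z \<in> S" by (simp add: z_def S_closed)

lemma H_z: "z \<in> H (1,2,1)"
  unfolding z_def by (intro H_closed H_mult'[OF H_x2 H_x5] H_mult'[OF H_x3 H_x(2)]; simp)

lemma qc_z: "qc {0} z (0,0,0)"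
proof (rule qcI3[OF hid0 z_S])
  have 31: "x3 * x1 = sc (inverse q) * (x1 * x3)" by (rule flip_scalar[OF rels(3)])
  have "z * x1 = x1 * z"
  proof -
    have "x1 * z = sc q * (x2 * (x1 * x5)) - sc q * ((x1 * x3) * x4)"
      by (simp add: z_def right_diff_distrib sc_left rels(1) mult.assoc flip: mult.assoc[of x1 x2 x5])
    also have "\<dots> = sc q * (x2 * (sc (inverse q) * (x5 * x1) + x3)) - sc q * (sc q * (x3 * (x1 * x4)))"
      by (simp only: x1_x5 rels(3) mult.assoc)
    also have "\<dots> = x2 * (x5 * x1) + sc q * (x2 * x3) - sc (q * q) * (x3 * (sc (inverse q) * (x4 * x1) + x2))"
      by (simp only: x1_x4 distrib_left sc_left sc_merge) (simp add: sc_cancel sc_simps(2) qqi)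
    also have "\<dots> = z * x1"
      by (simp add: z_def rels(4) distrib_left left_diff_distrib sc_left sc_merge mult.assoc sc_simps(2) qqi)
    finally show ?thesis by simp
  qed
  then show "z * x1 - sc (q powi 0) * (x1 * z) \<in> {0}" by (simp add: sc_simps)
  have "z * x4 = x4 * z"
  proof -
    have "z * x4 = x2 * (x5 * x4) - sc q * (x3 * x4 * x4)" by (simp add: z_def left_diff_distrib mult.assoc)
    also have "\<dots> = sc (inverse q) * ((x2 * x4) * x5) - sc q * (x4 * (x3 * x4))"
      by (simp add: flip_scalar[OF x4_x5] sc_left mult.assoc rels(5))
    also have "\<dots> = x4 * z"
      by (simp add: rels(2) z_def right_diff_distrib sc_left sc_cancel mult.assoc)
    finally show ?thesis .
  qed
  then show "z * x4 - sc (q powi 0) * (x4 * z) \<in> {0}" by (simp add: sc_simps)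
  have "z * x6 = x6 * z"
  proof -
    have "z * x6 = x2 * (x5 * x6) - sc q * (x3 * (x4 * x6))" by (simp add: z_def left_diff_distrib mult.assoc)
    also have "\<dots> = sc q * ((x2 * x6) * x5) - sc q * (x3 * (sc (inverse q) * (x6 * x4) + x5))"
      by (simp add: x5_x6 x4_x6 sc_left mult.assoc)
    also have "\<dots> = sc q * ((sc (inverse q) * (x6 * x2) + x3) * x5) - sc q * (x3 * (sc (inverse q) * (x6 * x4) + x5))"
      by (simp only: x2_x6)
    also have "\<dots> = x6 * (x2 * x5) - (x3 * x6) * x4"
      by (simp add: distrib_left distrib_right sc_left sc_cancel mult.assoc)
    also have "\<dots> = x6 * z"
      by (simp add: rels(6) z_def right_diff_distrib sc_left mult.assoc)
    finally show ?thesis .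
  qed
  then show "z * x6 - sc (q powi 0) * (x6 * z) \<in> {0}" by (simp add: sc_simps)
qed

abbreviation "J3 \<equiv> J M3"
abbreviation "J32 \<equiv> J M32"
abbreviation "J35 \<equiv> J M35"

lemmas hids = hid_J[OF stable_masks(2)] hid_J[OF stable_masks(3)] hid_J[OF stable_masks(4)]
   hid_J[OF stable_masks(5)] hid_J[OF stable_masks(6)]

text \<open>The only defect is the q-commutator with \<open>x6\<close>, which equals
  \<open>x3\<close>; hence normality holds only modulo \<open>J3\<close>.\<close>

lemma qc_x2: "qc J3 x2 (-1,1,-1)"
  using rels(2) flip_scalar[OF rels(1)] rels(7) s3.y_in hidD(2)[OF hids(1)]
  by (intro qcI3[OF hids(1)]) (simp_all add: power_int_minus S_closed)

lemma qc_x5: "qc J3 x5 (1,-1,1)"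
proof (rule qcI3[OF hids(1)])
  have "x5 * x1 - sc (q powi 1) * (x1 * x5) = sc (- q) * x3"
    by (simp add: x1_x5 distrib_left sc_cancel sc_simps)
  then show "x5 * x1 - sc (q powi 1) * (x1 * x5) \<in> J3" using s3.y_in hidD(7)[OF hids(1)] by metis
qed (use flip_scalar[OF x4_x5] x5_x6 hidD(2)[OF hids(1)] in \<open>simp_all add: power_int_minus S_closed\<close>)

lemma qc_x1: "qc J32 x1 (0,-1,0)"
  using x2_def s2.y_in hidD(2)[OF hids(2)] x1_x6
  by (intro qcI3[OF hids(2)]) (simp_all add: power_int_minus S_closed sc_simps(2) flip: x2_def)

lemma qc_x6: "qc J35 x6 (0,1,0)"
proof (rule qcI3[OF hids(3)])
  have "x6 * x4 - sc (q powi 1) * (x4 * x6) = sc (- q) * x5"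
    by (simp add: x4_x6 distrib_left sc_cancel sc_simps)
  then show "x6 * x4 - sc (q powi 1) * (x4 * x6) \<in> J35" using s5.y_in hidD(7)[OF hids(3)] by metis
qed (use x1_x6 hidD(2)[OF hids(3)] in \<open>simp_all add: S_closed sc_simps(2)\<close>)

end

text \<open>With the scalar action as a separate operation, the simplifier collects scalars in front
  of noncommutative monomials.\<close>

definition scl :: "'k::field \<Rightarrow> 'k lin \<Rightarrow> 'k lin" where "scl c u = sc c * u"

lemma scl_simps: "sc c * u = scl c u" "scl a (scl b u) = scl (a * b) u" "scl a u * v = scl a (u * v)"
  "u * scl a v = scl a (u * v)" "scl a (u + v) = scl a u + scl a v" "scl a (u - v) = scl a u - scl a v"
  "scl a (- u) = - scl a u" "scl (a + b) u = scl a u + scl b u" "scl (a - b) u = scl a u - scl b u"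
  "scl (- a) u = - scl a u" "scl 1 u = u" "scl 0 u = 0" "scl a 0 = 0"
  by (simp_all add: scl_def sc_simps mult.assoc sc_comm2[of u] distrib_left distrib_right
      right_diff_distrib left_diff_distrib)

lemmas ring_norm = scl_simps left_diff_distrib right_diff_distrib distrib_left distrib_right mult.assoc
  mult_minus_left mult_minus_right

context quantum_parameter begin

section \<open>The automorphism exchanging the two outer generators\<close>

definition genf :: "letter \<Rightarrow> 'k lin" where
  "genf l = (case l of E1 \<Rightarrow> x6 | E2 \<Rightarrow> x4 | E3 \<Rightarrow> x1)"

lemma genf_ideal: "f \<in> serre_ideal q \<Longrightarrow> ev genf f = 0"
proof (rule ev_serre_ideal)
  fix r assume "r \<in> serre_rels q"
  then have "r = letter E1 * letter E3 - letter E3 * letter E1 \<or>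
      (\<exists>a b. (a, b) \<in> {(E1, E2), (E2, E1), (E2, E3), (E3, E2)} \<and> r = letter a ^ 2 * letter b
        - scalar (q + inverse q) * (letter a * letter b * letter a) + letter b * letter a ^ 2)"
    unfolding serre_rels_def by blast
  moreover have "ev genf (letter a ^ 2 * letter b
        - scalar (q + inverse q) * (letter a * letter b * letter a) + letter b * letter a ^ 2)
      = genf a * genf a * genf b - sc (q + inverse q) * (genf a * genf b * genf a) + genf b * genf a * genf a" for a b
    by (simp only: ev_add ev_diff ev_mult ev_basic power2_eq_square mult.assoc)
  moreover have "ev genf (letter E1 * letter E3 - letter E3 * letter E1) = 0"
    by (simp add: ev_diff ev_mult ev_basic genf_def x1_x6)
  ultimately show "ev genf r = 0"
    using serre_14 serre_41 serre_46 serre_64 by (auto simp: genf_def simp del: sc_simps)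
qed

text \<open>Defined through a preimage in the free algebra. The choice is harmless: two preimages
  differ by an element of the Serre ideal, which is symmetric in the outer generators.\<close>

definition flip :: "'k lin \<Rightarrow> 'k lin" where "flip u = ev genf (SOME f. \<phi> f = u)"

lemma flip_\<phi>: "flip (\<phi> f) = ev genf f"
proof -
  have "\<phi> (SOME g. \<phi> g = \<phi> f) = \<phi> f" by (rule someI) (rule refl)
  then have "(SOME g. \<phi> g = \<phi> f) - f \<in> serre_ideal q" by (simp only: \<phi>_eq_iff)
  then show ?thesis using genf_ideal[of "(SOME g. \<phi> g = \<phi> f) - f"] by (simp add: flip_def ev_diff)
qed

lemma flip_simps: "u \<in> S \<Longrightarrow> v \<in> S \<Longrightarrow> flip (u + v) = flip u + flip v"
  "u \<in> S \<Longrightarrow> v \<in> S \<Longrightarrow> flip (u - v) = flip u - flip v"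
  "u \<in> S \<Longrightarrow> v \<in> S \<Longrightarrow> flip (u * v) = flip u * flip v" "flip (sc c) = sc c"
  "flip (gen l) = genf l" "flip 0 = 0"
proof -
  show "u \<in> S \<Longrightarrow> v \<in> S \<Longrightarrow> flip (u + v) = flip u + flip v"
    "u \<in> S \<Longrightarrow> v \<in> S \<Longrightarrow> flip (u - v) = flip u - flip v"
    "u \<in> S \<Longrightarrow> v \<in> S \<Longrightarrow> flip (u * v) = flip u * flip v"
    by (auto simp: S_def flip_\<phi> ev_add ev_diff ev_mult simp flip: \<phi>_simps(1-3))
  show "flip (sc c) = sc c" "flip (gen l) = genf l" "flip 0 = 0"
    using flip_\<phi>[of "scalar c"] flip_\<phi>[of "letter l"] flip_\<phi>[of 0] by (simp_all add: \<phi>_simps ev_basic)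
qed

lemma flip_x: "flip x1 = x6" "flip x4 = x4" "flip x6 = x1"
  using flip_simps(5)[of E1] flip_simps(5)[of E2] flip_simps(5)[of E3] by (simp_all add: gen_def genf_def)

lemma flip_sc: "u \<in> S \<Longrightarrow> flip (sc c * u) = sc c * flip u"
  using flip_simps(3)[of "sc c" u] flip_simps(4) S_closed by simp

lemma genf_S: "genf l \<in> S" by (cases l) (simp_all add: genf_def S_closed)

lemma flip_S: "u \<in> S \<Longrightarrow> flip u \<in> S"
  by (induction u rule: S_induct) (simp_all add: flip_simps flip_sc S_closed genf_S)

lemma flip_genf: "flip (genf l) = gen l"
  by (cases l) (simp_all add: genf_def gen_def flip_x)

lemma flip_flip: "u \<in> S \<Longrightarrow> flip (flip u) = u"
  by (induction u rule: S_induct) (simp_all add: flip_simps flip_sc flip_S S_closed genf_S flip_genf)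

lemma flip_H: "u \<in> H \<gamma> \<Longrightarrow> flip u \<in> H (flipw \<gamma>)"
proof (induction rule: H_induct)
  case (gen \<delta> u l)
  have "genf l \<in> H (flipw (aw l))"
    using H_x by (cases l) (simp_all add: genf_def aw_def)
  then show ?case using H_mult gen H_S by (simp add: flip_simps flip_genf S_closed flipw_add)
qed (use H_S in \<open>simp_all add: flip_simps flip_sc H_closed flipw_add\<close>)

definition De where "De = flip x3"

lemma flip_x25: "flip x2 = w1" "flip x5 = w6"
  by (simp_all add: x2_def x5_def w1_def w6_def flip_simps flip_sc S_closed flip_x)

lemma De_S: "De \<in> S" and H_De: "De \<in> H (1,1,1)" and flip_De: "flip De = x3"
  using flip_S[OF S_closed(9)] flip_H[OF H_x3] flip_flip[OF S_closed(9)] by (simp_all add: De_def)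

lemma De_w1: "De = w1 * x1 - sc (inverse q) * (x1 * w1)"
  using arg_cong[OF rels(7), of flip] by (simp add: flip_simps flip_sc S_closed flip_x flip_x25 De_def)

lemma flip_rel: "u * v = sc c * (v * u) \<Longrightarrow> u \<in> S \<Longrightarrow> v \<in> S \<Longrightarrow> flip u * flip v = sc c * (flip v * flip u)"
proof -
  assume e: "u * v = sc c * (v * u)" and S: "u \<in> S" "v \<in> S"
  have "flip u * flip v = flip (sc c * (v * u))" using flip_simps(3)[OF S] by (simp only: e)
  also have "\<dots> = sc c * (flip v * flip u)"
    using flip_sc[OF S_closed(3)[OF S(2) S(1)]] flip_simps(3)[OF S(2) S(1)] by simp
  finally show ?thesis .
qed

lemma qc_De: "qc {0} De (1,0,-1)"
proof -
  have "De * x1 = sc q * (x1 * De)" "x6 * De = sc q * (De * x6)" "De * x4 = sc 1 * (x4 * De)"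
    using flip_rel[OF rels(6)] flip_rel[OF rels(3)] flip_rel[of x3 x4 1] rels(5)
    by (simp_all add: flip_x De_def[symmetric] S_closed sc_simps(2))
  then show ?thesis
    using flip_scalar[of x6 De] De_S by (intro qcI3[OF hid0]) (simp_all add: power_int_minus sc_simps(2))
qed

lemma qqi': "inverse q * q = 1" "inverse q * (q * c) = c" "q * (inverse q * c) = c"
  using q_nz by (simp_all flip: mult.assoc)

text \<open>The right side is a combination of multiples of \<open>x2\<close>, so \<open>w1\<close>
  and \<open>x1\<close> q-commute modulo \<open>J32\<close>, with the scalar
  \<open>q\<close>.\<close>

lemma w1_x1: "w1 * x1 - sc q * (x1 * w1) = x2 * x6 - sc q * (x6 * x2)"
proof -
  have "x6 * (x4 * x1) = x6 * (x4 * x1)" ..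
  have c: "x6 * x1 = x1 * x6" "x6 * (x1 * u) = x1 * (x6 * u)" for u
    using x1_x6 by (simp_all flip: mult.assoc)
  show ?thesis
    by (simp add: w1_def x2_def ring_norm c qqi qqi')
qed

lemma w_rels: "w1 * x4 = sc q * (x4 * w1)" "w1 * x6 = sc (inverse q) * (x6 * w1)"
  "w6 * x1 = sc q * (x1 * w6)" "w6 * x4 = sc (inverse q) * (x4 * w6)"
proof -
  show "w1 * x4 = sc q * (x4 * w1)" "w6 * x1 = sc q * (x1 * w6)"
    using flip_rel[OF rels(2) S_closed(8,10)] flip_rel[OF x5_x6 S_closed(11,12)]
    by (simp_all only: flip_x flip_x25)
  have "x6 * w1 = sc q * (w1 * x6)" "x4 * w6 = sc q * (w6 * x4)"
    using flip_rel[OF rels(1) S_closed(7,8)] flip_rel[OF x4_x5 S_closed(10,11)]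
    by (simp_all only: flip_x flip_x25)
  then show "w1 * x6 = sc (inverse q) * (x6 * w1)" "w6 * x4 = sc (inverse q) * (x4 * w6)"
    by (blast intro: flip_scalar)+
qed

lemma qc_w1: "qc J32 w1 (1,1,-1)"
proof (rule qcI3[OF hids(2)])
  have "w1 * x1 - sc q * (x1 * w1) \<in> J32"
    unfolding w1_x1
    by (rule hidD(3)[OF hids(2) hidD(6)[OF hids(2) S_closed(12) s2.y_in]
        hidD(7)[OF hids(2) hidD(5)[OF hids(2) S_closed(12) s2.y_in]]])
  then show "w1 * x1 - sc (q powi 1) * (x1 * w1) \<in> J32" by simp
  show "w1 * x4 - sc (q powi 1) * (x4 * w1) \<in> J32" "w1 * x6 - sc (q powi - 1) * (x6 * w1) \<in> J32"
    using hidD(2)[OF hids(2)] by (simp_all add: w_rels power_int_minus)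
qed (rule w_S)

lemma w6_x6: "w6 * x6 - sc (inverse q) * (x6 * w6) = x5 * x1 - sc (inverse q) * (x1 * x5)"
proof -
  have c: "x6 * x1 = x1 * x6" "x6 * (x1 * u) = x1 * (x6 * u)" for u
    using x1_x6 by (simp_all flip: mult.assoc)
  show ?thesis
    by (simp add: w6_def x5_def ring_norm c qqi qqi')
qed

lemma qc_w6: "qc J35 w6 (1,-1,-1)"
proof (rule qcI3[OF hids(3)])
  have "w6 * x6 - sc (inverse q) * (x6 * w6) \<in> J35"
    unfolding w6_x6
    by (rule hidD(3)[OF hids(3) hidD(6)[OF hids(3) S_closed(7) s5.y_in]
        hidD(7)[OF hids(3) hidD(5)[OF hids(3) S_closed(7) s5.y_in]]])
  then show "w6 * x6 - sc (q powi - 1) * (x6 * w6) \<in> J35" by (simp add: power_int_minus)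
  show "w6 * x1 - sc (q powi 1) * (x1 * w6) \<in> J35" "w6 * x4 - sc (q powi - 1) * (x4 * w6) \<in> J35"
    using hidD(2)[OF hids(3)] by (simp_all add: w_rels power_int_minus)
qed (rule w_S)

subsection \<open>Division steps\<close>

lemma J_comp:
  assumes "u \<in> J M"
  shows "comp \<gamma> u \<in> J M"
proof -
  have "comp \<gamma> u \<in> S" using comp_H[of u \<gamma>] H_S[of "comp \<gamma> u" \<gamma>] assms by (simp add: J_def)
  moreover have "VM M (app (comp \<gamma> u) v)" if v: "v \<in> V" for v
    unfolding VM_def
  proof (intro allI impI)
    fix m assume "\<not> M m"
    then show "app (comp \<gamma> u) v m = 0"
      using J_D[OF assms V_restrict[OF v]] by (simp add: comp.rep_eq)
  qed
  ultimately show ?thesis by (simp add: J_def)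
qed

text \<open>The pair \<open>(y, y')\<close> consists of elements that are normal and regular modulo \<open>I\<close>, and
  \<open>I' = I + y S\<close>, with \<open>y'\<close> regular modulo \<open>I'\<close>.\<close>

definition step where
  "step I I' y \<eta> n y' \<eta>' n' \<longleftrightarrow> hid I \<and> hid I' \<and> I \<subseteq> I' \<and> y \<in> I' \<and> y \<in> H \<eta> \<and> y' \<in> H \<eta>' \<and>
     qc I y n \<and> qc I y' n' \<and> pr n' \<eta> = - pr n \<eta>' \<and>
     (\<forall>\<beta>. \<forall>u\<in>H \<beta>. y * u \<in> I \<longrightarrow> u \<in> I) \<and> (\<forall>\<beta>. \<forall>u\<in>H \<beta>. y' * u \<in> I' \<longrightarrow> u \<in> I') \<and>
     (\<forall>\<beta>. \<forall>u\<in>H (\<beta> + \<eta>). u \<in> I' \<longrightarrow> (\<exists>s\<in>H \<beta>. u - y * s \<in> I))"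

lemma (in shift_step) divide_H:
  assumes c: "crit M" and u: "u \<in> H (\<beta> + \<eta>)" "u \<in> J M'" and y: "y \<in> H \<eta>"
  shows "\<exists>s\<in>H \<beta>. u - y * s \<in> J M"
proof -
  obtain s where s: "s \<in> S" "u - y * s \<in> J M" using divide[OF c u(2)] by blast
  have "comp (\<eta> + \<beta>) (u - y * s) = u - y * comp \<beta> s"
    using comp_mult_left[of \<eta> y \<beta> s] y comp_eq[OF u(1)] by (simp add: comp_diff H_def add.commute)
  then show ?thesis using J_comp[OF s(2), of "\<eta> + \<beta>"] comp_H[OF s(1)] by metis
qed

text \<open>Modulo \<open>J32\<close> the element \<open>De\<close> becomes
  \<open>q - inverse q\<close> times \<open>x1 * w1\<close>, a product of two regular elements. This
  forces \<open>u\<close> into \<open>J32\<close>; writing \<open>u\<close> as a multiple of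
  \<open>x2\<close> modulo \<open>J3\<close> and cancelling \<open>x2\<close> reduces the claim to
  smaller weight.\<close>

lemma De_reg: "u \<in> H \<beta> \<Longrightarrow> De * u \<in> J3 \<Longrightarrow> u \<in> J3"
proof (induction "nat (fst \<beta> + 1)" arbitrary: u \<beta> rule: less_induct)
  case less
  obtain a b c where \<beta>: "\<beta> = (a,b,c)" by (cases \<beta>)
  note uS = H_S[OF less.prems(1)]
  show ?case
  proof (cases "a < 0")
    case True
    then have "u = 0" using H_neg less.prems(1) \<beta> by blast
    then show ?thesis using hidD(2)[OF hids(1)] by simp
  next
    case False
    have 1: "De * u \<in> J32" using less.prems(2) s2.sub by blast
    let ?k = "q - inverse q"
    have "w1 * x1 - sc q * (x1 * w1) \<in> J32"
      using qcD[OF qc_w1 H_x(1)] by simp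
    then have "(w1 * x1 - sc q * (x1 * w1)) * u \<in> J32"
      by (rule hidD(6)[OF hids(2) uS])
    then have "De * u - (w1 * x1 - sc q * (x1 * w1)) * u \<in> J32" by (rule hidD(3)[OF hids(2) 1])
    moreover have "De * u - (w1 * x1 - sc q * (x1 * w1)) * u = sc ?k * (x1 * (w1 * u))"
      by (simp add: De_w1 ring_norm)
    ultimately have "sc (inverse ?k) * (sc ?k * (x1 * (w1 * u))) \<in> J32"
      using hidD(7)[OF hids(2)] by metis
    then have "x1 * (w1 * u) \<in> J32"
      using h by (simp add: sc_merge sc_simps(2))
    then have "u \<in> J32" using s1.reg w1_reg uS S_closed(3) w_S by blast
    then obtain s where s: "s \<in> H (\<beta> - (1,1,0))" "u - x2 * s \<in> J3"
      using s2.divide_H[OF crits(2), of u "\<beta> - (1,1,0)" "(1,1,0)"] less.prems(1) H_x2 by auto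
    have "De * x2 = sc q * (x2 * De)" using qcD[OF qc_De H_x2] by simp
    then have e: "De * (x2 * s) = sc q * (x2 * (De * s))" by (metis mult.assoc)
    have "De * u - De * (u - x2 * s) \<in> J3"
      by (intro hidD(3)[OF hids(1)] less.prems hidD(5)[OF hids(1) De_S] s)
    then have "sc q * (x2 * (De * s)) \<in> J3" by (simp add: right_diff_distrib e)
    then have "sc (inverse q) * (sc q * (x2 * (De * s))) \<in> J3" by (rule hidD(7)[OF hids(1)])
    then have "De * s \<in> J3" using s2.reg H_S[OF s(1)] De_S S_closed(3) by (simp add: sc_cancel)
    then have "s \<in> J3" using less.hyps[OF _ s(1)] False \<beta> by simp
    then have "(u - x2 * s) + x2 * s \<in> J3"
      by (intro hidD(4)[OF hids(1)] s hidD(5)[OF hids(1) S_closed(8)])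
    then show ?thesis by simp
  qed
qed

lemma stepI:
  assumes "hid I" "hid I'" "I \<subseteq> I'" "y \<in> I'" "y \<in> H \<eta>" "y' \<in> H \<eta>'" "qc I y n" "qc I y' n'"
    "pr n' \<eta> = - pr n \<eta>'" "\<And>\<beta> u. u \<in> H \<beta> \<Longrightarrow> y * u \<in> I \<Longrightarrow> u \<in> I"
    "\<And>\<beta> u. u \<in> H \<beta> \<Longrightarrow> y' * u \<in> I' \<Longrightarrow> u \<in> I'"
    "\<And>\<beta> u. u \<in> H (\<beta> + \<eta>) \<Longrightarrow> u \<in> I' \<Longrightarrow> \<exists>s\<in>H \<beta>. u - y * s \<in> I"
  shows "step I I' y \<eta> n y' \<eta>' n'"
  unfolding step_def using assms by blast

text \<open>The coprime pairs used are \<open>x3\<close> with \<open>De\<close> in U,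
  \<open>x2\<close> with \<open>x5\<close> modulo \<open>J3\<close> in both orders,
  \<open>x1\<close> with \<open>w1\<close> modulo \<open>J32\<close>, and \<open>x6\<close> with
  \<open>w6\<close> modulo \<open>J35\<close>.\<close>

lemma step3: "step {0} J3 x3 (1,1,1) (-1,0,1) De (1,1,1) (1,0,-1)"
  by (rule stepI[OF hid0 hids(1) _ s3.y_in H_x3 H_De qc_x3 qc_De _ s3.reg[OF H_S, unfolded J_M0] De_reg
        s3.divide_H[OF crits(1) _ _ H_x3, unfolded J_M0]])
    (simp_all add: hidD(2)[OF hids(1)])

lemma step2: "step J3 J32 x2 (1,1,0) (-1,1,-1) x5 (0,1,1) (1,-1,1)"
  by (rule stepI[OF hids(1) hids(2) s2.sub s2.y_in H_x2 H_x5 qc_x2 qc_x5 _ s2.reg[OF H_S] s25.reg[OF H_S]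
        s2.divide_H[OF crits(2) _ _ H_x2]]) simp_all

lemma step1: "step J32 (J M321) x1 (1,0,0) (0,-1,0) w1 (0,1,1) (1,1,-1)"
  by (rule stepI[OF hids(2) hids(4) s1.sub s1.y_in H_x(1) H_w1 qc_x1 qc_w1 _ s1.reg[OF H_S] w1_reg[OF disjI2[OF refl] H_S]
        s1.divide_H[OF crits(3) _ _ H_x(1)]]) simp_all

lemma step5: "step J3 J35 x5 (0,1,1) (1,-1,1) x2 (1,1,0) (-1,1,-1)"
  by (rule stepI[OF hids(1) hids(3) s5.sub s5.y_in H_x5 H_x2 qc_x5 qc_x2 _ s5.reg[OF H_S] s52.reg[OF H_S]
        s5.divide_H[OF crits(2) _ _ H_x5]]) simp_all

lemma step6: "step J35 (J M356) x6 (0,0,1) (0,1,0) w6 (1,1,0) (1,-1,-1)"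
  by (rule stepI[OF hids(3) hids(5) s6.sub s6.y_in H_x(3) H_w6 qc_x6 qc_w6 _ s6.reg[OF H_S] w6_reg[OF H_S]
        s6.divide_H[OF crits(4) _ _ H_x(3)]]) simp_all

section \<open>Skew derivations\<close>

abbreviation qe :: "weight \<Rightarrow> weight \<Rightarrow> 'k" where "qe n \<delta> \<equiv> q powi pr n \<delta>"

text \<open>\<open>tder I t \<gamma> E\<close>: modulo the ideal \<open>I\<close>, the family \<open>E\<close> is a homogeneous skew derivation of
  weight \<open>\<gamma>\<close>, twisted by the automorphism scaling weight \<open>\<delta>\<close> by \<open>qe t \<delta>\<close>. The weight of the
  argument is passed explicitly.\<close>

definition tder :: "'k lin set \<Rightarrow> weight \<Rightarrow> weight \<Rightarrow> (weight \<Rightarrow> 'k lin \<Rightarrow> 'k lin) \<Rightarrow> bool" where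
  "tder I t \<gamma> E \<longleftrightarrow>
     (\<forall>\<delta>. \<forall>u\<in>H \<delta>. E \<delta> u \<in> H (\<delta> + \<gamma>)) \<and>
     (\<forall>\<delta>. \<forall>u\<in>H \<delta>. \<forall>v\<in>H \<delta>. E \<delta> (u + v) - (E \<delta> u + E \<delta> v) \<in> I) \<and>
     (\<forall>\<delta> c. \<forall>u\<in>H \<delta>. E \<delta> (sc c * u) - sc c * E \<delta> u \<in> I) \<and>
     (\<forall>\<delta> \<epsilon>. \<forall>u\<in>H \<delta>. \<forall>v\<in>H \<epsilon>. E (\<delta> + \<epsilon>) (u * v) - (E \<delta> u * v + sc (qe t \<delta>) * (u * E \<epsilon> v)) \<in> I) \<and>
     (\<forall>\<delta>. \<forall>u\<in>H \<delta>. u \<in> I \<longrightarrow> E \<delta> u \<in> I)"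

lemma tderD:
  assumes "tder I t \<gamma> E"
  shows "u \<in> H \<delta> \<Longrightarrow> E \<delta> u \<in> H (\<delta> + \<gamma>)"
    "u \<in> H \<delta> \<Longrightarrow> v \<in> H \<delta> \<Longrightarrow> E \<delta> (u + v) - (E \<delta> u + E \<delta> v) \<in> I"
    "u \<in> H \<delta> \<Longrightarrow> E \<delta> (sc c * u) - sc c * E \<delta> u \<in> I"
    "u \<in> H \<delta> \<Longrightarrow> v \<in> H \<epsilon> \<Longrightarrow> E (\<delta> + \<epsilon>) (u * v) - (E \<delta> u * v + sc (qe t \<delta>) * (u * E \<epsilon> v)) \<in> I"
    "u \<in> H \<delta> \<Longrightarrow> u \<in> I \<Longrightarrow> E \<delta> u \<in> I"
  using assms unfolding tder_def by blast+

lemma tderI: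
  assumes "\<And>\<delta> u. u \<in> H \<delta> \<Longrightarrow> E \<delta> u \<in> H (\<delta> + \<gamma>)"
    "\<And>\<delta> u v. u \<in> H \<delta> \<Longrightarrow> v \<in> H \<delta> \<Longrightarrow> E \<delta> (u + v) - (E \<delta> u + E \<delta> v) \<in> I"
    "\<And>\<delta> u c. u \<in> H \<delta> \<Longrightarrow> E \<delta> (sc c * u) - sc c * E \<delta> u \<in> I"
    "\<And>\<delta> \<epsilon> u v. u \<in> H \<delta> \<Longrightarrow> v \<in> H \<epsilon> \<Longrightarrow> E (\<delta> + \<epsilon>) (u * v) - (E \<delta> u * v + sc (qe t \<delta>) * (u * E \<epsilon> v)) \<in> I"
    "\<And>\<delta> u. u \<in> H \<delta> \<Longrightarrow> u \<in> I \<Longrightarrow> E \<delta> u \<in> I"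
  shows "tder I t \<gamma> E"
  using assms unfolding tder_def by blast

definition inn :: "weight \<Rightarrow> 'k lin \<Rightarrow> weight \<Rightarrow> 'k lin \<Rightarrow> 'k lin" where
  "inn t x \<delta> u = x * u - sc (qe t \<delta>) * (u * x)"

lemma inn_H: "x \<in> H \<gamma> \<Longrightarrow> u \<in> H \<delta> \<Longrightarrow> inn t x \<delta> u \<in> H (\<delta> + \<gamma>)"
  unfolding inn_def using H_mult'[of x \<gamma> u \<delta> "\<delta> + \<gamma>"] H_mult[of u \<delta> x \<gamma>]
  by (intro H_closed(2) H_closed(3)) (simp_all add: add.commute)

lemma inn_rules:
  "inn t x \<delta> (u + v) = inn t x \<delta> u + inn t x \<delta> v"
  "inn t x \<delta> (sc c * u) = sc c * inn t x \<delta> u"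
  "inn t x (\<delta> + \<epsilon>) (u * v) = inn t x \<delta> u * v + sc (qe t \<delta>) * (u * inn t x \<epsilon> v)"
  using q_nz by (simp_all add: inn_def ring_norm pr_add power_int_add mult.commute)

lemma inn_ideal: "hid I \<Longrightarrow> x \<in> S \<Longrightarrow> u \<in> I \<Longrightarrow> inn t x \<delta> u \<in> I"
  unfolding inn_def by (intro hidD(3) hidD(7) hidD(5) hidD(6))

lemma tder_minus_inn:
  assumes E: "tder I t \<gamma> E" and I: "hid I" and x: "x \<in> H \<gamma>"
  shows "tder I t \<gamma> (\<lambda>\<delta> u. E \<delta> u - inn t x \<delta> u)"
proof (rule tderI)
  fix \<delta> \<epsilon> u v c assume u: "u \<in> H \<delta>"
  show "E \<delta> u - inn t x \<delta> u \<in> H (\<delta> + \<gamma>)"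
    using tderD(1)[OF E u] inn_H[OF x u] by (rule H_closed)
  show "E \<delta> (sc c * u) - inn t x \<delta> (sc c * u) - sc c * (E \<delta> u - inn t x \<delta> u) \<in> I"
    using tderD(3)[OF E u, of c] by (simp add: inn_rules right_diff_distrib)
  show "u \<in> I \<Longrightarrow> E \<delta> u - inn t x \<delta> u \<in> I"
    by (intro hidD(3)[OF I] tderD(5)[OF E u] inn_ideal[OF I H_S[OF x]])
  show "v \<in> H \<delta> \<Longrightarrow> E \<delta> (u + v) - inn t x \<delta> (u + v) - (E \<delta> u - inn t x \<delta> u + (E \<delta> v - inn t x \<delta> v)) \<in> I"
    using tderD(2)[OF E u, of v] by (simp add: inn_rules algebra_simps)
  show "v \<in> H \<epsilon> \<Longrightarrow> E (\<delta> + \<epsilon>) (u * v) - inn t x (\<delta> + \<epsilon>) (u * v) -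
     ((E \<delta> u - inn t x \<delta> u) * v + sc (qe t \<delta>) * (u * (E \<epsilon> v - inn t x \<epsilon> v))) \<in> I"
    using tderD(4)[OF E u, of v \<epsilon>] by (simp add: inn_rules ring_norm add_diff_eq diff_diff_eq2 diff_diff_eq add.assoc add.commute add.left_commute)
qed

lemma hid_cong: "hid I \<Longrightarrow> u \<in> I \<Longrightarrow> v - u \<in> I \<Longrightarrow> v \<in> I"
  using hidD(4)[of I u "v - u"] by simp

text \<open>Apply \<open>E\<close> to the relation by which \<open>y\<close> passes
  \<open>u\<close>, then move \<open>y\<close> past \<open>E \<delta> u\<close>, whose weight is
  \<open>\<delta> + \<gamma>\<close>. The two scalars in front of \<open>y * E \<delta> u\<close>
  come from these two moves. If they differ, \<open>E\<close> is determined by its value on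
  \<open>y\<close>; if they agree, that value is itself normal.\<close>

lemma key1:
  assumes I: "hid I" and E: "tder I t \<gamma> E" and y: "y \<in> H \<eta>" "qc I y n" and u: "u \<in> H \<delta>"
  shows "E \<eta> y * u - sc (qe n \<delta> * qe t \<delta>) * (u * E \<eta> y)
     - sc (inverse (qe n \<gamma>) - qe t \<eta>) * (y * E \<delta> u) \<in> I"
proof -
  let ?a = "E \<eta> y" and ?e = "E \<delta> u" and ?\<epsilon> = "\<eta> + \<delta>"
  let ?w = "y * u - sc (qe n \<delta>) * (u * y)"
  define p1 where "p1 = E ?\<epsilon> (y * u) - (?a * u + sc (qe t \<eta>) * (y * ?e))"
  define p2 where "p2 = E ?\<epsilon> ?w"
  define p3 where "p3 = E ?\<epsilon> (?w + sc (qe n \<delta>) * (u * y)) - (E ?\<epsilon> ?w + E ?\<epsilon> (sc (qe n \<delta>) * (u * y)))"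
  define p4 where "p4 = E ?\<epsilon> (sc (qe n \<delta>) * (u * y)) - sc (qe n \<delta>) * E ?\<epsilon> (u * y)"
  define p5 where "p5 = E ?\<epsilon> (u * y) - (?e * y + sc (qe t \<delta>) * (u * ?a))"
  define p6 where "p6 = y * ?e - sc (qe n (\<delta> + \<gamma>)) * (?e * y)"
  have uy: "u * y \<in> H ?\<epsilon>" using H_mult[OF u y(1)] by (simp add: add.commute)
  have yu: "y * u \<in> H ?\<epsilon>" using H_mult[OF y(1) u] .
  have w: "?w \<in> H ?\<epsilon>" "?w \<in> I" using H_closed(2)[OF yu H_closed(3)[OF uy]] qcD[OF y(2) u] by blast+
  have p: "p1 \<in> I" "p2 \<in> I" "p3 \<in> I" "p4 \<in> I" "p6 \<in> I"
    unfolding p1_def p2_def p3_def p4_def p6_def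
    using tderD(4)[OF E y(1) u] tderD(5)[OF E w] tderD(2)[OF E w(1) H_closed(3)[OF uy]] tderD(3)[OF E uy]
      qcD[OF y(2) tderD(1)[OF E u]] by blast+
  have p5: "p5 \<in> I" unfolding p5_def using tderD(4)[OF E u y(1)] by (simp add: add.commute)
  have qq: "inverse (qe n \<gamma>) * qe n (\<delta> + \<gamma>) = qe n \<delta>" "qe n (\<delta> + \<gamma>) * inverse (qe n \<gamma>) = qe n \<delta>"
    "qe t \<delta> * qe n \<delta> = qe n \<delta> * qe t \<delta>"
    using q_nz by (simp_all add: pr_add power_int_add)
  have "E \<eta> y * u - sc (qe n \<delta> * qe t \<delta>) * (u * E \<eta> y)
     - sc (inverse (qe n \<gamma>) - qe t \<eta>) * (y * E \<delta> u) =
     - p1 + p3 + p2 + p4 + sc (qe n \<delta>) * p5 - sc (inverse (qe n \<gamma>)) * p6"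
    unfolding p1_def p2_def p3_def p4_def p5_def p6_def diff_add_cancel
    by (simp add: ring_norm qq)
  moreover have "\<dots> \<in> I"
    by (intro hidD(3,4,7,8)[OF I] p p5)
  ultimately show ?thesis by simp
qed

lemma stepD:
  assumes "step I I' y \<eta> n y' \<eta>' n'"
  shows "hid I" "hid I'" "I \<subseteq> I'" "y \<in> I'" "y \<in> H \<eta>" "y' \<in> H \<eta>'" "qc I y n" "qc I y' n'"
    "pr n' \<eta> = - pr n \<eta>'" "\<And>\<beta> u. u \<in> H \<beta> \<Longrightarrow> y * u \<in> I \<Longrightarrow> u \<in> I"
    "\<And>\<beta> u. u \<in> H \<beta> \<Longrightarrow> y' * u \<in> I' \<Longrightarrow> u \<in> I'"
    "\<And>\<beta> u. u \<in> H (\<beta> + \<eta>) \<Longrightarrow> u \<in> I' \<Longrightarrow> \<exists>s\<in>H \<beta>. u - y * s \<in> I"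
  using assms unfolding step_def by blast+

lemma hid_sc: "hid I \<Longrightarrow> sc c * u \<in> I \<Longrightarrow> c \<noteq> 0 \<Longrightarrow> u \<in> I"
proof -
  assume "hid I" "sc c * u \<in> I" "c \<noteq> 0"
  then have "sc (inverse c) * (sc c * u) \<in> I" using hidD(7) by blast
  then show ?thesis using \<open>c \<noteq> 0\<close> by (simp add: sc_merge sc_simps(2))
qed

text \<open>If \<open>E\<close> were extended to the localization at \<open>y\<close>, then \<open>E\<close> would be inner, implemented by a
  multiple of \<open>y\<^sup>-\<^sup>1 (E y)\<close>; the same holds for \<open>y'\<close>, and comparing the two expressions shows that \<open>y\<close>
  divides \<open>E y\<close>.\<close>

lemma inner_mod:
  assumes st: "step I I' y \<eta> n y' \<eta>' n'" and E: "tder I t \<gamma> E"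
    and ne: "- pr n \<gamma> \<noteq> pr t \<eta>" and ne': "- pr n' \<gamma> \<noteq> pr t \<eta>'"
  obtains x where "x \<in> H \<gamma>" "\<And>\<delta> u. u \<in> H \<delta> \<Longrightarrow> E \<delta> u - inn t x \<delta> u \<in> I"
proof -
  note I = stepD(1)[OF st] and I' = stepD(2)[OF st] and y = stepD(5)[OF st] and y' = stepD(6)[OF st]
  let ?a = "E \<eta> y" and ?b = "E \<eta>' y'"
  define k where "k = inverse (qe n \<gamma>) - qe t \<eta>"
  define k' where "k' = inverse (qe n' \<gamma>) - qe t \<eta>'"
  have inv: "inverse (qe m \<gamma>) = q powi (- pr m \<gamma>)" for m by (simp add: power_int_minus)
  have k: "k \<noteq> 0" "k' \<noteq> 0" using ne ne' unfolding k_def k'_def inv by simp_all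
  have a: "?a \<in> H (\<gamma> + \<eta>)" using tderD(1)[OF E y] by (simp add: add.commute)
  define r1 where "r1 = ?a * y' - sc (qe n \<eta>' * qe t \<eta>') * (y' * ?a) - sc k * (y * ?b)"
  define r2 where "r2 = y' * ?a - sc (qe n' (\<gamma> + \<eta>)) * (?a * y')"
  have r: "r1 \<in> I" "r2 \<in> I"
    unfolding r1_def r2_def k_def using key1[OF I E y stepD(7)[OF st] y'] qcD[OF stepD(8)[OF st] a] by blast+
  have yb: "y * ?b \<in> I'" by (rule hidD(6)[OF I' H_S[OF tderD(1)[OF E y']] stepD(4)[OF st]])
  have n': "qe n' (\<gamma> + \<eta>) = qe n' \<gamma> * qe n' \<eta>" using q_nz by (simp add: pr_add power_int_add)
  have n: "qe n \<eta>' = inverse (qe n' \<eta>)" by (simp add: stepD(9)[OF st] power_int_minus)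
  have cancel: "qe m \<delta> * (inverse (qe m \<delta>) * c) = c" "inverse (qe m \<delta>) * (qe m \<delta> * c) = c"
    "qe m \<delta> * (c * inverse (qe m \<delta>)) = c" "inverse (qe m \<delta>) * (c * qe m \<delta>) = c" for m \<delta> c
    using q_nz by (simp_all add: field_simps)
  \<comment> \<open>Eliminates \<open>?a * y'\<close> from \<open>r1\<close> and \<open>r2\<close>.
    The condition \<open>pr n' \<eta> = - pr n \<eta>'\<close> turns the remaining coefficient of
    \<open>y' * ?a\<close> into \<open>k'\<close>, and all other terms lie in
    \<open>I'\<close>.\<close>
  have "sc k' * (y' * ?a) = sc (qe n' \<eta>) * (sc k * (y * ?b)) + sc (qe n' \<eta>) * r1 + sc (inverse (qe n' \<gamma>)) * r2"
    unfolding r1_def r2_def n n' k'_def by (simp add: ring_norm cancel)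
  moreover have "\<dots> \<in> I'"
    using r stepD(3)[OF st] by (intro hidD(4)[OF I'] hidD(7)[OF I'] yb) blast+
  ultimately have "sc k' * (y' * ?a) \<in> I'" by simp
  then have "y' * ?a \<in> I'" by (rule hid_sc[OF I']) (rule k)
  then have "?a \<in> I'" by (rule stepD(11)[OF st a])
  then obtain s where s: "s \<in> H \<gamma>" "?a - y * s \<in> I" using stepD(12)[OF st a] by blast
  \<comment> \<open>By \<open>key1\<close>, \<open>k\<close> times \<open>y * E \<delta> u\<close>
    is the twisted commutator of \<open>?a\<close> with \<open>u\<close>. Replacing
    \<open>?a\<close> by \<open>y * s\<close> and cancelling \<open>y\<close> leaves
    \<open>s\<close>, divided by \<open>k\<close>, as the implementing element.\<close>
  define x where "x = sc (inverse k) * s"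
  have x: "x \<in> H \<gamma>" unfolding x_def by (rule H_closed(3)[OF s(1)])
  have "E \<delta> u - inn t x \<delta> u \<in> I" if u: "u \<in> H \<delta>" for \<delta> u
  proof -
    define p1 where "p1 = ?a * u - sc (qe n \<delta> * qe t \<delta>) * (u * ?a) - sc k * (y * E \<delta> u)"
    define p2 where "p2 = ?a - y * s"
    define p3 where "p3 = y * u - sc (qe n \<delta>) * (u * y)"
    have p: "p1 \<in> I" "p2 \<in> I" "p3 \<in> I"
      unfolding p1_def p2_def p3_def k_def using key1[OF I E y stepD(7)[OF st] u] s(2) qcD[OF stepD(7)[OF st] u] by blast+
    have "y * (E \<delta> u - inn t x \<delta> u) = - (sc (inverse k) * p1) + sc (inverse k) * (p2 * u)
        - sc (inverse k * (qe n \<delta> * qe t \<delta>)) * (u * p2) + sc (inverse k * qe t \<delta>) * (p3 * s)"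
      unfolding p1_def p2_def p3_def inn_def x_def using k by (simp add: ring_norm mult_ac)
    moreover have "\<dots> \<in> I"
      by (intro hidD(3,4,8,7)[OF I] hidD(5,6)[OF I] p H_S[OF u] H_S[OF s(1)])
    ultimately have "y * (E \<delta> u - inn t x \<delta> u) \<in> I" by simp
    then show ?thesis using stepD(10)[OF st H_closed(2)[OF tderD(1)[OF E u] inn_H[OF x u]]] by blast
  qed
  then show ?thesis using that x by blast
qed

text \<open>In the Leibniz rule \<open>y\<close> has to be moved to the left of \<open>u\<close>,
  which costs \<open>qe n \<delta>\<close>. This is why the quotient is twisted by
  \<open>t - n\<close>.\<close>

lemma divide_tder:
  assumes st: "step I I' y \<eta> n y' \<eta>' n'" and E: "tder I t \<gamma> E"
    and div: "\<And>\<delta> u. u \<in> H \<delta> \<Longrightarrow> E \<delta> u \<in> I'"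
  obtains F where "tder I (t - n) (\<gamma> - \<eta>) F" "\<And>\<delta> u. u \<in> H \<delta> \<Longrightarrow> E \<delta> u - y * F \<delta> u \<in> I"
proof -
  note I = stepD(1)[OF st] and y = stepD(5)[OF st] and reg = stepD(10)[OF st]
  have "\<exists>s\<in>H (\<delta> + (\<gamma> - \<eta>)). E \<delta> u - y * s \<in> I" if u: "u \<in> H \<delta>" for \<delta> u
    using stepD(12)[OF st, of "E \<delta> u" "\<delta> + (\<gamma> - \<eta>)"] tderD(1)[OF E u] div[OF u] by (simp add: algebra_simps)
  then have ex: "\<exists>s. s \<in> H (\<delta> + (\<gamma> - \<eta>)) \<and> E \<delta> u - y * s \<in> I" if "u \<in> H \<delta>" for \<delta> u
    using that by blast
  \<comment> \<open>The quotient is unique modulo \<open>I\<close> because \<open>y\<close> is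
    regular there. Each law for \<open>F\<close> is therefore proved after multiplication by
    \<open>y\<close>, where it is a law for \<open>E\<close>.\<close>
  define F where "F \<delta> u = (SOME s. s \<in> H (\<delta> + (\<gamma> - \<eta>)) \<and> E \<delta> u - y * s \<in> I)" for \<delta> u
  have F: "F \<delta> u \<in> H (\<delta> + (\<gamma> - \<eta>)) \<and> E \<delta> u - y * F \<delta> u \<in> I" if "u \<in> H \<delta>" for \<delta> u
    unfolding F_def using someI_ex[OF ex[OF that]] .
  have "tder I (t - n) (\<gamma> - \<eta>) F"
  proof (rule tderI)
    fix \<delta> \<epsilon> u v c assume u: "u \<in> H \<delta>"
    note Fu = F[OF u, THEN conjunct1] and eu = F[OF u, THEN conjunct2]
    show "F \<delta> u \<in> H (\<delta> + (\<gamma> - \<eta>))" by (rule Fu)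
    define eu' where "eu' = E \<delta> u - y * F \<delta> u"
    have eu': "eu' \<in> I" using eu by (simp add: eu'_def)
    show "F \<delta> (sc c * u) - sc c * F \<delta> u \<in> I"
    proof (rule reg)
      have cu: "sc c * u \<in> H \<delta>" by (rule H_closed(3)[OF u])
      define ec where "ec = E \<delta> (sc c * u) - y * F \<delta> (sc c * u)"
      define p where "p = E \<delta> (sc c * u) - sc c * E \<delta> u"
      have *: "ec \<in> I" "p \<in> I" unfolding ec_def p_def using F[OF cu] tderD(3)[OF E u] by blast+
      have "y * (F \<delta> (sc c * u) - sc c * F \<delta> u) = - ec + p + sc c * eu'"
        unfolding ec_def p_def eu'_def by (simp add: ring_norm)
      then show "y * (F \<delta> (sc c * u) - sc c * F \<delta> u) \<in> I"
        using hidD(4)[OF I hidD(4)[OF I hidD(8)[OF I *(1)] *(2)] hidD(7)[OF I eu']] by simp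
      show "F \<delta> (sc c * u) - sc c * F \<delta> u \<in> H (\<delta> + (\<gamma> - \<eta>))"
        using F[OF cu] Fu by (intro H_closed) blast+
    qed
    show "u \<in> I \<Longrightarrow> F \<delta> u \<in> I"
    proof (rule reg[OF Fu])
      assume "u \<in> I"
      then have "E \<delta> u - eu' \<in> I" by (intro hidD(3)[OF I] tderD(5)[OF E u] eu')
      then show "y * F \<delta> u \<in> I" by (simp add: eu'_def)
    qed
    show "F \<delta> (u + v) - (F \<delta> u + F \<delta> v) \<in> I" if v: "v \<in> H \<delta>"
    proof (rule reg)
      have uv: "u + v \<in> H \<delta>" by (rule H_closed(1)[OF u v])
      define ec where "ec = E \<delta> (u + v) - y * F \<delta> (u + v)"
      define ev' where "ev' = E \<delta> v - y * F \<delta> v"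
      define p where "p = E \<delta> (u + v) - (E \<delta> u + E \<delta> v)"
      have *: "ec \<in> I" "p \<in> I" "ev' \<in> I"
        unfolding ec_def p_def ev'_def using F[OF uv] F[OF v] tderD(2)[OF E u v] by blast+
      have "y * (F \<delta> (u + v) - (F \<delta> u + F \<delta> v)) = - ec + p + eu' + ev'"
        unfolding ec_def p_def eu'_def ev'_def by (simp add: ring_norm)
      moreover have "- ec + p + eu' + ev' \<in> I" by (intro hidD(4,8)[OF I] * eu')
      ultimately show "y * (F \<delta> (u + v) - (F \<delta> u + F \<delta> v)) \<in> I" by simp
      show "F \<delta> (u + v) - (F \<delta> u + F \<delta> v) \<in> H (\<delta> + (\<gamma> - \<eta>))"
        using F[OF uv] F[OF v] Fu by (intro H_closed) blast+
    qed
    show "F (\<delta> + \<epsilon>) (u * v) - (F \<delta> u * v + sc (qe (t - n) \<delta>) * (u * F \<epsilon> v)) \<in> I" if v: "v \<in> H \<epsilon>"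
    proof (rule reg)
      have uv: "u * v \<in> H (\<delta> + \<epsilon>)" by (rule H_mult[OF u v])
      define ec where "ec = E (\<delta> + \<epsilon>) (u * v) - y * F (\<delta> + \<epsilon>) (u * v)"
      define ev' where "ev' = E \<epsilon> v - y * F \<epsilon> v"
      define p where "p = E (\<delta> + \<epsilon>) (u * v) - (E \<delta> u * v + sc (qe t \<delta>) * (u * E \<epsilon> v))"
      define p3 where "p3 = y * u - sc (qe n \<delta>) * (u * y)"
      have *: "ec \<in> I" "p \<in> I" "ev' \<in> I" "p3 \<in> I"
        unfolding ec_def p_def ev'_def p3_def
        using F[OF uv] F[OF v] tderD(4)[OF E u v] qcD[OF stepD(7)[OF st] u] by blast+
      have qq: "qe (t - n) \<delta> * qe n \<delta> = qe t \<delta>" "qe n \<delta> * qe (t - n) \<delta> = qe t \<delta>"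
        using q_nz by (simp_all add: pr_add power_int_diff)
      have "y * (F (\<delta> + \<epsilon>) (u * v) - (F \<delta> u * v + sc (qe (t - n) \<delta>) * (u * F \<epsilon> v)))
          = - ec + p + eu' * v + sc (qe t \<delta>) * (u * ev') - sc (qe (t - n) \<delta>) * (p3 * F \<epsilon> v)"
        unfolding ec_def p_def eu'_def ev'_def p3_def by (simp add: ring_norm qq)
      moreover have "\<dots> \<in> I"
        by (intro hidD(3,4,8,7)[OF I] hidD(5,6)[OF I] * eu' H_S[OF u] H_S[OF v]
            H_S[OF F[OF v, THEN conjunct1]])
      ultimately show "y * (F (\<delta> + \<epsilon>) (u * v) - (F \<delta> u * v + sc (qe (t - n) \<delta>) * (u * F \<epsilon> v))) \<in> I" by simp
      have "u * F \<epsilon> v \<in> H (\<delta> + \<epsilon> + (\<gamma> - \<eta>))"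
        by (rule H_mult'[OF u F[OF v, THEN conjunct1]]) (simp add: add.assoc)
      moreover have "F \<delta> u * v \<in> H (\<delta> + \<epsilon> + (\<gamma> - \<eta>))"
        by (rule H_mult'[OF Fu v]) (simp add: add_ac)
      ultimately show "F (\<delta> + \<epsilon>) (u * v) - (F \<delta> u * v + sc (qe (t - n) \<delta>) * (u * F \<epsilon> v)) \<in> H (\<delta> + \<epsilon> + (\<gamma> - \<eta>))"
        using F[OF uv] by (intro H_closed) blast+
    qed
  qed
  then show ?thesis using that F by blast
qed

text \<open>Since \<open>I'\<close> is \<open>I\<close> together with the multiples of
  \<open>y\<close>, the Leibniz rule reduces stability of \<open>I'\<close> under \<open>E\<close>
  to the value on \<open>y\<close>.\<close>

lemma tder_mono:
  assumes st: "step I I' y \<eta> n y' \<eta>' n'" and E: "tder I t \<gamma> E" and Ey: "E \<eta> y \<in> I'"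
  shows "tder I' t \<gamma> E"
proof (rule tderI)
  fix \<delta> \<epsilon> u v c assume u: "u \<in> H \<delta>"
  note I = stepD(1)[OF st] and y = stepD(5)[OF st] and I' = stepD(2)[OF st]
  show "E \<delta> u \<in> H (\<delta> + \<gamma>)" by (rule tderD(1)[OF E u])
  show "v \<in> H \<delta> \<Longrightarrow> E \<delta> (u + v) - (E \<delta> u + E \<delta> v) \<in> I'" "E \<delta> (sc c * u) - sc c * E \<delta> u \<in> I'"
    "v \<in> H \<epsilon> \<Longrightarrow> E (\<delta> + \<epsilon>) (u * v) - (E \<delta> u * v + sc (qe t \<delta>) * (u * E \<epsilon> v)) \<in> I'"
    using tderD(2-4)[OF E u] stepD(3)[OF st] by blast+
  assume "u \<in> I'"
  then obtain s where s: "s \<in> H (\<delta> - \<eta>)" "u - y * s \<in> I"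
    using stepD(12)[OF st, of u "\<delta> - \<eta>"] u by auto
  have ys: "y * s \<in> H \<delta>" by (rule H_mult'[OF y s(1)]) simp
  have us: "u - y * s \<in> H \<delta>" by (rule H_closed(2)[OF u ys])
  have 1: "E \<delta> (y * s) - (E \<eta> y * s + sc (qe t \<eta>) * (y * E (\<delta> - \<eta>) s)) \<in> I"
    using tderD(4)[OF E y s(1)] by simp
  have "E \<eta> y * s + sc (qe t \<eta>) * (y * E (\<delta> - \<eta>) s) \<in> I'"
    using stepD(4)[OF st] H_S[OF s(1)] H_S[OF tderD(1)[OF E s(1)]] Ey
    by (intro hidD(4)[OF I'] hidD(7)[OF I'] hidD(6)[OF I'])
  then have 2: "E \<delta> (y * s) \<in> I'" using hid_cong[OF I'] 1 stepD(3)[OF st] by blast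
  have 3: "E \<delta> (u - y * s) \<in> I'" using tderD(5)[OF E us s(2)] stepD(3)[OF st] by blast
  have "E \<delta> ((u - y * s) + y * s) - (E \<delta> (u - y * s) + E \<delta> (y * s)) \<in> I'"
    using tderD(2)[OF E us ys] stepD(3)[OF st] by blast
  then show "E \<delta> u \<in> I'" using hid_cong[OF I' hidD(4)[OF I' 3 2]] by simp
qed

lemma tder_value: "step I I' y \<eta> n y' \<eta>' n' \<Longrightarrow> tder I t \<gamma> F \<Longrightarrow> u \<in> H \<delta> \<Longrightarrow> E - y * F \<delta> u \<in> I \<Longrightarrow> E \<in> I \<Longrightarrow> F \<delta> u \<in> I"
proof -
  assume st: "step I I' y \<eta> n y' \<eta>' n'" and F: "tder I t \<gamma> F" and u: "u \<in> H \<delta>" and e: "E - y * F \<delta> u \<in> I" "E \<in> I"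
  have "E - (E - y * F \<delta> u) \<in> I" by (rule hidD(3)[OF stepD(1)[OF st] e(2) e(1)])
  then show ?thesis using stepD(10)[OF st tderD(1)[OF F u]] by simp
qed

lemma tder_one: "hid I \<Longrightarrow> tder I t \<gamma> E \<Longrightarrow> E 0 (sc c) \<in> I"
proof -
  assume I: "hid I" and E: "tder I t \<gamma> E"
  have "E (0 + 0) (1 * 1) - (E 0 1 * 1 + sc (qe t 0) * (1 * E 0 1)) \<in> I"
    by (rule tderD(4)[OF E H_closed(6) H_closed(6)])
  then have "- E 0 1 \<in> I" by (simp add: pr_add sc_simps(2))
  from hidD(8)[OF I this] have "sc c * E 0 1 \<in> I" by (intro hidD(7)[OF I]) simp
  moreover have "E 0 (sc c) - sc c * E 0 1 \<in> I" using tderD(3)[OF E H_closed(6), of c] by simp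
  ultimately show ?thesis by (rule hid_cong[OF I])
qed

lemma tder_gens:
  assumes I: "hid I" and E: "tder I t \<gamma> E" and g: "\<And>l. E (aw l) (gen l) \<in> I" and u: "u \<in> H \<delta>"
  shows "E \<delta> u \<in> I"
  using u
proof (induction rule: H_induct)
  case (zero \<delta>)
  then show ?case using tderD(5)[OF E H_closed(4) hidD(2)[OF I]] .
next
  case (sc c)
  then show ?case by (rule tder_one[OF I E])
next
  case (add \<delta> u v)
  show ?case by (rule hid_cong[OF I hidD(4)[OF I add(3,4)] tderD(2)[OF E add(1,2)]])
next
  case (scale \<delta> u c)
  show ?case by (rule hid_cong[OF I hidD(7)[OF I scale(2)] tderD(3)[OF E scale(1)]])
next
  case (gen \<delta> u l)
  have "E (aw l) (gen l) * u + sc (qe t (aw l)) * (gen l * E \<delta> u) \<in> I"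
    by (intro hidD(4)[OF I] hidD(7)[OF I] hidD(5)[OF I S_closed(13)] hidD(6)[OF I H_S[OF gen(1)]] g gen(2))
  then show ?case by (rule hid_cong[OF I]) (rule tderD(4)[OF E H_gen gen(1)])
qed

section \<open>Central elements\<close>

lemma qc_mono: "qc I y n \<Longrightarrow> I \<subseteq> I' \<Longrightarrow> qc I' y n"
  unfolding qc_def by blast

lemma zero_sub: "hid I \<Longrightarrow> {0} \<subseteq> I" using hidD(2) by blast

text \<open>Commuting \<open>y\<close> past \<open>b\<close> by the character of \<open>y\<close>,
  and back by that of \<open>b\<close>, multiplies the product by a scalar different from 1.\<close>

lemma qc_clash:
  assumes I: "hid I" and y: "y \<in> H \<eta>" "qc I y n" and b: "b \<in> H \<beta>" "qc I b m" and ne: "pr n \<beta> \<noteq> - pr m \<eta>"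
  shows "y * b \<in> I"
proof -
  define p1 where "p1 = y * b - sc (qe n \<beta>) * (b * y)"
  define p2 where "p2 = b * y - sc (qe m \<eta>) * (y * b)"
  have p: "p1 \<in> I" "p2 \<in> I" unfolding p1_def p2_def using qcD[OF y(2) b(1)] qcD[OF b(2) y(1)] by blast+
  have "sc (1 - qe n \<beta> * qe m \<eta>) * (y * b) = p1 + sc (qe n \<beta>) * p2"
    unfolding p1_def p2_def by (simp add: ring_norm mult_ac)
  moreover have "\<dots> \<in> I" by (intro hidD(4,7)[OF I] p)
  moreover have "qe n \<beta> * qe m \<eta> = q powi (pr n \<beta> + pr m \<eta>)" using q_nz by (simp add: power_int_add)
  then have "1 - qe n \<beta> * qe m \<eta> \<noteq> 0" using ne powi_eq_1[of "pr n \<beta> + pr m \<eta>"] by auto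
  ultimately show ?thesis using hid_sc[OF I] by metis
qed

lemma qc_divide:
  assumes st: "step I I' y \<eta> n y' \<eta>' n'" and b: "qc I b m" "b - y * s \<in> I" and s: "s \<in> H \<sigma>"
  shows "qc I s (m - n)"
  unfolding qc_def
proof (intro allI ballI)
  fix \<delta> u assume u: "u \<in> H \<delta>"
  note I = stepD(1)[OF st]
  define p0 where "p0 = b - y * s"
  define p1 where "p1 = b * u - sc (qe m \<delta>) * (u * b)"
  define p2 where "p2 = y * u - sc (qe n \<delta>) * (u * y)"
  have p: "p0 \<in> I" "p1 \<in> I" "p2 \<in> I" unfolding p0_def p1_def p2_def
    using b(2) qcD[OF b(1) u] qcD[OF stepD(7)[OF st] u] by blast+
  have qq: "qe (m - n) \<delta> * qe n \<delta> = qe m \<delta>" "qe n \<delta> * qe (m - n) \<delta> = qe m \<delta>"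
    using q_nz by (simp_all add: pr_add power_int_diff)
  have "y * (s * u - sc (qe (m - n) \<delta>) * (u * s)) = p1 - p0 * u + sc (qe m \<delta>) * (u * p0) - sc (qe (m - n) \<delta>) * (p2 * s)"
    unfolding p0_def p1_def p2_def by (simp add: ring_norm qq)
  moreover have "\<dots> \<in> I"
    by (intro hidD(3,4,7)[OF I] hidD(5,6)[OF I] p H_S[OF u] H_S[OF s])
  ultimately have 1: "y * (s * u - sc (qe (m - n) \<delta>) * (u * s)) \<in> I" by simp
  have "s * u - sc (qe (m - n) \<delta>) * (u * s) \<in> H (\<sigma> + \<delta>)"
    using H_mult[OF s u] H_mult'[OF u s, of "\<sigma> + \<delta>"] by (intro H_closed(2) H_closed(3)) (simp_all add: add.commute)
  then show "s * u - sc (qe (m - n) \<delta>) * (u * s) \<in> I" using stepD(10)[OF st] 1 by blast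
qed

lemma qc_flip: "qc {0} b m \<Longrightarrow> b \<in> S \<Longrightarrow> qc {0} (flip b) (flipw m)"
  unfolding qc_def
proof (intro allI ballI)
  fix \<delta> u assume *: "\<forall>\<delta>. \<forall>u\<in>H \<delta>. b * u - sc (qe m \<delta>) * (u * b) \<in> {0}" and b: "b \<in> S" and u: "u \<in> H \<delta>"
  have "b * flip u - sc (qe m (flipw \<delta>)) * (flip u * b) \<in> {0}" using * flip_H[OF u] by blast
  then have "b * flip u = sc (qe m (flipw \<delta>)) * (flip u * b)" by simp
  from arg_cong[OF this, of flip] have "flip b * u = sc (qe m (flipw \<delta>)) * (u * flip b)"
    using b u by (simp add: flip_simps flip_sc flip_flip S_closed flip_S H_S)
  then show "flip b * u - sc (qe (flipw m) \<delta>) * (u * flip b) \<in> {0}"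
    using flipw_add(4)[of m "flipw \<delta>"] by (simp add: flipw_add)
qed

lemma div_x3:
  assumes b: "b \<in> H (a,c,a')" "qc {0} b m" "b \<in> J3"
  obtains s where "s \<in> H (a - 1, c - 1, a' - 1)" "b = x3 * s" "qc {0} s (m - (-1,0,1))"
proof -
  have "b \<in> H ((a - 1, c - 1, a' - 1) + (1,1,1))" using b(1) by simp
  then obtain s where s: "s \<in> H (a - 1, c - 1, a' - 1)" "b - x3 * s \<in> {0}"
    using stepD(12)[OF step3] b(3) by blast
  then show ?thesis using that[OF s(1)] qc_divide[OF step3 b(2) s(2) s(1)] by simp
qed

text \<open>\<open>x2\<close> is normal and regular modulo \<open>J3\<close>, so an element whose
  character is incompatible with that of \<open>x2\<close> must vanish there. The next lemmas use
  \<open>x1\<close> modulo \<open>J32\<close> and \<open>x6\<close> modulo \<open>J35\<close> in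
  this way, and then divide by \<open>x2\<close> or \<open>x5\<close>.\<close>

lemma J3_clash:
  assumes b: "b \<in> H (a,c,a')" "qc J3 b (i,j,k)" and "c - a - a' \<noteq> - (i + j)"
  shows "b \<in> J3"
proof -
  have "x2 * b \<in> J3"
    by (rule qc_clash[OF hids(1) H_x2 qc_x2 b]) (use assms(3) in simp)
  then show ?thesis by (rule stepD(10)[OF step2 b(1)])
qed

lemma J3_clash0: "b \<in> H (a,c,a') \<Longrightarrow> qc {0} b (i,j,k) \<Longrightarrow> c - a - a' \<noteq> - (i + j) \<Longrightarrow> b \<in> J3"
  using J3_clash qc_mono[OF _ zero_sub[OF hids(1)]] by blast

lemma J32_clash:
  assumes b: "b \<in> H (a,c,a')" "qc J3 b (i,j,k)" and ne: "c \<noteq> i"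
  obtains s where "s \<in> H (a - 1,c - 1,a')" "b - x2 * s \<in> J3" "qc J3 s (i + 1, j - 1, k + 1)"
proof -
  have "x1 * b \<in> J32"
    by (rule qc_clash[OF hids(2) H_x(1) qc_x1 b(1) qc_mono[OF b(2) stepD(3)[OF step2]]]) (use ne in simp)
  then have "b \<in> J32" by (rule stepD(10)[OF step1 b(1)])
  moreover have "b \<in> H ((a - 1,c - 1,a') + (1,1,0))" using b(1) by simp
  ultimately obtain s where s: "s \<in> H (a - 1,c - 1,a')" "b - x2 * s \<in> J3"
    using stepD(12)[OF step2] by blast
  then show ?thesis using that[OF s] qc_divide[OF step2 b(2) s(2) s(1)] by simp
qed

lemma J35_clash:
  assumes b: "b \<in> H (a,c,a')" "qc J3 b (i,j,k)" and ne: "c \<noteq> - k"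
  obtains s where "s \<in> H (a,c - 1,a' - 1)" "b - x5 * s \<in> J3" "qc J3 s (i - 1, j + 1, k - 1)"
proof -
  have "x6 * b \<in> J35"
    by (rule qc_clash[OF hids(3) H_x(3) qc_x6 b(1) qc_mono[OF b(2) stepD(3)[OF step5]]]) (use ne in simp)
  then have "b \<in> J35" by (rule stepD(10)[OF step6 b(1)])
  moreover have "b \<in> H ((a,c - 1,a' - 1) + (0,1,1))" using b(1) by simp
  ultimately obtain s where s: "s \<in> H (a,c - 1,a' - 1)" "b - x5 * s \<in> J3"
    using stepD(12)[OF step5] by blast
  then show ?thesis using that[OF s] qc_divide[OF step5 b(2) s(2) s(1)] by simp
qed

text \<open>The parameters follow repeated division by \<open>x2\<close> of an element of weight
  \<open>(A,2A+1,A)\<close> with the character of \<open>x3\<close>, which is the case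
  \<open>k = A + 1\<close>. Each division lowers \<open>k\<close> by one, and the clash with
  \<open>x1\<close> persists as long as \<open>k\<close> is positive. At \<open>k = 0\<close> the
  weight is negative.\<close>

lemma like_x3_aux: "b \<in> H (int k - 1, A + int k, A) \<Longrightarrow> qc J3 b (A - int k, int k - A - 1, A + 2 - int k) \<Longrightarrow> b \<in> J3"
proof (induction k arbitrary: b)
  case 0
  then have "b = 0" using H_neg by force
  then show ?case using hidD(2)[OF hids(1)] by simp
next
  case (Suc k)
  obtain s where s: "s \<in> H (int (Suc k) - 1 - 1, A + int (Suc k) - 1, A)" "b - x2 * s \<in> J3"
     "qc J3 s (A - int (Suc k) + 1, int (Suc k) - A - 1 - 1, A + 2 - int (Suc k) + 1)"
    by (rule J32_clash[OF Suc.prems]) auto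
  then have "s \<in> J3" by (intro Suc.IH) (simp_all add: algebra_simps)
  then have "x2 * s \<in> J3" by (rule hidD(5)[OF hids(1) S_closed(8)])
  then show ?case using hid_cong[OF hids(1) _ s(2)] by blast
qed

text \<open>Meant for the value of a derivation on \<open>x3\<close>. Outside the weights with
  \<open>B = 2 * A + 1\<close> the relation with \<open>x2\<close> already clashes.\<close>

lemma like_x3:
  assumes b: "b \<in> H (A,B,A)" "qc {0} b (-1,0,1)"
  shows "b \<in> J3"
proof (cases "B = 2 * A + 1 \<and> 0 \<le> A")
  case True
  then show ?thesis
    using like_x3_aux[of b "nat (A + 1)" A] b qc_mono[OF b(2) zero_sub[OF hids(1)]] by (simp add: algebra_simps)
next
  case False
  show ?thesis
  proof (cases "0 \<le> A")
    case True
    then show ?thesis using False by (intro J3_clash0[OF b]) auto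
  next
    case False
    then have "b = 0" using H_neg[OF b(1)] by simp
    then show ?thesis using hidD(2)[OF hids(1)] by simp
  qed
qed

lemma qc_0D:
  assumes b: "qc {0} b (0,0,0)" and u: "u \<in> S"
  shows "b * u = u * b"
  using u
proof (induction u rule: hom_induct)
  case (hom \<gamma> u)
  then show ?case using qcD[OF b, of u \<gamma>] by (cases \<gamma>) (simp add: sc_simps(2))
qed (simp add: distrib_left distrib_right)

lemma qc_0I: "(\<And>u. u \<in> S \<Longrightarrow> b * u = u * b) \<Longrightarrow> qc {0} b (0,0,0)"
  unfolding qc_def using H_S by (simp add: sc_simps(2) pr_def split_beta)

lemma z_comm: "u \<in> S \<Longrightarrow> z * u = u * z" by (rule qc_0D[OF qc_z])

lemma z_pow_comm: "u \<in> S \<Longrightarrow> z ^ n * u = u * z ^ n"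
proof (induction n)
  case (Suc n)
  have "z ^ Suc n * u = z * (z ^ n * u)" by (simp add: mult.assoc)
  also have "\<dots> = (z * u) * z ^ n" using Suc by (simp add: mult.assoc)
  also have "\<dots> = u * z ^ Suc n" using z_comm[OF Suc.prems] by (simp add: mult.assoc)
  finally show ?case .
qed simp

lemma H_z_pow: "z ^ n \<in> H (int n, 2 * int n, int n)"
proof (induction n)
  case 0
  show ?case using H_closed(6) by (simp add: zero_prod_def)
next
  case (Suc n)
  show ?case using H_mult'[OF H_z Suc, of "(int (Suc n), 2 * int (Suc n), int (Suc n))"] by (simp add: algebra_simps)
qed

lemma z_mod: "z - x2 * x5 \<in> J3"
proof -
  have "z - x2 * x5 = sc (- q) * (x3 * x4)" by (simp add: z_def ring_norm)
  then show ?thesis using hidD(7)[OF hids(1) hidD(6)[OF hids(1) S_closed(10) s3.y_in]] by metis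
qed

text \<open>Clashes with \<open>x1\<close> and \<open>x6\<close> split off a factor
  \<open>x2\<close> and then a factor \<open>x5\<close>, and \<open>z\<close> is congruent to
  \<open>x2 * x5\<close> modulo \<open>J3\<close>.\<close>

lemma central_mod: "\<mu> \<in> H (int n, 2 * int n, int n) \<Longrightarrow> qc J3 \<mu> (0,0,0) \<Longrightarrow> \<exists>\<beta>. \<mu> - sc \<beta> * z ^ n \<in> J3"
proof (induction n arbitrary: \<mu>)
  case 0
  then obtain c where "\<mu> = sc c" using H_zero_scalar[of \<mu>] by (auto simp: zero_prod_def)
  then show ?case using hidD(2)[OF hids(1)] by (intro exI[of _ c]) simp
next
  case (Suc n)
  let ?N = "int (Suc n)"
  obtain s where s: "s \<in> H (?N - 1, 2 * ?N - 1, ?N)" "\<mu> - x2 * s \<in> J3" "qc J3 s (0 + 1, 0 - 1, 0 + 1)"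
    by (rule J32_clash[OF Suc.prems]) auto
  obtain r where r: "r \<in> H (?N - 1, 2 * ?N - 1 - 1, ?N - 1)" "s - x5 * r \<in> J3" "qc J3 r (0 + 1 - 1, 0 - 1 + 1, 0 + 1 - 1)"
    by (rule J35_clash[OF s(1,3)]) auto
  obtain \<beta> where \<beta>: "r - sc \<beta> * z ^ n \<in> J3" using Suc.IH[of r] r by (auto simp: algebra_simps)
  define p0 where "p0 = \<mu> - x2 * s"
  define p1 where "p1 = s - x5 * r"
  define p2 where "p2 = r - sc \<beta> * z ^ n"
  define p3 where "p3 = z - x2 * x5"
  have p: "p0 \<in> J3" "p1 \<in> J3" "p2 \<in> J3" "p3 \<in> J3"
    unfolding p0_def p1_def p2_def p3_def using s r \<beta> z_mod by blast+
  have "\<mu> - sc \<beta> * z ^ Suc n = p0 + x2 * p1 + x2 * (x5 * p2) - sc \<beta> * (p3 * z ^ n)"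
    unfolding p0_def p1_def p2_def p3_def by (simp add: ring_norm)
  moreover have "\<dots> \<in> J3"
    by (intro hidD(3,4,7)[OF hids(1)] hidD(5)[OF hids(1) S_closed(8)] hidD(5)[OF hids(1) S_closed(11)]
        hidD(6)[OF hids(1) H_S[OF H_z_pow]] p)
  ultimately show ?case by metis
qed

text \<open>The clash with \<open>x2\<close> compares \<open>n\<close> with \<open>-n\<close>. It
  gives divisibility by \<open>x3\<close>, which raises \<open>n\<close> and lowers \<open>a\<close>
  within the same family, so the descent never meets a resonance before the weight turns
  negative.\<close>

lemma like_power_zero:
  "n \<ge> 1 \<Longrightarrow> b \<in> H (a, 2 * a + n, a) \<Longrightarrow> qc {0} b (n,0,-n) \<Longrightarrow> b = 0"
proof (induction "nat (a + 1)" arbitrary: a n b rule: less_induct)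
  case less
  show ?case
  proof (cases "a < 0")
    case True
    then show ?thesis using H_neg less.prems(2) by blast
  next
    case False
    have "b \<in> J3" by (rule J3_clash0[OF less.prems(2,3)]) (use less.prems(1) in simp)
    then obtain s where s: "s \<in> H (a - 1, 2 * a + n - 1, a - 1)" "b = x3 * s" "qc {0} s ((n,0,-n) - (-1,0,1))"
      by (rule div_x3[OF less.prems(2,3)])
    have "((n,0,-n) - (-1,0,1) :: weight) = (n + 1, 0, -(n + 1))" by simp
    then have s3: "qc {0} s (n + 1, 0, -(n + 1))" using s(3) by (simp only:)
    have s1: "s \<in> H (a - 1, 2 * (a - 1) + (n + 1), a - 1)" using s(1) by (simp add: algebra_simps)
    have "s = 0"
      by (rule less.hyps[OF _ _ s1 s3]) (use False less.prems(1) in auto)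
    then show ?thesis using s by simp
  qed
qed

lemma central_exceptional:
  assumes "\<nu> \<in> H (int n, 2 * int n, int n)" "qc {0} \<nu> (0,0,0)"
  shows "\<exists>\<beta>. \<nu> = sc \<beta> * z ^ n"
proof -
  obtain \<beta> where \<beta>: "\<nu> - sc \<beta> * z ^ n \<in> J3"
    using central_mod[OF assms(1) qc_mono[OF assms(2) zero_sub[OF hids(1)]]] by blast
  let ?b = "\<nu> - sc \<beta> * z ^ n"
  have H: "?b \<in> H (int n, 2 * int n, int n)" using assms(1) H_z_pow by (intro H_closed)
  have c: "qc {0} ?b (0,0,0)"
    by (rule qc_0I) (simp add: ring_norm z_pow_comm qc_0D[OF assms(2)])
  obtain s where s: "s \<in> H (int n - 1, 2 * int n - 1, int n - 1)" "?b = x3 * s" "qc {0} s ((0,0,0) - (-1,0,1))"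
    by (rule div_x3[OF H c \<beta>])
  have "s = 0"
    by (rule like_power_zero[of 1 s "int n - 1"]) (use s in \<open>auto simp: algebra_simps\<close>)
  then have "\<nu> = sc \<beta> * z ^ n" using s(2) by simp
  then show ?thesis ..
qed

text \<open>The weight clashes with \<open>x2\<close> once for \<open>\<nu>\<close> and once more
  for the flipped quotient, which has the character of \<open>x3\<close>. With
  \<open>central_exceptional\<close> this shows that a central element of weight
  \<open>(a,b,a)\<close> is a scalar multiple of a product of powers of \<open>x3 * De\<close> and
  \<open>z\<close>.\<close>

lemma central_generic:
  assumes \<nu>: "\<nu> \<in> H (a,b,a)" "qc {0} \<nu> (0,0,0)" and ne: "b \<noteq> 2 * a"
  obtains \<nu>' where "\<nu>' \<in> H (a - 2, b - 2, a - 2)" "qc {0} \<nu>' (0,0,0)" "\<nu> = x3 * (De * \<nu>')"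
proof -
  have "\<nu> \<in> J3" by (rule J3_clash0[OF \<nu>]) (use ne in simp)
  then obtain s where s: "s \<in> H (a - 1, b - 1, a - 1)" "\<nu> = x3 * s" "qc {0} s ((0,0,0) - (-1,0,1))"
    by (rule div_x3[OF \<nu>])
  have f: "flip s \<in> H (a - 1, b - 1, a - 1)" "qc {0} (flip s) (-1,0,1)"
    using flip_H[OF s(1)] qc_flip[OF s(3) H_S[OF s(1)]] by simp_all
  have "flip s \<in> J3" by (rule J3_clash0[OF f]) (use ne in simp)
  then obtain r where r: "r \<in> H (a - 1 - 1, b - 1 - 1, a - 1 - 1)" "flip s = x3 * r" "qc {0} r ((-1,0,1) - (-1,0,1))"
    by (rule div_x3[OF f])
  have "s = De * flip r"
    using arg_cong[OF r(2), of flip] s(1) r(1) by (simp add: flip_flip flip_simps S_closed H_S De_def)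
  then show ?thesis
    using that[of "flip r"] flip_H[OF r(1)] qc_flip[OF r(3) H_S[OF r(1)]] s(2)
    by (simp add: flipw_add zero_prod_def)
qed

subsection \<open>The right ideal generated by \<open>x1\<close> and \<open>x2\<close>\<close>

text \<open>Modulo this right ideal \<open>De\<close> is a scalar multiple of \<open>x3\<close>, while it contains no nonzero
  central element. Hence a derivation has the same eigenvalue on \<open>x3\<close> and on \<open>De\<close>.\<close>

definition P where "P = {x1 * s + x2 * s' | s s'. s \<in> S \<and> s' \<in> S}"

lemma P_add: "u \<in> P \<Longrightarrow> v \<in> P \<Longrightarrow> u + v \<in> P"
  unfolding P_def
proof clarify
  fix s s' r r' assume "s \<in> S" "s' \<in> S" "r \<in> S" "r' \<in> S"
  then show "\<exists>t t'. x1 * s + x2 * s' + (x1 * r + x2 * r') = x1 * t + x2 * t' \<and> t \<in> S \<and> t' \<in> S"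
    by (intro exI[of _ "s + r"] exI[of _ "s' + r'"]) (simp add: S_closed algebra_simps)
qed
lemma P_right: "u \<in> P \<Longrightarrow> s \<in> S \<Longrightarrow> u * s \<in> P"
  unfolding P_def
proof clarify
  fix r r' assume "s \<in> S" "r \<in> S" "r' \<in> S"
  then show "\<exists>t t'. (x1 * r + x2 * r') * s = x1 * t + x2 * t' \<and> t \<in> S \<and> t' \<in> S"
    by (intro exI[of _ "r * s"] exI[of _ "r' * s"]) (simp add: S_closed algebra_simps)
qed
lemma P_gens: "s \<in> S \<Longrightarrow> x1 * s \<in> P" "s \<in> S \<Longrightarrow> x2 * s \<in> P"
proof -
  assume s: "s \<in> S"
  have "x1 * s = x1 * s + x2 * 0" "x2 * s = x1 * 0 + x2 * s" by simp_all
  then show "x1 * s \<in> P" "x2 * s \<in> P" unfolding P_def using s S_closed(5) by blast+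
qed

lemma P_vac: "u \<in> P \<Longrightarrow> app u vac (0,0,c,d,e,f) = 0"
  unfolding P_def using S_V[OF _ V_dl] by (auto simp: app_x1 app_x2 V_neg)

lemma P_crit:
  assumes u: "u \<in> S" and "\<And>c d e f. app u vac (0,0,c,d,e,f) = 0"
  shows "u \<in> P"
proof -
  let ?v = "app u vac"
  have v: "?v \<in> V" by (rule S_V[OF u V_dl])
  define w1 where "w1 = (\<lambda>m. if m \<in> N6 then (case m of (a,b,c,d,e,f) \<Rightarrow> ?v (a + 1,b,c,d,e,f)) else 0)"
  \<comment> \<open>The restriction to \<open>a = 0\<close> keeps monomials containing both factors
    from being counted twice; they are divided by \<open>x1\<close>.\<close>
  define w2 where "w2 = (\<lambda>m. if m \<in> N6 then (case m of (a,b,c,d,e,f) \<Rightarrow> if a = 0 then ?v (a,b + 1,c,d,e,f) else 0) else 0)"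
  have "w1 \<in> V"
  proof (rule V_I)
    show "finite {m. w1 m \<noteq> 0}"
    proof (rule finite_subset)
      show "{m. w1 m \<noteq> 0} \<subseteq> {m. ?v ((\<lambda>(a,b,c,d,e,f). (a + 1,b,c,d,e,f)) m) \<noteq> 0}"
        by (rule subsetI, rename_tac m, case_tac m) (auto simp: w1_def split: if_splits)
      show "finite {m. ?v ((\<lambda>(a,b,c,d,e,f). (a + 1,b,c,d,e,f)) m) \<noteq> 0}"
        by (rule V_shift_finite[OF v]) (auto simp: inj_on_def)
    qed
  qed (simp add: w1_def)
  then obtain s where s: "s \<in> S" "app s vac = w1" using V_surj by blast
  have "w2 \<in> V"
  proof (rule V_I)
    show "finite {m. w2 m \<noteq> 0}"
    proof (rule finite_subset)
      show "{m. w2 m \<noteq> 0} \<subseteq> {m. ?v ((\<lambda>(a,b,c,d,e,f). (a,b + 1,c,d,e,f)) m) \<noteq> 0}"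
        by (rule subsetI, rename_tac m, case_tac m) (auto simp: w2_def split: if_splits)
      show "finite {m. ?v ((\<lambda>(a,b,c,d,e,f). (a,b + 1,c,d,e,f)) m) \<noteq> 0}"
        by (rule V_shift_finite[OF v]) (auto simp: inj_on_def)
    qed
  qed (simp add: w2_def)
  then obtain s' where s': "s' \<in> S" "app s' vac = w2" using V_surj by blast
  have "?v m = app (x1 * s + x2 * s') vac m" for m
  proof -
    obtain a b c d e f where m: "m = (a,b,c,d,e,f)" by (cases m)
    have 1: "app (x1 * s + x2 * s') vac m = w1 (a - 1,b,c,d,e,f) + q powi (- a) * w2 (a,b - 1,c,d,e,f)"
      by (simp add: s s' m app_x1 app_x2)
    show ?thesis
    proof (cases "m \<in> N6")
      case False
      then show ?thesis unfolding 1 using V_zero[OF v, of m] by (auto simp: m w1_def w2_def N6_def)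
    next
      case True
      then show ?thesis unfolding 1 using assms(2)
        by (cases "a = 0"; cases "b = 0") (auto simp: m w1_def w2_def N6_def)
    qed
  qed
  then have "u - (x1 * s + x2 * s') = 0"
    using u s s' by (intro S_faithful) (auto simp: S_closed)
  then have "u = x1 * s + x2 * s'" by simp
  then show ?thesis unfolding P_def using s s' by blast
qed

text \<open>In a monomial without \<open>x1\<close> and \<open>x2\<close> the first weight
  coordinate is the exponent of \<open>x3\<close>, which the third coordinate bounds.\<close>

lemma P_weight: "u \<in> H (a,b,c) \<Longrightarrow> a > c \<Longrightarrow> u \<in> P"
proof (rule P_crit)
  assume u: "u \<in> H (a,b,c)" "a > c"
  show "u \<in> S" by (rule H_S[OF u(1)])
  fix c' d e f
  show "app u vac (0,0,c',d,e,f) = 0"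
    using vac_support[OF u(1), of "(0,0,c',d,e,f)"] u(2) by (force simp: N6_def)
qed

lemma De_P: "\<exists>A\<in>H (0,1,1). \<exists>B\<in>H (0,0,1). De = sc (q * q) * x3 + x1 * A + x2 * B"
proof (intro bexI)
  let ?k = "q - inverse q"
  \<comment> \<open>The witnesses come from moving \<open>x1\<close> to the left in
    \<open>De_w1\<close>. The factor \<open>q * q\<close> of \<open>x3\<close> arises from
    reordering \<open>x5 * x1\<close>, and \<open>?B\<close> from reordering
    \<open>x4 * x1\<close>.\<close>
  let ?A = "sc (?k * q) * (x4 * x6) - sc (q * q) * x5 - sc (inverse q) * w1"
  let ?B = "sc (- (?k * q)) * x6"
  have 64: "x6 * x4 = sc q * (x4 * x6) - sc q * x5"
    by (simp add: x5_def ring_norm qqi qqi')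
  have 51: "x5 * x1 = sc q * (x1 * x5) - sc q * x3"
    by (simp add: x3_def ring_norm qqi qqi')
  have 41: "x4 * x1 = sc q * (x1 * x4) - sc q * x2"
    by (simp add: x2_def ring_norm qqi qqi')
  have w: "w1 = sc ?k * (x4 * x6) - sc q * x5" by (simp add: w1_def 64 ring_norm)
  have "x4 * (x6 * x1) = x4 * (x1 * x6)" by (simp only: x1_x6)
  also have "\<dots> = sc q * (x1 * (x4 * x6)) - sc q * (x2 * x6)"
    using arg_cong[OF 41, of "\<lambda>u. u * x6"] by (simp add: ring_norm)
  finally have 461: "x4 * (x6 * x1) = sc q * (x1 * (x4 * x6)) - sc q * (x2 * x6)" .
  have "De = sc ?k * (x4 * (x6 * x1)) - sc q * (x5 * x1) - sc (inverse q) * (x1 * w1)"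
    unfolding De_w1 by (subst w) (simp add: ring_norm)
  then show "De = sc (q * q) * x3 + x1 * ?A + x2 * ?B"
    unfolding 461 51 by (simp add: ring_norm mult.commute algebra_simps)
  show "?A \<in> H (0,1,1)"
    by (intro H_closed H_x5 H_w1 H_mult'[OF H_x(2) H_x(3)]) simp
  show "?B \<in> H (0,0,1)" by (intro H_closed H_x)
qed

lemma vac_De: "s \<in> S \<Longrightarrow> app (De * s) vac (0,0,c,d,e,f) = q * q * app s vac (0,0,c - 1,d,e,f)"
proof -
  assume s: "s \<in> S"
  obtain A B where AB: "A \<in> S" "B \<in> S" "De = sc (q * q) * x3 + x1 * A + x2 * B" using De_P H_S by blast
  have "De * s - sc (q * q) * (x3 * s) = x1 * (A * s) + x2 * (B * s)" unfolding AB(3) by (simp add: ring_norm)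
  also have "\<dots> \<in> P" using AB s by (intro P_add P_gens S_closed)
  finally have "app (De * s - sc (q * q) * (x3 * s)) vac (0,0,c,d,e,f) = 0" by (rule P_vac)
  then show ?thesis by (simp add: app_x3)
qed

lemma vac_z: "s \<in> S \<Longrightarrow> app (z * s) vac (0,0,c,d,e,f) = - q * app s vac (0,0,c - 1,d - 1,e,f)"
proof -
  assume s: "s \<in> S"
  have v: "app (x5 * s) vac \<in> V" "app s vac \<in> V"
    using S_V[OF S_closed(3)[OF S_closed(11) s] V_dl] S_V[OF s V_dl] by simp_all
  then show ?thesis using V_neg[OF v(1)] V_neg[OF v(2)]
    by (simp add: z_def left_diff_distrib mult.assoc app_x2 app_x3 app_x4)
qed

lemma vac_z_pow: "app (z ^ n) vac (0,0,int n,int n,0,0) = (- q) ^ n"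
proof (induction n)
  case (Suc n)
  have "app (z ^ Suc n) vac (0,0,int (Suc n),int (Suc n),0,0)
      = - q * app (z ^ n) vac (0,0,int (Suc n) - 1,int (Suc n) - 1,0,0)"
    unfolding power_Suc by (rule vac_z[OF H_S[OF H_z_pow]])
  then show ?case using Suc.IH by (simp del: times_lin.rep_eq)
qed (simp add: dl_def)

text \<open>On coordinates with neither \<open>x1\<close> nor \<open>x2\<close>, multiplication by
  \<open>x3 * De\<close> or by \<open>z\<close> is a shift with a nonzero factor. The coordinate of
  a power of \<open>z\<close> that \<open>vac_z_pow\<close> computes therefore survives.\<close>

lemma central_P: "\<nu> \<in> H (a,b,a) \<Longrightarrow> qc {0} \<nu> (0,0,0) \<Longrightarrow> \<nu> \<in> P \<Longrightarrow> \<nu> = 0"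
proof (induction "nat (a + 1)" arbitrary: a b \<nu> rule: less_induct)
  case less
  show ?case
  proof (cases "a < 0")
    case True
    then show ?thesis using H_neg less.prems(1) by blast
  next
    case False
    show ?thesis
    proof (cases "b = 2 * a")
      case True
      then obtain \<beta> where \<beta>: "\<nu> = sc \<beta> * z ^ nat a"
        using central_exceptional[of \<nu> "nat a"] less.prems(1,2) False by auto
      have "app \<nu> vac (0,0,int (nat a),int (nat a),0,0) = \<beta> * (- q) ^ nat a"
        unfolding \<beta> by (simp only: times_lin.rep_eq app_sc vac_z_pow)
      then have "\<beta> = 0" using P_vac[OF less.prems(3)] q_nz by simp
      then show ?thesis using \<beta> by (simp add: sc_simps)
    next
      case ne: False
      obtain \<nu>' where n: "\<nu>' \<in> H (a - 2, b - 2, a - 2)" "qc {0} \<nu>' (0,0,0)" "\<nu> = x3 * (De * \<nu>')"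
        by (rule central_generic[OF less.prems(1,2) ne])
      have "\<nu>' \<in> P"
      proof (rule P_crit[OF H_S[OF n(1)]])
        fix c d e f
        have "app \<nu> vac (0,0,c + 2,d,e,f) = q * q * app \<nu>' vac (0,0,c,d,e,f)"
          unfolding n(3) using vac_De[OF H_S[OF n(1)], of "c + 1" d e f] by (simp add: app_x3 add.commute[of 1])
        then show "app \<nu>' vac (0,0,c,d,e,f) = 0" using P_vac[OF less.prems(3)] q_nz by simp
      qed
      then have "\<nu>' = 0" using less.hyps[OF _ n(1,2)] False by simp
      then show ?thesis using n by simp
    qed
  qed
qed

text \<open>The hypothesis on the pairing is the resonance excluded in \<open>inner_mod\<close>:
  where \<open>y\<close> cannot make a skew derivation inner, subtracting an inner part does not
  disturb the value on \<open>y\<close>.\<close>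

lemma inn_val:
  assumes I: "hid I" and y: "y \<in> H \<eta>" "qc I y n" and x: "x \<in> H \<gamma>" and e: "pr n \<gamma> = - pr t \<eta>"
  shows "inn t x \<eta> y \<in> I"
proof -
  define p where "p = y * x - sc (qe n \<gamma>) * (x * y)"
  have p: "p \<in> I" unfolding p_def by (rule qcD[OF y(2) x])
  have "qe t \<eta> * qe n \<gamma> = 1" "qe n \<gamma> * qe t \<eta> = 1" unfolding e using q_nz by (simp_all add: power_int_minus)
  then have "inn t x \<eta> y = - (sc (qe t \<eta>) * p)" unfolding p_def inn_def by (simp add: ring_norm)
  also have "\<dots> \<in> I" by (intro hidD(8,7)[OF I] p)
  finally show ?thesis .
qed

text \<open>Reassembles implementing elements after a division: \<open>x\<close> for the part split
  off and \<open>x'\<close> for the quotient combine to \<open>x + y * x'\<close>.\<close>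

lemma inn_compose:
  assumes I: "hid I" and y: "qc I y n" and x': "x' \<in> S" and u: "u \<in> H \<delta>"
  shows "inn t (x + y * x') \<delta> u - (inn t x \<delta> u + y * inn (t - n) x' \<delta> u) \<in> I"
proof -
  define p where "p = y * u - sc (qe n \<delta>) * (u * y)"
  have p: "p \<in> I" unfolding p_def by (rule qcD[OF y u])
  have qq: "qe (t - n) \<delta> * qe n \<delta> = qe t \<delta>" "qe n \<delta> * qe (t - n) \<delta> = qe t \<delta>"
    using q_nz by (simp_all add: pr_add power_int_diff)
  have "inn t (x + y * x') \<delta> u - (inn t x \<delta> u + y * inn (t - n) x' \<delta> u) = sc (qe (t - n) \<delta>) * (p * x')"
    unfolding p_def inn_def by (simp add: ring_norm qq)
  also have "\<dots> \<in> I" by (intro hidD(7)[OF I] hidD(6)[OF I x'] p)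
  finally show ?thesis .
qed

lemma inn_compose0: "qc {0} y n \<Longrightarrow> x' \<in> S \<Longrightarrow> u \<in> H \<delta> \<Longrightarrow>
    inn t (x + y * x') \<delta> u = inn t x \<delta> u + y * inn (t - n) x' \<delta> u"
  using inn_compose[OF hid0, of y n x' u \<delta> t x] by simp

lemma inn_0: "inn t 0 \<delta> u = 0" by (simp add: inn_def)

lemma x3_cancel: "u \<in> H \<beta> \<Longrightarrow> x3 * u = 0 \<Longrightarrow> u = 0"
  using stepD(10)[OF step3] by blast

lemma De_cancel: "u \<in> H \<beta> \<Longrightarrow> De * u = 0 \<Longrightarrow> u = 0"
proof -
  assume u: "u \<in> H \<beta>" "De * u = 0"
  have "x3 * flip u = 0" using arg_cong[OF u(2), of flip] by (simp add: flip_simps De_S H_S[OF u(1)] flip_De)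
  then have "flip u = 0" using x3_cancel flip_H[OF u(1)] by blast
  then show ?thesis using flip_flip[OF H_S[OF u(1)]] by (simp add: flip_simps)
qed

text \<open>One step of the descent. As \<open>E\<close> kills \<open>x3\<close> it acts modulo
  \<open>J3\<close>, where the pair \<open>x2\<close>, \<open>x5\<close> makes it inner; the
  remainder is a multiple of \<open>x3\<close>. The inequality excludes resonance with both
  \<open>x2\<close> and \<open>x5\<close>.\<close>

lemma x3_division:
  assumes E: "tder {0} (n,0,-n) (a,b,a) E" and E0: "E (1,1,1) x3 = 0" and ne: "2 * a - b \<noteq> n"
  obtains x F where "x \<in> H (a,b,a)" "tder {0} (n + 1,0,-(n + 1)) (a - 1,b - 1,a - 1) F" "F (1,1,1) x3 = 0"
    "\<And>\<delta> u. u \<in> H \<delta> \<Longrightarrow> E \<delta> u = inn (n,0,-n) x \<delta> u + x3 * F \<delta> u"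
proof -
  have E': "tder J3 (n,0,-n) (a,b,a) E"
    using tder_mono[OF step3 E] E0 hidD(2)[OF hids(1)] by simp
  obtain x where x: "x \<in> H (a,b,a)" "\<And>\<delta> u. u \<in> H \<delta> \<Longrightarrow> E \<delta> u - inn (n,0,-n) x \<delta> u \<in> J3"
    by (rule inner_mod[OF step2 E']) (use ne in auto)
  obtain F where F: "tder {0} ((n,0,-n) - (-1,0,1)) ((a,b,a) - (1,1,1)) F"
     "\<And>\<delta> u. u \<in> H \<delta> \<Longrightarrow> (E \<delta> u - inn (n,0,-n) x \<delta> u) - x3 * F \<delta> u \<in> {0}"
    using divide_tder[OF step3 tder_minus_inn[OF E hid0 x(1)] x(2)] by blast
  have "((n,0,-n) - (-1,0,1) :: weight) = (n + 1,0,-(n + 1))" "((a,b,a) - (1,1,1) :: weight) = (a - 1,b - 1,a - 1)"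
    by simp_all
  then have F1: "tder {0} (n + 1,0,-(n + 1)) (a - 1,b - 1,a - 1) F" using F(1) by simp
  have "inn (n,0,-n) x (1,1,1) x3 = 0"
    using inn_val[OF hid0 H_x3 qc_x3 x(1), of "(n,0,-n)"] by simp
  then have "F (1,1,1) x3 = 0"
    using tder_value[OF step3 F1 H_x3 F(2)[OF H_x3]] E0 by simp
  then show ?thesis using that[OF x(1) F1] F(2) by (auto simp: algebra_simps)
qed

lemma gens_negative:
  assumes E: "tder {0} t (a,b,a) E" and a: "a < 0" and u: "u \<in> H \<delta>"
  shows "E \<delta> u = 0"
proof -
  have "E (aw l) (gen l) \<in> {0}" for l
    using tderD(1)[OF E H_gen[of l]] H_neg[of "E (aw l) (gen l)"] a by (cases l) (auto simp: aw_def)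
  then show ?thesis using tder_gens[OF hid0 E _ u] by blast
qed

text \<open>The weights and twists form a family closed under division by \<open>x3\<close>:
  \<open>a\<close> drops by one and \<open>n\<close> grows by one. Within the family the inequality
  needed for \<open>x3_division\<close> is \<open>-n \<noteq> n\<close>, so no resonance
  occurs.\<close>

lemma twisted_inner:
  "n \<ge> 1 \<Longrightarrow> tder {0} (n,0,-n) (a,2 * a + n,a) E \<Longrightarrow> E (1,1,1) x3 = 0 \<Longrightarrow>
    \<exists>x\<in>H (a,2 * a + n,a). \<forall>\<delta>. \<forall>u\<in>H \<delta>. E \<delta> u = inn (n,0,-n) x \<delta> u"
proof (induction "nat (a + 1)" arbitrary: a n E rule: less_induct)
  case less
  show ?case
  proof (cases "a < 0")
    case True
    then show ?thesis using gens_negative[OF less.prems(2)] H_closed(4) inn_0 by metis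
  next
    case False
    obtain x F where x: "x \<in> H (a,2 * a + n,a)" "tder {0} (n + 1,0,-(n + 1)) (a - 1,2 * a + n - 1,a - 1) F" "F (1,1,1) x3 = 0"
      "\<And>\<delta> u. u \<in> H \<delta> \<Longrightarrow> E \<delta> u = inn (n,0,-n) x \<delta> u + x3 * F \<delta> u"
      by (rule x3_division[OF less.prems(2,3)]) (use less.prems(1) in auto)
    have e: "2 * a + n - 1 = 2 * (a - 1) + (n + 1)" by simp
    obtain x' where x': "x' \<in> H (a - 1,2 * (a - 1) + (n + 1),a - 1)"
      "\<forall>\<delta>. \<forall>u\<in>H \<delta>. F \<delta> u = inn (n + 1,0,-(n + 1)) x' \<delta> u"
      using less.hyps[OF _ _ x(2)[unfolded e] x(3)] False less.prems(1) by auto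
    have "((n,0,-n) - (-1,0,1) :: weight) = (n + 1,0,-(n + 1))" by simp
    then have "E \<delta> u = inn (n,0,-n) (x + x3 * x') \<delta> u" if "u \<in> H \<delta>" for \<delta> u
      using inn_compose0[OF qc_x3 H_S[OF x'(1)] that, of "(n,0,-n)" x] x(4)[OF that] x'(2) that by simp
    moreover have "x + x3 * x' \<in> H (a,2 * a + n,a)"
      by (intro H_closed x H_mult'[OF H_x3 x'(1)]) simp
    ultimately show ?thesis by blast
  qed
qed

subsection \<open>Euler derivations\<close>

text \<open>On elements of weight \<open>\<delta>\<close>, \<open>el \<nu>1 \<nu>4 \<nu>6 \<delta>\<close> is \<open>\<nu>1 D\<^sub>1 + \<nu>4 D\<^sub>4 + \<nu>6 D\<^sub>6\<close>.\<close>

definition el :: "'k lin \<Rightarrow> 'k lin \<Rightarrow> 'k lin \<Rightarrow> weight \<Rightarrow> 'k lin \<Rightarrow> 'k lin" where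
  "el \<nu>1 \<nu>4 \<nu>6 = (\<lambda>(i,j,k) u. (sc (of_int i) * \<nu>1 + sc (of_int j) * \<nu>4 + sc (of_int k) * \<nu>6) * u)"

lemma el_simp: "el \<nu>1 \<nu>4 \<nu>6 (i,j,k) u = (sc (of_int i) * \<nu>1 + sc (of_int j) * \<nu>4 + sc (of_int k) * \<nu>6) * u"
  by (simp add: el_def)

lemma el_add: "el (a + a') (b + b') (c + c') \<delta> u = el a b c \<delta> u + el a' b' c' \<delta> u"
  by (cases \<delta>) (simp add: el_simp algebra_simps)

lemma el_mult: "el (y * a) (y * b) (y * c) \<delta> u = y * el a b c \<delta> u"
  by (cases \<delta>) (simp add: el_simp ring_norm)

text \<open>Centrality is encoded as normality with trivial character, which makes the clash and
  division lemmas applicable.\<close>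

definition cen :: "weight \<Rightarrow> 'k lin set" where "cen \<gamma> = {\<nu> \<in> H \<gamma>. qc {0} \<nu> (0,0,0)}"

lemma cenD: "\<nu> \<in> cen \<gamma> \<Longrightarrow> \<nu> \<in> H \<gamma>" "\<nu> \<in> cen \<gamma> \<Longrightarrow> qc {0} \<nu> (0,0,0)" "\<nu> \<in> cen \<gamma> \<Longrightarrow> u \<in> S \<Longrightarrow> \<nu> * u = u * \<nu>"
  using qc_0D by (auto simp: cen_def)

lemma cenI: "\<nu> \<in> H \<gamma> \<Longrightarrow> (\<And>u. u \<in> S \<Longrightarrow> \<nu> * u = u * \<nu>) \<Longrightarrow> \<nu> \<in> cen \<gamma>"
  unfolding cen_def using qc_0I by blast

lemma cen_closed: "0 \<in> cen \<gamma>" "\<nu> \<in> cen \<gamma> \<Longrightarrow> \<mu> \<in> cen \<gamma> \<Longrightarrow> \<nu> + \<mu> \<in> cen \<gamma>"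
  "\<nu> \<in> cen \<gamma> \<Longrightarrow> sc c * \<nu> \<in> cen \<gamma>" "\<nu> \<in> cen \<gamma> \<Longrightarrow> \<mu> \<in> cen \<gamma> \<Longrightarrow> \<nu> - \<mu> \<in> cen \<gamma>"
proof -
  show "0 \<in> cen \<gamma>" by (rule cenI) (simp_all add: H_closed)
  show "\<nu> \<in> cen \<gamma> \<Longrightarrow> \<mu> \<in> cen \<gamma> \<Longrightarrow> \<nu> + \<mu> \<in> cen \<gamma>"
  proof (rule cenI)
    assume *: "\<nu> \<in> cen \<gamma>" "\<mu> \<in> cen \<gamma>"
    show "\<nu> + \<mu> \<in> H \<gamma>" using *[THEN cenD(1)] by (rule H_closed)
    show "(\<nu> + \<mu>) * u = u * (\<nu> + \<mu>)" if "u \<in> S" for u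
      by (simp only: distrib_left distrib_right *[THEN cenD(3), OF that])
  qed
  show "\<nu> \<in> cen \<gamma> \<Longrightarrow> \<mu> \<in> cen \<gamma> \<Longrightarrow> \<nu> - \<mu> \<in> cen \<gamma>"
  proof (rule cenI)
    assume *: "\<nu> \<in> cen \<gamma>" "\<mu> \<in> cen \<gamma>"
    show "\<nu> - \<mu> \<in> H \<gamma>" using *[THEN cenD(1)] by (rule H_closed)
    show "(\<nu> - \<mu>) * u = u * (\<nu> - \<mu>)" if "u \<in> S" for u
      by (simp only: left_diff_distrib right_diff_distrib *[THEN cenD(3), OF that])
  qed
  show "\<nu> \<in> cen \<gamma> \<Longrightarrow> sc c * \<nu> \<in> cen \<gamma>"
  proof (rule cenI)
    assume *: "\<nu> \<in> cen \<gamma>"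
    show "sc c * \<nu> \<in> H \<gamma>" using *[THEN cenD(1)] by (rule H_closed)
    show "(sc c * \<nu>) * u = u * (sc c * \<nu>)" if "u \<in> S" for u
      using *[THEN cenD(3), OF that] by (simp add: mult.assoc sc_comm2[of u])
  qed
qed

lemma z_pow_cen: "z ^ n \<in> cen (int n, 2 * int n, int n)"
  by (intro cenI H_z_pow z_pow_comm)

lemma tder_el:
  assumes "\<nu>1 \<in> cen \<gamma>" "\<nu>4 \<in> cen \<gamma>" "\<nu>6 \<in> cen \<gamma>"
  shows "tder {0} 0 \<gamma> (el \<nu>1 \<nu>4 \<nu>6)"
proof (rule tderI)
  fix \<delta> \<epsilon> :: weight and u v c assume u: "u \<in> H \<delta>"
  obtain i j k i' j' k' where d: "\<delta> = (i,j,k)" "\<epsilon> = (i',j',k')" by (cases \<delta>; cases \<epsilon>)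
  have "sc (of_int i) * \<nu>1 + sc (of_int j) * \<nu>4 + sc (of_int k) * \<nu>6 \<in> H \<gamma>"
    using assms by (intro H_closed cenD(1))
  then show "el \<nu>1 \<nu>4 \<nu>6 \<delta> u \<in> H (\<delta> + \<gamma>)"
    unfolding d el_simp using H_mult'[OF _ u] d by (metis add.commute)
  show "v \<in> H \<delta> \<Longrightarrow> el \<nu>1 \<nu>4 \<nu>6 \<delta> (u + v) - (el \<nu>1 \<nu>4 \<nu>6 \<delta> u + el \<nu>1 \<nu>4 \<nu>6 \<delta> v) \<in> {0}"
    by (simp add: d el_simp distrib_left)
  show "el \<nu>1 \<nu>4 \<nu>6 \<delta> (sc c * u) - sc c * el \<nu>1 \<nu>4 \<nu>6 \<delta> u \<in> {0}"
    by (simp add: d el_simp ring_norm mult_ac)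
  show "u \<in> {0} \<Longrightarrow> el \<nu>1 \<nu>4 \<nu>6 \<delta> u \<in> {0}" by (simp add: d el_simp)
  show "el \<nu>1 \<nu>4 \<nu>6 (\<delta> + \<epsilon>) (u * v) - (el \<nu>1 \<nu>4 \<nu>6 \<delta> u * v + sc (qe 0 \<delta>) * (u * el \<nu>1 \<nu>4 \<nu>6 \<epsilon> v)) \<in> {0}"
    if v: "v \<in> H \<epsilon>"
  proof -
    have c: "u * (\<nu>1 * v) = \<nu>1 * (u * v)" "u * (\<nu>4 * v) = \<nu>4 * (u * v)" "u * (\<nu>6 * v) = \<nu>6 * (u * v)"
      using assms[THEN cenD(3), OF H_S[OF u]] by (metis mult.assoc)+
    have e: "pr 0 (i,j,k) = 0" by (rule pr_add(5))
    show ?thesis unfolding d e el_simp add_Pair of_int_add by (simp add: ring_norm c el_simp algebra_simps)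
  qed
qed

lemma tder_diff:
  assumes I: "hid I" and E: "tder I t \<gamma> E" and F: "tder I t \<gamma> F"
  shows "tder I t \<gamma> (\<lambda>\<delta> u. E \<delta> u - F \<delta> u)"
proof (rule tderI)
  fix \<delta> \<epsilon> u v c assume u: "u \<in> H \<delta>"
  show "E \<delta> u - F \<delta> u \<in> H (\<delta> + \<gamma>)" by (intro H_closed(2) tderD(1)[OF E u] tderD(1)[OF F u])
  show "E \<delta> (sc c * u) - F \<delta> (sc c * u) - sc c * (E \<delta> u - F \<delta> u) \<in> I"
    using hidD(3)[OF I tderD(3)[OF E u] tderD(3)[OF F u], of c c] by (simp add: algebra_simps)
  show "u \<in> I \<Longrightarrow> E \<delta> u - F \<delta> u \<in> I" by (intro hidD(3)[OF I] tderD(5)[OF E u] tderD(5)[OF F u])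
  show "v \<in> H \<delta> \<Longrightarrow> E \<delta> (u + v) - F \<delta> (u + v) - (E \<delta> u - F \<delta> u + (E \<delta> v - F \<delta> v)) \<in> I"
    using hidD(3)[OF I tderD(2)[OF E u] tderD(2)[OF F u], of v v] by (simp add: algebra_simps)
  show "v \<in> H \<epsilon> \<Longrightarrow> E (\<delta> + \<epsilon>) (u * v) - F (\<delta> + \<epsilon>) (u * v) -
     ((E \<delta> u - F \<delta> u) * v + sc (qe t \<delta>) * (u * (E \<epsilon> v - F \<epsilon> v))) \<in> I"
    using hidD(3)[OF I tderD(4)[OF E u] tderD(4)[OF F u], of v \<epsilon> v \<epsilon>] by (simp add: algebra_simps)
qed

lemma tder_J3: "tder {0} t \<gamma> E \<Longrightarrow> E (1,1,1) x3 = 0 \<Longrightarrow> tder J3 t \<gamma> E"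
  using tder_mono[OF step3] hidD(2)[OF hids(1)] by simp

lemma one_notin_J3: "1 \<notin> J3"
proof
  assume "1 \<in> J3"
  from J_D[OF this V_dl, of "(0,0,0,0,0,0)"] show False by (simp add: M3_def dl_def)
qed

lemma x2_notin: "sc c * x2 \<in> J3 \<Longrightarrow> c = 0" and x5_notin: "sc c * x5 \<in> J3 \<Longrightarrow> c = 0"
proof -
  show "c = 0" if "sc c * x2 \<in> J3"
    using stepD(10)[OF step2 H_closed(6)] hid_sc[OF hids(1) that] one_notin_J3 by auto
  show "c = 0" if "sc c * x5 \<in> J3"
    using stepD(10)[OF step5 H_closed(6)] hid_sc[OF hids(1) that] one_notin_J3 by auto
qed

lemma De_notin: "sc c * De \<in> J3 \<Longrightarrow> c = 0"
  using De_reg[OF H_closed(6)] hid_sc[OF hids(1), of c De] one_notin_J3 by auto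

text \<open>In weight zero every generator is scaled by a constant. Vanishing on \<open>x2\<close>,
  \<open>x5\<close> and \<open>De\<close> modulo \<open>J3\<close> gives three linear equations for
  the three constants, with only the zero solution.\<close>

lemma mod_base:
  assumes E: "tder J3 0 (0,0,0) E" and v: "E (1,1,0) x2 \<in> J3" "E (0,1,1) x5 \<in> J3" "E (1,1,1) De \<in> J3" and u: "u \<in> H \<delta>"
  shows "E \<delta> u \<in> J3"
proof -
  have "\<forall>l. \<exists>c. E (aw l) (gen l) = sc c * gen l"
    using tderD(1)[OF E H_gen] H_gen_scalar by (simp add: zero_prod_def[symmetric])
  then obtain c where c: "\<And>l. E (aw l) (gen l) = sc (c l) * gen l" by metis
  define F where "F = el (sc (c E1)) (sc (c E2)) (sc (c E3))"
  have cen: "sc c \<in> cen (0,0,0)" for c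
    using H_closed(5)[of c] by (intro cenI) (simp_all add: sc_comm zero_prod_def)
  have F: "tder {0} 0 (0,0,0) F" unfolding F_def by (intro tder_el cen)
  have "F (1,1,1) x3 \<in> J3"
    unfolding F_def el_simp using hidD(5)[OF hids(1) _ s3.y_in] S_closed by simp
  then have F3: "tder J3 0 (0,0,0) F" by (rule tder_mono[OF step3 F])
  have "E \<delta> u - F \<delta> u \<in> J3" if u: "u \<in> H \<delta>" for \<delta> u
  proof (rule tder_gens[OF hids(1) tder_diff[OF hids(1) E F3] _ u])
    fix l show "E (aw l) (gen l) - F (aw l) (gen l) \<in> J3"
      using c[of l] hidD(2)[OF hids(1)] by (cases l) (simp_all add: F_def aw_def el_simp sc_simps)
  qed
  then have *: "F \<delta> u \<in> J3" if "u \<in> H \<delta>" "E \<delta> u \<in> J3" for \<delta> u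
    using hidD(3)[OF hids(1) that(2), of "E \<delta> u - F \<delta> u"] that(1) by simp
  have "sc (c E1 + c E2) * x2 \<in> J3" "sc (c E2 + c E3) * x5 \<in> J3" "sc (c E1 + c E2 + c E3) * De \<in> J3"
    using *[OF H_x2 v(1)] *[OF H_x5 v(2)] *[OF H_De v(3)] by (simp_all add: F_def el_simp sc_simps)
  then have "c E1 + c E2 = 0" "c E2 + c E3 = 0" "c E1 + c E2 + c E3 = 0"
    using x2_notin x5_notin De_notin by blast+
  then have "c E1 = 0" "c E2 = 0" "c E3 = 0" by (auto simp: add_eq_0_iff)
  then have z: "c l = 0" for l by (cases l) auto
  show ?thesis
    by (rule tder_gens[OF hids(1) E _ u]) (simp add: c z sc_simps hidD(2)[OF hids(1)])
qed

text \<open>Modulo \<open>J3\<close> the pair \<open>x2\<close>, \<open>x5\<close> is resonant, so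
  the argument is run one level deeper: modulo \<open>J32\<close> with \<open>x1\<close> and
  \<open>w1\<close>, then, after division by \<open>x2\<close>, modulo \<open>J35\<close> with
  \<open>x6\<close> and \<open>w6\<close>. Division by \<open>x2\<close> and then \<open>x5\<close>
  lowers \<open>g\<close> by one and restores the trivial twist. By \<open>inn_val\<close> the three
  vanishing values persist down to \<open>mod_base\<close>.\<close>

lemma inner_mod_x3:
  "tder J3 0 (int g,2 * int g,int g) E \<Longrightarrow> E (1,1,0) x2 \<in> J3 \<Longrightarrow> E (0,1,1) x5 \<in> J3 \<Longrightarrow> E (1,1,1) De \<in> J3 \<Longrightarrow>
    \<exists>x\<in>H (int g,2 * int g,int g). \<forall>\<delta>. \<forall>u\<in>H \<delta>. E \<delta> u - inn 0 x \<delta> u \<in> J3"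
proof (induction g arbitrary: E)
  case 0
  then show ?case using mod_base[of E] H_closed(4) inn_0 by (intro bexI[of _ 0]) simp_all
next
  case (Suc g')
  define g where "g = int (Suc g')"
  have g: "g \<ge> 1" by (simp add: g_def)
  note E = Suc.prems[folded g_def]
  have E32: "tder J32 0 (g,2 * g,g) E"
    using tder_mono[OF step2 E(1)] E(2) stepD(3)[OF step2] by blast
  obtain x where x: "x \<in> H (g,2 * g,g)" "\<And>\<delta> u. u \<in> H \<delta> \<Longrightarrow> E \<delta> u - inn 0 x \<delta> u \<in> J32"
    by (rule inner_mod[OF step1 E32]) (use g in \<open>auto simp: pr_add\<close>)
  note E1 = tder_minus_inn[OF E(1) hids(1) x(1)]
  obtain F where F: "tder J3 (0 - (-1,1,-1)) ((g,2 * g,g) - (1,1,0)) F"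
     "\<And>\<delta> u. u \<in> H \<delta> \<Longrightarrow> (E \<delta> u - inn 0 x \<delta> u) - x2 * F \<delta> u \<in> J3"
    using divide_tder[OF step2 E1 x(2)] by blast
  have w: "(0 - (-1,1,-1) :: weight) = (1,-1,1)" "((g,2 * g,g) - (1,1,0) :: weight) = (g - 1,2 * g - 1,g)"
    by (simp_all add: zero_prod_def)
  note F1 = F(1)[unfolded w]
  have Fv: "F (1,1,0) x2 \<in> J3" "F (0,1,1) x5 \<in> J3" "F (1,1,1) De \<in> J3"
  proof -
    have "inn 0 x (1,1,0) x2 \<in> J3" "inn 0 x (0,1,1) x5 \<in> J3" "inn 0 x (1,1,1) De \<in> J3"
      by (rule inn_val[OF hids(1) H_x2 qc_x2 x(1)] inn_val[OF hids(1) H_x5 qc_x5 x(1)]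
          inn_val[OF hids(1) H_De qc_mono[OF qc_De zero_sub[OF hids(1)]] x(1)]; simp add: pr_add)+
    then show "F (1,1,0) x2 \<in> J3" "F (0,1,1) x5 \<in> J3" "F (1,1,1) De \<in> J3"
      using tder_value[OF step2 F1 H_x2 F(2)[OF H_x2]] tder_value[OF step2 F1 H_x5 F(2)[OF H_x5]]
        tder_value[OF step2 F1 H_De F(2)[OF H_De]] hidD(3)[OF hids(1)] E(2-4) by blast+
  qed
  let ?t = "(1,-1,1) :: weight"
  have F35: "tder J35 ?t (g - 1,2 * g - 1,g) F"
    using tder_mono[OF step5 F1] Fv(2) stepD(3)[OF step5] by blast
  obtain x' where x': "x' \<in> H (g - 1,2 * g - 1,g)" "\<And>\<delta> u. u \<in> H \<delta> \<Longrightarrow> F \<delta> u - inn ?t x' \<delta> u \<in> J35"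
    by (rule inner_mod[OF step6 F35]) (use g in auto)
  obtain G where G: "tder J3 (?t - (1,-1,1)) ((g - 1,2 * g - 1,g) - (0,1,1)) G"
     "\<And>\<delta> u. u \<in> H \<delta> \<Longrightarrow> (F \<delta> u - inn ?t x' \<delta> u) - x5 * G \<delta> u \<in> J3"
    using divide_tder[OF step5 tder_minus_inn[OF F1 hids(1) x'(1)] x'(2)] by blast
  have w': "(?t - (1,-1,1)) = 0" "((g - 1,2 * g - 1,g) - (0,1,1) :: weight) = (int g',2 * int g',int g')"
    by (simp_all add: g_def)
  note G1 = G(1)[unfolded w']
  have Gv: "G (1,1,0) x2 \<in> J3" "G (0,1,1) x5 \<in> J3" "G (1,1,1) De \<in> J3"
  proof -
    have "inn ?t x' (1,1,0) x2 \<in> J3" "inn ?t x' (0,1,1) x5 \<in> J3" "inn ?t x' (1,1,1) De \<in> J3"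
      by (rule inn_val[OF hids(1) H_x2 qc_x2 x'(1)] inn_val[OF hids(1) H_x5 qc_x5 x'(1)]
          inn_val[OF hids(1) H_De qc_mono[OF qc_De zero_sub[OF hids(1)]] x'(1)]; simp)+
    then show "G (1,1,0) x2 \<in> J3" "G (0,1,1) x5 \<in> J3" "G (1,1,1) De \<in> J3"
      using tder_value[OF step5 G1 H_x2 G(2)[OF H_x2]] tder_value[OF step5 G1 H_x5 G(2)[OF H_x5]]
        tder_value[OF step5 G1 H_De G(2)[OF H_De]] hidD(3)[OF hids(1)] Fv by blast+
  qed
  obtain x'' where x'': "x'' \<in> H (int g',2 * int g',int g')" "\<And>\<delta> u. u \<in> H \<delta> \<Longrightarrow> G \<delta> u - inn 0 x'' \<delta> u \<in> J3"
    using Suc.IH[OF G1 Gv] by blast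
  let ?y = "x' + x5 * x''" and ?X = "x + x2 * (x' + x5 * x'')"
  have y: "?y \<in> H (g - 1,2 * g - 1,g)"
    by (intro H_closed(1) x' H_mult'[OF H_x5 x''(1)]) (simp add: g_def)
  have X: "?X \<in> H (g,2 * g,g)"
    by (intro H_closed(1) x H_mult'[OF H_x2 y]) simp
  have "E \<delta> u - inn 0 ?X \<delta> u \<in> J3" if u: "u \<in> H \<delta>" for \<delta> u
  proof -
    define p1 where "p1 = (E \<delta> u - inn 0 x \<delta> u) - x2 * F \<delta> u"
    define p2 where "p2 = (F \<delta> u - inn ?t x' \<delta> u) - x5 * G \<delta> u"
    define p3 where "p3 = G \<delta> u - inn 0 x'' \<delta> u"
    define p4 where "p4 = inn 0 ?X \<delta> u - (inn 0 x \<delta> u + x2 * inn (0 - (-1,1,-1)) ?y \<delta> u)"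
    define p5 where "p5 = inn ?t ?y \<delta> u - (inn ?t x' \<delta> u + x5 * inn (?t - (1,-1,1)) x'' \<delta> u)"
    have p: "p1 \<in> J3" "p2 \<in> J3" "p3 \<in> J3" "p4 \<in> J3" "p5 \<in> J3"
      unfolding p1_def p2_def p3_def p4_def p5_def
      using F(2)[OF u] G(2)[OF u] x''(2)[OF u] inn_compose[OF hids(1) qc_x2 H_S[OF y] u]
        inn_compose[OF hids(1) qc_x5 H_S[OF x''(1)] u] by blast+
    have "E \<delta> u - inn 0 ?X \<delta> u = p1 + x2 * p2 + x2 * (x5 * p3) - p4 - x2 * p5"
      unfolding p1_def p2_def p3_def p4_def p5_def w w' by (simp add: right_diff_distrib distrib_left)
    also have "\<dots> \<in> J3"
      by (intro hidD(3,4)[OF hids(1)] hidD(5)[OF hids(1) S_closed(8)] hidD(5)[OF hids(1) S_closed(11)] p)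
    finally show ?thesis .
  qed
  then show ?case using X unfolding g_def by blast
qed

section \<open>Homogeneous derivations\<close>

definition standard :: "weight \<Rightarrow> (weight \<Rightarrow> 'k lin \<Rightarrow> 'k lin) \<Rightarrow> bool" where
  "standard \<gamma> D \<longleftrightarrow> (\<exists>x\<in>H \<gamma>. \<exists>\<nu>1\<in>cen \<gamma>. \<exists>\<nu>4\<in>cen \<gamma>. \<exists>\<nu>6\<in>cen \<gamma>.
     \<forall>\<delta>. \<forall>u\<in>H \<delta>. D \<delta> u = inn 0 x \<delta> u + el \<nu>1 \<nu>4 \<nu>6 \<delta> u)"

lemma standardI: "x \<in> H \<gamma> \<Longrightarrow> \<nu>1 \<in> cen \<gamma> \<Longrightarrow> \<nu>4 \<in> cen \<gamma> \<Longrightarrow> \<nu>6 \<in> cen \<gamma> \<Longrightarrow>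
    (\<And>\<delta> u. u \<in> H \<delta> \<Longrightarrow> D \<delta> u = inn 0 x \<delta> u + el \<nu>1 \<nu>4 \<nu>6 \<delta> u) \<Longrightarrow> standard \<gamma> D"
  unfolding standard_def by blast

lemma el_0: "el 0 0 0 \<delta> u = 0"
  by (cases \<delta>) (simp add: el_simp)

lemma standard_add_el:
  assumes "standard \<gamma> (\<lambda>\<delta> u. D \<delta> u - el \<mu>1 \<mu>4 \<mu>6 \<delta> u)" "\<mu>1 \<in> cen \<gamma>" "\<mu>4 \<in> cen \<gamma>" "\<mu>6 \<in> cen \<gamma>"
  shows "standard \<gamma> D"
proof -
  obtain x \<nu>1 \<nu>4 \<nu>6 where *: "x \<in> H \<gamma>" "\<nu>1 \<in> cen \<gamma>" "\<nu>4 \<in> cen \<gamma>" "\<nu>6 \<in> cen \<gamma>"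
    "\<And>\<delta> u. u \<in> H \<delta> \<Longrightarrow> D \<delta> u - el \<mu>1 \<mu>4 \<mu>6 \<delta> u = inn 0 x \<delta> u + el \<nu>1 \<nu>4 \<nu>6 \<delta> u"
    using assms(1) unfolding standard_def by blast
  show ?thesis
  proof (rule standardI)
    show "D \<delta> u = inn 0 x \<delta> u + el (\<nu>1 + \<mu>1) (\<nu>4 + \<mu>4) (\<nu>6 + \<mu>6) \<delta> u" if "u \<in> H \<delta>" for \<delta> u
      using *(5)[OF that] by (simp add: el_add algebra_simps)
  qed (use * assms in \<open>auto intro: cen_closed\<close>)
qed

lemma inn0_val0: "y \<in> H \<eta> \<Longrightarrow> qc {0} y n \<Longrightarrow> x \<in> H \<gamma> \<Longrightarrow> pr n \<gamma> = 0 \<Longrightarrow> inn 0 x \<eta> y = 0"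
  using inn_val[OF hid0, of y \<eta> n x \<gamma> 0] by (simp add: pr_add)

definition fl :: "(weight \<Rightarrow> 'k lin \<Rightarrow> 'k lin) \<Rightarrow> weight \<Rightarrow> 'k lin \<Rightarrow> 'k lin" where
  "fl E \<delta> u = flip (E (flipw \<delta>) (flip u))"

lemma qe_flip: "qe (flipw t) \<delta> = qe t (flipw \<delta>)"
  using flipw_add(4)[of t "flipw \<delta>"] by (simp add: flipw_add)

lemma tder_flip:
  assumes E: "tder {0} t \<gamma> E"
  shows "tder {0} (flipw t) (flipw \<gamma>) (fl E)"
proof (rule tderI)
  fix \<delta> \<epsilon> :: weight and u v c assume u: "u \<in> H \<delta>"
  note S = H_S[OF u] flip_S[OF H_S[OF u]] H_S[OF tderD(1)[OF E flip_H[OF u]]]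
  show "fl E \<delta> u \<in> H (\<delta> + flipw \<gamma>)"
    using flip_H[OF tderD(1)[OF E flip_H[OF u]]] by (simp add: fl_def flipw_add)
  show "fl E \<delta> (u + v) - (fl E \<delta> u + fl E \<delta> v) \<in> {0}" if v: "v \<in> H \<delta>"
  proof -
    note Sv = H_S[OF v] H_S[OF tderD(1)[OF E flip_H[OF v]]]
    have "E (flipw \<delta>) (flip u + flip v) = E (flipw \<delta>) (flip u) + E (flipw \<delta>) (flip v)"
      using tderD(2)[OF E flip_H[OF u] flip_H[OF v]] by simp
    then show ?thesis using S Sv by (simp add: fl_def flip_simps)
  qed
  show "fl E \<delta> (sc c * u) - sc c * fl E \<delta> u \<in> {0}"
  proof -
    have "E (flipw \<delta>) (sc c * flip u) = sc c * E (flipw \<delta>) (flip u)"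
      using tderD(3)[OF E flip_H[OF u], of c] by simp
    then show ?thesis using S by (simp add: fl_def flip_sc)
  qed
  show "u \<in> {0} \<Longrightarrow> fl E \<delta> u \<in> {0}"
    using tderD(5)[OF E H_closed(4)] by (simp add: fl_def flip_simps)
  show "fl E (\<delta> + \<epsilon>) (u * v) - (fl E \<delta> u * v + sc (qe (flipw t) \<delta>) * (u * fl E \<epsilon> v)) \<in> {0}" if v: "v \<in> H \<epsilon>"
  proof -
    note Sv = H_S[OF v] flip_S[OF H_S[OF v]] H_S[OF tderD(1)[OF E flip_H[OF v]]]
    have "E (flipw \<delta> + flipw \<epsilon>) (flip u * flip v) = E (flipw \<delta>) (flip u) * flip v
        + sc (qe t (flipw \<delta>)) * (flip u * E (flipw \<epsilon>) (flip v))"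
      using tderD(4)[OF E flip_H[OF u] flip_H[OF v]] by simp
    then show ?thesis using S Sv
      by (simp add: fl_def flipw_add flip_simps(1,3,4) flip_sc S_closed flip_flip qe_flip)
  qed
qed

lemma flip_inn: "x \<in> S \<Longrightarrow> u \<in> S \<Longrightarrow> flip (inn t x (flipw \<delta>) (flip u)) = inn (flipw t) (flip x) \<delta> u"
  by (simp add: inn_def flip_simps(2,3,4) flip_sc S_closed flip_S flip_flip qe_flip)

text \<open>Apply \<open>E\<close> to the defining formula of \<open>z\<close>: as \<open>E\<close>
  kills \<open>z\<close> and \<open>x3\<close>, only a multiple of \<open>x3\<close> is left
  over.\<close>

lemma x2_x5_value:
  assumes E: "tder {0} 0 \<gamma> E" "E (1,1,1) x3 = 0" "E (1,2,1) z = 0"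
  shows "E (1,1,0) x2 * x5 + x2 * E (0,1,1) x5 \<in> J3"
proof -
  have q0: "qe 0 \<delta> = 1" for \<delta> by (simp add: pr_add)
  have h25: "x2 * x5 \<in> H (1,2,1)" and h34: "x3 * x4 \<in> H (1,2,1)"
    by (rule H_mult'[OF H_x2 H_x5], simp, rule H_mult'[OF H_x3 H_x(2)], simp)
  have e1: "E (1,2,1) (x2 * x5) = E (1,1,0) x2 * x5 + x2 * E (0,1,1) x5"
    using tderD(4)[OF E(1) H_x2 H_x5] by (simp add: pr_add sc_simps(2))
  have e2: "E (1,2,1) (x3 * x4) = x3 * E (0,1,0) x4"
    using tderD(4)[OF E(1) H_x3 H_x(2)] E(2) by (simp add: pr_add sc_simps(2))
  have e3: "E (1,2,1) (sc (- q) * (x3 * x4)) = sc (- q) * E (1,2,1) (x3 * x4)"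
    using tderD(3)[OF E(1) h34, of "- q"] by simp
  have "z = x2 * x5 + sc (- q) * (x3 * x4)" by (simp add: z_def sc_simps)
  then have "E (1,2,1) z = E (1,2,1) (x2 * x5) + E (1,2,1) (sc (- q) * (x3 * x4))"
    using tderD(2)[OF E(1) h25 H_closed(3)[OF h34], of "- q"] by simp
  then have "E (1,1,0) x2 * x5 + x2 * E (0,1,1) x5 = sc q * (x3 * E (0,1,0) x4)"
    using E(3) e1 e2 e3 by (simp add: sc_simps algebra_simps)
  also have "\<dots> \<in> J3"
    using H_S[OF tderD(1)[OF E(1) H_x(2)]] by (intro hidD(7)[OF hids(1)] hidD(6)[OF hids(1)] s3.y_in)
  finally show ?thesis .
qed

lemma standard_killing:
  "tder {0} 0 (a,b,a) D \<Longrightarrow> D (1,1,1) x3 = 0 \<Longrightarrow> D (1,1,1) De = 0 \<Longrightarrow> standard (a,b,a) D"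
proof (induction "nat (a + 1)" arbitrary: a b D rule: less_induct)
  case less
  note D = less.prems
  show ?case
  proof (cases "a < 0")
    case True
    show ?thesis
      by (rule standardI[of 0 _ 0 0 0])
        (use gens_negative[OF D(1) True] H_closed(4) cen_closed(1) in \<open>auto simp: inn_0 el_0\<close>)
  next
    case a: False
    show ?thesis
    proof (cases "b = 2 * a")
      case False
      have D0: "tder {0} (0,0,-0) (a,b,a) D" using D(1) by (simp add: zero_prod_def)
      obtain x F where x: "x \<in> H (a,b,a)" "tder {0} (0 + 1,0,-(0 + 1)) (a - 1,b - 1,a - 1) F" "F (1,1,1) x3 = 0"
        "\<And>\<delta> u. u \<in> H \<delta> \<Longrightarrow> D \<delta> u = inn (0,0,-0) x \<delta> u + x3 * F \<delta> u"
        by (rule x3_division[OF D0 D(2)]) (use False in auto)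
      have x4: "D \<delta> u = inn 0 x \<delta> u + x3 * F \<delta> u" if "u \<in> H \<delta>" for \<delta> u
        using x(4)[OF that] by (simp add: zero_prod_def)
      have "x3 * F (1,1,1) De = 0"
        using x4[OF H_De] D(3) inn0_val0[OF H_De qc_De x(1)] by simp
      then have FDe: "F (1,1,1) De = 0" using x3_cancel tderD(1)[OF x(2) H_De] by blast
      \<comment> \<open>\<open>F\<close> has twist \<open>(1,0,-1)\<close>; its mirror image has
        twist \<open>(-1,0,1)\<close>, so \<open>x3_division\<close> applies with parameter -1.
        Flipping back turns this second division by \<open>x3\<close> into one by \<open>De\<close>
        and restores the trivial twist.\<close>
      have ff: "tder {0} (-1,0,-(-1)) (a - 1,b - 1,a - 1) (fl F)"
        using tder_flip[OF x(2)] by simp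
      have fv: "fl F (1,1,1) x3 = 0" "fl F (1,1,1) De = 0"
        using FDe x(3) by (simp_all add: fl_def De_def[symmetric] flip_De flip_simps)
      obtain x' G where x': "x' \<in> H (a - 1,b - 1,a - 1)" "tder {0} (-1 + 1,0,-(-1 + 1)) (a - 1 - 1,b - 1 - 1,a - 1 - 1) G"
        "G (1,1,1) x3 = 0" "\<And>\<delta> u. u \<in> H \<delta> \<Longrightarrow> fl F \<delta> u = inn (-1,0,-(-1)) x' \<delta> u + x3 * G \<delta> u"
        by (rule x3_division[OF ff fv(1)]) (use False in auto)
      have G: "tder {0} 0 (a - 2,b - 2,a - 2) G" using x'(2) by (simp add: zero_prod_def)
      have "inn (-1,0,-(-1)) x' (1,1,1) De = 0"
        using inn_val[OF hid0 H_De qc_De x'(1), of "(-1,0,-(-1))"] by simp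
      then have "x3 * G (1,1,1) De = 0" using x'(4)[OF H_De] fv(2) by simp
      then have GDe: "G (1,1,1) De = 0" using x3_cancel tderD(1)[OF G H_De] by blast
      define D1 where "D1 = fl G"
      have D1: "tder {0} 0 (a - 2,b - 2,a - 2) D1" "D1 (1,1,1) x3 = 0" "D1 (1,1,1) De = 0"
        using tder_flip[OF G] GDe x'(3) unfolding D1_def
        by (simp_all add: flipw_add fl_def De_def[symmetric] flip_De flip_simps)
      have F: "F \<delta> u = inn (1,0,-1) (flip x') \<delta> u + De * D1 \<delta> u" if u: "u \<in> H \<delta>" for \<delta> u
      proof -
        have fu: "flip u \<in> H (flipw \<delta>)" using u by (rule flip_H)
        have "F \<delta> u = flip (fl F (flipw \<delta>) (flip u))"
          using flip_flip[OF H_S[OF u]] flip_flip[OF H_S[OF tderD(1)[OF x(2) u]]] by (simp add: fl_def flipw_add)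
        also have "\<dots> = flip (inn (-1,0,-(-1)) x' (flipw \<delta>) (flip u) + x3 * G (flipw \<delta>) (flip u))"
          by (simp only: x'(4)[OF fu])
        also have "\<dots> = flip (inn (-1,0,-(-1)) x' (flipw \<delta>) (flip u)) + flip (x3 * G (flipw \<delta>) (flip u))"
          by (intro flip_simps(1) S_closed H_S[OF inn_H[OF x'(1) fu]] H_S[OF tderD(1)[OF G fu]])
        also have "flip (inn (-1,0,-(-1)) x' (flipw \<delta>) (flip u)) = inn (1,0,-1) (flip x') \<delta> u"
          using flip_inn[OF H_S[OF x'(1)] H_S[OF u], of "(-1,0,-(-1))" \<delta>] by simp
        also have "flip (x3 * G (flipw \<delta>) (flip u)) = De * D1 \<delta> u"
          using H_S[OF tderD(1)[OF G fu]] by (simp add: flip_simps S_closed De_def D1_def fl_def)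
        finally show ?thesis .
      qed
      have "standard (a - 2,b - 2,a - 2) D1"
        using less.hyps[OF _ D1] a by simp
      then obtain y \<nu>1 \<nu>4 \<nu>6 where y: "y \<in> H (a - 2,b - 2,a - 2)" "\<nu>1 \<in> cen (a - 2,b - 2,a - 2)"
        "\<nu>4 \<in> cen (a - 2,b - 2,a - 2)" "\<nu>6 \<in> cen (a - 2,b - 2,a - 2)"
        "\<And>\<delta> u. u \<in> H \<delta> \<Longrightarrow> D1 \<delta> u = inn 0 y \<delta> u + el \<nu>1 \<nu>4 \<nu>6 \<delta> u"
        unfolding standard_def by blast
      have fx: "flip x' \<in> H (a - 1,b - 1,a - 1)" using flip_H[OF x'(1)] by simp
      have Dey: "De * y \<in> H (a - 1,b - 1,a - 1)" by (rule H_mult'[OF H_De y(1)]) simp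
      have Y: "flip x' + De * y \<in> H (a - 1,b - 1,a - 1)" by (rule H_closed(1)[OF fx Dey])
      have pc: "x3 * (De * u) = u * (x3 * De)" if "u \<in> H \<delta>" for u \<delta>
      proof -
        obtain i j k where d: "\<delta> = (i,j,k)" by (cases \<delta>)
        have e1: "De * u = sc (q powi (i - k)) * (u * De)" using qcD[OF qc_De that] by (simp add: d)
        have e2: "x3 * u = sc (q powi (k - i)) * (u * x3)" using qcD[OF qc_x3 that] by (simp add: d)
        have qq: "q powi (i - k) * q powi (k - i) = 1" using q_nz by (simp flip: power_int_add)
        have "x3 * (De * u) = sc (q powi (i - k)) * ((x3 * u) * De)" by (simp add: e1 sc_left mult.assoc)
        also have "\<dots> = u * (x3 * De)" by (simp add: e2 sc_merge mult.assoc qq sc_simps(2))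
        finally show ?thesis .
      qed
      have cen: "x3 * (De * \<nu>) \<in> cen (a,b,a)" if \<nu>: "\<nu> \<in> cen (a - 2,b - 2,a - 2)" for \<nu>
      proof (rule cenI)
        have De\<nu>: "De * \<nu> \<in> H (a - 1,b - 1,a - 1)" by (rule H_mult'[OF H_De cenD(1)[OF \<nu>]]) simp
        show "x3 * (De * \<nu>) \<in> H (a,b,a)" by (rule H_mult'[OF H_x3 De\<nu>]) simp
        fix u assume "u \<in> S"
        then show "x3 * (De * \<nu>) * u = u * (x3 * (De * \<nu>))"
        proof (induction u rule: hom_induct)
          case (hom \<delta> u)
          have "x3 * (De * \<nu>) * u = (x3 * (De * u)) * \<nu>"
            using cenD(3)[OF \<nu> H_S[OF hom]] by (simp add: mult.assoc)
          then show ?case unfolding pc[OF hom] by (simp add: mult.assoc)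
        qed (simp add: distrib_left distrib_right)
      qed
      show ?thesis
      proof (rule standardI)
        show "x + x3 * (flip x' + De * y) \<in> H (a,b,a)"
          by (intro H_closed(1) x(1) H_mult'[OF H_x3 Y]) simp
        show "x3 * (De * \<nu>1) \<in> cen (a,b,a)" "x3 * (De * \<nu>4) \<in> cen (a,b,a)" "x3 * (De * \<nu>6) \<in> cen (a,b,a)"
          using y cen by blast+
        fix \<delta> u assume u: "u \<in> H \<delta>"
        have w: "(0 - (-1,0,1) :: weight) = (1,0,-1)" "((1,0,-1) - (1,0,-1) :: weight) = 0"
          by (simp_all add: zero_prod_def)
        have "D \<delta> u = inn 0 x \<delta> u + x3 * (inn (1,0,-1) (flip x') \<delta> u + De * (inn 0 y \<delta> u + el \<nu>1 \<nu>4 \<nu>6 \<delta> u))"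
          by (simp only: x4[OF u] F[OF u] y(5)[OF u])
        also have "\<dots> = inn 0 x \<delta> u + x3 * (inn (1,0,-1) (flip x') \<delta> u + De * inn 0 y \<delta> u)
            + el (x3 * (De * \<nu>1)) (x3 * (De * \<nu>4)) (x3 * (De * \<nu>6)) \<delta> u"
          by (simp only: el_mult distrib_left add.assoc)
        also have "inn (1,0,-1) (flip x') \<delta> u + De * inn 0 y \<delta> u = inn (1,0,-1) (flip x' + De * y) \<delta> u"
          using inn_compose0[OF qc_De H_S[OF y(1)] u, of "(1,0,-1)" "flip x'"] unfolding w by simp
        also have "inn 0 x \<delta> u + x3 * inn (1,0,-1) (flip x' + De * y) \<delta> u = inn 0 (x + x3 * (flip x' + De * y)) \<delta> u"
          using inn_compose0[OF qc_x3 H_S[OF Y] u, of 0 x] unfolding w by simp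
        finally show "D \<delta> u = inn 0 (x + x3 * (flip x' + De * y)) \<delta> u
            + el (x3 * (De * \<nu>1)) (x3 * (De * \<nu>4)) (x3 * (De * \<nu>6)) \<delta> u" .
      qed
    next
      case b: True
      define g where "g = nat a"
      have g: "a = int g" "b = 2 * int g" using a b by (simp_all add: g_def)
      note D = D[unfolded g]
      let ?\<gamma> = "(int g,2 * int g,int g)"
      have zc: "sc c * z ^ g \<in> cen ?\<gamma>" for c by (intro cen_closed(3) z_pow_cen)
      have "qc {0} (D (1,2,1) z) (0,0,0)"
        unfolding qc_def
      proof (intro allI ballI)
        fix \<delta> u assume u: "u \<in> H \<delta>"
        show "D (1,2,1) z * u - sc (qe (0,0,0) \<delta>) * (u * D (1,2,1) z) \<in> {0}"
          using key1[OF hid0 D(1) H_z qc_z u] by (cases \<delta>) (simp add: sc_simps pr_add)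
      qed
      moreover have "D (1,2,1) z \<in> H (int (Suc g),2 * int (Suc g),int (Suc g))"
        using tderD(1)[OF D(1) H_z] by simp
      ultimately obtain \<beta> where \<beta>: "D (1,2,1) z = sc \<beta> * z ^ Suc g"
        using central_exceptional[of _ "Suc g"] by blast
      \<comment> \<open>\<open>x3\<close> and \<open>De\<close> have weight \<open>(1,1,1)\<close>
        and \<open>z\<close> has weight \<open>(1,2,1)\<close>. The coefficients -1, 1, 0 therefore
        add up to 0 on the first two and to 1 on \<open>z\<close>, which removes the value on
        \<open>z\<close> without reviving those on \<open>x3\<close> and \<open>De\<close>.\<close>
      define D' where "D' = (\<lambda>\<delta> u. D \<delta> u - el (sc (- \<beta>) * z ^ g) (sc \<beta> * z ^ g) (sc 0 * z ^ g) \<delta> u)"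
      have D': "tder {0} 0 ?\<gamma> D'" unfolding D'_def by (intro tder_diff[OF hid0 D(1)] tder_el zc)
      have two: "scl (\<beta> * 2) w = scl \<beta> w + scl \<beta> w" for w by (simp only: mult_2_right[of \<beta>] scl_simps)
      have D'v: "D' (1,1,1) x3 = 0" "D' (1,1,1) De = 0" "D' (1,2,1) z = 0"
        using D(2,3) \<beta> two by (simp_all add: D'_def el_simp ring_norm power_commutes)
      have D'3: "tder J3 0 ?\<gamma> D'" by (rule tder_J3[OF D' D'v(1)])
      let ?b = "D' (1,1,0) x2"
      have b: "?b \<in> H ((int g,2 * int g,int g) + (1,1,0))"
        using tderD(1)[OF D' H_x2] by (simp add: add.commute)
      \<comment> \<open>Modulo \<open>J32\<close> the Leibniz rule for \<open>x2 * x5\<close> leaves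
        only \<open>?b * x5\<close>. Since \<open>x5\<close> is normal and regular there,
        \<open>?b\<close> is a multiple of \<open>x2\<close> modulo \<open>J3\<close>, and the
        cofactor is central modulo \<open>J3\<close>.\<close>
      have "?b * x5 + x2 * D' (0,1,1) x5 \<in> J32"
        using x2_x5_value[OF D' D'v(1,3)] stepD(3)[OF step2] by blast
      moreover have "x2 * D' (0,1,1) x5 \<in> J32"
        by (rule hidD(6)[OF hids(2) H_S[OF tderD(1)[OF D' H_x5]] s2.y_in])
      ultimately have "?b * x5 + x2 * D' (0,1,1) x5 - x2 * D' (0,1,1) x5 \<in> J32" by (rule hidD(3)[OF hids(2)])
      then have "sc c * (?b * x5) \<in> J32" for c by (intro hidD(7)[OF hids(2)]) simp
      then have "x5 * ?b \<in> J32"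
        using hid_cong[OF hids(2)] qcD[OF qc_x5 b] stepD(3)[OF step2] by blast
      then have "?b \<in> J32" by (rule stepD(11)[OF step2 b])
      then obtain \<mu> where \<mu>: "\<mu> \<in> H ?\<gamma>" "?b - x2 * \<mu> \<in> J3" using stepD(12)[OF step2 b] by blast
      have "qc J3 ?b (-1,1,-1)"
        unfolding qc_def
      proof (intro allI ballI)
        fix \<delta> u assume u: "u \<in> H \<delta>"
        show "?b * u - sc (qe (-1,1,-1) \<delta>) * (u * ?b) \<in> J3"
          using key1[OF hids(1) D'3 H_x2 qc_x2 u] by (simp add: pr_add sc_simps(1))
      qed
      from qc_divide[OF step2 this \<mu>(2,1)] have "qc J3 \<mu> (0,0,0)" by (simp add: zero_prod_def)
      then obtain \<beta>' where \<beta>': "\<mu> - sc \<beta>' * z ^ g \<in> J3" using central_mod[OF \<mu>(1)] by blast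
      \<comment> \<open>The coefficients 1, 0, -1 sum to zero on the weights of \<open>x3\<close>,
        \<open>De\<close> and \<open>z\<close> and to 1 on that of \<open>x2\<close>. Only the value
        on \<open>x2\<close> still to be removed is affected, together with that on
        \<open>x5\<close>, which the relation for \<open>x2 * x5\<close> then controls.\<close>
      define D'' where "D'' = (\<lambda>\<delta> u. D' \<delta> u - el (sc \<beta>' * z ^ g) (sc 0 * z ^ g) (sc (- \<beta>') * z ^ g) \<delta> u)"
      have D'': "tder {0} 0 ?\<gamma> D''" unfolding D''_def by (intro tder_diff[OF hid0 D'] tder_el zc)
      have D''v: "D'' (1,1,1) x3 = 0" "D'' (1,1,1) De = 0" "D'' (1,2,1) z = 0"
        using D'v by (simp_all add: D''_def el_simp ring_norm)
      have D''3: "tder J3 0 ?\<gamma> D''" by (rule tder_J3[OF D'' D''v(1)])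
      have "D'' (1,1,0) x2 = (?b - x2 * \<mu>) + x2 * (\<mu> - sc \<beta>' * z ^ g)"
        by (simp add: D''_def el_simp ring_norm z_pow_comm[OF S_closed(8)])
      also have "\<dots> \<in> J3" by (intro hidD(4)[OF hids(1)] hidD(5)[OF hids(1) S_closed(8)] \<mu> \<beta>')
      finally have v2: "D'' (1,1,0) x2 \<in> J3" .
      have "D'' (1,1,0) x2 * x5 + x2 * D'' (0,1,1) x5 - D'' (1,1,0) x2 * x5 \<in> J3"
        by (intro hidD(3)[OF hids(1)] x2_x5_value[OF D'' D''v(1,3)] hidD(6)[OF hids(1) S_closed(11) v2])
      then have v5: "D'' (0,1,1) x5 \<in> J3"
        using stepD(10)[OF step2 tderD(1)[OF D'' H_x5]] by simp
      obtain x where x: "x \<in> H ?\<gamma>" "\<And>\<delta> u. u \<in> H \<delta> \<Longrightarrow> D'' \<delta> u - inn 0 x \<delta> u \<in> J3"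
        using inner_mod_x3[OF D''3 v2 v5] D''v(2) hidD(2)[OF hids(1)] by auto
      obtain F where F: "tder {0} (0 - (-1,0,1)) (?\<gamma> - (1,1,1)) F"
        "\<And>\<delta> u. u \<in> H \<delta> \<Longrightarrow> (D'' \<delta> u - inn 0 x \<delta> u) - x3 * F \<delta> u \<in> {0}"
        using divide_tder[OF step3 tder_minus_inn[OF D'' hid0 x(1)] x(2)] by blast
      have w: "(0 - (-1,0,1) :: weight) = (1,0,-1)" "(?\<gamma> - (1,1,1)) = (int g - 1,2 * (int g - 1) + 1,int g - 1)"
        by (simp_all add: zero_prod_def)
      have F1: "tder {0} (1,0,-1) (int g - 1,2 * (int g - 1) + 1,int g - 1) F" using F(1) unfolding w .
      have "F (1,1,1) x3 = 0"
        using tder_value[OF step3 F1 H_x3 F(2)[OF H_x3]] D''v(1) inn0_val0[OF H_x3 qc_x3 x(1)] by simp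
      \<comment> \<open>Division by \<open>x3\<close> has led to the case \<open>n = 1\<close> of
        the nonresonant family.\<close>
      then obtain x' where x': "x' \<in> H (int g - 1,2 * (int g - 1) + 1,int g - 1)"
        "\<And>\<delta> u. u \<in> H \<delta> \<Longrightarrow> F \<delta> u = inn (1,0,-1) x' \<delta> u"
        using twisted_inner[OF _ F1] by auto
      have "standard ?\<gamma> D''"
      proof (rule standardI[OF _ cen_closed(1) cen_closed(1) cen_closed(1)])
        show "x + x3 * x' \<in> H ?\<gamma>" by (intro H_closed(1) x(1) H_mult'[OF H_x3 x'(1)]) simp
        fix \<delta> u assume u: "u \<in> H \<delta>"
        show "D'' \<delta> u = inn 0 (x + x3 * x') \<delta> u + el 0 0 0 \<delta> u"
          using F(2)[OF u] x'(2)[OF u] inn_compose0[OF qc_x3 H_S[OF x'(1)] u, of 0 x]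
          by (simp add: el_0 w algebra_simps)
      qed
      then have "standard ?\<gamma> D'" unfolding D''_def by (rule standard_add_el) (rule zc)+
      then have "standard ?\<gamma> D" unfolding D'_def by (rule standard_add_el) (rule zc)+
      then show ?thesis by (simp only: g)
    qed
  qed
qed

lemma flip_cen: "\<nu> \<in> cen \<gamma> \<Longrightarrow> flip \<nu> \<in> cen (flipw \<gamma>)"
  using flip_H[of \<nu> \<gamma>] qc_flip[of \<nu> "(0,0,0)"] H_S[of \<nu> \<gamma>] by (simp add: cen_def)

text \<open>In this weight the two scalars of \<open>key1\<close> agree, so the value on
  \<open>x3\<close> q-commutes like \<open>x3\<close> and is divisible by it; the quotient then has
  trivial character.\<close>

lemma x3_value:
  assumes D: "tder {0} 0 (a,b,a) D"
  shows "\<exists>\<mu>\<in>cen (a,b,a). D (1,1,1) x3 = x3 * \<mu>"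
proof -
  have H: "D (1,1,1) x3 \<in> H (1 + a,1 + b,1 + a)" using tderD(1)[OF D H_x3] by simp
  have c: "qc {0} (D (1,1,1) x3) (-1,0,1)"
    unfolding qc_def
  proof (intro allI ballI)
    fix \<delta> u assume u: "u \<in> H \<delta>"
    show "D (1,1,1) x3 * u - sc (qe (-1,0,1) \<delta>) * (u * D (1,1,1) x3) \<in> {0}"
      using key1[OF hid0 D H_x3 qc_x3 u] by (simp add: pr_add sc_simps(1))
  qed
  obtain \<mu> where \<mu>: "\<mu> \<in> H (1 + a - 1,1 + b - 1,1 + a - 1)" "D (1,1,1) x3 = x3 * \<mu>" "qc {0} \<mu> ((-1,0,1) - (-1,0,1))"
    by (rule div_x3[OF H c like_x3[OF H c]])
  then have "\<mu> \<in> cen (a,b,a)" by (simp add: cen_def zero_prod_def)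
  then show ?thesis using \<mu>(2) by blast
qed

lemma x3_De_values:
  assumes D: "tder {0} 0 (a,b,a) D"
  obtains \<mu> where "\<mu> \<in> cen (a,b,a)" "D (1,1,1) x3 = x3 * \<mu>" "D (1,1,1) De = De * \<mu>"
proof -
  obtain \<mu> where \<mu>: "\<mu> \<in> cen (a,b,a)" "D (1,1,1) x3 = x3 * \<mu>" using x3_value[OF D] by blast
  have "tder {0} 0 (a,b,a) (fl D)" using tder_flip[OF D] by (simp add: flipw_add)
  then obtain \<rho> where \<rho>: "\<rho> \<in> cen (a,b,a)" "fl D (1,1,1) x3 = x3 * \<rho>" using x3_value by blast
  define \<mu>' where "\<mu>' = flip \<rho>"
  have \<mu>': "\<mu>' \<in> cen (a,b,a)" using flip_cen[OF \<rho>(1)] by (simp add: \<mu>'_def)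
  have "flip (fl D (1,1,1) x3) = De * \<mu>'"
    using H_S[OF cenD(1)[OF \<rho>(1)]] by (simp add: \<rho>(2) flip_simps S_closed De_def \<mu>'_def)
  then have De: "D (1,1,1) De = De * \<mu>'"
    using flip_flip[OF H_S[OF tderD(1)[OF D H_De]]] by (simp add: fl_def De_def[symmetric])
  obtain A B where AB: "A \<in> H (0,1,1)" "B \<in> H (0,0,1)" "De = sc (q * q) * x3 + x1 * A + x2 * B"
    using De_P by blast
  have h: "x1 * A \<in> H (1,1,1)" "x2 * B \<in> H (1,1,1)" "sc (q * q) * x3 \<in> H (1,1,1)"
    by (rule H_mult'[OF H_x(1) AB(1)], simp, rule H_mult'[OF H_x2 AB(2)], simp, rule H_closed(3)[OF H_x3])
  note S = H_S[OF cenD(1)[OF \<mu>(1)]] H_S[OF cenD(1)[OF \<mu>'(1)]] H_S[OF AB(1)] H_S[OF AB(2)]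
  have "D (1,1,1) De = D (1,1,1) (sc (q * q) * x3) + D (1,1,1) (x1 * A) + D (1,1,1) (x2 * B)"
    unfolding AB(3) using tderD(2)[OF D H_closed(1)[OF h(3,1)] h(2)] tderD(2)[OF D h(3,1)] by simp
  moreover have "D (1,1,1) (sc (q * q) * x3) = sc (q * q) * (x3 * \<mu>)"
    using tderD(3)[OF D H_x3, of "q * q"] \<mu>(2) by simp
  moreover have "D (1,1,1) (x1 * A) = D (1,0,0) x1 * A + x1 * D (0,1,1) A"
    using tderD(4)[OF D H_x(1) AB(1)] by (simp add: pr_add sc_simps(2))
  moreover have "D (1,1,1) (x2 * B) = D (1,1,0) x2 * B + x2 * D (0,0,1) B"
    using tderD(4)[OF D H_x2 AB(2)] by (simp add: pr_add sc_simps(2))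
  ultimately have 1: "De * \<mu>' = sc (q * q) * (x3 * \<mu>) + (D (1,0,0) x1 * A + x1 * D (0,1,1) A) + (D (1,1,0) x2 * B + x2 * D (0,0,1) B)"
    using De by simp
  \<comment> \<open>A weight \<open>(a,b,a)\<close> preserves the excess of the first coordinate
    over the third, and this alone places the images of \<open>x1\<close> and \<open>x2\<close> in
    \<open>P\<close>. Modulo \<open>P\<close>, applying \<open>D\<close> to the formula for
    \<open>De\<close> thus compares only the two eigenvalues.\<close>
  have "D (1,0,0) x1 \<in> P" "D (1,1,0) x2 \<in> P"
    using P_weight[of _ "1 + a" b a] P_weight[of _ "1 + a" "1 + b" a] tderD(1)[OF D H_x(1)] tderD(1)[OF D H_x2] by simp_all
  then have P1: "(D (1,0,0) x1 * A + x1 * D (0,1,1) A) + (D (1,1,0) x2 * B + x2 * D (0,0,1) B) \<in> P"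
    using S H_S[OF tderD(1)[OF D AB(1)]] H_S[OF tderD(1)[OF D AB(2)]] by (intro P_add P_right P_gens)
  have P2: "x1 * (A * (- \<mu>')) + x2 * (B * (- \<mu>')) \<in> P"
    using S S_closed(2)[OF S_closed(5) S(2)] by (intro P_add P_gens S_closed) simp_all
  let ?\<nu> = "\<mu>' - \<mu>"
  have "sc (q * q) * (x3 * ?\<nu>) = (D (1,0,0) x1 * A + x1 * D (0,1,1) A) + (D (1,1,0) x2 * B + x2 * D (0,0,1) B)
      + (x1 * (A * (- \<mu>')) + x2 * (B * (- \<mu>')))"
    using 1 unfolding AB(3) by (simp add: algebra_simps)
  also have "\<dots> \<in> P" by (rule P_add[OF P1 P2])
  finally have 2: "sc (q * q) * (x3 * ?\<nu>) \<in> P" .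
  have cen: "?\<nu> \<in> cen (a,b,a)" by (rule cen_closed(4)[OF \<mu>' \<mu>(1)])
  have "?\<nu> \<in> P"
  proof (rule P_crit[OF H_S[OF cenD(1)[OF cen]]])
    fix c d e f
    have "app (sc (q * q) * (x3 * ?\<nu>)) vac (0,0,c + 1,d,e,f) = q * q * app ?\<nu> vac (0,0,c,d,e,f)"
      by (simp only: times_lin.rep_eq app_sc app_x3) simp
    then show "app ?\<nu> vac (0,0,c,d,e,f) = 0" using P_vac[OF 2] q_nz by simp
  qed
  then have "?\<nu> = 0" using central_P cenD[OF cen] by blast
  then show ?thesis using that[OF \<mu>] De by simp
qed

theorem tder_standard:
  assumes D: "tder {0} 0 \<gamma> D"
  shows "standard \<gamma> D"
proof -
  obtain a b c where \<gamma>: "\<gamma> = (a,b,c)" by (cases \<gamma>)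
  show ?thesis
  proof (cases "a = c")
    case False
    obtain x where x: "x \<in> H \<gamma>" "\<And>\<delta> u. u \<in> H \<delta> \<Longrightarrow> D \<delta> u - inn 0 x \<delta> u \<in> {0}"
      by (rule inner_mod[OF step3 D]) (use False \<gamma> in \<open>auto simp: pr_add\<close>)
    then show ?thesis
      by (intro standardI[OF x(1) cen_closed(1) cen_closed(1) cen_closed(1)]) (simp add: el_0)
  next
    case True
    note D = D[unfolded \<gamma>, folded True]
    obtain \<mu> where \<mu>: "\<mu> \<in> cen (a,b,a)" "D (1,1,1) x3 = x3 * \<mu>" "D (1,1,1) De = De * \<mu>"
      by (rule x3_De_values[OF D])
    let ?D = "\<lambda>\<delta> u. D \<delta> u - el \<mu> 0 0 \<delta> u"
    have "standard (a,b,a) ?D"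
    proof (rule standard_killing)
      show "tder {0} 0 (a,b,a) ?D" by (intro tder_diff[OF hid0 D] tder_el \<mu> cen_closed)
      show "D (1,1,1) x3 - el \<mu> 0 0 (1,1,1) x3 = 0" "D (1,1,1) De - el \<mu> 0 0 (1,1,1) De = 0"
        using \<mu>(2,3) cenD(3)[OF \<mu>(1) S_closed(9)] cenD(3)[OF \<mu>(1) De_S] by (simp_all add: el_simp sc_simps(2))
    qed
    then have "standard (a,b,a) D"
      by (rule standard_add_el) (intro \<mu> cen_closed)+
    then show ?thesis using \<gamma> True by simp
  qed
qed

subsection \<open>Uniqueness\<close>

lemma z_reg: "u \<in> H (a,b,c) \<Longrightarrow> z * u = 0 \<Longrightarrow> u = 0"
proof (induction "nat (a + 1)" arbitrary: a b c u rule: less_induct)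
  case less
  show ?case
  proof (cases "a < 0")
    case True
    then show ?thesis using H_neg less.prems(1) by blast
  next
    case False
    have "x2 * (x5 * u) = z * u - (z - x2 * x5) * u" by (simp add: left_diff_distrib mult.assoc)
    also have "\<dots> \<in> J3"
      using less.prems(2) hidD(2)[OF hids(1)] by (intro hidD(3)[OF hids(1)] hidD(6)[OF hids(1) H_S[OF less.prems(1)] z_mod]) simp
    finally have "x5 * u \<in> J3" by (rule stepD(10)[OF step2 H_mult[OF H_x5 less.prems(1)]])
    then have "u \<in> J3" by (rule stepD(10)[OF step5 less.prems(1)])
    moreover have "u \<in> H ((a - 1,b - 1,c - 1) + (1,1,1))" using less.prems(1) by simp
    ultimately obtain s where s: "s \<in> H (a - 1,b - 1,c - 1)" "u - x3 * s \<in> {0}"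
      using stepD(12)[OF step3] by blast
    have "x3 * (z * s) = z * (x3 * s)" using z_comm[OF S_closed(9)] by (simp flip: mult.assoc)
    also have "\<dots> = 0" using s(2) less.prems(2) by simp
    finally have "z * s = 0" using x3_cancel H_mult[OF H_z s(1)] by blast
    then have "s = 0" using less.hyps[OF _ s(1)] False by simp
    then show ?thesis using s(2) by simp
  qed
qed

lemma z_pow_notin: "z ^ n \<notin> J3"
proof (induction n)
  case 0
  show ?case using one_notin_J3 by simp
next
  case (Suc n)
  show ?case
  proof
    assume *: "z ^ Suc n \<in> J3"
    have "x2 * (x5 * z ^ n) = z ^ Suc n - (z - x2 * x5) * z ^ n" by (simp add: left_diff_distrib mult.assoc)
    also have "\<dots> \<in> J3" by (intro hidD(3)[OF hids(1) *] hidD(6)[OF hids(1) H_S[OF H_z_pow] z_mod])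
    finally have "x5 * z ^ n \<in> J3" by (rule stepD(10)[OF step2 H_mult[OF H_x5 H_z_pow]])
    then show False using stepD(10)[OF step5 H_z_pow] Suc by blast
  qed
qed

text \<open>Off resonance the twisted commutator of \<open>x\<close> with \<open>x2\<close> is a
  nonzero multiple of \<open>x2 * x\<close> modulo \<open>J3\<close>.\<close>

lemma inner_x2_divide:
  assumes x: "x \<in> H (a,b,a)" and i: "inn (n,0,-n) x (1,1,0) x2 \<in> J3" and ne: "2 * a - b \<noteq> n"
  obtains s where "s \<in> H (a - 1,b - 1,a - 1)" "x = x3 * s"
proof -
  let ?t = "(n,0,-n)"
  define p where "p = x2 * x - sc (qe (-1,1,-1) (a,b,a)) * (x * x2)"
  have p: "p \<in> J3" unfolding p_def by (rule qcD[OF qc_x2 x])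
  let ?k = "inverse (qe (-1,1,-1) (a,b,a)) - qe ?t (1,1,0)"
  have nz: "q powi n * inverse (q powi n) = 1" for n using q_nz by simp
  have "sc ?k * (x2 * x) = inn ?t x (1,1,0) x2 + sc (inverse (qe (-1,1,-1) (a,b,a))) * p"
    unfolding p_def inn_def using nz by (simp add: ring_norm)
  also have "\<dots> \<in> J3" by (intro hidD(4)[OF hids(1) i] hidD(7)[OF hids(1)] p)
  finally have "sc ?k * (x2 * x) \<in> J3" .
  moreover have "inverse (qe (-1,1,-1) (a,b,a)) = q powi (2 * a - b)" by (simp add: power_int_minus[symmetric])
  then have "?k \<noteq> 0" using ne by simp
  ultimately have "x2 * x \<in> J3" by (rule hid_sc[OF hids(1)])
  then have "x \<in> J3" by (rule stepD(10)[OF step2 x])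
  moreover have "x \<in> H ((a - 1,b - 1,a - 1) + (1,1,1))" using x by simp
  ultimately obtain s where "s \<in> H (a - 1,b - 1,a - 1)" "x - x3 * s \<in> {0}"
    using stepD(12)[OF step3] by blast
  then show ?thesis using that by simp
qed

text \<open>No nonzero central multiple of the difference of \<open>D1\<close> and
  \<open>D6\<close>, with which \<open>standard_unique\<close> is left, is inner. Off resonance
  \<open>\<nu>\<close> is divisible by \<open>x3 * De\<close>, the value on \<open>x2\<close> forces
  \<open>x\<close> to be so as well, and cancelling lowers the weight.\<close>

lemma not_inner:
  "x \<in> H (a,b,a) \<Longrightarrow> \<nu> \<in> cen (a,b,a) \<Longrightarrow> (\<And>\<delta> u. u \<in> H \<delta> \<Longrightarrow> inn 0 x \<delta> u = sc (of_int (pr (1,0,-1) \<delta>)) * (\<nu> * u)) \<Longrightarrow> \<nu> = 0"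
proof (induction "nat (a + 1)" arbitrary: a b x \<nu> rule: less_induct)
  case less
  note x = less.prems(1) and \<nu> = less.prems(2) and eq = less.prems(3)
  show ?case
  proof (cases "a < 0")
    case True
    then show ?thesis using H_neg cenD(1)[OF \<nu>] by blast
  next
    case a: False
    have x2: "inn 0 x (1,1,0) x2 = x2 * \<nu>"
      using eq[OF H_x2] cenD(3)[OF \<nu> S_closed(8)] by (simp add: sc_simps(2))
    show ?thesis
    proof (cases "b = 2 * a")
      case True
      \<comment> \<open>At the resonance every inner derivation kills \<open>x2\<close> modulo
        \<open>J3\<close>, whereas \<open>x2 * \<nu>\<close> stays nonzero there because
        \<open>\<nu>\<close> is a multiple of a power of \<open>z\<close>.\<close>
      have "inn 0 x (1,1,0) x2 \<in> J3"
        by (rule inn_val[OF hids(1) H_x2 qc_x2 x]) (simp add: True pr_add)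
      then have "\<nu> \<in> J3" using x2 stepD(10)[OF step2 cenD(1)[OF \<nu>]] by simp
      moreover obtain \<beta> where \<beta>: "\<nu> = sc \<beta> * z ^ nat a"
        using central_exceptional[of \<nu> "nat a"] cenD[OF \<nu>] a True by auto
      ultimately have "\<beta> = 0" using hid_sc[OF hids(1)] z_pow_notin by blast
      then show ?thesis using \<beta> by (simp add: sc_simps)
    next
      case False
      obtain \<nu>' where \<nu>': "\<nu>' \<in> H (a - 2,b - 2,a - 2)" "qc {0} \<nu>' (0,0,0)" "\<nu> = x3 * (De * \<nu>')"
        by (rule central_generic[OF cenD(1,2)[OF \<nu>] False])
      have cen': "\<nu>' \<in> cen (a - 2,b - 2,a - 2)" using \<nu>' by (simp add: cen_def)
      note \<nu>'S = H_S[OF \<nu>'(1)]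
      have "x2 * \<nu> = \<nu> * x2" using cenD(3)[OF \<nu> S_closed(8)] by simp
      also have "\<dots> \<in> J3" unfolding \<nu>'(3) mult.assoc
        by (rule hidD(6)[OF hids(1) _ s3.y_in]) (intro S_closed De_S \<nu>'S)
      finally have "inn (0,0,-0) x (1,1,0) x2 \<in> J3" using x2 by (simp add: zero_prod_def)
      then obtain x1' where x1': "x1' \<in> H (a - 1,b - 1,a - 1)" "x = x3 * x1'"
        by (rule inner_x2_divide[OF x]) (use False in auto)
      have w: "(0 - (-1,0,1) :: weight) = (1,0,-1)" "((1,0,-1) - (1,0,-1) :: weight) = 0"
        by (simp_all add: zero_prod_def)
      have 1: "inn (1,0,-1) x1' \<delta> u = sc (of_int (pr (1,0,-1) \<delta>)) * (De * (\<nu>' * u))" if u: "u \<in> H \<delta>" for \<delta> u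
      proof -
        have "x3 * inn (1,0,-1) x1' \<delta> u = inn 0 x \<delta> u"
          using inn_compose0[OF qc_x3 H_S[OF x1'(1)] u, of 0 0] unfolding w x1'(2) by (simp add: inn_0)
        also have "\<dots> = x3 * (sc (of_int (pr (1,0,-1) \<delta>)) * (De * (\<nu>' * u)))"
          using eq[OF u] unfolding \<nu>'(3) by (simp add: sc_left mult.assoc)
        finally have "x3 * (inn (1,0,-1) x1' \<delta> u - sc (of_int (pr (1,0,-1) \<delta>)) * (De * (\<nu>' * u))) = 0"
          by (simp add: right_diff_distrib)
        moreover have "inn (1,0,-1) x1' \<delta> u - sc (of_int (pr (1,0,-1) \<delta>)) * (De * (\<nu>' * u)) \<in> H (\<delta> + (a - 1,b - 1,a - 1))"
        proof (rule H_closed(2)[OF inn_H[OF x1'(1) u] H_closed(3)])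
          have "\<nu>' * u \<in> H ((a - 2,b - 2,a - 2) + \<delta>)" by (rule H_mult[OF \<nu>'(1) u])
          from H_mult'[OF H_De this, of "\<delta> + (a - 1,b - 1,a - 1)"]
          show "De * (\<nu>' * u) \<in> H (\<delta> + (a - 1,b - 1,a - 1))" by (cases \<delta>) simp
        qed
        ultimately show ?thesis using x3_cancel by fastforce
      qed
      define y where "y = flip x1'"
      have y: "y \<in> H (a - 1,b - 1,a - 1)" using flip_H[OF x1'(1)] by (simp add: y_def)
      have 2: "inn (-1,0,1) y \<delta> u = sc (of_int (pr (-1,0,1) \<delta>)) * (x3 * (flip \<nu>' * u))" if u: "u \<in> H \<delta>" for \<delta> u
      proof -
        have pf: "pr (1,0,-1) (flipw \<delta>) = pr (-1,0,1) \<delta>" by (cases \<delta>) simp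
        have "inn (-1,0,1) y \<delta> u = flip (inn (1,0,-1) x1' (flipw \<delta>) (flip u))"
          using flip_inn[OF H_S[OF x1'(1)] H_S[OF u], of "(1,0,-1)" \<delta>] by (simp add: y_def)
        also have "\<dots> = flip (sc (of_int (pr (-1,0,1) \<delta>)) * (De * (\<nu>' * flip u)))"
          using 1[OF flip_H[OF u]] by (simp add: pf)
        also have "\<dots> = sc (of_int (pr (-1,0,1) \<delta>)) * (x3 * (flip \<nu>' * u))"
          using H_S[OF u] \<nu>'S by (simp add: flip_sc flip_simps S_closed De_S flip_S flip_De flip_flip)
        finally show ?thesis .
      qed
      have "inn (-1,0,-(-1)) y (1,1,0) x2 \<in> J3"
        using 2[OF H_x2] by (simp del: pr_simp)
          (intro hidD(7)[OF hids(1)] hidD(6)[OF hids(1) _ s3.y_in] S_closed flip_S \<nu>'S)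
      then obtain y1 where y1: "y1 \<in> H (a - 1 - 1,b - 1 - 1,a - 1 - 1)" "y = x3 * y1"
        by (rule inner_x2_divide[OF y]) (use False in auto)
      define x'' where "x'' = flip y1"
      have x'': "x'' \<in> H (a - 2,b - 2,a - 2)" using flip_H[OF y1(1)] by (simp add: x''_def)
      have x1'': "x1' = De * x''"
        using arg_cong[OF y1(2), of flip] H_S[OF x1'(1)] H_S[OF y1(1)]
        by (simp add: y_def flip_flip flip_simps S_closed De_def x''_def)
      have "inn 0 x'' \<delta> u = sc (of_int (pr (1,0,-1) \<delta>)) * (\<nu>' * u)" if u: "u \<in> H \<delta>" for \<delta> u
      proof -
        have "De * inn 0 x'' \<delta> u = inn (1,0,-1) x1' \<delta> u"
          using inn_compose0[OF qc_De H_S[OF x''] u, of "(1,0,-1)" 0] unfolding w x1'' by (simp add: inn_0)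
        then have "De * (inn 0 x'' \<delta> u - sc (of_int (pr (1,0,-1) \<delta>)) * (\<nu>' * u)) = 0"
          using 1[OF u] by (simp add: right_diff_distrib sc_comm2[of De])
        moreover have "inn 0 x'' \<delta> u - sc (of_int (pr (1,0,-1) \<delta>)) * (\<nu>' * u) \<in> H (\<delta> + (a - 2,b - 2,a - 2))"
          using H_mult'[OF \<nu>'(1) u, of "\<delta> + (a - 2,b - 2,a - 2)"]
          by (intro H_closed(2)[OF inn_H[OF x'' u] H_closed(3)]) (simp add: add.commute)
        ultimately show ?thesis using De_cancel by fastforce
      qed
      then have "\<nu>' = 0" using less.hyps[OF _ x'' cen'] a by simp
      then show ?thesis using \<nu>'(3) by simp
    qed
  qed
qed

lemma standard_unique:
  assumes x: "x \<in> H \<gamma>" and \<nu>: "\<nu>1 \<in> cen \<gamma>" "\<nu>4 \<in> cen \<gamma>" "\<nu>6 \<in> cen \<gamma>"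
    and eq: "\<And>\<delta> u. u \<in> H \<delta> \<Longrightarrow> inn 0 x \<delta> u + el \<nu>1 \<nu>4 \<nu>6 \<delta> u = 0"
  shows "\<nu>1 = 0 \<and> \<nu>4 = 0 \<and> \<nu>6 = 0"
proof -
  obtain a b c where \<gamma>: "\<gamma> = (a,b,c)" by (cases \<gamma>)
  show ?thesis
  proof (cases "a = c")
    case False
    have "\<nu> = 0" if "\<nu> \<in> cen \<gamma>" for \<nu>
      using qc_clash[OF hid0 H_x3 qc_x3 cenD(1,2)[OF that]] x3_cancel[OF cenD(1)[OF that]] False \<gamma> by simp
    then show ?thesis using \<nu> by blast
  next
    case True
    note x = x[unfolded \<gamma>, folded True] and \<nu> = \<nu>[unfolded \<gamma>, folded True]
    \<comment> \<open>By resonance the inner part vanishes on \<open>x3\<close> and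
      \<open>z\<close>. What remains are two linear equations, with coefficients 1, 1, 1 and 1, 2,
      1, which leave \<open>\<nu>4 = 0\<close> and \<open>\<nu>6 = - \<nu>1\<close>.\<close>
    have "inn 0 x (1,1,1) x3 = 0" "inn 0 x (1,2,1) z = 0"
      using inn0_val0[OF H_x3 qc_x3 x] inn0_val0[OF H_z qc_z x] by simp_all
    then have "(\<nu>1 + \<nu>4 + \<nu>6) * x3 = 0" "(\<nu>1 + sc 2 * \<nu>4 + \<nu>6) * z = 0"
      using eq[OF H_x3] eq[OF H_z] by (simp_all add: el_simp sc_simps(2))
    moreover have c: "\<nu>1 + \<nu>4 + \<nu>6 \<in> cen (a,b,a)" "\<nu>1 + sc 2 * \<nu>4 + \<nu>6 \<in> cen (a,b,a)"
      by (intro cen_closed \<nu>)+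
    ultimately have s: "\<nu>1 + \<nu>4 + \<nu>6 = 0" "\<nu>1 + sc 2 * \<nu>4 + \<nu>6 = 0"
      using x3_cancel[OF cenD(1)[OF c(1)]] z_reg[OF cenD(1)[OF c(2)]]
        cenD(3)[OF c(1) S_closed(9)] cenD(3)[OF c(2) z_S] by simp_all
    have "sc (1 + 1) * \<nu>4 = \<nu>4 + \<nu>4"
      by (simp only: sc_simps(2,3) distrib_right mult_1_left)
    then have "sc 2 * \<nu>4 = \<nu>4 + \<nu>4" by (simp only: one_add_one)
    then have "\<nu>4 = (\<nu>1 + sc 2 * \<nu>4 + \<nu>6) - (\<nu>1 + \<nu>4 + \<nu>6)" by simp
    then have 4: "\<nu>4 = 0" using s by simp
    then have 6: "\<nu>6 = - \<nu>1" using s(1) by (simp add: add_eq_0_iff)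
    have "- \<nu>1 = 0"
    proof (rule not_inner[OF x])
      have "sc (-1) * \<nu>1 \<in> cen (a,b,a)" by (rule cen_closed(3)[OF \<nu>(1)])
      then show "- \<nu>1 \<in> cen (a,b,a)" by (simp add: sc_simps)
      fix \<delta> u assume u: "u \<in> H \<delta>"
      obtain i j k where d: "\<delta> = (i,j,k)" by (cases \<delta>)
      show "inn 0 x \<delta> u = sc (of_int (pr (1,0,-1) \<delta>)) * (- \<nu>1 * u)"
        using eq[OF u] by (simp add: d el_simp 4 6 sc_simps algebra_simps add_eq_0_iff)
    qed
    then show ?thesis using 4 6 by simp
  qed
qed

end

section \<open>Derivations, centers and quotient modules\<close>

locale quotient_of_module = module R M for R :: "'r ring" (structure) and M :: "('r, 'm) module" (structure) +
  fixes N
  assumes N: "submodule N R M"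
begin

lemma abelian_subgroup_N: "abelian_subgroup N M"
  using submodule.axioms(1)[OF N] M.abelian_group_axioms by (intro abelian_subgroupI3 additive_subgroup.intro)

sublocale N: abelian_subgroup N M by (rule abelian_subgroup_N)

lemma quotient_simps:
  "carrier (quotient_module M N) = (\<lambda>m. N +>\<^bsub>M\<^esub> m) ` carrier M" "zero (quotient_module M N) = N"
  "m \<in> carrier M \<Longrightarrow> n \<in> carrier M \<Longrightarrow> (N +>\<^bsub>M\<^esub> m) \<oplus>\<^bsub>quotient_module M N\<^esub> (N +>\<^bsub>M\<^esub> n) = N +>\<^bsub>M\<^esub> (m \<oplus>\<^bsub>M\<^esub> n)"
  by (auto simp: quotient_module_def A_RCOSETS_def' N.a_rcos_sum)

lemma coset_smult:
  assumes r: "r \<in> carrier R" and m: "m \<in> carrier M"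
  shows "r \<odot>\<^bsub>quotient_module M N\<^esub> (N +>\<^bsub>M\<^esub> m) = N +>\<^bsub>M\<^esub> (r \<odot>\<^bsub>M\<^esub> m)"
proof -
  have "N +>\<^bsub>M\<^esub> (r \<odot>\<^bsub>M\<^esub> m') = N +>\<^bsub>M\<^esub> (r \<odot>\<^bsub>M\<^esub> m)" if m': "m' \<in> N +>\<^bsub>M\<^esub> m" for m'
  proof -
    obtain n where n: "n \<in> N" "m' = n \<oplus>\<^bsub>M\<^esub> m" using m' by (auto simp: a_r_coset_def')
    have "r \<odot>\<^bsub>M\<^esub> m' = r \<odot>\<^bsub>M\<^esub> n \<oplus>\<^bsub>M\<^esub> r \<odot>\<^bsub>M\<^esub> m"
      unfolding n(2) by (rule smult_r_distr[OF r _ m]) (use n(1) N.a_subset in blast)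
    moreover have "r \<odot>\<^bsub>M\<^esub> n \<in> N" by (rule submodule.smult_closed[OF N r n(1)])
    ultimately have "r \<odot>\<^bsub>M\<^esub> m' \<in> N +>\<^bsub>M\<^esub> (r \<odot>\<^bsub>M\<^esub> m)" by (auto simp: a_r_coset_def')
    then show ?thesis using M.a_repr_independence[OF _ smult_closed[OF r m] N.a_subgroup] by simp
  qed
  then have "(\<lambda>m'. N +>\<^bsub>M\<^esub> (r \<odot>\<^bsub>M\<^esub> m')) ` (N +>\<^bsub>M\<^esub> m) = {N +>\<^bsub>M\<^esub> (r \<odot>\<^bsub>M\<^esub> m)}"
    using N.a_rcos_self[OF m] by blast
  then show ?thesis by (simp add: quotient_module_def)
qed

lemma coset_zero_iff: "m \<in> carrier M \<Longrightarrow> N +>\<^bsub>M\<^esub> m = N \<longleftrightarrow> m \<in> N"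
  using N.a_rcos_self[of m] N.a_rcos_const[of m] by auto

lemma quotient_module: "module R (quotient_module M N)"
proof -
  let ?Q = "quotient_module M N" and ?c = "\<lambda>m. N +>\<^bsub>M\<^esub> m"
  have cases: thesis if "x \<in> carrier ?Q" "\<And>m. m \<in> carrier M \<Longrightarrow> x = ?c m \<Longrightarrow> thesis" for x thesis
    using that unfolding quotient_simps(1) by blast
  have closed: "?c m \<in> carrier ?Q" if "m \<in> carrier M" for m
    using that unfolding quotient_simps(1) by blast
  have zero: "?c \<zero>\<^bsub>M\<^esub> = \<zero>\<^bsub>?Q\<^esub>"
    unfolding quotient_simps(2) by (rule N.a_rcos_const) (rule N.zero_closed)
  note coset = quotient_simps(3) coset_smult
  show ?thesis
  proof (rule moduleI)
    show "cring R" by (rule R.cring_axioms)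
    show "abelian_group ?Q"
    proof (rule abelian_groupI)
      show "\<zero>\<^bsub>?Q\<^esub> \<in> carrier ?Q" unfolding zero[symmetric] by (rule closed) simp
      fix x assume "x \<in> carrier ?Q"
      then obtain m where m: "m \<in> carrier M" "x = ?c m" by (rule cases)
      show "\<zero>\<^bsub>?Q\<^esub> \<oplus>\<^bsub>?Q\<^esub> x = x" unfolding zero[symmetric] m(2) using m(1) by (simp only: coset M.zero_closed M.l_zero)
      have "?c (\<ominus>\<^bsub>M\<^esub> m) \<oplus>\<^bsub>?Q\<^esub> x = \<zero>\<^bsub>?Q\<^esub>"
        unfolding zero[symmetric] m(2) using m(1) by (simp only: coset M.a_inv_closed M.l_neg)
      then show "\<exists>y\<in>carrier ?Q. y \<oplus>\<^bsub>?Q\<^esub> x = \<zero>\<^bsub>?Q\<^esub>" using closed[of "\<ominus>\<^bsub>M\<^esub> m"] m by blast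
      fix y assume "y \<in> carrier ?Q"
      then obtain n where n: "n \<in> carrier M" "y = ?c n" by (rule cases)
      show "x \<oplus>\<^bsub>?Q\<^esub> y \<in> carrier ?Q" "x \<oplus>\<^bsub>?Q\<^esub> y = y \<oplus>\<^bsub>?Q\<^esub> x"
        using closed[of "m \<oplus>\<^bsub>M\<^esub> n"] m(1) n(1) M.a_comm[of m n] by (simp_all only: m(2) n(2) coset M.a_closed)
      fix w assume "w \<in> carrier ?Q"
      then obtain l where l: "l \<in> carrier M" "w = ?c l" by (rule cases)
      show "x \<oplus>\<^bsub>?Q\<^esub> y \<oplus>\<^bsub>?Q\<^esub> w = x \<oplus>\<^bsub>?Q\<^esub> (y \<oplus>\<^bsub>?Q\<^esub> w)"
        using m(1) n(1) l(1) by (simp only: m(2) n(2) l(2) coset M.a_closed M.a_assoc)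
    qed
  next
    fix a b x y assume a: "a \<in> carrier R" and "x \<in> carrier ?Q"
    then obtain m where m: "m \<in> carrier M" "x = ?c m" by (metis cases)
    show "a \<odot>\<^bsub>?Q\<^esub> x \<in> carrier ?Q" using closed[of "a \<odot>\<^bsub>M\<^esub> m"] a m(1) by (simp only: m(2) coset smult_closed)
    show "(a \<oplus> b) \<odot>\<^bsub>?Q\<^esub> x = a \<odot>\<^bsub>?Q\<^esub> x \<oplus>\<^bsub>?Q\<^esub> b \<odot>\<^bsub>?Q\<^esub> x"
      "(a \<otimes> b) \<odot>\<^bsub>?Q\<^esub> x = a \<odot>\<^bsub>?Q\<^esub> (b \<odot>\<^bsub>?Q\<^esub> x)" if "b \<in> carrier R"
      using a m(1) that by (simp_all only: m(2) coset smult_closed smult_l_distr smult_assoc1 R.a_closed R.m_closed)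
    assume "y \<in> carrier ?Q"
    then obtain n where n: "n \<in> carrier M" "y = ?c n" by (rule cases)
    show "a \<odot>\<^bsub>?Q\<^esub> (x \<oplus>\<^bsub>?Q\<^esub> y) = a \<odot>\<^bsub>?Q\<^esub> x \<oplus>\<^bsub>?Q\<^esub> a \<odot>\<^bsub>?Q\<^esub> y"
      using a m(1) n(1) by (simp only: m(2) n(2) coset smult_closed smult_r_distr M.a_closed)
  next
    fix x assume "x \<in> carrier ?Q"
    then obtain m where m: "m \<in> carrier M" "x = ?c m" by (rule cases)
    show "\<one> \<odot>\<^bsub>?Q\<^esub> x = x" using m(1) by (simp only: m(2) coset R.one_closed smult_one)
  qed
qed

lemma coset_finsum:
  assumes "finite I" "f \<in> I \<rightarrow> carrier M"
  shows "(\<Oplus>\<^bsub>quotient_module M N\<^esub>i\<in>I. N +>\<^bsub>M\<^esub> f i) = N +>\<^bsub>M\<^esub> (\<Oplus>\<^bsub>M\<^esub>i\<in>I. f i)"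
  using assms
proof induction
  interpret Q: module R "quotient_module M N" by (rule quotient_module)
  case empty
  then show ?case using coset_zero_iff[OF M.zero_closed] N.zero_closed by (simp add: quotient_simps)
next
  interpret Q: module R "quotient_module M N" by (rule quotient_module)
  case (insert i I)
  then have *: "f \<in> I \<rightarrow> carrier M" "f i \<in> carrier M" by auto
  then have "(\<lambda>i. N +>\<^bsub>M\<^esub> f i) \<in> I \<rightarrow> carrier (quotient_module M N)" "N +>\<^bsub>M\<^esub> f i \<in> carrier (quotient_module M N)"
    by (auto simp: quotient_simps)
  then show ?case using insert * by (simp add: quotient_simps)
qed

lemma quotient_basis:
  assumes I: "finite I" and b: "b \<in> I \<rightarrow> carrier M"
    and span: "\<And>m. m \<in> carrier M \<Longrightarrow> \<exists>n\<in>N. \<exists>a \<in> I \<rightarrow> carrier R. m = n \<oplus>\<^bsub>M\<^esub> (\<Oplus>\<^bsub>M\<^esub>i\<in>I. a i \<odot>\<^bsub>M\<^esub> b i)"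
    and indep: "\<And>a. a \<in> I \<rightarrow> carrier R \<Longrightarrow> (\<Oplus>\<^bsub>M\<^esub>i\<in>I. a i \<odot>\<^bsub>M\<^esub> b i) \<in> N \<Longrightarrow> \<forall>i\<in>I. a i = \<zero>"
  shows "module_basis R (quotient_module M N) I (\<lambda>i. N +>\<^bsub>M\<^esub> b i)"
proof -
  let ?Q = "quotient_module M N"
  interpret Q: module R ?Q by (rule quotient_module)
  have cl: "(\<lambda>i. a i \<odot>\<^bsub>M\<^esub> b i) \<in> I \<rightarrow> carrier M" if "a \<in> I \<rightarrow> carrier R" for a
    using that b by (auto intro!: smult_closed)
  have eq: "(\<Oplus>\<^bsub>?Q\<^esub>i\<in>I. a i \<odot>\<^bsub>?Q\<^esub> (N +>\<^bsub>M\<^esub> b i)) = N +>\<^bsub>M\<^esub> (\<Oplus>\<^bsub>M\<^esub>i\<in>I. a i \<odot>\<^bsub>M\<^esub> b i)"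
    if a: "a \<in> I \<rightarrow> carrier R" for a
  proof -
    have "(\<Oplus>\<^bsub>?Q\<^esub>i\<in>I. a i \<odot>\<^bsub>?Q\<^esub> (N +>\<^bsub>M\<^esub> b i)) = (\<Oplus>\<^bsub>?Q\<^esub>i\<in>I. N +>\<^bsub>M\<^esub> (a i \<odot>\<^bsub>M\<^esub> b i))"
    proof (rule Q.M.finsum_cong')
      show "(\<lambda>i. N +>\<^bsub>M\<^esub> (a i \<odot>\<^bsub>M\<^esub> b i)) \<in> I \<rightarrow> carrier ?Q" using cl[OF a] by (auto simp: quotient_simps)
      show "a i \<odot>\<^bsub>?Q\<^esub> (N +>\<^bsub>M\<^esub> b i) = N +>\<^bsub>M\<^esub> (a i \<odot>\<^bsub>M\<^esub> b i)" if "i \<in> I" for i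
        by (rule coset_smult) (use a b that in auto)
    qed simp
    then show ?thesis using coset_finsum[OF I cl[OF a]] by simp
  qed
  show ?thesis
    unfolding module_basis_def
  proof (intro conjI ballI impI)
    show "(\<lambda>i. N +>\<^bsub>M\<^esub> b i) \<in> I \<rightarrow> carrier ?Q" using b by (auto simp: quotient_simps)
    fix C assume "C \<in> carrier ?Q"
    then obtain m where m: "m \<in> carrier M" "C = N +>\<^bsub>M\<^esub> m" by (auto simp: quotient_simps)
    obtain n a where n: "n \<in> N" "a \<in> I \<rightarrow> carrier R" "m = n \<oplus>\<^bsub>M\<^esub> (\<Oplus>\<^bsub>M\<^esub>i\<in>I. a i \<odot>\<^bsub>M\<^esub> b i)"
      using span[OF m(1)] by blast
    have s: "(\<Oplus>\<^bsub>M\<^esub>i\<in>I. a i \<odot>\<^bsub>M\<^esub> b i) \<in> carrier M" using M.finsum_closed[OF cl[OF n(2)]] .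
    have "m \<in> N +>\<^bsub>M\<^esub> (\<Oplus>\<^bsub>M\<^esub>i\<in>I. a i \<odot>\<^bsub>M\<^esub> b i)" unfolding n(3) using n(1) by (auto simp: a_r_coset_def')
    then have "C = N +>\<^bsub>M\<^esub> (\<Oplus>\<^bsub>M\<^esub>i\<in>I. a i \<odot>\<^bsub>M\<^esub> b i)"
      using M.a_repr_independence[OF _ s N.a_subgroup] m(2) by simp
    then show "\<exists>a\<in>I \<rightarrow> carrier R. C = (\<Oplus>\<^bsub>?Q\<^esub>i\<in>I. a i \<odot>\<^bsub>?Q\<^esub> (N +>\<^bsub>M\<^esub> b i))"
      using eq[OF n(2)] n(2) by auto
  next
    fix a i assume a: "a \<in> I \<rightarrow> carrier R" "(\<Oplus>\<^bsub>?Q\<^esub>i\<in>I. a i \<odot>\<^bsub>?Q\<^esub> (N +>\<^bsub>M\<^esub> b i)) = \<zero>\<^bsub>?Q\<^esub>" and i: "i \<in> I"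
    then have "(\<Oplus>\<^bsub>M\<^esub>i\<in>I. a i \<odot>\<^bsub>M\<^esub> b i) \<in> N"
      using eq[OF a(1)] coset_zero_iff[OF M.finsum_closed[OF cl[OF a(1)]]] by (simp add: quotient_simps)
    then show "a i = \<zero>" using indep[OF a(1)] i by blast
  qed (rule I)
qed

end

section \<open>The derivations of an algebra as a module over its center\<close>

locale type_algebra = ring A for A :: "('k, 'a) module" (structure) +
  assumes smult_closed: "x \<in> carrier A \<Longrightarrow> c \<odot> x \<in> carrier A"
    and smult_add: "x \<in> carrier A \<Longrightarrow> y \<in> carrier A \<Longrightarrow> c \<odot> (x \<oplus> y) = c \<odot> x \<oplus> c \<odot> y"
    and smult_mult: "x \<in> carrier A \<Longrightarrow> y \<in> carrier A \<Longrightarrow> (c \<odot> x) \<otimes> y = c \<odot> (x \<otimes> y)"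
    and mult_smult: "x \<in> carrier A \<Longrightarrow> y \<in> carrier A \<Longrightarrow> x \<otimes> (c \<odot> y) = c \<odot> (x \<otimes> y)"
begin

lemma smult_zero: "c \<odot> \<zero> = \<zero>"
  by (rule trans[OF _ r_null[OF smult_closed[OF zero_closed]]]) (simp add: smult_mult)

lemma smult_uminus: "x \<in> carrier A \<Longrightarrow> c \<odot> (\<ominus> x) = \<ominus> (c \<odot> x)"
  using smult_add[of "\<ominus> x" x c] by (metis a_inv_closed l_neg minus_equality smult_closed smult_zero)

lemma center_simps:
  "mult (center A) = mult A" "one (center A) = one A" "zero (center A) = zero A" "add (center A) = add A"
  by (simp_all add: center_def)

lemma centerD: "c \<in> carrier (center A) \<Longrightarrow> c \<in> carrier A" "c \<in> carrier (center A) \<Longrightarrow> x \<in> carrier A \<Longrightarrow> x \<otimes> c = c \<otimes> x"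
  by (simp_all add: center_def)

lemma centerI: "c \<in> carrier A \<Longrightarrow> (\<And>x. x \<in> carrier A \<Longrightarrow> c \<otimes> x = x \<otimes> c) \<Longrightarrow> c \<in> carrier (center A)"
  by (simp add: center_def)

lemma center_swap: "c \<in> carrier (center A) \<Longrightarrow> x \<in> carrier A \<Longrightarrow> y \<in> carrier A \<Longrightarrow> x \<otimes> (c \<otimes> y) = c \<otimes> (x \<otimes> y)"
  using centerD(2)[of c x] centerD(1)[of c] m_assoc[of x c y] m_assoc[of c x y] by simp

lemma center_closed:
  assumes x: "x \<in> carrier (center A)"
  shows "\<ominus> x \<in> carrier (center A)" "y \<in> carrier (center A) \<Longrightarrow> x \<oplus> y \<in> carrier (center A)"
    "y \<in> carrier (center A) \<Longrightarrow> x \<otimes> y \<in> carrier (center A)"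
proof -
  note xc = centerD(1)[OF x]
  show "\<ominus> x \<in> carrier (center A)"
    by (rule centerI) (simp_all add: xc l_minus r_minus centerD(2)[OF x])
  assume y: "y \<in> carrier (center A)"
  note yc = centerD(1)[OF y]
  show "x \<oplus> y \<in> carrier (center A)"
  proof (rule centerI)
    fix w assume w: "w \<in> carrier A"
    show "(x \<oplus> y) \<otimes> w = w \<otimes> (x \<oplus> y)"
      by (simp only: l_distr[OF xc yc w] r_distr[OF xc yc w] centerD(2)[OF x w] centerD(2)[OF y w])
  qed (simp add: xc yc)
  show "x \<otimes> y \<in> carrier (center A)"
  proof (rule centerI)
    fix w assume w: "w \<in> carrier A"
    have "(x \<otimes> y) \<otimes> w = x \<otimes> (w \<otimes> y)" by (simp only: m_assoc[OF xc yc w] centerD(2)[OF y w])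
    also have "\<dots> = w \<otimes> (x \<otimes> y)" by (rule center_swap[OF x w yc, symmetric])
    finally show "(x \<otimes> y) \<otimes> w = w \<otimes> (x \<otimes> y)" .
  qed (simp add: xc yc)
qed

lemma cring_center: "cring (center A)"
proof (intro cringI abelian_groupI comm_monoidI; unfold center_simps)
  fix x y w assume x: "x \<in> carrier (center A)"
  note xc = centerD(1)[OF x]
  show "\<exists>y\<in>carrier (center A). y \<oplus> x = \<zero>"
    using center_closed(1)[OF x] l_neg[OF xc] by blast
  show "\<zero> \<oplus> x = x" "\<one> \<otimes> x = x" using xc by simp_all
  assume y: "y \<in> carrier (center A)"
  note yc = centerD(1)[OF y]
  show "x \<oplus> y \<in> carrier (center A)" "x \<otimes> y \<in> carrier (center A)" by (rule center_closed(2,3)[OF x y])+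
  show "x \<oplus> y = y \<oplus> x" "x \<otimes> y = y \<otimes> x" by (rule a_comm[OF xc yc], rule centerD(2)[OF y xc])
  assume "w \<in> carrier (center A)"
  note wc = centerD(1)[OF this]
  show "(x \<oplus> y) \<oplus> w = x \<oplus> (y \<oplus> w)" "(x \<otimes> y) \<otimes> w = x \<otimes> (y \<otimes> w)"
    "(x \<oplus> y) \<otimes> w = x \<otimes> w \<oplus> y \<otimes> w"
    by (rule a_assoc[OF xc yc wc] m_assoc[OF xc yc wc] l_distr[OF xc yc wc])+
next
  show "\<zero> \<in> carrier (center A)" "\<one> \<in> carrier (center A)" by (rule centerI; simp)+
qed

lemma derivationD:
  assumes "D \<in> derivations A"
  shows "x \<in> carrier A \<Longrightarrow> D x \<in> carrier A" "D \<in> extensional (carrier A)"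
    "x \<in> carrier A \<Longrightarrow> y \<in> carrier A \<Longrightarrow> D (x \<oplus> y) = D x \<oplus> D y"
    "x \<in> carrier A \<Longrightarrow> D (c \<odot> x) = c \<odot> D x"
    "x \<in> carrier A \<Longrightarrow> y \<in> carrier A \<Longrightarrow> D (x \<otimes> y) = D x \<otimes> y \<oplus> x \<otimes> D y"
  using assms by (auto simp: derivations_def PiE_def)

lemma derivation_eqI:
  "D \<in> derivations A \<Longrightarrow> E \<in> derivations A \<Longrightarrow> (\<And>x. x \<in> carrier A \<Longrightarrow> D x = E x) \<Longrightarrow> D = E"
  by (rule extensionalityI[OF derivationD(2) derivationD(2)])

lemma derivationI:
  assumes "\<And>x. x \<in> carrier A \<Longrightarrow> d x \<in> carrier A"
    "\<And>x y. x \<in> carrier A \<Longrightarrow> y \<in> carrier A \<Longrightarrow> d (x \<oplus> y) = d x \<oplus> d y"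
    "\<And>c x. x \<in> carrier A \<Longrightarrow> d (c \<odot> x) = c \<odot> d x"
    "\<And>x y. x \<in> carrier A \<Longrightarrow> y \<in> carrier A \<Longrightarrow> d (x \<otimes> y) = d x \<otimes> y \<oplus> x \<otimes> d y"
  shows "(\<lambda>x\<in>carrier A. d x) \<in> derivations A"
  using assms by (auto simp: derivations_def smult_closed)

lemma Der_simps:
  "carrier (Der A) = derivations A" "zero (Der A) = (\<lambda>x\<in>carrier A. \<zero>)"
  "D \<oplus>\<^bsub>Der A\<^esub> E = (\<lambda>x\<in>carrier A. D x \<oplus> E x)" "c \<odot>\<^bsub>Der A\<^esub> D = (\<lambda>x\<in>carrier A. c \<otimes> D x)"
  by (simp_all add: Der_def)

lemma Der_closed:
  "(\<lambda>x\<in>carrier A. \<zero>) \<in> derivations A"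
  "D \<in> derivations A \<Longrightarrow> E \<in> derivations A \<Longrightarrow> (\<lambda>x\<in>carrier A. D x \<oplus> E x) \<in> derivations A"
  "D \<in> derivations A \<Longrightarrow> (\<lambda>x\<in>carrier A. \<ominus> D x) \<in> derivations A"
  "c \<in> carrier (center A) \<Longrightarrow> D \<in> derivations A \<Longrightarrow> (\<lambda>x\<in>carrier A. c \<otimes> D x) \<in> derivations A"
proof -
  show "(\<lambda>x\<in>carrier A. \<zero>) \<in> derivations A" by (rule derivationI) (simp_all add: smult_zero)
  show "(\<lambda>x\<in>carrier A. D x \<oplus> E x) \<in> derivations A" if "D \<in> derivations A" "E \<in> derivations A"
    using that[THEN derivationD(1)]
    by (intro derivationI) (simp_all add: that[THEN derivationD(3)] that[THEN derivationD(4)] that[THEN derivationD(5)]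
       smult_add l_distr r_distr a_ac)
  show "(\<lambda>x\<in>carrier A. \<ominus> D x) \<in> derivations A" if D: "D \<in> derivations A"
    using D[THEN derivationD(1)]
    by (intro derivationI) (simp_all add: derivationD(3-5)[OF D] smult_uminus minus_add l_minus r_minus)
  show "(\<lambda>x\<in>carrier A. c \<otimes> D x) \<in> derivations A" if c: "c \<in> carrier (center A)" and D: "D \<in> derivations A"
  proof (rule derivationI)
    note d = derivationD(1)[OF D] and cc = centerD(1)[OF c]
    show "c \<otimes> D x \<in> carrier A" "c \<otimes> D (k \<odot> x) = k \<odot> (c \<otimes> D x)" if "x \<in> carrier A" for x k
      using d[OF that] cc by (simp_all add: derivationD(4)[OF D that] mult_smult)
    fix x y assume x: "x \<in> carrier A" and y: "y \<in> carrier A"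
    show "c \<otimes> D (x \<oplus> y) = c \<otimes> D x \<oplus> c \<otimes> D y"
      by (simp only: derivationD(3)[OF D x y] r_distr[OF d[OF x] d[OF y] cc])
    show "c \<otimes> D (x \<otimes> y) = c \<otimes> D x \<otimes> y \<oplus> x \<otimes> (c \<otimes> D y)"
      by (simp only: derivationD(5)[OF D x y] r_distr[OF m_closed[OF d[OF x] y] m_closed[OF x d[OF y]] cc]
          m_assoc[OF cc d[OF x] y] center_swap[OF c x d[OF y]])
  qed
qed

lemma module_Der: "module (center A) (Der A)"
proof (rule moduleI)
  show "cring (center A)" by (rule cring_center)
  show "abelian_group (Der A)"
  proof (rule abelian_groupI; unfold Der_simps)
    fix D assume D: "D \<in> derivations A"
    have "(\<lambda>x\<in>carrier A. (\<lambda>x\<in>carrier A. \<ominus> D x) x \<oplus> D x) = (\<lambda>x\<in>carrier A. \<zero>)"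
      by (rule restrict_ext) (simp add: derivationD(1)[OF D] l_neg)
    then show "\<exists>E\<in>derivations A. (\<lambda>x\<in>carrier A. E x \<oplus> D x) = (\<lambda>x\<in>carrier A. \<zero>)"
      using Der_closed(3)[OF D] by blast
    show "(\<lambda>x\<in>carrier A. (\<lambda>x\<in>carrier A. \<zero>) x \<oplus> D x) = D"
      by (rule derivation_eqI[OF Der_closed(2)[OF Der_closed(1) D] D]) (simp add: derivationD(1)[OF D])
  qed (auto intro!: restrict_ext Der_closed simp: derivationD(1) a_ac)
next
  fix D assume D: "D \<in> carrier (Der A)"
  then have "D \<in> derivations A" by (simp add: Der_simps)
  moreover have "\<one> \<in> carrier (center A)" by (rule centerI) simp_all
  ultimately show "\<one>\<^bsub>center A\<^esub> \<odot>\<^bsub>Der A\<^esub> D = D"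
    unfolding Der_simps center_simps
    by (intro derivation_eqI[OF Der_closed(4)]) (auto simp: derivationD(1))
qed (auto intro!: restrict_ext simp: Der_simps Der_closed(2,4) center_simps derivationD(1) centerD(1) l_distr r_distr m_assoc)

lemma ad_derivation:
  assumes x: "x \<in> carrier A"
  shows "ad A x \<in> derivations A"
  unfolding ad_def
proof (rule derivationI)
  fix y w assume y: "y \<in> carrier A" and w: "w \<in> carrier A"
  have tele: "p \<ominus> n = (p \<ominus> r) \<oplus> (r \<ominus> n)" if "p \<in> carrier A" "r \<in> carrier A" "n \<in> carrier A" for p r n
    using that by (simp add: a_minus_def a_assoc r_neg1 r_neg2)
  have "x \<otimes> (y \<otimes> w) \<ominus> y \<otimes> w \<otimes> x = (x \<otimes> (y \<otimes> w) \<ominus> y \<otimes> (x \<otimes> w)) \<oplus> (y \<otimes> (x \<otimes> w) \<ominus> y \<otimes> w \<otimes> x)"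
    by (rule tele) (simp_all add: x y w)
  then show "x \<otimes> (y \<otimes> w) \<ominus> y \<otimes> w \<otimes> x = (x \<otimes> y \<ominus> y \<otimes> x) \<otimes> w \<oplus> y \<otimes> (x \<otimes> w \<ominus> w \<otimes> x)"
    using x y w by (simp add: a_minus_def l_distr r_distr l_minus r_minus m_assoc)
qed (use x in \<open>simp_all add: a_minus_def smult_mult mult_smult smult_add smult_uminus smult_closed
    l_distr r_distr minus_add a_ac\<close>)

lemma submodule_inner: "submodule (inner_derivations A) (center A) (Der A)"
proof (rule module.submoduleI[OF module_Der])
  interpret M: module "center A" "Der A" by (rule module_Der)
  show "inner_derivations A \<subseteq> carrier (Der A)"
    by (auto simp: inner_derivations_def Der_simps ad_derivation)
  have z: "ad A \<zero> = \<zero>\<^bsub>Der A\<^esub>" unfolding ad_def Der_simps by (rule restrict_ext) (simp add: a_minus_def)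
  then show "\<zero>\<^bsub>Der A\<^esub> \<in> inner_derivations A"
    using image_eqI[of _ "ad A" \<zero> "carrier A"] by (auto simp: inner_derivations_def)
  have add: "ad A x \<oplus>\<^bsub>Der A\<^esub> ad A y = ad A (x \<oplus> y)" if "x \<in> carrier A" "y \<in> carrier A" for x y
    unfolding ad_def Der_simps using that
    by (intro restrict_ext) (simp add: a_minus_def l_distr r_distr minus_add a_ac)
  then show "D \<oplus>\<^bsub>Der A\<^esub> E \<in> inner_derivations A" if "D \<in> inner_derivations A" "E \<in> inner_derivations A" for D E
    using that by (auto simp: inner_derivations_def)
  show "\<ominus>\<^bsub>Der A\<^esub> D \<in> inner_derivations A" if "D \<in> inner_derivations A" for D
  proof -
    obtain x where x: "x \<in> carrier A" "D = ad A x" using \<open>D \<in> inner_derivations A\<close> by (auto simp: inner_derivations_def)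
    have "ad A (\<ominus> x) \<oplus>\<^bsub>Der A\<^esub> D = \<zero>\<^bsub>Der A\<^esub>" using add[of "\<ominus> x" x] x z by (simp add: l_neg)
    then have "\<ominus>\<^bsub>Der A\<^esub> D = ad A (\<ominus> x)"
      by (rule M.minus_equality) (simp_all add: Der_simps ad_derivation x)
    then show ?thesis using x by (simp add: inner_derivations_def)
  qed
  show "c \<odot>\<^bsub>Der A\<^esub> D \<in> inner_derivations A" if c: "c \<in> carrier (center A)" and "D \<in> inner_derivations A" for c D
  proof -
    obtain x where x: "x \<in> carrier A" "D = ad A x" using \<open>D \<in> inner_derivations A\<close> by (auto simp: inner_derivations_def)
    have "c \<odot>\<^bsub>Der A\<^esub> D = ad A (c \<otimes> x)"
      unfolding x ad_def Der_simps using x(1) centerD(1)[OF c] center_swap[OF c]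
      by (intro restrict_ext) (simp add: a_minus_def r_distr r_minus m_assoc)
    then show ?thesis using x centerD(1)[OF c] by (simp add: inner_derivations_def)
  qed
qed

sublocale HH: quotient_of_module "center A" "Der A" "inner_derivations A"
  using module_Der submodule_inner by (intro quotient_of_module.intro quotient_of_module_axioms.intro)

end

context quantum_parameter begin

section \<open>Derivations of the algebra\<close>

definition Z where "Z = {\<nu> \<in> S. \<forall>u\<in>S. \<nu> * u = u * \<nu>}"

lemma comp_Z: "\<nu> \<in> Z \<Longrightarrow> comp \<gamma> \<nu> \<in> cen \<gamma>"
proof (rule cenI)
  assume \<nu>: "\<nu> \<in> Z"
  then show "comp \<gamma> \<nu> \<in> H \<gamma>" by (simp add: Z_def comp_H)
  fix u assume "u \<in> S"
  then show "comp \<gamma> \<nu> * u = u * comp \<gamma> \<nu>"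
  proof (induction u rule: hom_induct)
    case (hom \<delta> u)
    then have "loc \<delta> u" "\<nu> * u = u * \<nu>" using \<nu> by (auto simp: H_def Z_def)
    then show ?case using comp_mult_right[of \<delta> u \<gamma> \<nu>] comp_mult_left[of \<delta> u \<gamma> \<nu>] by (simp add: add.commute)
  qed (simp add: distrib_left distrib_right)
qed

lemma cen_Z: "\<nu> \<in> cen \<gamma> \<Longrightarrow> \<nu> \<in> Z"
  using cenD(3) H_S[OF cenD(1)] by (auto simp: Z_def)

lemma Z_sum: "(\<And>i. i \<in> G \<Longrightarrow> \<nu> i \<in> Z) \<Longrightarrow> sum \<nu> G \<in> Z"
  by (induction G rule: infinite_finite_induct) (simp_all add: Z_def S_closed distrib_left distrib_right)

lemma S_sum: "(\<And>i. i \<in> G \<Longrightarrow> \<nu> i \<in> S) \<Longrightarrow> sum \<nu> G \<in> S"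
  by (induction G rule: infinite_finite_induct) (simp_all add: S_closed)

lemma el_gen: "el (\<nu> E1) (\<nu> E2) (\<nu> E3) (aw l) u = \<nu> l * u"
  by (cases l) (simp_all add: aw_def el_simp sc_simps(1,2))

lemma inn_commutator: "inn 0 x \<delta> u = x * u - u * x"
  by (cases \<delta>) (simp add: inn_def zero_prod_def sc_simps(2))

text \<open>Links arbitrary derivations to the homogeneous theory: each component is a skew
  derivation with trivial twist.\<close>

lemma derivation_component:
  assumes d: "\<And>u. u \<in> S \<Longrightarrow> d u \<in> S" "\<And>u v. u \<in> S \<Longrightarrow> v \<in> S \<Longrightarrow> d (u + v) = d u + d v"
    "\<And>c u. u \<in> S \<Longrightarrow> d (sc c * u) = sc c * d u" "\<And>u v. u \<in> S \<Longrightarrow> v \<in> S \<Longrightarrow> d (u * v) = d u * v + u * d v"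
  shows "tder {0} 0 \<gamma> (\<lambda>\<delta> u. comp (\<delta> + \<gamma>) (d u))"
proof (rule tderI)
  fix \<delta> \<epsilon> :: weight and u v c assume u: "u \<in> H \<delta>"
  note uS = H_S[OF u]
  show "comp (\<delta> + \<gamma>) (d u) \<in> H (\<delta> + \<gamma>)" by (rule comp_H[OF d(1)[OF uS]])
  show "v \<in> H \<delta> \<Longrightarrow> comp (\<delta> + \<gamma>) (d (u + v)) - (comp (\<delta> + \<gamma>) (d u) + comp (\<delta> + \<gamma>) (d v)) \<in> {0}"
    using d(2)[OF uS, of v] H_S by (simp add: comp_add)
  show "comp (\<delta> + \<gamma>) (d (sc c * u)) - sc c * comp (\<delta> + \<gamma>) (d u) \<in> {0}"
    using d(3)[OF uS] by (simp add: comp_sc)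
  show "comp (\<delta> + \<epsilon> + \<gamma>) (d (u * v)) - (comp (\<delta> + \<gamma>) (d u) * v + sc (qe 0 \<delta>) * (u * comp (\<epsilon> + \<gamma>) (d v))) \<in> {0}"
    if v: "v \<in> H \<epsilon>"
  proof -
    have l: "loc \<epsilon> v" "loc \<delta> u" using u v by (simp_all add: H_def)
    have w: "\<delta> + \<epsilon> + \<gamma> = (\<delta> + \<gamma>) + \<epsilon>" "(\<delta> + \<gamma>) + \<epsilon> = \<delta> + (\<epsilon> + \<gamma>)" by (simp_all add: add_ac)
    have "comp (\<delta> + \<epsilon> + \<gamma>) (d u * v) = comp (\<delta> + \<gamma>) (d u) * v"
      unfolding w(1) by (rule comp_mult_right[OF l(1)])
    moreover have "comp (\<delta> + \<epsilon> + \<gamma>) (u * d v) = u * comp (\<epsilon> + \<gamma>) (d v)"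
      unfolding w by (rule comp_mult_left[OF l(2)])
    ultimately show ?thesis
      using d(4)[OF uS H_S[OF v]] by (cases \<delta>) (simp add: comp_add zero_prod_def sc_simps(2))
  qed
  show "u \<in> {0} \<Longrightarrow> comp (\<delta> + \<gamma>) (d u) \<in> {0}"
    using d(3)[OF S_closed(5), of 0] by (simp add: sc_simps(1) comp_0)
qed

text \<open>The conclusion concerns generators only, as these determine a derivation. Only finitely
  many weights occur in the three values, so finitely many implementing elements are summed.\<close>

theorem S_derivation:
  assumes d: "\<And>u. u \<in> S \<Longrightarrow> d u \<in> S" "\<And>u v. u \<in> S \<Longrightarrow> v \<in> S \<Longrightarrow> d (u + v) = d u + d v"
    "\<And>c u. u \<in> S \<Longrightarrow> d (sc c * u) = sc c * d u" "\<And>u v. u \<in> S \<Longrightarrow> v \<in> S \<Longrightarrow> d (u * v) = d u * v + u * d v"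
  shows "\<exists>x\<in>S. \<exists>\<nu>. (\<forall>l. \<nu> l \<in> Z) \<and> (\<forall>l. d (gen l) = x * gen l - gen l * x + \<nu> l * gen l)"
proof -
  have "\<exists>x \<nu>. x \<in> H \<gamma> \<and> (\<forall>l. \<nu> l \<in> Z) \<and> (\<forall>l. comp (aw l + \<gamma>) (d (gen l)) = x * gen l - gen l * x + \<nu> l * gen l)" for \<gamma>
  proof -
    obtain x \<nu>1 \<nu>4 \<nu>6 where x: "x \<in> H \<gamma>" and \<nu>: "\<nu>1 \<in> cen \<gamma>" "\<nu>4 \<in> cen \<gamma>" "\<nu>6 \<in> cen \<gamma>"
      and eq: "\<And>\<delta> u. u \<in> H \<delta> \<Longrightarrow> comp (\<delta> + \<gamma>) (d u) = inn 0 x \<delta> u + el \<nu>1 \<nu>4 \<nu>6 \<delta> u"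
      using tder_standard[OF derivation_component[OF d]] unfolding standard_def by blast
    define \<nu> where "\<nu> = case_letter \<nu>1 \<nu>4 \<nu>6"
    have "\<nu> l \<in> Z" for l using \<nu> cen_Z by (cases l) (auto simp: \<nu>_def)
    moreover have "comp (aw l + \<gamma>) (d (gen l)) = x * gen l - gen l * x + \<nu> l * gen l" for l
      using eq[OF H_gen] el_gen[of \<nu> l "gen l"]
      by (simp add: \<nu>_def inn_commutator)
    ultimately show ?thesis using x by blast
  qed
  then obtain X N where X: "\<And>\<gamma>. X \<gamma> \<in> H \<gamma>" and N: "\<And>\<gamma> l. N \<gamma> l \<in> Z"
    and eq: "\<And>\<gamma> l. comp (aw l + \<gamma>) (d (gen l)) = X \<gamma> * gen l - gen l * X \<gamma> + N \<gamma> l * gen l"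
    by metis
  obtain F where F: "\<And>l. finite (F l)" "\<And>l G. finite G \<Longrightarrow> F l \<subseteq> G \<Longrightarrow> d (gen l) = (\<Sum>\<omega>\<in>G. comp \<omega> (d (gen l)))"
    using comp_sum_ex[OF d(1)[OF S_closed(13)]] by metis
  \<comment> \<open>A component of weight \<open>\<omega>\<close> in the value on generator
    \<open>l\<close> belongs to the derivation component of weight \<open>\<omega> - aw l\<close>.
    One finite set must serve all three generators, since the same \<open>x\<close> has to implement
    the inner part on each.\<close>
  define G where "G = (\<Union>l\<in>{E1,E2,E3}. (\<lambda>\<omega>. \<omega> - aw l) ` F l)"
  have G: "finite G" using F(1) by (simp add: G_def)
  have "d (gen l) = (\<Sum>\<gamma>\<in>G. X \<gamma>) * gen l - gen l * (\<Sum>\<gamma>\<in>G. X \<gamma>) + (\<Sum>\<gamma>\<in>G. N \<gamma> l) * gen l" for l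
  proof -
    have "l \<in> {E1,E2,E3}" by (cases l) simp_all
    then have "F l \<subseteq> (\<lambda>\<gamma>. aw l + \<gamma>) ` G" unfolding G_def by force
    then have "d (gen l) = (\<Sum>\<omega>\<in>(\<lambda>\<gamma>. aw l + \<gamma>) ` G. comp \<omega> (d (gen l)))"
      using F(2)[of "(\<lambda>\<gamma>. aw l + \<gamma>) ` G" l] G by blast
    also have "\<dots> = (\<Sum>\<gamma>\<in>G. comp (aw l + \<gamma>) (d (gen l)))"
      by (subst sum.reindex) (simp_all add: o_def)
    also have "\<dots> = (\<Sum>\<gamma>\<in>G. X \<gamma>) * gen l - gen l * (\<Sum>\<gamma>\<in>G. X \<gamma>) + (\<Sum>\<gamma>\<in>G. N \<gamma> l) * gen l"
      by (simp only: eq sum.distrib sum_subtractf sum_distrib_left sum_distrib_right)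
    finally show ?thesis .
  qed
  then show ?thesis
    by (intro bexI[of _ "\<Sum>\<gamma>\<in>G. X \<gamma>"] exI[of _ "\<lambda>l. \<Sum>\<gamma>\<in>G. N \<gamma> l"] conjI allI S_sum H_S[OF X] Z_sum N)
qed

text \<open>Each weight component of the relation is a skew derivation vanishing on generators,
  hence everywhere, and then \<open>standard_unique\<close> applies.\<close>

theorem S_unique:
  assumes x: "x \<in> S" and \<nu>: "\<And>l. \<nu> l \<in> Z" and eq: "\<And>l. x * gen l - gen l * x + \<nu> l * gen l = 0"
  shows "\<nu> l = 0"
proof -
  have "comp \<gamma> (\<nu> l) = 0" for \<gamma> l
  proof -
    let ?x = "comp \<gamma> x" and ?n = "\<lambda>l. comp \<gamma> (\<nu> l)"
    let ?E = "\<lambda>\<delta> u. el (?n E1) (?n E2) (?n E3) \<delta> u - inn 0 (- ?x) \<delta> u"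
    have n: "?n l \<in> cen \<gamma>" for l by (rule comp_Z[OF \<nu>])
    have xH: "?x \<in> H \<gamma>" by (rule comp_H[OF x])
    have minus: "inn 0 (- ?x) \<delta> u = - inn 0 ?x \<delta> u" for \<delta> u by (simp add: inn_def)
    have E: "tder {0} 0 \<gamma> ?E" by (intro tder_minus_inn[OF tder_el[OF n n n] hid0] H_uminus xH)
    have g: "?E (aw l) (gen l) \<in> {0}" for l
    proof -
      have l: "loc (aw l) (gen l)" using H_gen[of l] by (simp add: H_def)
      have "0 = comp (\<gamma> + aw l) (x * gen l - gen l * x + \<nu> l * gen l)" using eq comp_0 by simp
      also have "\<dots> = ?x * gen l - gen l * ?x + ?n l * gen l"
        using comp_mult_right[OF l, of \<gamma>] comp_mult_left[OF l, of \<gamma> x] by (simp add: comp_add comp_diff add.commute[of \<gamma>])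
      also have "\<dots> = ?E (aw l) (gen l)"
        by (simp add: inn_commutator el_gen[of ?n] add.commute)
      finally show ?thesis by simp
    qed
    have "?E \<delta> u \<in> {0}" if "u \<in> H \<delta>" for \<delta> u by (rule tder_gens[OF hid0 E g that])
    then have "inn 0 ?x \<delta> u + el (?n E1) (?n E2) (?n E3) \<delta> u = 0" if "u \<in> H \<delta>" for \<delta> u
      using that by (simp add: minus add.commute)
    then show ?thesis using standard_unique[OF xH n n n] by (cases l) blast+
  qed
  then show ?thesis using comp_sum_ex[of "\<nu> l"] \<nu>[of l] by (auto simp: Z_def)
qed

section \<open>Transport between the quotient algebra and its faithful image\<close>

lemma type_algebra_Uq: "type_algebra (Uq q)"
proof -
  have car: "\<exists>f. u = Uq_class q f" if "u \<in> carrier (Uq q)" for u using that by (auto simp: carrier_Uq)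
  show ?thesis
  proof (intro type_algebra.intro ring_Uq type_algebra_axioms.intro)
    fix u v c assume "u \<in> carrier (Uq q)"
    then obtain f where u: "u = Uq_class q f" using car by blast
    show "c \<odot>\<^bsub>Uq q\<^esub> u \<in> carrier (Uq q)" unfolding u Uq_class_scalar[symmetric] by (simp add: carrier_Uq)
    assume "v \<in> carrier (Uq q)"
    then obtain g where v: "v = Uq_class q g" using car by blast
    show "c \<odot>\<^bsub>Uq q\<^esub> (u \<oplus>\<^bsub>Uq q\<^esub> v) = c \<odot>\<^bsub>Uq q\<^esub> u \<oplus>\<^bsub>Uq q\<^esub> c \<odot>\<^bsub>Uq q\<^esub> v"
      by (simp only: u v Uq_class_ring_hom(1)[symmetric] Uq_class_scalar[symmetric] distrib_left)
    show "(c \<odot>\<^bsub>Uq q\<^esub> u) \<otimes>\<^bsub>Uq q\<^esub> v = c \<odot>\<^bsub>Uq q\<^esub> (u \<otimes>\<^bsub>Uq q\<^esub> v)"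
      by (simp only: u v Uq_class_ring_hom(2)[symmetric] Uq_class_scalar[symmetric] mult.assoc)
    have "f * (scalar c * g) = scalar c * (f * g)"
      by (simp only: mult.assoc[symmetric] scalar_commutes)
    then show "u \<otimes>\<^bsub>Uq q\<^esub> (c \<odot>\<^bsub>Uq q\<^esub> v) = c \<odot>\<^bsub>Uq q\<^esub> (u \<otimes>\<^bsub>Uq q\<^esub> v)"
      by (simp only: u v Uq_class_ring_hom(2)[symmetric] Uq_class_scalar[symmetric])
  qed
qed

sublocale U: type_algebra "Uq q" by (rule type_algebra_Uq)

definition rep :: "'k free_alg set \<Rightarrow> 'k lin" where
  "rep u = \<phi> (SOME f. Uq_class q f = u)"

definition cl :: "'k lin \<Rightarrow> 'k free_alg set" where
  "cl x = Uq_class q (SOME f. \<phi> f = x)"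

lemma class_eq_iff: "Uq_class q f = Uq_class q g \<longleftrightarrow> \<phi> f = \<phi> g"
  by (simp add: Uq_class_eq_iff \<phi>_eq_iff)

lemma rep_class: "rep (Uq_class q f) = \<phi> f"
  unfolding rep_def class_eq_iff[symmetric] by (rule someI[of "\<lambda>g. Uq_class q g = Uq_class q f"]) simp

lemma cl_\<phi>: "cl (\<phi> f) = Uq_class q f"
  unfolding cl_def class_eq_iff by (rule someI[of "\<lambda>g. \<phi> g = \<phi> f"]) simp

lemma classE: "u \<in> carrier (Uq q) \<Longrightarrow> (\<And>f. u = Uq_class q f \<Longrightarrow> thesis) \<Longrightarrow> thesis"
  by (auto simp: carrier_Uq)

lemma class_carrier: "Uq_class q f \<in> carrier (Uq q)"
  by (simp add: carrier_Uq)

lemma SE: "x \<in> S \<Longrightarrow> (\<And>f. x = \<phi> f \<Longrightarrow> thesis) \<Longrightarrow> thesis"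
  by (auto simp: S_def)

lemma \<phi>_S: "\<phi> f \<in> S"
  by (simp add: S_def)

lemma rep_S: "u \<in> carrier (Uq q) \<Longrightarrow> rep u \<in> S"
  by (erule classE) (simp add: rep_class \<phi>_S)

lemma cl_carrier: "x \<in> S \<Longrightarrow> cl x \<in> carrier (Uq q)"
  by (erule SE) (simp add: cl_\<phi> class_carrier)

lemma cl_rep: "u \<in> carrier (Uq q) \<Longrightarrow> cl (rep u) = u"
  by (erule classE) (simp add: rep_class cl_\<phi>)

lemma rep_cl: "x \<in> S \<Longrightarrow> rep (cl x) = x"
  by (erule SE) (simp add: rep_class cl_\<phi>)

lemma rep_hom:
  assumes "u \<in> carrier (Uq q)"
  shows "v \<in> carrier (Uq q) \<Longrightarrow> rep (u \<oplus>\<^bsub>Uq q\<^esub> v) = rep u + rep v"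
    "v \<in> carrier (Uq q) \<Longrightarrow> rep (u \<otimes>\<^bsub>Uq q\<^esub> v) = rep u * rep v"
    "v \<in> carrier (Uq q) \<Longrightarrow> rep (u \<ominus>\<^bsub>Uq q\<^esub> v) = rep u - rep v"
    "rep (c \<odot>\<^bsub>Uq q\<^esub> u) = sc c * rep u"
  using assms
  by (auto elim!: classE simp only: Uq_class_ring_hom[symmetric] Uq_class_diff[symmetric] Uq_class_scalar[symmetric] rep_class \<phi>_simps)

lemma rep_zero: "rep \<zero>\<^bsub>Uq q\<^esub> = 0"
  by (simp only: Uq_class_ring_hom[symmetric] rep_class \<phi>_simps)

lemma rep_inj: "u \<in> carrier (Uq q) \<Longrightarrow> v \<in> carrier (Uq q) \<Longrightarrow> rep u = rep v \<Longrightarrow> u = v"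
  using cl_rep by metis

lemma rep_gen: "rep (Uq_gen q l) = gen l"
  by (simp add: Uq_gen_def rep_class \<phi>_simps)

lemma gen_carrier: "Uq_gen q l \<in> carrier (Uq q)"
  by (simp add: Uq_gen_def class_carrier)

lemma rep_center: "u \<in> carrier (center (Uq q)) \<longleftrightarrow> u \<in> carrier (Uq q) \<and> rep u \<in> Z"
proof
  assume u: "u \<in> carrier (center (Uq q))"
  note uc = U.centerD(1)[OF u]
  have "rep u * x = x * rep u" if x: "x \<in> S" for x
    using U.centerD(2)[OF u cl_carrier[OF x]] rep_hom(2)[OF uc cl_carrier[OF x]] rep_hom(2)[OF cl_carrier[OF x] uc]
    by (simp add: rep_cl[OF x])
  then show "u \<in> carrier (Uq q) \<and> rep u \<in> Z" using uc rep_S by (simp add: Z_def)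
next
  assume u: "u \<in> carrier (Uq q) \<and> rep u \<in> Z"
  show "u \<in> carrier (center (Uq q))"
  proof (rule U.centerI)
    fix v assume v: "v \<in> carrier (Uq q)"
    have "rep u * rep v = rep v * rep u" using u rep_S[OF v] by (simp add: Z_def)
    then have "rep (u \<otimes>\<^bsub>Uq q\<^esub> v) = rep (v \<otimes>\<^bsub>Uq q\<^esub> u)" using u v by (simp only: rep_hom(2))
    then show "u \<otimes>\<^bsub>Uq q\<^esub> v = v \<otimes>\<^bsub>Uq q\<^esub> u" using u v by (intro rep_inj) simp_all
  qed (use u in simp)
qed

lemma ad_gen: "x \<in> carrier (Uq q) \<Longrightarrow> rep (ad (Uq q) x (Uq_gen q l)) = rep x * gen l - gen l * rep x"
  using gen_carrier by (simp add: ad_def rep_hom rep_gen)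

definition Dl :: "letter \<Rightarrow> 'k free_alg set \<Rightarrow> 'k free_alg set" where
  "Dl = case_letter (D1 q) (D4 q) (D6 q)"

lemma Dl: "Dl l \<in> derivations (Uq q)" "Dl l (Uq_gen q m) = (if l = m then Uq_gen q m else \<zero>\<^bsub>Uq q\<^esub>)"
proof -
  have X: "Uq_X q 1 = Uq_gen q E1" "Uq_X q 4 = Uq_gen q E2" "Uq_X q 6 = Uq_gen q E3"
    by (simp_all add: Uq_X_def)
  note s = scales_X_D[of q, unfolded scales_X_def]
  show "Dl l \<in> derivations (Uq q)" using s by (cases l) (auto simp: Dl_def)
  have "\<forall>j\<in>{1,4,6}. D1 q (Uq_X q j) = (if j \<in> {1,2,3} then Uq_X q j else \<zero>\<^bsub>Uq q\<^esub>)"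
    "\<forall>j\<in>{1,4,6}. D4 q (Uq_X q j) = (if j \<in> {2,3,4,5} then Uq_X q j else \<zero>\<^bsub>Uq q\<^esub>)"
    "\<forall>j\<in>{1,4,6}. D6 q (Uq_X q j) = (if j \<in> {3,5,6} then Uq_X q j else \<zero>\<^bsub>Uq q\<^esub>)"
    using s by auto
  then show "Dl l (Uq_gen q m) = (if l = m then Uq_gen q m else \<zero>\<^bsub>Uq q\<^esub>)"
    by (cases l; cases m) (simp_all add: Dl_def X X(1)[simplified])
qed

text \<open>Indexing by letters treats the three derivations uniformly: on the generator of each
  letter the combination is multiplication by the coefficient of that letter.\<close>

definition comb :: "(letter \<Rightarrow> 'k free_alg set) \<Rightarrow> 'k free_alg set \<Rightarrow> 'k free_alg set" where
  "comb \<mu> = \<mu> E1 \<odot>\<^bsub>Der (Uq q)\<^esub> Dl E1 \<oplus>\<^bsub>Der (Uq q)\<^esub> \<mu> E2 \<odot>\<^bsub>Der (Uq q)\<^esub> Dl E2 \<oplus>\<^bsub>Der (Uq q)\<^esub> \<mu> E3 \<odot>\<^bsub>Der (Uq q)\<^esub> Dl E3"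

lemma Dl_Der: "Dl l \<in> carrier (Der (Uq q))"
  by (simp add: U.Der_simps Dl)

lemma comb_Der: "(\<And>l. \<mu> l \<in> carrier (center (Uq q))) \<Longrightarrow> comb \<mu> \<in> carrier (Der (Uq q))"
  unfolding comb_def by (intro U.HH.M.a_closed U.HH.smult_closed Dl_Der)

lemma comb_gen:
  assumes "\<And>l. \<mu> l \<in> carrier (center (Uq q))"
  shows "comb \<mu> (Uq_gen q l) = \<mu> l \<otimes>\<^bsub>Uq q\<^esub> Uq_gen q l"
  using U.centerD(1)[OF assms] gen_carrier[of l] by (cases l) (simp_all add: comb_def U.Der_simps Dl)

lemma Uq_derivation_decomp:
  assumes D: "D \<in> derivations (Uq q)"
  obtains x \<mu> where "x \<in> carrier (Uq q)" "\<And>l. \<mu> l \<in> carrier (center (Uq q))" "D = ad (Uq q) x \<oplus>\<^bsub>Der (Uq q)\<^esub> comb \<mu>"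
proof -
  note d = U.derivationD[OF D]
  have "\<exists>x\<in>S. \<exists>\<nu>. (\<forall>l. \<nu> l \<in> Z) \<and> (\<forall>l. rep (D (cl (gen l))) = x * gen l - gen l * x + \<nu> l * gen l)"
  proof (rule S_derivation)
    fix u v c assume u: "u \<in> S"
    note uc = cl_carrier[OF u]
    show "rep (D (cl u)) \<in> S" by (rule rep_S[OF d(1)[OF uc]])
    have "cl (sc c * u) = c \<odot>\<^bsub>Uq q\<^esub> cl u"
      using u uc by (intro rep_inj) (simp_all add: rep_cl cl_carrier S_closed rep_hom(4) U.smult_closed)
    then show "rep (D (cl (sc c * u))) = sc c * rep (D (cl u))"
      using d(1,4)[OF uc] by (simp add: rep_hom(4))
    assume v: "v \<in> S"
    note vc = cl_carrier[OF v]
    have "cl (u + v) = cl u \<oplus>\<^bsub>Uq q\<^esub> cl v"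
      using u v uc vc by (intro rep_inj) (simp_all add: rep_cl cl_carrier S_closed rep_hom)
    moreover have "cl (u * v) = cl u \<otimes>\<^bsub>Uq q\<^esub> cl v"
      using u v uc vc by (intro rep_inj) (simp_all add: rep_cl cl_carrier S_closed rep_hom)
    ultimately show "rep (D (cl (u + v))) = rep (D (cl u)) + rep (D (cl v))"
      "rep (D (cl (u * v))) = rep (D (cl u)) * v + u * rep (D (cl v))"
      using d(1)[OF uc] d(1)[OF vc] d(3,5)[OF uc vc] uc vc u v by (simp_all add: rep_hom rep_cl)
  qed
  then obtain x \<nu> where x: "x \<in> S" and \<nu>: "\<And>l. \<nu> l \<in> Z"
    and eq: "\<And>l. rep (D (cl (gen l))) = x * gen l - gen l * x + \<nu> l * gen l"
    by blast
  define \<mu> where "\<mu> l = cl (\<nu> l)" for l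
  have \<mu>: "\<mu> l \<in> carrier (center (Uq q))" for l
    using \<nu>[of l] cl_carrier[of "\<nu> l"] rep_cl[of "\<nu> l"] by (simp add: rep_center \<mu>_def Z_def)
  have xc: "cl x \<in> carrier (Uq q)" by (rule cl_carrier[OF x])
  note ad = U.ad_derivation[OF xc] and cb = comb_Der[OF \<mu>, unfolded U.Der_simps]
  have "D = ad (Uq q) (cl x) \<oplus>\<^bsub>Der (Uq q)\<^esub> comb \<mu>"
  proof (rule Uq_derivation_eqI[OF D])
    show "ad (Uq q) (cl x) \<oplus>\<^bsub>Der (Uq q)\<^esub> comb \<mu> \<in> derivations (Uq q)"
      unfolding U.Der_simps by (rule U.Der_closed(2)[OF ad cb])
    fix l
    note g = gen_carrier[of l]
    have a: "ad (Uq q) (cl x) (Uq_gen q l) \<in> carrier (Uq q)" by (rule U.derivationD(1)[OF ad g])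
    have m: "\<mu> l \<otimes>\<^bsub>Uq q\<^esub> Uq_gen q l \<in> carrier (Uq q)" using U.centerD(1)[OF \<mu>] g by simp
    have "cl (gen l) = Uq_gen q l" using cl_rep[OF g] by (simp add: rep_gen)
    moreover have "rep (\<mu> l) = \<nu> l" using \<nu>[of l] by (simp add: \<mu>_def rep_cl Z_def)
    ultimately have "rep (D (Uq_gen q l)) = rep (ad (Uq q) (cl x) (Uq_gen q l) \<oplus>\<^bsub>Uq q\<^esub> \<mu> l \<otimes>\<^bsub>Uq q\<^esub> Uq_gen q l)"
      using eq[of l] by (simp add: rep_hom(1)[OF a m] rep_hom(2)[OF U.centerD(1)[OF \<mu>] g] ad_gen[OF xc] rep_gen rep_cl[OF x])
    then have "D (Uq_gen q l) = ad (Uq q) (cl x) (Uq_gen q l) \<oplus>\<^bsub>Uq q\<^esub> \<mu> l \<otimes>\<^bsub>Uq q\<^esub> Uq_gen q l"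
      by (rule rep_inj[OF d(1)[OF g] U.a_closed[OF a m]])
    then show "D (Uq_gen q l) = (ad (Uq q) (cl x) \<oplus>\<^bsub>Der (Uq q)\<^esub> comb \<mu>) (Uq_gen q l)"
      using g by (simp add: U.Der_simps comb_gen[OF \<mu>])
  qed
  then show ?thesis by (rule that[OF xc \<mu>])
qed

lemma comb_inner:
  assumes \<mu>: "\<And>l. \<mu> l \<in> carrier (center (Uq q))" and c: "comb \<mu> \<in> inner_derivations (Uq q)"
  shows "\<mu> l = \<zero>\<^bsub>Uq q\<^esub>"
proof -
  obtain x where x: "x \<in> carrier (Uq q)" "comb \<mu> = ad (Uq q) x" using c by (auto simp: inner_derivations_def)
  \<comment> \<open>\<open>S_unique\<close> has the inner part and the coefficients on the same
    side, hence the sign of \<open>rep x\<close>.\<close>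
  have "- rep x * gen l - gen l * (- rep x) + rep (\<mu> l) * gen l = 0" for l
  proof -
    have "rep x * gen l - gen l * rep x = rep (\<mu> l) * gen l"
      using arg_cong[OF x(2), of "\<lambda>d. rep (d (Uq_gen q l))"]
      by (simp add: comb_gen[OF \<mu>] ad_gen[OF x(1)] rep_hom(2)[OF U.centerD(1)[OF \<mu>] gen_carrier] rep_gen)
    then show ?thesis by (simp add: algebra_simps)
  qed
  moreover have "- rep x \<in> S" using S_closed(2)[OF S_closed(5) rep_S[OF x(1)]] by simp
  moreover have "rep (\<mu> l) \<in> Z" for l using \<mu> by (simp add: rep_center)
  ultimately have "rep (\<mu> l) = 0" using S_unique[of "- rep x" "\<lambda>l. rep (\<mu> l)"] by blast
  then have "rep (\<mu> l) = rep \<zero>\<^bsub>Uq q\<^esub>" by (simp only: rep_zero)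
  then show ?thesis by (rule rep_inj[OF U.centerD(1)[OF \<mu>] U.zero_closed])
qed

lemma decomp_unique:
  assumes \<mu>: "\<And>l. \<mu> l \<in> carrier (center (Uq q))" and \<mu>': "\<And>l. \<mu>' l \<in> carrier (center (Uq q))"
    and i: "\<delta> \<in> inner_derivations (Uq q)" "\<delta>' \<in> inner_derivations (Uq q)"
    and eq: "\<delta> \<oplus>\<^bsub>Der (Uq q)\<^esub> comb \<mu> = \<delta>' \<oplus>\<^bsub>Der (Uq q)\<^esub> comb \<mu>'"
  shows "\<delta> = \<delta>' \<and> (\<forall>l. \<mu> l = \<mu>' l)"
proof -
  let ?M = "Der (Uq q)"
  note sub = U.HH.submoduleE[OF U.submodule_inner]
  have ic: "\<delta> \<in> carrier ?M" "\<delta>' \<in> carrier ?M" using i sub(1) by auto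
  note cc = comb_Der[OF \<mu>] comb_Der[OF \<mu>']
  have \<rho>: "\<mu> l \<ominus>\<^bsub>Uq q\<^esub> \<mu>' l \<in> carrier (center (Uq q))" for l
    unfolding a_minus_def by (intro U.center_closed(2)[OF \<mu> U.center_closed(1)[OF \<mu>']])
  have k: "\<mu> l \<ominus>\<^bsub>Uq q\<^esub> \<mu>' l \<oplus>\<^bsub>Uq q\<^esub> \<mu>' l = \<mu> l" for l
    using U.centerD(1)[OF \<mu>, of l] U.centerD(1)[OF \<mu>', of l] by (simp add: a_minus_def U.a_assoc U.l_neg)
  have "comb (\<lambda>l. \<mu> l \<ominus>\<^bsub>Uq q\<^esub> \<mu>' l) \<oplus>\<^bsub>?M\<^esub> comb \<mu>' = comb \<mu>"
  proof (rule Uq_derivation_eqI)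
    show "comb (\<lambda>l. \<mu> l \<ominus>\<^bsub>Uq q\<^esub> \<mu>' l) \<oplus>\<^bsub>?M\<^esub> comb \<mu>' \<in> derivations (Uq q)" "comb \<mu> \<in> derivations (Uq q)"
      using U.HH.M.a_closed[OF comb_Der[OF \<rho>] cc(2)] cc(1) unfolding U.Der_simps(1) .
    fix l
    show "(comb (\<lambda>l. \<mu> l \<ominus>\<^bsub>Uq q\<^esub> \<mu>' l) \<oplus>\<^bsub>?M\<^esub> comb \<mu>') (Uq_gen q l) = comb \<mu> (Uq_gen q l)"
    proof -
      note g = gen_carrier[of l] and m = U.centerD(1)[OF \<mu>, of l] U.centerD(1)[OF \<mu>', of l] U.centerD(1)[OF \<rho>, of l]
      show ?thesis
        using g k by (simp add: U.Der_simps comb_gen[OF \<rho>] comb_gen[OF \<mu>] comb_gen[OF \<mu>'] U.l_distr[OF m(3,2) g, symmetric])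
    qed
  qed
  then have "\<delta> \<oplus>\<^bsub>?M\<^esub> comb (\<lambda>l. \<mu> l \<ominus>\<^bsub>Uq q\<^esub> \<mu>' l) \<oplus>\<^bsub>?M\<^esub> comb \<mu>' = \<delta>' \<oplus>\<^bsub>?M\<^esub> comb \<mu>'"
    using eq by (simp add: U.HH.M.a_assoc ic comb_Der[OF \<rho>] cc)
  then have s: "\<delta> \<oplus>\<^bsub>?M\<^esub> comb (\<lambda>l. \<mu> l \<ominus>\<^bsub>Uq q\<^esub> \<mu>' l) = \<delta>'"
    using ic U.HH.M.a_closed[OF ic(1) comb_Der[OF \<rho>]] comb_Der[of \<mu>', OF \<mu>'] by simp
  have "comb (\<lambda>l. \<mu> l \<ominus>\<^bsub>Uq q\<^esub> \<mu>' l) = \<ominus>\<^bsub>?M\<^esub> \<delta> \<oplus>\<^bsub>?M\<^esub> \<delta>'"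
    unfolding s[symmetric] by (rule U.HH.M.r_neg1[OF ic(1) comb_Der[OF \<rho>], symmetric])
  also have "\<dots> \<in> inner_derivations (Uq q)" by (intro sub(5) sub(3) i)
  finally have "\<mu> l \<ominus>\<^bsub>Uq q\<^esub> \<mu>' l = \<zero>\<^bsub>Uq q\<^esub>" for l by (rule comb_inner[OF \<rho>])
  then have m: "\<mu> l = \<mu>' l" for l using k[of l] U.centerD(1)[OF \<mu>', of l] by simp
  then have "comb \<mu> = comb \<mu>'" by (simp add: comb_def)
  then show ?thesis using eq comb_Der[of \<mu>', OF \<mu>'] ic m by simp
qed

lemma inner_decomposition:
  assumes D: "D \<in> derivations (Uq q)"
  shows "\<exists>!(\<delta>, \<mu>1, \<mu>4, \<mu>6). \<delta> \<in> inner_derivations (Uq q) \<and>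
     \<mu>1 \<in> carrier (center (Uq q)) \<and> \<mu>4 \<in> carrier (center (Uq q)) \<and> \<mu>6 \<in> carrier (center (Uq q)) \<and>
     D = \<delta> \<oplus>\<^bsub>Der (Uq q)\<^esub> \<mu>1 \<odot>\<^bsub>Der (Uq q)\<^esub> D1 q \<oplus>\<^bsub>Der (Uq q)\<^esub> \<mu>4 \<odot>\<^bsub>Der (Uq q)\<^esub> D4 q \<oplus>\<^bsub>Der (Uq q)\<^esub> \<mu>6 \<odot>\<^bsub>Der (Uq q)\<^esub> D6 q"
proof -
  let ?M = "Der (Uq q)" and ?Z = "carrier (center (Uq q))" and ?I = "inner_derivations (Uq q)"
  have I: "\<delta> \<in> carrier ?M" if "\<delta> \<in> ?I" for \<delta> using that U.HH.submoduleE(1)[OF U.submodule_inner] by blast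
  have c: "\<delta> \<oplus>\<^bsub>?M\<^esub> \<mu>1 \<odot>\<^bsub>?M\<^esub> D1 q \<oplus>\<^bsub>?M\<^esub> \<mu>4 \<odot>\<^bsub>?M\<^esub> D4 q \<oplus>\<^bsub>?M\<^esub> \<mu>6 \<odot>\<^bsub>?M\<^esub> D6 q = \<delta> \<oplus>\<^bsub>?M\<^esub> comb (case_letter \<mu>1 \<mu>4 \<mu>6)"
    if "\<delta> \<in> ?I" "\<mu>1 \<in> ?Z" "\<mu>4 \<in> ?Z" "\<mu>6 \<in> ?Z" for \<delta> \<mu>1 \<mu>4 \<mu>6
    using Dl_Der[of E1] Dl_Der[of E2] Dl_Der[of E3] that I by (simp add: comb_def Dl_def U.HH.M.a_assoc)
  obtain x \<mu> where x: "x \<in> carrier (Uq q)" and \<mu>: "\<And>l. \<mu> l \<in> ?Z" and eq: "D = ad (Uq q) x \<oplus>\<^bsub>?M\<^esub> comb \<mu>"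
    using Uq_derivation_decomp[OF D] by blast
  have xi: "ad (Uq q) x \<in> ?I" using x by (simp add: inner_derivations_def)
  have "case_letter (\<mu> E1) (\<mu> E2) (\<mu> E3) l = \<mu> l" for l by (cases l) simp_all
  then have e: "case_letter (\<mu> E1) (\<mu> E2) (\<mu> E3) = \<mu>" by blast
  show ?thesis
  proof (rule ex1I[of _ "(ad (Uq q) x, \<mu> E1, \<mu> E2, \<mu> E3)"])
    show "case (ad (Uq q) x, \<mu> E1, \<mu> E2, \<mu> E3) of (\<delta>, \<mu>1, \<mu>4, \<mu>6) \<Rightarrow> \<delta> \<in> ?I \<and> \<mu>1 \<in> ?Z \<and> \<mu>4 \<in> ?Z \<and> \<mu>6 \<in> ?Z \<and>
       D = \<delta> \<oplus>\<^bsub>?M\<^esub> \<mu>1 \<odot>\<^bsub>?M\<^esub> D1 q \<oplus>\<^bsub>?M\<^esub> \<mu>4 \<odot>\<^bsub>?M\<^esub> D4 q \<oplus>\<^bsub>?M\<^esub> \<mu>6 \<odot>\<^bsub>?M\<^esub> D6 q"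
      using xi \<mu> eq c[OF xi \<mu> \<mu> \<mu>, of E1 E2 E3] by (simp add: e)
    fix p assume p: "case p of (\<delta>, \<mu>1, \<mu>4, \<mu>6) \<Rightarrow> \<delta> \<in> ?I \<and> \<mu>1 \<in> ?Z \<and> \<mu>4 \<in> ?Z \<and> \<mu>6 \<in> ?Z \<and>
       D = \<delta> \<oplus>\<^bsub>?M\<^esub> \<mu>1 \<odot>\<^bsub>?M\<^esub> D1 q \<oplus>\<^bsub>?M\<^esub> \<mu>4 \<odot>\<^bsub>?M\<^esub> D4 q \<oplus>\<^bsub>?M\<^esub> \<mu>6 \<odot>\<^bsub>?M\<^esub> D6 q"
    obtain \<delta> \<mu>1 \<mu>4 \<mu>6 where pe: "p = (\<delta>, \<mu>1, \<mu>4, \<mu>6)" by (cases p)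
    have q: "\<delta> \<in> ?I" "\<mu>1 \<in> ?Z" "\<mu>4 \<in> ?Z" "\<mu>6 \<in> ?Z" "D = \<delta> \<oplus>\<^bsub>?M\<^esub> comb (case_letter \<mu>1 \<mu>4 \<mu>6)"
      using p c[of \<delta> \<mu>1 \<mu>4 \<mu>6] unfolding pe by simp_all
    have "case_letter \<mu>1 \<mu>4 \<mu>6 l \<in> ?Z" for l using q by (cases l) simp_all
    from decomp_unique[of "case_letter \<mu>1 \<mu>4 \<mu>6" \<mu>, OF this \<mu> q(1) xi] q(5) eq
    have "\<delta> = ad (Uq q) x" "\<forall>l. case_letter \<mu>1 \<mu>4 \<mu>6 l = \<mu> l" by simp_all
    then show "p = (ad (Uq q) x, \<mu> E1, \<mu> E2, \<mu> E3)"
      using pe spec[OF \<open>\<forall>l. _ l = \<mu> l\<close>, of E1] spec[OF \<open>\<forall>l. _ l = \<mu> l\<close>, of E2] spec[OF \<open>\<forall>l. _ l = \<mu> l\<close>, of E3] by simp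
  qed
qed

lemma HH1_basis:
  "module_basis (center (Uq q)) (HH1 (Uq q)) {..<3} (\<lambda>i. HH1_class (Uq q) ([D1 q, D4 q, D6 q] ! i))"
  unfolding HH1_def HH1_class_def
proof (rule U.HH.quotient_basis)
  let ?M = "Der (Uq q)" and ?Z = "carrier (center (Uq q))" and ?b = "\<lambda>i. [D1 q, D4 q, D6 q] ! i"
  define s where "s = [E1,E2,E3]"
  have three: "{..<3} = {0,1,2::nat}" by auto
  have b: "?b i \<in> carrier ?M" if "i < 3" for i
    using that Dl_Der[of E1] Dl_Der[of E2] Dl_Der[of E3] by (auto simp: less_Suc_eq numeral_3_eq_3 Dl_def)
  then show "?b \<in> {..<3} \<rightarrow> carrier ?M" by simp
  have sum: "(\<Oplus>\<^bsub>?M\<^esub>i\<in>{..<3}. a i \<odot>\<^bsub>?M\<^esub> ?b i) = comb (case_letter (a 0) (a 1) (a 2))"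
    if "a \<in> {..<3} \<rightarrow> ?Z" for a
  proof -
    have a: "a 0 \<in> ?Z" "a 1 \<in> ?Z" "a (Suc 0) \<in> ?Z" "a 2 \<in> ?Z" using that by auto
    show ?thesis
      using a Dl_Der[of E1] Dl_Der[of E2] Dl_Der[of E3]
      by (simp add: three comb_def Dl_def U.HH.M.finsum_insert U.HH.M.a_assoc)
  qed
  {
    fix D assume "D \<in> carrier ?M"
    then have D: "D \<in> derivations (Uq q)" by (simp add: U.Der_simps)
    obtain x \<mu> where x: "x \<in> carrier (Uq q)" and \<mu>: "\<And>l. \<mu> l \<in> ?Z" and eq: "D = ad (Uq q) x \<oplus>\<^bsub>?M\<^esub> comb \<mu>"
      using Uq_derivation_decomp[OF D] by blast
    define a where "a = (\<lambda>i. \<mu> ([E1,E2,E3] ! i))"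
    have "case_letter (a 0) (a 1) (a 2) l = \<mu> l" for l by (cases l) (simp_all add: a_def)
    then have "case_letter (a 0) (a 1) (a 2) = \<mu>" by blast
    moreover have az: "a \<in> {..<3} \<rightarrow> ?Z" using \<mu> by (simp add: a_def)
    ultimately have "D = ad (Uq q) x \<oplus>\<^bsub>?M\<^esub> (\<Oplus>\<^bsub>?M\<^esub>i\<in>{..<3}. a i \<odot>\<^bsub>?M\<^esub> ?b i)"
      using eq sum[OF az] by simp
    then show "\<exists>n\<in>inner_derivations (Uq q). \<exists>a\<in>{..<3} \<rightarrow> ?Z. D = n \<oplus>\<^bsub>?M\<^esub> (\<Oplus>\<^bsub>?M\<^esub>i\<in>{..<3}. a i \<odot>\<^bsub>?M\<^esub> ?b i)"
      using az x unfolding inner_derivations_def by blast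
  next
    fix a assume a: "a \<in> {..<3} \<rightarrow> ?Z" and "(\<Oplus>\<^bsub>?M\<^esub>i\<in>{..<3}. a i \<odot>\<^bsub>?M\<^esub> ?b i) \<in> inner_derivations (Uq q)"
    then have i: "comb (case_letter (a 0) (a 1) (a 2)) \<in> inner_derivations (Uq q)" using sum[OF a] by simp
    have z: "case_letter (a 0) (a 1) (a 2) l \<in> ?Z" for l using a by (cases l) auto
    note c = comb_inner[OF z i]
    show "\<forall>i\<in>{..<3}. a i = \<zero>\<^bsub>center (Uq q)\<^esub>"
      using c[of E1] c[of E2] c[of E3] unfolding three by (simp add: U.center_simps)
  }
qed simp

end

theorem theorem3p11:
  fixes q :: "'k::field_char_0"
  assumes "q \<noteq> 0"
    and "\<forall>n::nat. n > 0 \<longrightarrow> q ^ n \<noteq> 1"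
  shows "(\<forall>D \<in> derivations (Uq q).
            \<exists>!(\<delta>, \<mu>1, \<mu>4, \<mu>6). \<delta> \<in> inner_derivations (Uq q) \<and>
              \<mu>1 \<in> carrier (center (Uq q)) \<and>
              \<mu>4 \<in> carrier (center (Uq q)) \<and>
              \<mu>6 \<in> carrier (center (Uq q)) \<and>
              D = \<delta> \<oplus>\<^bsub>Der (Uq q)\<^esub> \<mu>1 \<odot>\<^bsub>Der (Uq q)\<^esub> D1 q
                    \<oplus>\<^bsub>Der (Uq q)\<^esub> \<mu>4 \<odot>\<^bsub>Der (Uq q)\<^esub> D4 q
                    \<oplus>\<^bsub>Der (Uq q)\<^esub> \<mu>6 \<odot>\<^bsub>Der (Uq q)\<^esub> D6 q) \<and>
         free_of_rank (center (Uq q)) (HH1 (Uq q)) 3 \<and>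
         module_basis (center (Uq q)) (HH1 (Uq q)) {..<3}
           (\<lambda>i. HH1_class (Uq q) ([D1 q, D4 q, D6 q] ! i))"
proof -
  interpret quantum_parameter q using assms by unfold_locales auto
  have "module (center (Uq q)) (HH1 (Uq q))"
    unfolding HH1_def by (rule U.HH.quotient_module)
  then have "free_of_rank (center (Uq q)) (HH1 (Uq q)) 3"
    unfolding free_of_rank_def using HH1_basis by (intro conjI exI)
  then show ?thesis
    by (intro conjI ballI inner_decomposition HH1_basis)
qed

end
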